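(* For each $n\ge 1$ let $G_n$ be the $n\times n$ random matrix with i.i.d. standard complex Gaussian entries and let $Q_n(z)=\det(zI-G_n)$ be its characteristic polynomial. There exist positive random variables $A_n$ (possibly dependent on $Q_n$) such that the normalized characteristic polynomial $Q_n(z)/A_n$ converges in distribution, as $n\to\infty$, to a random analytic function $Q(z)$ on $\mathbb{C}$, where convergence in distribution is with respect to the topology of uniform convergence on compact subsets of $\mathbb{C}$. Moreover, there exists a random positive definite Hermitian function $K(z,w)$, $z,w\in\mathbb{C}$, such that given $K$ the function $Q$ is a (complex) Gaussian field with covariance kernel $K$. Further, $K$ is analytic in $z$ and anti-analytic in $w$; hence, conditionally on $K$, $Q$ is a Gaussian analytic function.
   Context: A standard complex Gaussian random variable is $X+iY$ with $X,Y$ i.i.d. real $N(0,1/2)$. A complex Gaussian field on $\mathbb{C}$ with covariance kernel $K$ is a random function $f$ on $\mathbb{C}$ whose values are jointly centered complex Gaussian (isotropic, i.e. $\mathbf{E}[f(z)f(w)]=0$) with $\mathbf{E}[f(z)\overline{f(w)}]=K(z,w)$. A Gaussian analytic function (GAF) is a complex Gaussian field on $\mathbb{C}$ which is almost surely analytic. "There exists a random $K$ such that given $K$, $Q$ is Gaussian with covariance $K$" means that there is a joint distribution of $(Q,K)$, with $Q$ having the limiting law, such that the conditional law of $Q$ given $K$ is that of the complex Gaussian field with covariance kernel $K$. *)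

theory Defs
  imports "HOL-Probability.Probability" "Jordan_Normal_Form.Determinant"
begin

hide_const (open) Determinants.det

section \<open>The Ginibre ensemble and its characteristic polynomial\<close>

definition std_complex_gaussian :: "complex measure" where
  "std_complex_gaussian =
     distr (density lborel (normal_density 0 (sqrt (1/2))) \<Otimes>\<^sub>M
            density lborel (normal_density 0 (sqrt (1/2))))
           borel (\<lambda>(x, y). Complex x y)"

definition ginibre_matrix :: "nat \<Rightarrow> 'a measure \<Rightarrow> ('a \<Rightarrow> complex mat) \<Rightarrow> bool" where
  "ginibre_matrix n M G \<longleftrightarrow>
     prob_space M \<and>
     (\<forall>\<omega>\<in>space M. G \<omega> \<in> carrier_mat n n) \<and>
     prob_space.indep_vars M (\<lambda>_. borel) (\<lambda>(i, j) \<omega>. G \<omega> $$ (i, j)) ({..<n} \<times> {..<n}) \<and>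
     (\<forall>i<n. \<forall>j<n. distr M borel (\<lambda>\<omega>. G \<omega> $$ (i, j)) = std_complex_gaussian)"

definition charpoly_fun :: "nat \<Rightarrow> complex mat \<Rightarrow> complex \<Rightarrow> complex" where
  "charpoly_fun n A z = Determinant.det (z \<cdot>\<^sub>m 1\<^sub>m n - A)"


section \<open>Entire functions under uniform convergence on compact sets\<close>

definition entire :: "(complex \<Rightarrow> complex) set" where
  "entire = {f. f holomorphic_on UNIV}"

definition ucc_topology :: "(complex \<Rightarrow> complex) topology" where
  "ucc_topology = topology (\<lambda>U. U \<subseteq> entire \<and>
     (\<forall>f\<in>U. \<exists>C e. compact C \<and> 0 < e \<and> {g \<in> entire. \<forall>z\<in>C. dist (g z) (f z) < e} \<subseteq> U))"

lemma openin_ucc_topology: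
  "openin ucc_topology U \<longleftrightarrow> U \<subseteq> entire \<and>
     (\<forall>f\<in>U. \<exists>C e. compact C \<and> 0 < e \<and> {g \<in> entire. \<forall>z\<in>C. dist (g z) (f z) < e} \<subseteq> U)"
proof -
  let ?P = "\<lambda>U. U \<subseteq> entire \<and>
     (\<forall>f\<in>U. \<exists>C e. compact C \<and> (0::real) < e \<and> {g \<in> entire. \<forall>z\<in>C. dist (g z) (f z) < e} \<subseteq> U)"
  have "istopology ?P"
    unfolding istopology_def
  proof (intro conjI allI impI)
    fix S T assume S: "?P S" and T: "?P T"
    show "S \<inter> T \<subseteq> entire" using S by blast
    show "\<forall>f\<in>S \<inter> T. \<exists>C e. compact C \<and> 0 < e \<and> {g \<in> entire. \<forall>z\<in>C. dist (g z) (f z) < e} \<subseteq> S \<inter> T"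
    proof
      fix f assume f: "f \<in> S \<inter> T"
      obtain C1 e1 where 1: "compact C1" "0 < e1"
        "{g \<in> entire. \<forall>z\<in>C1. dist (g z) (f z) < e1} \<subseteq> S" using S f by blast
      obtain C2 e2 where 2: "compact C2" "0 < e2"
        "{g \<in> entire. \<forall>z\<in>C2. dist (g z) (f z) < e2} \<subseteq> T" using T f by blast
      have "{g \<in> entire. \<forall>z\<in>C1 \<union> C2. dist (g z) (f z) < min e1 e2} \<subseteq> S \<inter> T"
        using 1(3) 2(3) by auto
      moreover have "compact (C1 \<union> C2)" "0 < min e1 e2"
        using 1 2 by (auto intro: compact_Un)
      ultimately show "\<exists>C e. compact C \<and> 0 < e \<and>
          {g \<in> entire. \<forall>z\<in>C. dist (g z) (f z) < e} \<subseteq> S \<inter> T" by blast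
    qed
  next
    fix \<K> assume K: "\<forall>S\<in>\<K>. ?P S"
    show "\<Union>\<K> \<subseteq> entire" using K by blast
    show "\<forall>f\<in>\<Union>\<K>. \<exists>C e. compact C \<and> 0 < e \<and> {g \<in> entire. \<forall>z\<in>C. dist (g z) (f z) < e} \<subseteq> \<Union>\<K>"
    proof
      fix f assume "f \<in> \<Union>\<K>"
      then obtain S where S: "S \<in> \<K>" "f \<in> S" by (rule UnionE)
      have "?P S" using K S(1) by (rule bspec)
      with S(2) obtain C e where Ce: "compact C" "0 < e"
        "{g \<in> entire. \<forall>z\<in>C. dist (g z) (f z) < e} \<subseteq> S" by blast
      have "{g \<in> entire. \<forall>z\<in>C. dist (g z) (f z) < e} \<subseteq> \<Union>\<K>"
        using Ce(3) Union_upper[OF S(1)] by (rule order_trans)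
      with Ce(1,2) show "\<exists>C e. compact C \<and> 0 < e \<and>
          {g \<in> entire. \<forall>z\<in>C. dist (g z) (f z) < e} \<subseteq> \<Union>\<K>" by blast
    qed
  qed
  then show ?thesis
    unfolding ucc_topology_def by (rule topology_inverse'[THEN fun_cong])
qed

lemma topspace_ucc_topology: "topspace ucc_topology = entire"
proof
  show "topspace ucc_topology \<subseteq> entire"
    using openin_topspace[of ucc_topology] unfolding openin_ucc_topology by (rule conjunct1)
  have "openin ucc_topology entire"
    unfolding openin_ucc_topology
    by (intro conjI ballI exI[of _ "{}"] exI[of _ "1::real"]) auto
  then show "entire \<subseteq> topspace ucc_topology" by (rule openin_subset)
qed

lemma limitin_ucc_topology:
  "limitin ucc_topology X f F \<longleftrightarrow>
     f \<in> entire \<and> (\<forall>\<^sub>F n in F. X n \<in> entire) \<and> (\<forall>C. compact C \<longrightarrow> uniform_limit C X f F)"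
proof (intro iffI conjI allI impI)
  assume L: "limitin ucc_topology X f F"
  show f: "f \<in> entire" using L by (simp add: limitin_def topspace_ucc_topology)
  show "\<forall>\<^sub>F n in F. X n \<in> entire"
    using L f openin_topspace[of ucc_topology] by (simp add: limitin_def topspace_ucc_topology)
  fix C :: "complex set" assume C: "compact C"
  show "uniform_limit C X f F"
  proof (rule uniform_limitI)
    fix e :: real assume e: "0 < e"
    define U where "U = {g \<in> entire. \<exists>d<e. \<forall>z\<in>C. dist (g z) (f z) \<le> d}"
    have "openin ucc_topology U"
      unfolding openin_ucc_topology
    proof (intro conjI ballI)
      show "U \<subseteq> entire" by (auto simp: U_def)
      fix g assume "g \<in> U"
      then obtain d where d: "d < e" "\<And>z. z \<in> C \<Longrightarrow> dist (g z) (f z) \<le> d"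
        by (auto simp: U_def)
      have "h \<in> U" if h: "h \<in> entire" "\<forall>z\<in>C. dist (h z) (g z) < (e - d) / 2" for h
      proof -
        have "dist (h z) (f z) \<le> (e + d) / 2" if "z \<in> C" for z
        proof -
          have "dist (h z) (f z) \<le> dist (h z) (g z) + dist (g z) (f z)" by (rule dist_triangle)
          also have "\<dots> \<le> (e - d) / 2 + d"
            using h(2) d(2)[OF that] that by (intro add_mono) (simp_all add: less_imp_le)
          also have "\<dots> = (e + d) / 2" by (simp add: field_simps)
          finally show ?thesis .
        qed
        moreover have "(e + d) / 2 < e" using d(1) by simp
        ultimately show ?thesis unfolding U_def using h(1) by blast
      qed
      then have "{h \<in> entire. \<forall>z\<in>C. dist (h z) (g z) < (e - d) / 2} \<subseteq> U" by blast
      moreover have "0 < (e - d) / 2" using d(1) by simp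
      ultimately show "\<exists>C e. compact C \<and> 0 < e \<and>
          {h \<in> entire. \<forall>z\<in>C. dist (h z) (g z) < e} \<subseteq> U" using C by blast
    qed
    moreover have "f \<in> U" using f e by (auto simp: U_def)
    ultimately have "\<forall>\<^sub>F n in F. X n \<in> U" using L by (simp add: limitin_def)
    then show "\<forall>\<^sub>F n in F. \<forall>z\<in>C. dist (X n z) (f z) < e"
      by (rule eventually_mono) (force simp: U_def)
  qed
next
  assume R: "f \<in> entire \<and> (\<forall>\<^sub>F n in F. X n \<in> entire) \<and> (\<forall>C. compact C \<longrightarrow> uniform_limit C X f F)"
  show "limitin ucc_topology X f F"
    unfolding limitin_def topspace_ucc_topology
  proof (intro conjI allI impI)
    show "f \<in> entire" using R by blast
    fix U assume U: "openin ucc_topology U \<and> f \<in> U"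
    then obtain C e where Ce: "compact C" "0 < e"
      "{g \<in> entire. \<forall>z\<in>C. dist (g z) (f z) < e} \<subseteq> U"
      unfolding openin_ucc_topology by blast
    then have "\<forall>\<^sub>F n in F. \<forall>z\<in>C. dist (X n z) (f z) < e"
      using R by (simp add: uniform_limitD)
    moreover have "\<forall>\<^sub>F n in F. X n \<in> entire" using R by blast
    ultimately show "\<forall>\<^sub>F n in F. X n \<in> U"
      by eventually_elim (use Ce(3) in blast)
  qed
qed


section \<open>Convergence in distribution in a topological space\<close>

definition borel_of :: "'a topology \<Rightarrow> 'a measure" where
  "borel_of T = sigma (topspace T) {U. openin T U}"

text \<open>The random elements may live on different probability spaces.\<close>

definition converges_in_distribution ::
  "'b topology \<Rightarrow> (nat \<Rightarrow> 'a measure) \<Rightarrow> (nat \<Rightarrow> 'a \<Rightarrow> 'b) \<Rightarrow> 'c measure \<Rightarrow> ('c \<Rightarrow> 'b) \<Rightarrow> bool" where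
  "converges_in_distribution T M X N Y \<longleftrightarrow>
     (\<forall>\<^sub>F n in sequentially. X n \<in> measurable (M n) (borel_of T)) \<and>
     Y \<in> measurable N (borel_of T) \<and>
     (\<forall>\<Phi>. continuous_map T euclideanreal \<Phi> \<and> bounded (\<Phi> ` topspace T) \<longrightarrow>
        (\<lambda>n. \<integral>\<omega>. \<Phi> (X n \<omega>) \<partial>M n) \<longlonglongrightarrow> (\<integral>\<omega>. \<Phi> (Y \<omega>) \<partial>N))"


section \<open>Complex Gaussian fields\<close>

text \<open>The point mass at 0 counts as a (degenerate) centered normal law.\<close>

definition centered_normal :: "'a measure \<Rightarrow> ('a \<Rightarrow> real) \<Rightarrow> bool" where
  "centered_normal P X \<longleftrightarrow> X \<in> borel_measurable P \<and>
     ((AE \<omega> in P. X \<omega> = 0) \<or> (\<exists>\<sigma>>0. distributed P lborel X (normal_density 0 \<sigma>)))"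

text \<open>
  Joint Gaussianity means that every real linear combination of the real and imaginary
  parts of finitely many values is centered normal. As \<open>c\<close> ranges over complex
  coefficients, the real parts below are exactly these combinations.
\<close>

definition complex_gaussian_field ::
  "'a measure \<Rightarrow> (complex \<Rightarrow> 'a \<Rightarrow> complex) \<Rightarrow> (complex \<Rightarrow> complex \<Rightarrow> complex) \<Rightarrow> bool" where
  "complex_gaussian_field P f k \<longleftrightarrow>
     prob_space P \<and>
     (\<forall>z. f z \<in> borel_measurable P) \<and>
     (\<forall>S c. finite S \<longrightarrow> centered_normal P (\<lambda>\<omega>. Re (\<Sum>z\<in>S. c z * f z \<omega>))) \<and>
     (\<forall>z w. (\<integral>\<omega>. f z \<omega> * f w \<omega> \<partial>P) = 0) \<and>
     (\<forall>z w. (\<integral>\<omega>. f z \<omega> * cnj (f w \<omega>) \<partial>P) = k z w)"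

definition gaussian_analytic_function ::
  "'a measure \<Rightarrow> (complex \<Rightarrow> 'a \<Rightarrow> complex) \<Rightarrow> (complex \<Rightarrow> complex \<Rightarrow> complex) \<Rightarrow> bool" where
  "gaussian_analytic_function P f k \<longleftrightarrow>
     complex_gaussian_field P f k \<and> (AE \<omega> in P. (\<lambda>z. f z \<omega>) holomorphic_on UNIV)"


section \<open>Kernels and conditional laws\<close>

definition hermitian_kernel :: "(complex \<Rightarrow> complex \<Rightarrow> complex) \<Rightarrow> bool" where
  "hermitian_kernel k \<longleftrightarrow> (\<forall>z w. k w z = cnj (k z w))"

text \<open>
  Positive definiteness is strict. With the semidefinite notion the zero kernel would be
  admissible. For Hermitian \<open>k\<close> the double sum is real.
\<close>

definition positive_definite_kernel :: "(complex \<Rightarrow> complex \<Rightarrow> complex) \<Rightarrow> bool" where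
  "positive_definite_kernel k \<longleftrightarrow>
     (\<forall>S c. finite S \<and> (\<exists>z\<in>S. c z \<noteq> 0) \<longrightarrow>
        0 < Re (\<Sum>z\<in>S. \<Sum>w\<in>S. c z * cnj (c w) * k z w))"

definition analytic_antianalytic_kernel :: "(complex \<Rightarrow> complex \<Rightarrow> complex) \<Rightarrow> bool" where
  "analytic_antianalytic_kernel k \<longleftrightarrow>
     (\<forall>w. (\<lambda>z. k z w) holomorphic_on UNIV) \<and> (\<forall>z. (\<lambda>w. cnj (k z w)) holomorphic_on UNIV)"

abbreviation kernel_space :: "(complex \<times> complex \<Rightarrow> complex) measure" where
  "kernel_space \<equiv> Pi\<^sub>M UNIV (\<lambda>_. borel)"

definition random_kernel :: "'a measure \<Rightarrow> ('a \<Rightarrow> complex \<Rightarrow> complex \<Rightarrow> complex) \<Rightarrow> bool" where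
  "random_kernel N K \<longleftrightarrow> (\<lambda>\<omega>. case_prod (K \<omega>)) \<in> measurable N kernel_space"

definition sigma_of_kernel :: "'a measure \<Rightarrow> ('a \<Rightarrow> complex \<Rightarrow> complex \<Rightarrow> complex) \<Rightarrow> 'a measure" where
  "sigma_of_kernel N K = vimage_algebra (space N) (\<lambda>\<omega>. case_prod (K \<omega>)) kernel_space"

text \<open>\<open>\<kappa>\<close> is a regular version of the conditional law of the \<open>S\<close>-valued \<open>X\<close> given \<open>F\<close>.\<close>

definition conditional_law ::
  "'a measure \<Rightarrow> 'a measure \<Rightarrow> 'b measure \<Rightarrow> ('a \<Rightarrow> 'b) \<Rightarrow> ('a \<Rightarrow> 'b measure) \<Rightarrow> bool" where
  "conditional_law N F S X \<kappa> \<longleftrightarrow>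
     subalgebra N F \<and> X \<in> measurable N S \<and> \<kappa> \<in> measurable F (prob_algebra S) \<and>
     (\<forall>B\<in>sets S. AE \<omega> in N. real_cond_exp N F (\<lambda>\<omega>'. indicator B (X \<omega>')) \<omega> = measure (\<kappa> \<omega>) B)"

end

theory Submission
  imports Defs "HOL-Complex_Analysis.Complex_Analysis" "HOL-Real_Asymp.Real_Asymp" "Jordan_Normal_Form.Char_Poly"
begin

text \<open>
  Conditionally on its first \<open>n\<close> rows and columns, the Ginibre matrix is bordered by an independent
  Gaussian row and column. By rotation invariance, the pair (characteristic polynomial, Gram matrix
  of the cofactors of the last row) is, up to a common random factor, a Markov chain in \<open>n\<close>: the
  new polynomial is a mean plus a Gaussian vector with covariance the Gram matrix, and the new Gram
  matrix is a convex-like combination of the old one and a rank one term. After normalisation the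
  mean is negligible and the Gram matrix is an \<open>L\<^sup>1\<close> Cauchy sequence, uniformly on weighted spaces of
  Taylor coefficients; its limit is the conditional covariance kernel. Strict positivity
  of the limit follows from negative moment bounds along the chain and an \<open>\<epsilon>\<close>-net argument.
\<close>

text \<open>The statement concerns laws only, so the matrices may be exchanged for a process driven
  by one fixed noise, whose conditional kernels converge on a single probability space. The two
  agree only up to a random factor \<open>s\<close> for the polynomial and \<open>s\<^sup>2\<close>
  for the Gram matrix, so only scale invariant functionals are compared. This is also why
  \<open>A n\<close> is the square root of one Gram entry, the conditional variance of the constant
  coefficient. The factor is free and is chosen so that the old kernel gets the constant weight
  \<open>1 - 1/n\<close> and the rank one term a weight of mean \<open>1/n\<close>: the kernel is
  then a martingale up to a drift quadratic in the mean, and the mean itself shrinks like n^(-1/2).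
  Gaussian samples are produced by a Cholesky factor, which is continuous only at nondegenerate
  kernels. Strict positivity of the limit is therefore needed for the convergence itself, not only
  for the conclusion. It must hold outside one null set for uncountably many configurations of
  points, hence the net and negative moments of arbitrarily high order.\<close>

hide_const (open) Determinants.det Finite_Cartesian_Product.vec Finite_Cartesian_Product.row module.smult

abbreviation half_normal :: "real measure" where
 "half_normal \<equiv> density lborel (normal_density 0 (sqrt (1/2)))"
abbreviation (input) seq_limit (infix "---->" 60) where "seq_limit X L \<equiv> X \<longlonglongrightarrow> L"
abbreviation std_expectation (binder "\<G>" 10) where "std_expectation f \<equiv> nn_integral std_complex_gaussian f"
abbreviation half_expectation (binder "\<H>" 10) where "half_expectation f \<equiv> nn_integral half_normal f"
abbreviation lborel_integral (binder "\<L>" 10) where "lborel_integral f \<equiv> nn_integral lborel f"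
abbreviation "nsq x \<equiv> (norm x)\<^sup>2"
abbreviation "ucc_borel \<equiv> borel_of ucc_topology"
abbreviation "stdc \<equiv> std_complex_gaussian"

section \<open>Standard complex Gaussians and their rotation invariance\<close>

lemma prob_space_half_normal: "prob_space half_normal"
 by (rule prob_space_normal_density) simp

lemma measurable_Complex [measurable]:
 assumes [measurable]: "f : borel_measurable M" "g : borel_measurable M"
 shows "(%x. Complex (f x) (g x)) : borel_measurable M"
 unfolding Complex_eq by measurable

lemma sets_std_complex_gaussian [measurable_cong, simp]: "sets stdc = sets borel"
 by (simp add: std_complex_gaussian_def)

lemma space_std_complex_gaussian [simp]: "space stdc = UNIV"
 by (simp add: std_complex_gaussian_def)

interpretation std: prob_space stdc
proof -
 interpret a: prob_space half_normal by (rule prob_space_half_normal)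
 interpret p: pair_prob_space half_normal half_normal ..
 show "prob_space stdc"
  unfolding std_complex_gaussian_def by (rule p.prob_space_distr) simp
qed

lemma nn_integral_std:
 assumes [measurable]: "f : borel_measurable borel"
 shows "(\<G> w. f w)
    = (\<H> x y. f (Complex x y))"
proof -
 interpret a: prob_space half_normal by (rule prob_space_half_normal)
 have "(\<G> w. f w)
   = (\<integral>\<^sup>+p. f (case p of (x, y) => Complex x y) \<partial>(half_normal \<Otimes>\<^sub>M half_normal))"
  unfolding std_complex_gaussian_def by (subst nn_integral_distr) auto
 also have "... = (\<H> x y. f (Complex x y))"
  by (subst a.nn_integral_fst[symmetric]) auto
 finally show ?thesis .
qed

text \<open>A rotation is a composition of two one-dimensional affine substitutions, whose factors
  1/|c| and |c| cancel. They divide by \<open>c\<close>, so the quarter turn \<open>c = 0\<close> is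
  treated separately as a signed exchange of the variables.\<close>

lemma nn_integral_lborel_rotation:
 fixes H :: "real \<times> real => ennreal"
 assumes H [measurable]: "H : borel_measurable (borel \<Otimes>\<^sub>M borel)" and cs: "c\<^sup>2+s\<^sup>2 = 1"
 shows "(\<L> x y. H (c*x+s*y,-s*x+c*y))
    = (\<L> x y. H (x, y))"
proof (cases "c = 0")
 case True
 then have s: "s ~= 0" "\<bar>s\<bar> = 1" using cs by (auto simp: power2_eq_1_iff)
 have "(\<L> x y. H (x, y))
   = (\<L> x y. H (0+s*x, y))"
  by (subst nn_integral_real_affine[where t=0 and c=s]) (use s in \<open>auto\<close>)
 also have "... = (\<L> x y. H (0+s*x, 0+(- s)*y))"
  by (rule nn_integral_cong, rule trans[OF nn_integral_real_affine[of _ "- s" 0]]) (use s in \<open>auto\<close>)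
 also have "... = (\<L> y x. H (0+s*x, 0+(- s)*y))"
  by (rule lborel_pair.Fubini'[symmetric]) auto
 finally show ?thesis using True by simp
next
 case c: False
 have "(\<L> x y. H (x, y))
   = (\<L> x. ennreal (1/\<bar>c\<bar>)*(\<L> y. H (x,-s*x/c+1/c*y)))"
  by (intro nn_integral_cong, subst nn_integral_real_affine[where t="- s*x/c" and c="1/c" for x])
    (use c in \<open>auto\<close>)
 also have "... = ennreal (1/\<bar>c\<bar>)*(\<L> x y. H (x,-s*x/c+1/c*y))"
  by (subst nn_integral_cmult) auto
 also have "(\<L> x y. H (x,-s*x/c+1/c*y))
   = (\<L> y x. H (x,-s*x/c+1/c*y))"
  by (rule lborel_pair.Fubini'[symmetric]) auto
 also have "... = (\<L> y. ennreal \<bar>c\<bar>*(\<L> x. H (s*y+c*x,-s*(s*y+c*x)/c+1/c*y)))"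
  by (intro nn_integral_cong, subst nn_integral_real_affine[where t="s*y" and c="c" for y])
    (use c in \<open>auto\<close>)
 also have "... = ennreal \<bar>c\<bar>*(\<L> y x. H (s*y+c*x,-s*(s*y+c*x)/c+1/c*y))"
  by (subst nn_integral_cmult) auto
 also have "(\<L> y x. H (s*y+c*x,-s*(s*y+c*x)/c+1/c*y))
   = (\<L> y x. H (c*x+s*y,-s*x+c*y))"
 proof (intro nn_integral_cong arg_cong[where f=H])
  fix x y :: real
  have "c*(- s*(s*y+c*x)/c+1/c*y) = c*(- s*x+c*y)"
  proof -
   have "c*(- s*(s*y+c*x)/c+1/c*y) = y*(1-s * s)-c * s*x"
    using c by (simp add: field_simps)
   also have "1-s * s = c*c" using cs by (simp add: power2_eq_square)
   finally show ?thesis by (simp add: algebra_simps)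
  qed
  then have "- s*(s*y+c*x)/c+1/c*y =-s*x+c*y"
   using c by simp
  then show "(s*y+c*x,-s*(s*y+c*x)/c+1/c*y) = (c*x+s*y,-s*x+c*y)"
   by simp
 qed
 also have "... = (\<L> x y. H (c*x+s*y,-s*x+c*y))"
  by (rule lborel_pair.Fubini') auto
 finally show ?thesis
  using c by (simp add: mult.assoc[symmetric] ennreal_mult'[symmetric])
qed

lemma nn_integral_half_normal_rotation:
 fixes F :: "real \<times> real => ennreal"
 assumes F [measurable]: "F : borel_measurable (borel \<Otimes>\<^sub>M borel)" and cs: "c\<^sup>2+s\<^sup>2 = 1"
 shows "(\<H> x y. F (c*x+s*y,-s*x+c*y))
    = (\<H> x y. F (x, y))"
proof -
 define d where "d = normal_density 0 (sqrt (1/2))"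
 have [measurable]: "d : borel_measurable borel" by (simp add: d_def)
 have d0: "0 <= d x" for x by (simp add: d_def)
 define H where "H p = ennreal (d (fst p)*d (snd p))*F p" for p
 have H: "H : borel_measurable (borel \<Otimes>\<^sub>M borel)" unfolding H_def by measurable
 have dd: "d x*d y = d (c*x+s*y)*d (- s*x+c*y)" for x y
 proof -
  have "(c*x+s*y)\<^sup>2+(- s*x+c*y)^2 = (c\<^sup>2+s\<^sup>2)*(x\<^sup>2+y\<^sup>2)"
   by (simp add: power2_eq_square algebra_simps)
  then have "x\<^sup>2+y\<^sup>2 = (c*x+s*y)^2+(- s*x+c*y)^2" using cs by simp
  then show ?thesis
   by (simp add: d_def normal_density_def power2_eq_square flip: exp_add)
 qed
 have ex: "(\<H> x y. G x y)
   = (\<L> x y. ennreal (d x*d y)*G x y)"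
  if [measurable]: "case_prod G : borel_measurable (borel \<Otimes>\<^sub>M borel)" for G
  unfolding d_def[symmetric]
  by (simp add: nn_integral_density nn_integral_cmult[symmetric] ennreal_mult d0 mult.assoc)
 have "(\<H> x y. F (c*x+s*y,-s*x+c*y))
   = (\<L> x y. H (c*x+s*y,-s*x+c*y))"
  unfolding H_def fst_conv snd_conv dd[symmetric] by (subst ex) auto
 also have "... = (\<L> x y. H (x, y))"
  by (rule nn_integral_lborel_rotation[OF H cs])
 also have "... = (\<H> x y. F (x, y))"
  by (subst ex) (auto simp: H_def)
 finally show ?thesis .
qed

lemma nn_integral_std_phase:
 assumes [measurable]: "f : borel_measurable borel" and t: "norm t = 1"
 shows "(\<G> w. f (t*w)) = (\<G> w. f w)"
proof -
 have 1: "(Re t)\<^sup>2+(- Im t)^2 = 1" using t by (simp add: cmod_def)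
 have "t*Complex x y = Complex (Re t*x+(- Im t)*y) (- (- Im t)*x+Re t*y)" for x y
  by (simp add: complex_eq_iff)
 then show ?thesis
  using nn_integral_half_normal_rotation[OF _ 1, of "%p. f (Complex (fst p) (snd p))"]
  by (simp add: nn_integral_std)
qed

text \<open>Real coefficients rotate the real parts and the imaginary parts separately, by the same
  angle. \<open>swap\<close> reorders the four real integrals so that each of the two pairs is
  integrated together.\<close>

lemma nn_integral_std_rotation:
 fixes f :: "complex \<times> complex => ennreal"
 assumes [measurable]: "f : borel_measurable (borel \<Otimes>\<^sub>M borel)" and cs: "c\<^sup>2+s\<^sup>2 = 1"
 shows "(\<G> z w. f (of_real c*z + of_real s*w, - of_real s*z + of_real c*w)
      )
    = (\<G> z w. f (z, w))"
proof -
 interpret a: prob_space half_normal by (rule prob_space_half_normal)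
 interpret p: pair_sigma_finite half_normal half_normal ..
 have swap: "(\<G> z w. g z w)
   = (\<H> x x' y y'. g (Complex x y) (Complex x' y'))"
  if [measurable]: "case_prod g : borel_measurable (borel \<Otimes>\<^sub>M borel)" for g
 proof -
  have "(\<G> z w. g z w)
   = (\<H> x y x' y'. g (Complex x y) (Complex x' y'))"
   by (subst nn_integral_std, measurable) (simp add: nn_integral_std)
  also have "... = (\<H> x x' y y'. g (Complex x y) (Complex x' y'))"
   by (intro nn_integral_cong p.Fubini'[symmetric]) measurable
  finally show ?thesis .
 qed
 define H where "H p = (\<H> y y'. f (Complex (fst p) y, Complex (snd p) y'))" for p
 have Hm: "H : borel_measurable (borel \<Otimes>\<^sub>M borel)" unfolding H_def by measurable
 have 1: "(\<H> y y'. f (Complex u (c*y+s*y'), Complex v (- s*y+c*y'))) = H (u, v)" for u v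
  using nn_integral_half_normal_rotation[OF _ cs, of "%p. f (Complex u (fst p), Complex v (snd p))"]
  by (simp add: H_def)
 have C: "(of_real c*Complex x y + of_real s*Complex x' y', - of_real s*Complex x y + of_real c*Complex x' y')
   = (Complex (c*x+s*x') (c*y+s*y'), Complex (- s*x+c*x') (- s*y+c*y'))" for x y x' y'
  by (simp add: complex_eq_iff)
 show ?thesis
  apply (subst (1 2) swap)
   apply measurable
  unfolding C 1
  using nn_integral_half_normal_rotation[OF Hm cs] by (simp add: H_def)
qed

section \<open>Independent families of standard complex Gaussians\<close>

definition cgauss :: "('i => complex) measure" where
 "cgauss = Pi\<^sub>M UNIV (%_. stdc)"

abbreviation gauss_expectation (binder "\<E>" 10) where "gauss_expectation f \<equiv> nn_integral cgauss f"
abbreviation gauss_mean (binder "\<M>" 10) where "gauss_mean f \<equiv> integral\<^sup>L cgauss f"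

lemma sets_cgauss [measurable_cong]: "sets cgauss = sets (Pi\<^sub>M UNIV (%_. borel))"
 unfolding cgauss_def by (intro sets_PiM_cong) auto

lemma space_cgauss [simp]: "space cgauss = UNIV"
 by (simp add: cgauss_def space_PiM)

interpretation cgauss: prob_space cgauss
 unfolding cgauss_def by (intro prob_space_PiM std.prob_space_axioms)

lemma measurable_cgauss_component [measurable]: "(%x. x i) : borel_measurable cgauss"
 by measurable

text \<open>Besides being a law, \<open>cgauss\<close> names the measurable space of complex
  families: \<open>measurable M cgauss\<close> just means that every coordinate is measurable.
  Coefficient sequences and matrices below are typed in this way whatever their law.\<close>

lemma measurable_into_cgauss:
 assumes "!!i. (%x. f x i) : borel_measurable M"
 shows "f : measurable M cgauss"
 unfolding measurable_cong_sets[OF refl sets_cgauss]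
 by (rule measurable_PiM_single') (use assms in auto)

lemma distr_cgauss_mix:
 "distr (cgauss \<Otimes>\<^sub>M cgauss) cgauss (%(x, y) i. if i : J then x i else y i) = (cgauss :: ('i => complex) measure)"
proof -
 interpret P: product_prob_space "%_::'i. stdc" UNIV ..
 let ?m = "%(x::'i=>complex, y) i. if i : J then x i else y i"
 have m [measurable]: "?m : measurable (cgauss \<Otimes>\<^sub>M cgauss) cgauss"
  by (rule measurable_into_cgauss) (auto simp: case_prod_beta)
 show ?thesis
  unfolding cgauss_def
 proof (rule P.PiM_eq, unfold cgauss_def[symmetric])
  show "sets (distr (cgauss \<Otimes>\<^sub>M cgauss) cgauss ?m) = sets cgauss" by simp
  fix K :: "'i set" and A :: "'i => complex set"
  assume K: "finite K" and A: "!!i. i : K ==> A i : sets stdc"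
  let ?e = "%K. prod_emb UNIV (%_. stdc) K (Pi\<^sub>E K A)"
  have em: "?e K' : sets cgauss" if "K' \<subseteq> K" for K'
   unfolding cgauss_def using that K A by (intro sets_PiM_I) (auto intro: finite_subset)
  have e: "emeasure cgauss (?e K') = (\<Prod>i\<in>K'. emeasure stdc (A i))" if "K' \<subseteq> K" for K'
   unfolding cgauss_def using that K A by (intro P.emeasure_PiM_emb) (auto intro: finite_subset)
  have eq: "?m -` ?e K \<inter> space (cgauss \<Otimes>\<^sub>M cgauss) = ?e (K \<inter> J) \<times> ?e (K-J)"
   by (auto simp: prod_emb_def space_pair_measure PiE_def Pi_def restrict_def extensional_def split: if_splits)
  have "emeasure (distr (cgauss \<Otimes>\<^sub>M cgauss) cgauss ?m) (?e K)
    = emeasure (cgauss \<Otimes>\<^sub>M cgauss) (?e (K \<inter> J) \<times> ?e (K-J))"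
   using em[of K] by (subst emeasure_distr[OF m]) (auto simp: eq)
  also have "... = emeasure cgauss (?e (K \<inter> J))*emeasure cgauss (?e (K-J))"
   using em by (intro cgauss.emeasure_pair_measure_Times) auto
  also have "... = (\<Prod>i\<in>K. emeasure stdc (A i))"
   using e K by (simp add: prod.union_disjoint[symmetric] Int_Diff_Un Int_Diff_disjoint)
  finally show "emeasure (distr (cgauss \<Otimes>\<^sub>M cgauss) cgauss ?m) (?e K)
    = (\<Prod>i\<in>K. emeasure stdc (A i))" .
 qed
qed

text \<open>Independence of the coordinates inside and outside \<open>J\<close>, in the form in
  which it is used: the block \<open>J\<close> may be replaced by a fresh copy and integrated
  first.\<close>

lemma nn_integral_cgauss_mix:
 fixes F :: "('i => complex) => ennreal"
 assumes F [measurable]: "F : borel_measurable cgauss"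
 shows "(\<E> x. F x) = (\<E> y x. F (%i. if i : J then x i else y i))"
proof -
 interpret p: pair_prob_space "cgauss :: ('i => complex) measure" "cgauss :: ('i => complex) measure" ..
 have m [measurable]: "(%(x, y) i. if i : J then x i else y i) : measurable (cgauss \<Otimes>\<^sub>M cgauss) (cgauss :: ('i => complex) measure)"
  by (rule measurable_into_cgauss) (auto simp: case_prod_beta)
 have "(\<E> x. F x) = (\<integral>\<^sup>+p. F (case p of (x, y) => %i. if i : J then x i else y i) \<partial>(cgauss \<Otimes>\<^sub>M cgauss))"
  by (subst distr_cgauss_mix[of J, symmetric], subst nn_integral_distr) auto
 also have "... = (\<E> y x. F (%i. if i : J then x i else y i))"
  by (subst p.nn_integral_snd[symmetric]) (simp_all cong: if_cong)
 finally show ?thesis .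
qed

lemma distr_cgauss_component: "distr cgauss stdc (%x. x i) = stdc"
 unfolding cgauss_def by (rule distr_PiM_component) (auto intro: std.prob_space_axioms)

lemma nn_integral_cgauss_component:
 assumes [measurable]: "f : borel_measurable borel"
 shows "(\<E> x. f (x i)) = (\<G> w. f w)"
proof -
 have [measurable]: "f : borel_measurable stdc"
  using assms by (simp cong: measurable_cong_sets)
 show ?thesis
  by (subst distr_cgauss_component[of i, symmetric], subst nn_integral_distr) auto
qed

lemma measurable_cgauss_fun_upd [measurable]:
 assumes [measurable]: "f : measurable M cgauss" "g : borel_measurable M"
 shows "(%x. (f x)(i := g x)) : measurable M cgauss"
proof (rule measurable_into_cgauss)
 fix j
 have "(%x. f x j) : borel_measurable M" by measurable
 then show "(%x. ((f x)(i := g x)) j) : borel_measurable M" by (cases "j = i") auto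
qed

lemma nn_integral_cgauss_refresh:
 fixes F :: "('i => complex) => ennreal"
 assumes F [measurable]: "F : borel_measurable cgauss"
 shows "(\<E> x. F x) = (\<E> x. \<G> a. F (x(i := a)))"
proof -
 have "(\<E> x. F x) = (\<E> y x. F (%j. if j : {i} then x j else y j))"
  by (rule nn_integral_cgauss_mix) fact
 also have "(%y x j. if j : {i} then x j else y j) = (%y x. y(i := x i))"
  by (auto simp: fun_eq_iff)
 also have "(\<E> y x. F (y(i := x i))) = (\<E> x. \<G> a. F (x(i := a)))"
  by (intro nn_integral_cong nn_integral_cgauss_component) measurable
 finally show ?thesis by (simp add: fun_eq_iff)
qed

section \<open>Unitary changes of coordinates\<close>

definition phase :: "'i => complex => ('i => complex) => 'i => complex" where
 "phase i t x = x(i := t*x i)"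

definition plane_rotation :: "'i => 'i => real => real => ('i => complex) => 'i => complex" where
 "plane_rotation i j c s x =
   x(i := of_real c*x i + of_real s*x j, j := - of_real s*x i + of_real c*x j)"

lemma measurable_phase [measurable]: "phase i t : measurable cgauss cgauss"
 unfolding phase_def by measurable

lemma measurable_plane_rotation [measurable]: "plane_rotation i j c s : measurable cgauss cgauss"
 unfolding plane_rotation_def by measurable

lemma measurable_cgauss_upd2:
 assumes [measurable]: "F : borel_measurable cgauss"
 shows "(%p. F (x(i := fst p, j := snd p))) : borel_measurable (borel \<Otimes>\<^sub>M borel)"
proof -
 have [measurable]: "(%p. x(i := fst p, j := snd p)) : measurable (borel \<Otimes>\<^sub>M borel) cgauss"
  by (rule measurable_into_cgauss) auto
 show ?thesis by measurable
qed

lemma nn_integral_cgauss_phase: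
 fixes F :: "('i => complex) => ennreal"
 assumes F [measurable]: "F : borel_measurable cgauss" and t: "norm t = 1"
 shows "(\<E> x. F (phase i t x)) = (\<E> x. F x)"
proof -
 have [measurable]: "(%a. F (x(i := a))) : borel_measurable borel" for x
 proof -
  have [measurable]: "(%a. x(i := a)) : measurable borel cgauss"
   by (rule measurable_into_cgauss) auto
  show ?thesis by measurable
 qed
 have "(\<E> x. F (phase i t x)) = (\<E> x. \<G> a. F (x(i := t*a)))"
  by (subst nn_integral_cgauss_refresh[of _ i]) (auto simp: phase_def)
 also have "... = (\<E> x. \<G> a. F (x(i := a)))"
  by (intro nn_integral_cong nn_integral_std_phase[OF _ t]) measurable
 also have "... = (\<E> x. F x)"
  by (rule nn_integral_cgauss_refresh[symmetric]) fact
 finally show ?thesis .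
qed

lemma nn_integral_cgauss_refresh2:
 fixes F :: "('i => complex) => ennreal"
 assumes F [measurable]: "F : borel_measurable cgauss"
 shows "(\<E> x. F x)
    = (\<E> x. \<G> a b. F (x(i := a, j := b)))"
proof -
 have "(\<E> x. F x) = (\<E> x. \<G> b. F (x(j := b)))"
  by (rule nn_integral_cgauss_refresh) fact
 also have "... = (\<E> x. \<G> a b. F (x(i := a, j := b)))"
  by (rule nn_integral_cgauss_refresh) measurable
 finally show ?thesis .
qed

lemma nn_integral_cgauss_plane_rotation:
 fixes F :: "('i => complex) => ennreal"
 assumes F [measurable]: "F : borel_measurable cgauss" and cs: "c\<^sup>2+s\<^sup>2 = 1" and ij: "i ~= j"
 shows "(\<E> x. F (plane_rotation i j c s x)) = (\<E> x. F x)"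
proof -
 have "(\<E> x. F (plane_rotation i j c s x))
   = (\<E> x. \<G> a b. F (x(i := of_real c*a + of_real s*b, j := - of_real s*a + of_real c*b))
     )"
  using ij by (subst nn_integral_cgauss_refresh2[of _ i j]) (auto simp: plane_rotation_def fun_upd_twist)
 also have "... = (\<E> x. \<G> a b. F (x(i := a, j := b)))"
  using nn_integral_std_rotation[OF measurable_cgauss_upd2[OF F] cs]
  by (intro nn_integral_cong[of cgauss]) simp
 also have "... = (\<E> x. F x)"
  by (rule nn_integral_cgauss_refresh2[symmetric]) fact
 finally show ?thesis .
qed

text \<open>Unitary maps of the coordinates in \<open>I\<close>, described by generators instead of
  matrices. Invariance of \<open>cgauss\<close> then reduces by induction to phases of one
  coordinate and real rotations in a coordinate plane.\<close>

inductive_set rots :: "'i set => (('i => complex) => 'i => complex) set" for I where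
 rots_id: "(%x. x) : rots I"
| rots_phase: "f : rots I ==> i : I ==> norm t = 1 ==> (%x. phase i t (f x)) : rots I"
| rots_plane: "f : rots I ==> i : I ==> j : I ==> i ~= j ==> c\<^sup>2+s\<^sup>2 = 1 ==>
  (%x. plane_rotation i j c s (f x)) : rots I"

lemma rots_mono: "f : rots I ==> I \<subseteq> J ==> f : rots J"
 by (induction rule: rots.induct) (auto intro: rots.intros)

lemma rots_comp: "g : rots I ==> f : rots I ==> (%x. g (f x)) : rots I"
 by (induction rule: rots.induct) (auto intro: rots.intros)

lemma rots_outside: "f : rots I ==> k \<notin> I ==> f x k = x k"
 by (induction rule: rots.induct) (auto simp: phase_def plane_rotation_def)

lemma rots_zero: "f : rots I ==> (!!i. i : I ==> x i = 0) ==> f x = x"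
 by (induction rule: rots.induct) (auto simp: phase_def plane_rotation_def fun_eq_iff)

lemma rots_inner:
 assumes "f : rots I" "finite I"
 shows "(\<Sum>i\<in>I. f x i*cnj (f y i)) = (\<Sum>i\<in>I. x i*cnj (y i))"
 using assms(1)
proof (induction rule: rots.induct)
 case (rots_phase f i \<theta>)
 have "\<theta>*cnj \<theta> = 1" using rots_phase by (simp add: complex_norm_square[symmetric])
 then have "phase i \<theta> (f x) k*cnj (phase i \<theta> (f y) k) = f x k*cnj (f y k)" for k
 proof -
  have "\<theta>*a*cnj (\<theta>*b) = (\<theta>*cnj \<theta>)*(a*cnj b)" for a b by (simp add: ac_simps)
  then show ?thesis using \<open>\<theta> * cnj \<theta> = 1\<close> by (simp add: phase_def)
 qed
 then have "(\<Sum>k\<in>I. phase i \<theta> (f x) k*cnj (phase i \<theta> (f y) k)) = (\<Sum>k\<in>I. f x k*cnj (f y k))"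
  by (intro sum.cong refl)
 with rots_phase.IH show ?case by (simp only:)
next
 case (rots_plane f i j c s)
 have sp: "(\<Sum>k\<in>I. g k) = g i+g j+(\<Sum>k\<in>I-{i, j}. g k)" for g :: "'a => complex"
 proof -
  have "(\<Sum>k\<in>I. g k) = g i+(\<Sum>k\<in>I-{i}. g k)"
   using assms(2) rots_plane by (intro sum.remove) auto
  also have "(\<Sum>k\<in>I-{i}. g k) = g j+(\<Sum>k\<in>I-{i}-{j}. g k)"
   using assms(2) rots_plane by (intro sum.remove) auto
  also have "I-{i}-{j} = I-{i, j}" by auto
  finally show ?thesis by (simp only: add.assoc)
 qed
 let ?R = "plane_rotation i j c s"
 have cs: "(of_real c)\<^sup>2+(of_real s)^2 = (1::complex)"
  using rots_plane(5) by (metis of_real_1 of_real_add of_real_power)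
 have "?R (f x) i*cnj (?R (f y) i)+?R (f x) j*cnj (?R (f y) j)
   = ((of_real c)^2+(of_real s)^2)*(f x i*cnj (f y i)+f x j*cnj (f y j))"
  using rots_plane(4) by (simp add: plane_rotation_def power2_eq_square algebra_simps)
 moreover have "(\<Sum>k\<in>I-{i, j}. ?R (f x) k*cnj (?R (f y) k)) = (\<Sum>k\<in>I-{i, j}. f x k*cnj (f y k))"
  by (intro sum.cong) (auto simp: plane_rotation_def)
 ultimately have "(\<Sum>k\<in>I. ?R (f x) k*cnj (?R (f y) k)) = (\<Sum>k\<in>I. f x k*cnj (f y k))"
  unfolding sp cs by (simp only: mult_1_left)
 with rots_plane.IH show ?case by (simp only:)
qed simp

lemma measurable_rots [measurable_dest]: "f : rots I ==> f : measurable cgauss cgauss"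
 by (induction rule: rots.induct) auto

lemma nn_integral_cgauss_rots:
 assumes "f : rots I" "F : borel_measurable cgauss"
 shows "(\<E> x. F (f x)) = (\<E> x. F x)"
 using assms
proof (induction arbitrary: F rule: rots.induct)
 case (rots_phase f i t)
 note [measurable] = rots_phase.prems
 have "(\<E> x. F (phase i t (f x))) = (\<E> x. F (phase i t x))"
  by (rule rots_phase.IH) measurable
 with rots_phase show ?case by (simp add: nn_integral_cgauss_phase)
next
 case (rots_plane f i j c s)
 note [measurable] = rots_plane.prems
 have "(\<E> x. F (plane_rotation i j c s (f x))) = (\<E> x. F (plane_rotation i j c s x))"
  by (rule rots_plane.IH) measurable
 with rots_plane show ?case by (simp add: nn_integral_cgauss_plane_rotation)
qed simp

lemma distr_cgauss_rots:
 assumes "f : rots I"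
 shows "distr cgauss cgauss f = cgauss"
proof (rule measure_eqI)
 note [measurable] = measurable_rots[OF assms]
 fix A assume "A : sets (distr cgauss cgauss f)"
 then have [measurable]: "A : sets cgauss" by simp
 have "emeasure (distr cgauss cgauss f) A = (\<E> x. indicator A (f x))"
  by (subst nn_integral_indicator[symmetric], simp) (subst nn_integral_distr, auto)
 also have "... = (\<E> x. indicator A x)"
  by (rule nn_integral_cgauss_rots[OF assms]) measurable
 finally show "emeasure (distr cgauss cgauss f) A = emeasure cgauss A" by simp
qed simp

text \<open>Givens elimination: each coordinate \<open>j\<close> is rotated into coordinate
  \<open>k\<close>. Phases first make both coordinates nonnegative reals, because the plane
  rotations have real coefficients.\<close>

lemma rots_eliminate:
 assumes "finite J" "k : I" "J \<subseteq> I-{k}"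
 shows "\<exists>f\<in>rots I. \<forall>j\<in>J. f x j = 0"
 using assms
proof (induction J)
 case empty
 then show ?case by (auto intro: rots_id)
next
 case (insert j J)
 then obtain f where f: "f : rots I" "\<forall>j\<in>J. f x j = 0" by auto
 define y where "y = f x"
 have jk: "j ~= k" "j : I" "k : I" using insert by auto
 define ph where "ph w = (if w = 0 then 1 else cnj (sgn w))" for w :: complex
 have ph: "norm (ph w) = 1" "ph w*w = of_real (norm w)" for w
 proof -
  show "norm (ph w) = 1" by (simp add: ph_def norm_sgn)
  show "ph w*w = of_real (norm w)"
  proof (cases "w = 0")
   case False
   have "ph w*w = w*cnj w / of_real (norm w)"
    using False by (simp add: ph_def sgn_div_norm scaleR_conv_of_real divide_inverse)
   also have "... = of_real (norm w)"
    using False by (simp add: complex_norm_square[symmetric] power2_eq_square)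
   finally show ?thesis .
  qed simp
 qed
 define g where "g x = phase j (ph (y j)) (phase k (ph (y k)) (f x))" for x
 have g: "g : rots I" unfolding g_def using f(1) jk ph(1) by (intro rots_phase) auto
 have gx: "g x k = of_real (norm (y k))" "g x j = of_real (norm (y j))" "!!i. i ~= j ==> i ~= k ==> g x i = y i"
  using jk by (auto simp: g_def phase_def y_def[symmetric] ph)
 show ?case
 proof (cases "y j = 0")
  case True
  then show ?thesis using f by (auto simp: y_def)
 next
  case False
  define \<rho> where "\<rho> = sqrt (nsq (y k)+nsq (y j))"
  have \<rho>: "\<rho> > 0" using False by (auto simp: \<rho>_def intro: add_nonneg_pos)
  have "(norm (y k)/\<rho>)\<^sup>2+(norm (y j)/\<rho>)^2 = (nsq (y k)+nsq (y j))/\<rho>\<^sup>2"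
   by (simp add: power_divide add_divide_distrib)
  also have "\<rho>\<^sup>2 = nsq (y k)+nsq (y j)" by (simp add: \<rho>_def)
  also have "(nsq (y k)+nsq (y j))/(nsq (y k)+nsq (y j)) = 1"
   using False by (simp add: add_nonneg_eq_0_iff)
  finally have "(%x. plane_rotation k j (norm (y k)/\<rho>) (norm (y j)/\<rho>) (g x)) : rots I"
   using g jk by (intro rots_plane) auto
  moreover have "plane_rotation k j (norm (y k)/\<rho>) (norm (y j)/\<rho>) (g x) i = 0" if "i : insert j J" for i
  proof (cases "i = j")
   case True
   then show ?thesis using jk by (simp add: plane_rotation_def gx mult.commute)
  next
   case False
   then have "i : J" "i ~= k" using that insert.prems by auto
   with False show ?thesis using f(2) by (simp add: plane_rotation_def gx y_def)
  qed
  ultimately show ?thesis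
   by (intro bexI[where x="%x. plane_rotation k j (norm (y k)/\<rho>) (norm (y j)/\<rho>) (g x)"] ballI)
 qed
qed

lemma rots_to_axis:
 assumes "finite I" "k : I" "(\<Sum>i\<in>I. x i*cnj (x i)) = 1"
 shows "\<exists>f\<in>rots I. \<forall>i\<in>I. f x i = (if i = k then 1 else 0)"
proof -
 obtain f where f: "f : rots I" "\<forall>j\<in>I-{k}. f x j = 0"
  using rots_eliminate[of "I-{k}" k I x] assms by auto
 have "1 = (\<Sum>i\<in>I. f x i*cnj (f x i))" using rots_inner[OF f(1) assms(1), of x x] assms(3) by simp
 also have "... = f x k*cnj (f x k)" using assms f(2) by (subst sum.remove[of I k]) auto
 finally have 1: "cnj (f x k)*f x k = 1" by (simp add: mult.commute)
 then have "norm (cnj (f x k)) = 1"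
 proof -
  have "norm (f x k)*norm (f x k) = 1" using arg_cong[OF 1, of norm] by (simp add: norm_mult)
  then have "nsq (f x k) = 1" by (simp add: power2_eq_square)
  then have "norm (f x k) = 1" by (simp add: power2_eq_1_iff) (use norm_ge_zero[of "f x k"] in linarith)
  then show ?thesis by simp
 qed
 then have "(%x'. phase k (cnj (f x k)) (f x')) : rots I"
  using f(1) assms(2) by (intro rots_phase)
 moreover have "\<forall>i\<in>I. phase k (cnj (f x k)) (f x) i = (if i = k then 1 else 0)"
  using f(2) 1 by (auto simp: phase_def)
 ultimately show ?thesis by (intro bexI[where x="%x'. phase k (cnj (f x k)) (f x')"])
qed

text \<open>Induction on \<open>K\<close>. The image of the next vector is orthogonal to the axes
  already reached, so on \<open>I\<close> it is supported by the remaining coordinates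
  \<open>I'\<close>; a rotation of \<open>I'\<close> alone sends it to a new axis and fixes the
  vectors treated before.\<close>

lemma rots_orthonormal_to_axes:
 assumes "finite I" "finite K"
  and "!!k l. k : K ==> l : K ==> (\<Sum>i\<in>I. V k i*cnj (V l i)) = (if k = l then 1 else 0)"
 shows "\<exists>f\<in>rots I. \<exists>p. inj_on p K \<and> p ` K \<subseteq> I \<and> (\<forall>k\<in>K. \<forall>i\<in>I. f (V k) i = (if i = p k then 1 else 0))"
 using assms(2,3)
proof (induction K)
 case empty
 then show ?case by (auto intro: rots_id)
next
 case (insert m K)
 then obtain f p where f: "f : rots I" and p: "inj_on p K" "p ` K \<subseteq> I"
  and fp: "!!k i. k : K ==> i : I ==> f (V k) i = (if i = p k then 1 else 0)" by auto
 define y where "y = f (V m)"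
 have y0: "y (p k) = 0" if k: "k : K" for k
 proof -
  have "0 = (\<Sum>i\<in>I. V m i*cnj (V k i))" using insert k by auto
  also have "... = (\<Sum>i\<in>I. y i*cnj (f (V k) i))" by (simp add: rots_inner[OF f assms(1)] y_def)
  also have "... = (\<Sum>i\<in>I. if i = p k then y i else 0)" using fp[OF k] by (intro sum.cong) auto
  also have "... = y (p k)" using assms(1) p(2) k by auto
  finally show ?thesis by simp
 qed
 define I' where "I' = I-p ` K"
 have y1: "(\<Sum>i\<in>I'. y i*cnj (y i)) = 1"
 proof -
  have "1 = (\<Sum>i\<in>I. V m i*cnj (V m i))" using insert by auto
  also have "... = (\<Sum>i\<in>I. y i*cnj (y i))" by (simp add: rots_inner[OF f assms(1)] y_def)
  also have "... = (\<Sum>i\<in>I'. y i*cnj (y i))"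
   using assms(1) y0 by (intro sum.mono_neutral_right) (auto simp: I'_def)
  finally show ?thesis by simp
 qed
 then obtain k where k: "k : I'" by force
 obtain g where g: "g : rots I'" "\<forall>i\<in>I'. g y i = (if i = k then 1 else 0)"
  using rots_to_axis[OF _ k y1] assms(1) by (auto simp: I'_def)
 have "(%x. g (f x)) : rots I"
  using rots_mono[OF g(1)] f by (intro rots_comp[of g I f]) (auto simp: I'_def)
 moreover have "inj_on (p(m := k)) (insert m K)" "(p(m := k)) ` insert m K \<subseteq> I"
  using p k insert.hyps by (auto simp: inj_on_def I'_def)
 moreover have "g (f (V l)) i = (if i = (p(m := k)) l then 1 else 0)" if "l : insert m K" "i : I" for l i
 proof (cases "l = m")
  case True
  show ?thesis
  proof (cases "i : I'")
   case False
   then have "g y i = y i" "y i = 0" "i ~= k"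
    using g(1) y0 that k by (auto simp: rots_outside I'_def)
   then show ?thesis using True by (simp add: y_def)
  qed (use True g(2) in \<open>auto simp: y_def\<close>)
 next
  case False
  then have l: "l : K" using that by auto
  then have "g (f (V l)) = f (V l)"
   using fp by (intro rots_zero[OF g(1)]) (auto simp: I'_def)
  then show ?thesis using fp[OF l that(2)] False by simp
 qed
 ultimately show ?case
  by (intro bexI[where x="%x. g (f x)"] exI[where x="p(m := k)"] conjI ballI)
qed

text \<open>The rotation that carries the conjugated rows \<open>V\<close> to coordinate axes turns
  the linear forms into distinct coordinates. The conjugation appears because the forms are bilinear
  in \<open>W\<close> and \<open>x\<close>, while rotations preserve the Hermitian product.\<close>

theorem distr_cgauss_orthonormal:
 fixes W :: "'k => 'i => complex"
 assumes I: "finite I" and K: "finite K"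
  and orth: "!!k l. k : K ==> l : K ==> (\<Sum>i\<in>I. W k i*cnj (W l i)) = (if k = l then 1 else 0)"
 shows "distr cgauss (Pi\<^sub>M K (%_. stdc)) (%x. \<lambda>k\<in>K. \<Sum>i\<in>I. W k i*x i)
    = Pi\<^sub>M K (%_. stdc)"
proof -
 define V where "V k i = cnj (W k i)" for k i
 have oV: "(\<Sum>i\<in>I. V k i*cnj (V l i)) = (if k = l then 1 else 0)" if "k : K" "l : K" for k l
 proof -
  have "(\<Sum>i\<in>I. V k i*cnj (V l i)) = cnj (\<Sum>i\<in>I. W k i*cnj (W l i))" by (simp add: V_def)
  then show ?thesis using orth[OF that] by simp
 qed
 have "\<exists>f\<in>rots I. \<exists>p. inj_on p K \<and> p ` K \<subseteq> I \<and> (\<forall>k\<in>K. \<forall>i\<in>I. f (V k) i = (if i = p k then 1 else 0))"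
  using oV by (intro rots_orthonormal_to_axes I K)
 then obtain f p where f: "f : rots I" and p: "inj_on p K" "p ` K \<subseteq> I"
  and fp': "\<forall>k\<in>K. \<forall>i\<in>I. f (V k) i = (if i = p k then 1 else 0)"
  by (elim bexE exE conjE)
 have fp: "f (V k) i = (if i = p k then 1 else 0)" if "k : K" "i : I" for k i
  using fp' that by blast
 note [measurable] = measurable_rots[OF f]
 have eq: "(\<Sum>i\<in>I. W k i*x i) = f x (p k)" if k: "k : K" for k x
 proof -
  have "(\<Sum>i\<in>I. W k i*x i) = (\<Sum>i\<in>I. x i*cnj (V k i))" by (simp add: V_def mult.commute)
  also have "... = (\<Sum>i\<in>I. f x i*cnj (f (V k) i))" by (simp add: rots_inner[OF f I])
  also have "... = (\<Sum>i\<in>I. if i = p k then f x i else 0)" using fp[OF k] by (intro sum.cong) auto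
  also have "... = f x (p k)" using I p(2) k by auto
  finally show ?thesis .
 qed
 have [measurable]: "(%x. \<lambda>k\<in>K. x (p k)) : measurable cgauss (Pi\<^sub>M K (%_. stdc))"
  by (rule measurable_restrict) (simp add: measurable_cong_sets[OF refl sets_std_complex_gaussian])
 have "distr cgauss (Pi\<^sub>M K (%_. stdc)) (%x. \<lambda>k\<in>K. \<Sum>i\<in>I. W k i*x i)
   = distr cgauss (Pi\<^sub>M K (%_. stdc)) (%x. \<lambda>k\<in>K. f x (p k))"
  by (intro distr_cong refl restrict_ext eq)
 also have "... = distr (distr cgauss cgauss f) (Pi\<^sub>M K (%_. stdc)) (%x. \<lambda>k\<in>K. x (p k))"
  by (subst distr_distr) (auto simp: comp_def)
 also have "... = Pi\<^sub>M K (%_. stdc)"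
  unfolding distr_cgauss_rots[OF f] unfolding cgauss_def
  using p by (intro distr_PiM_reindex) (auto intro: std.prob_space_axioms)
 finally show ?thesis .
qed

section \<open>Positive semidefinite forms and an explicit Cholesky factor\<close>

definition sesq :: "nat => (nat \<times> nat => complex) => (nat => complex) => (nat => complex) => complex" where
 "sesq N T x y = (\<Sum>a<N. \<Sum>b<N. x a*cnj (y b)*T (a, b))"

definition psd :: "(nat \<times> nat => complex) => bool" where
 "psd T \<longleftrightarrow> (\<forall>a b. T (b, a) = cnj (T (a, b))) \<and> (\<forall>N x. 0 <= Re (sesq N T x x))"

definition unit_seq :: "nat => nat => complex" where
 "unit_seq k = (%a. if a = k then 1 else 0)"

lemma sesq_diff_left: "sesq N T (%a. x a-y a) z = sesq N T x z-sesq N T y z"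
 by (simp add: sesq_def algebra_simps sum_subtractf)

lemma sesq_diff_right: "sesq N T z (%a. x a-y a) = sesq N T z x-sesq N T z y"
 by (simp add: sesq_def algebra_simps sum_subtractf)

lemma sesq_scale_left: "sesq N T (%a. c*x a) y = c * sesq N T x y"
 by (simp add: sesq_def sum_distrib_left mult.assoc)

lemma sesq_scale_right: "sesq N T x (%a. c*y a) = cnj c * sesq N T x y"
 by (simp add: sesq_def sum_distrib_left ac_simps)

lemma sesq_sum_left: "sesq N T (%a. \<Sum>i\<in>I. f i a) y = (\<Sum>i\<in>I. sesq N T (f i) y)"
proof (induction I rule: infinite_finite_induct)
 case (insert i I)
 have "sesq N T (%a. f i a+g a) y = sesq N T (f i) y+sesq N T g y" for g
  by (simp add: sesq_def algebra_simps sum.distrib)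
 with insert show ?case by simp
qed (simp_all add: sesq_def)

lemma sesq_sum_right: "sesq N T x (%a. \<Sum>i\<in>I. f i a) = (\<Sum>i\<in>I. sesq N T x (f i))"
proof (induction I rule: infinite_finite_induct)
 case (insert i I)
 have "sesq N T x (%a. f i a+g a) = sesq N T x (f i)+sesq N T x g" for g
  by (simp add: sesq_def algebra_simps sum.distrib)
 with insert show ?case by simp
qed (simp_all add: sesq_def)

lemma sesq_cnj: "psd T ==> sesq N T y x = cnj (sesq N T x y)"
proof -
 assume T: "psd T"
 have "cnj (T (a, b)) = T (b, a)" for a b using T unfolding psd_def by metis
 then have "cnj (sesq N T x y) = (\<Sum>a<N. \<Sum>b<N. cnj (x a)*y b*T (b, a))"
  by (simp add: sesq_def)
 also have "... = (\<Sum>b<N. \<Sum>a<N. cnj (x a)*y b*T (b, a))" by (rule sum.swap)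
 finally show ?thesis by (simp add: sesq_def ac_simps)
qed

lemma sesq_self_real: "psd T ==> sesq N T x x = of_real (Re (sesq N T x x))"
 using sesq_cnj[of T N x x] by (simp add: complex_eq_iff)

lemma sesq_self_nonneg: "psd T ==> 0 <= Re (sesq N T x x)"
 by (simp add: psd_def)

text \<open>A null vector of a semidefinite form is orthogonal to everything, since otherwise moving
  \<open>x\<close> along \<open>y\<close> would make the form negative. The value of
  \<open>t\<close> is chosen so that the form becomes exactly -1.\<close>

lemma sesq_null:
 assumes T: "psd T" and y: "sesq N T y y = 0"
 shows "sesq N T x y = 0"
proof (rule ccontr)
 define w where "w = sesq N T x y"
 define t where "t = (Re (sesq N T x x)+1)/(2*nsq w)"
 assume "sesq N T x y ~= 0"
 then have w: "w ~= 0" by (simp add: w_def)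
 let ?s = "of_real t*w"
 have "sesq N T (%a. x a-?s*y a) (%a. x a-?s*y a)
   = sesq N T x x-cnj ?s*w-?s*cnj w"
  unfolding sesq_diff_left sesq_diff_right sesq_scale_left sesq_scale_right y sesq_cnj[OF T, of N y x] w_def[symmetric]
  by simp
 also have "cnj ?s*w = of_real (t*nsq w)"
  by (metis complex_cnj_complex_of_real complex_cnj_mult complex_norm_square mult.commute mult.left_commute of_real_mult)
 also have "?s*cnj w = of_real (t*nsq w)"
  by (metis complex_norm_square mult.assoc of_real_mult)
 finally have "Re (sesq N T (%a. x a-?s*y a) (%a. x a-?s*y a)) = Re (sesq N T x x)-2*t*nsq w"
  by simp
 also have "... = -1" using w by (simp add: t_def field_simps)
 finally show False using sesq_self_nonneg[OF T, of N "%a. x a-?s*y a"] by simp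
qed

lemma sesq_extend:
 assumes "!!a. m <= a ==> x a = 0" "!!b. n <= b ==> y b = 0" "m <= N" "n <= N"
 shows "sesq N T x y = (\<Sum>a<m. \<Sum>b<n. x a*cnj (y b)*T (a, b))"
proof -
 have "(\<Sum>b<N. x a*cnj (y b)*T (a, b)) = (\<Sum>b<n. x a*cnj (y b)*T (a, b))" for a
  using assms by (intro sum.mono_neutral_right) auto
 moreover have "(\<Sum>a<N. \<Sum>b<n. x a*cnj (y b)*T (a, b)) = (\<Sum>a<m. \<Sum>b<n. x a*cnj (y b)*T (a, b))"
  using assms by (intro sum.mono_neutral_right) auto
 ultimately show ?thesis by (simp add: sesq_def)
qed

lemma sesq_unit_left: "a < N ==> sesq N T (unit_seq a) y = (\<Sum>b<N. cnj (y b)*T (a, b))"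
 by (simp add: sesq_def unit_seq_def if_distrib[where f="%x. x * _"] if_distrib[where f="%x. _ x"] sum.If_cases cong: if_cong)
   (subst sum.remove[of _ a], auto)

lemma sesq_unit: "a < N ==> b < N ==> sesq N T (unit_seq a) (unit_seq b) = T (a, b)"
proof -
 assume "a < N" "b < N"
 then have "sesq N T (unit_seq a) (unit_seq b) = (\<Sum>c<N. cnj (unit_seq b c)*T (a, c))"
  by (simp add: sesq_unit_left)
 also have "... = (\<Sum>c<N. if c = b then T (a, c) else 0)"
  by (intro sum.cong) (auto simp: unit_seq_def)
 also have "... = T (a, b)" using \<open>b < N\<close> by simp
 finally show ?thesis .
qed

text \<open>Orthogonalisation of the unit sequences with respect to the form \<open>T\<close>,
  written with arithmetic operations only, so that measurability and continuity in \<open>T\<close>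
  can be read off. A vanishing denominator yields the coefficient 0, which is harmless by
  \<open>gs_coeff_null\<close>. The sums stop at \<open>j\<close>, beyond which the vector vanishes,
  so no ambient dimension enters.\<close>

function gram_schmidt :: "(nat \<times> nat => complex) => nat => nat => complex" where
 "gram_schmidt T k a = (if a = k then 1 else 0)-(\<Sum>j<k.
   (\<Sum>b\<le>j. cnj (gram_schmidt T j b)*T (k, b)) /
   (\<Sum>c\<le>j. \<Sum>b\<le>j. gram_schmidt T j c*cnj (gram_schmidt T j b)*T (c, b))*gram_schmidt T j a)"
 by pat_completeness auto
termination by (relation "Wellfounded.measure (%(T, k, a). k)") auto

declare gram_schmidt.simps [simp del]

definition gs_coeff :: "(nat \<times> nat => complex) => nat => nat => complex" where
 "gs_coeff T a j = (\<Sum>b\<le>j. cnj (gram_schmidt T j b)*T (a, b))"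

definition gs_norm :: "(nat \<times> nat => complex) => nat => complex" where
 "gs_norm T j = (\<Sum>c\<le>j. \<Sum>b\<le>j. gram_schmidt T j c*cnj (gram_schmidt T j b)*T (c, b))"

text \<open>Lower triangular factor of \<open>T\<close>. If the \<open>k\<close>-th Gram-Schmidt
  vector is null, division by 0 makes its column vanish, as it should.\<close>

definition chol :: "(nat \<times> nat => complex) => nat => nat => complex" where
 "chol T a k = gs_coeff T a k / of_real (sqrt (Re (gs_norm T k)))"

lemma gram_schmidt_eq:
 "gram_schmidt T k a = unit_seq k a-(\<Sum>j<k. gs_coeff T k j/gs_norm T j*gram_schmidt T j a)"
 by (subst gram_schmidt.simps) (simp add: gs_coeff_def gs_norm_def unit_seq_def)

lemma gram_schmidt_beyond: "k < a ==> gram_schmidt T k a = 0"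
 by (induction k rule: less_induct) (subst gram_schmidt_eq, simp add: unit_seq_def)

lemma gram_schmidt_nonzero: "gram_schmidt T k a ~= 0 ==> a <= k"
 using gram_schmidt_beyond not_le by blast

lemma gram_schmidt_diag: "gram_schmidt T k k = 1"
 by (subst gram_schmidt_eq) (simp add: unit_seq_def gram_schmidt_beyond)

lemma gs_coeff_sesq: "a < N ==> k < N ==> gs_coeff T a k = sesq N T (unit_seq a) (gram_schmidt T k)"
 unfolding gs_coeff_def
 by (subst sesq_unit_left)
   (auto intro!: sum.mono_neutral_left dest: gram_schmidt_nonzero)

lemma gs_norm_sesq: "k < N ==> gs_norm T k = sesq N T (gram_schmidt T k) (gram_schmidt T k)"
 by (subst sesq_extend[of "Suc k" _ "Suc k"]) (auto simp: gs_norm_def gram_schmidt_beyond lessThan_Suc_atMost)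

lemma gs_norm_real: "psd T ==> gs_norm T k = of_real (Re (gs_norm T k))"
 by (subst (1 2) gs_norm_sesq[of k "Suc k"]) (auto intro: sesq_self_real)

lemma gs_norm_nonneg: "psd T ==> 0 <= Re (gs_norm T k)"
 by (subst gs_norm_sesq[of k "Suc k"]) (auto intro: sesq_self_nonneg)

lemma gs_coeff_null: "psd T ==> gs_norm T k = 0 ==> gs_coeff T a k = 0"
 using gs_norm_sesq[of k "Suc (max a k)" T] gs_coeff_sesq[of a "Suc (max a k)" k T] sesq_null[of T] by auto

lemma sesq_gram_schmidt_left:
 "sesq N T (gram_schmidt T k) y
  = sesq N T (unit_seq k) y-(\<Sum>j<k. gs_coeff T k j/gs_norm T j * sesq N T (gram_schmidt T j) y)"
proof -
 have "gram_schmidt T k = (%a. unit_seq k a-(\<Sum>j<k. gs_coeff T k j/gs_norm T j*gram_schmidt T j a))"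
  by (rule ext) (rule gram_schmidt_eq)
 then have "sesq N T (gram_schmidt T k) y
  = sesq N T (%a. unit_seq k a-(\<Sum>j<k. gs_coeff T k j/gs_norm T j*gram_schmidt T j a)) y" by simp
 also have "... = sesq N T (unit_seq k) y-(\<Sum>j<k. gs_coeff T k j/gs_norm T j * sesq N T (gram_schmidt T j) y)"
  unfolding sesq_diff_left sesq_sum_left sesq_scale_left ..
 finally show ?thesis .
qed

lemma gram_schmidt_orthogonal:
 assumes T: "psd T"
 shows "i < k ==> k < N ==> sesq N T (gram_schmidt T k) (gram_schmidt T i) = 0"
proof (induction k arbitrary: i rule: less_induct)
 case (less k)
 have "(\<Sum>j<k. gs_coeff T k j/gs_norm T j * sesq N T (gram_schmidt T j) (gram_schmidt T i))
   = (\<Sum>j<k. if j = i then gs_coeff T k i else 0)"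
 proof (intro sum.cong refl)
  fix j assume j: "j : {..<k}"
  consider "j < i" | "j = i" | "i < j" by linarith
  then show "gs_coeff T k j/gs_norm T j * sesq N T (gram_schmidt T j) (gram_schmidt T i) = (if j = i then gs_coeff T k i else 0)"
  proof cases
   case 1
   then have "sesq N T (gram_schmidt T i) (gram_schmidt T j) = 0" using less by auto
   then show ?thesis using 1 sesq_cnj[OF T, of N "gram_schmidt T j" "gram_schmidt T i"] by simp
  next
   case 2
   have "gs_norm T i = sesq N T (gram_schmidt T i) (gram_schmidt T i)"
    using less.prems by (intro gs_norm_sesq) auto
   then show ?thesis using 2 gs_coeff_null[OF T, of i k] by (cases "gs_norm T i = 0") auto
  next
   case 3
   then have "sesq N T (gram_schmidt T j) (gram_schmidt T i) = 0" using less j by auto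
   then show ?thesis using 3 by simp
  qed
 qed
 also have "... = gs_coeff T k i" using less.prems by simp
 finally show ?case
  using less.prems by (subst sesq_gram_schmidt_left) (simp add: gs_coeff_sesq[of k N i])
qed

lemma gram_schmidt_orthogonal':
 assumes T: "psd T" and "i ~= k" "i < N" "k < N"
 shows "sesq N T (gram_schmidt T k) (gram_schmidt T i) = 0"
proof (cases "i < k")
 case False
 then have "sesq N T (gram_schmidt T i) (gram_schmidt T k) = 0"
  using assms by (intro gram_schmidt_orthogonal) auto
 then show ?thesis using sesq_cnj[OF T, of N "gram_schmidt T k" "gram_schmidt T i"] by simp
qed (use assms gram_schmidt_orthogonal in auto)

text \<open>Entries of the unit triangular matrix inverse to Gram-Schmidt. The diagonal is set to 1
  separately, because the quotient would be 0 for a null vector.\<close>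

definition gs_ratio :: "(nat \<times> nat => complex) => nat => nat => complex" where
 "gs_ratio T a k = (if k = a then 1 else gs_coeff T a k/gs_norm T k)"

lemma unit_seq_expansion: "unit_seq k a = (\<Sum>j\<le>k. gs_ratio T k j*gram_schmidt T j a)"
proof -
 have "(\<Sum>j\<le>k. gs_ratio T k j*gram_schmidt T j a)
   = (\<Sum>j<k. gs_ratio T k j*gram_schmidt T j a)+gram_schmidt T k a"
  by (simp add: lessThan_Suc_atMost[symmetric] gs_ratio_def)
 also have "(\<Sum>j<k. gs_ratio T k j*gram_schmidt T j a) = (\<Sum>j<k. gs_coeff T k j/gs_norm T j*gram_schmidt T j a)"
  by (intro sum.cong) (auto simp: gs_ratio_def)
 finally show ?thesis by (subst (asm) (2) gram_schmidt_eq) simp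
qed

lemma gs_coeff_eq:
 assumes T: "psd T"
 shows "gs_coeff T a k = (if k <= a then gs_ratio T a k*gs_norm T k else 0)"
proof -
 define N where "N = Suc (max a k)"
 have N: "a < N" "k < N" by (auto simp: N_def)
 have ax: "unit_seq a = (%b. \<Sum>j\<le>a. gs_ratio T a j*gram_schmidt T j b)"
  by (rule ext) (rule unit_seq_expansion)
 have "gs_coeff T a k = sesq N T (unit_seq a) (gram_schmidt T k)" using N by (rule gs_coeff_sesq)
 also have "... = (\<Sum>j\<le>a. gs_ratio T a j * sesq N T (gram_schmidt T j) (gram_schmidt T k))"
  by (subst ax) (simp only: sesq_sum_left sesq_scale_left)
 also have "... = (\<Sum>j\<le>a. if j = k then gs_ratio T a k*gs_norm T k else 0)"
  using N by (intro sum.cong) (auto simp: gs_norm_sesq[of k N] gram_schmidt_orthogonal'[OF T])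
 also have "... = (if k <= a then gs_ratio T a k*gs_norm T k else 0)" by simp
 finally show ?thesis .
qed

lemma chol_eq:
 assumes T: "psd T"
 shows "chol T a k = (if k <= a then gs_ratio T a k * of_real (sqrt (Re (gs_norm T k))) else 0)"
proof -
 define r :: complex where "r = of_real (sqrt (Re (gs_norm T k)))"
 have "gs_norm T k = of_real (sqrt (Re (gs_norm T k))) * of_real (sqrt (Re (gs_norm T k)))"
  using gs_norm_nonneg[OF T, of k] gs_norm_real[OF T, of k]
  by (metis of_real_mult real_sqrt_mult_self abs_of_nonneg)
 then have g: "gs_norm T k = r * r" unfolding r_def[symmetric] .
 have "chol T a k = gs_coeff T a k/r" by (simp add: chol_def r_def)
 also have "... = (if k <= a then gs_ratio T a k * r else 0)"
  by (cases "r = 0") (auto simp: gs_coeff_eq[OF T] g)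
 finally show ?thesis by (simp add: r_def)
qed

lemma chol_beyond: "psd T ==> a < k ==> chol T a k = 0"
 by (simp add: chol_eq)

lemma chol_nonzero: "psd T ==> chol T a k ~= 0 ==> k <= a"
 using chol_beyond not_le by blast

lemma chol_mult_cnj:
 assumes T: "psd T"
 shows "chol T a k*cnj (chol T b k) = (if k <= a \<and> k <= b then gs_ratio T a k*cnj (gs_ratio T b k)*gs_norm T k else 0)"
proof -
 have "gs_norm T k = of_real (sqrt (Re (gs_norm T k))) * of_real (sqrt (Re (gs_norm T k)))"
  using gs_norm_nonneg[OF T, of k] gs_norm_real[OF T, of k]
  by (metis of_real_mult real_sqrt_mult_self abs_of_nonneg)
 then show ?thesis by (simp add: chol_eq[OF T] ac_simps)
qed

theorem chol_factorization:
 assumes T: "psd T" and a: "a < M"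
 shows "T (a, b) = (\<Sum>k<M. chol T a k*cnj (chol T b k))"
proof -
 define N where "N = Suc (max a b)"
 have N: "a < N" "b < N" by (auto simp: N_def)
 have ax: "unit_seq a = (%c. \<Sum>j\<le>a. gs_ratio T a j*gram_schmidt T j c)" for a
  by (rule ext) (rule unit_seq_expansion)
 have "T (a, b) = sesq N T (unit_seq a) (unit_seq b)" using N by (simp add: sesq_unit)
 also have "... = (\<Sum>k\<le>a. \<Sum>l\<le>b. gs_ratio T a k*cnj (gs_ratio T b l) * sesq N T (gram_schmidt T k) (gram_schmidt T l))"
  by (subst (1 2) ax) (simp only: sesq_sum_left sesq_scale_left sesq_sum_right sesq_scale_right sum_distrib_left mult.assoc)
 also have "... = (\<Sum>k\<le>a. \<Sum>l\<le>b. if l = k then gs_ratio T a k*cnj (gs_ratio T b k)*gs_norm T k else 0)"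
  using N by (intro sum.cong refl) (auto simp: gs_norm_sesq[of _ N] gram_schmidt_orthogonal'[OF T])
 also have "... = (\<Sum>k\<le>a. chol T a k*cnj (chol T b k))"
  by (intro sum.cong refl) (simp add: chol_mult_cnj[OF T])
 also have "... = (\<Sum>k<M. chol T a k*cnj (chol T b k))"
  using a by (intro sum.mono_neutral_left) (auto simp: chol_beyond[OF T])
 finally show ?thesis .
qed

text \<open>The coefficients are ratios, hence homogeneous of degree 0 in \<open>T\<close>, and the
  Cholesky factor is homogeneous of degree 1/2. This lets a common scaling pass through a Gaussian
  sample.\<close>

lemma gram_schmidt_scale:
 assumes c: "c ~= 0"
 shows "gram_schmidt (%p. c*T p) k a = gram_schmidt T k a"
proof (induction k arbitrary: a rule: less_induct)
 case (less k)
 have "gs_coeff (%p. c*T p) k j = c*gs_coeff T k j" "gs_norm (%p. c*T p) j = c*gs_norm T j" if "j < k" for j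
  using less[OF that] by (simp_all add: gs_coeff_def gs_norm_def sum_distrib_left ac_simps)
 then have "(\<Sum>j<k. gs_coeff (%p. c*T p) k j/gs_norm (%p. c*T p) j*gram_schmidt (%p. c*T p) j a)
  = (\<Sum>j<k. gs_coeff T k j/gs_norm T j*gram_schmidt T j a)"
  using c less by (intro sum.cong) auto
 then show ?case by (subst (1 2) gram_schmidt_eq) simp
qed

lemma chol_scale:
 assumes s: "s > 0"
 shows "chol (%p. of_real (s\<^sup>2)*T p) a k = of_real s*chol T a k"
proof -
 have c: "of_real (s\<^sup>2) ~= (0::complex)" using s by simp
 have "gs_coeff (%p. of_real (s\<^sup>2)*T p) a k = of_real (s\<^sup>2)*gs_coeff T a k"
    "gs_norm (%p. of_real (s\<^sup>2)*T p) k = of_real (s\<^sup>2)*gs_norm T k"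
  by (simp_all only: gs_coeff_def gs_norm_def gram_schmidt_scale[OF c] sum_distrib_left) (simp_all add: ac_simps)
 moreover have "sqrt (Re (of_real (s\<^sup>2)*gs_norm T k)) = s * sqrt (Re (gs_norm T k))"
  using s by (simp add: real_sqrt_mult del: of_real_power)
 ultimately show ?thesis using s by (simp add: chol_def power2_eq_square del: of_real_power)
qed

lemma borel_measurable_cnj [measurable]: "cnj : borel_measurable borel"
 by (intro borel_measurable_continuous_onI continuous_intros)

lemma measurable_gram_schmidt [measurable (raw)]:
 assumes [measurable]: "!!p. (%x. T x p) : borel_measurable M"
 shows "(%x. gram_schmidt (T x) k a) : borel_measurable M"
proof (induction k arbitrary: a rule: less_induct)
 case (less k)
 note [measurable] = less
 have "(%x. \<Sum>j<k. (\<Sum>b\<le>j. cnj (gram_schmidt (T x) j b)*T x (k, b)) /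
   (\<Sum>c\<le>j. \<Sum>b\<le>j. gram_schmidt (T x) j c*cnj (gram_schmidt (T x) j b)*T x (c, b))*gram_schmidt (T x) j a)
   : borel_measurable M"
  by (intro borel_measurable_sum borel_measurable_times borel_measurable_divide measurable_compose[OF _ borel_measurable_cnj] less assms) auto
 then show ?case by (subst gram_schmidt.simps) measurable
qed

lemma measurable_chol [measurable (raw)]:
 assumes [measurable]: "!!p. (%x. T x p) : borel_measurable M"
 shows "(%x. chol (T x) a k) : borel_measurable M"
 unfolding chol_def gs_coeff_def gs_norm_def
 by (intro borel_measurable_sum borel_measurable_times borel_measurable_divide measurable_compose[OF _ borel_measurable_cnj]
   measurable_compose[OF _ borel_measurable_of_real] measurable_compose[OF _ borel_measurable_sqrt] measurable_compose[OF _ borel_measurable_Re]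
   measurable_gram_schmidt assms)

text \<open>All operations are continuous where the denominators do not vanish. At a degenerate form
  the factor may jump, so convergence of Gaussian samples rests on nondegeneracy of the limit
  kernel.\<close>

lemma tendsto_chol:
 assumes T: "!!p. (%n. X n p) ----> T p" and d: "!!k. gs_norm T k ~= 0" and psd: "psd T"
 shows "(%n. chol (X n) a k) ----> chol T a k"
proof -
 have gs: "(%n. gram_schmidt (X n) k a) ----> gram_schmidt T k a" for k a
 proof (induction k arbitrary: a rule: less_induct)
  case (less k)
  show ?case
   unfolding gram_schmidt_eq[of _ k]
   using d by (intro tendsto_intros less) (auto simp: gs_coeff_def gs_norm_def intro!: tendsto_intros less T)
 qed
 have "Re (gs_norm T k) ~= 0" using d[of k] gs_norm_real[OF psd, of k] by force
 then show ?thesis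
  unfolding chol_def gs_coeff_def gs_norm_def
  by (intro tendsto_intros gs T) (auto simp: gs_norm_def dest: gs_norm_nonneg)
qed

lemma sesq_gram:
 assumes "!!a b. T (a, b) = (\<Sum>i\<in>I. w i a*cnj (w i b))"
 shows "sesq N T x y = (\<Sum>i\<in>I. (\<Sum>a<N. x a*w i a)*cnj (\<Sum>b<N. y b*w i b))"
proof -
 have "sesq N T x y = (\<Sum>a<N. \<Sum>b<N. \<Sum>i\<in>I. (x a*w i a)*cnj (y b*w i b))"
  by (simp add: sesq_def assms sum_distrib_left ac_simps)
 also have "... = (\<Sum>a<N. \<Sum>i\<in>I. \<Sum>b<N. (x a*w i a)*cnj (y b*w i b))"
  by (intro sum.cong refl sum.swap)
 also have "... = (\<Sum>i\<in>I. \<Sum>a<N. \<Sum>b<N. (x a*w i a)*cnj (y b*w i b))"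
  by (rule sum.swap)
 also have "... = (\<Sum>i\<in>I. (\<Sum>a<N. x a*w i a)*cnj (\<Sum>b<N. y b*w i b))"
  by (simp only: sum_product cnj_sum)
 finally show ?thesis .
qed

lemma psd_gram:
 assumes "!!a b. T (a, b) = (\<Sum>i\<in>I. w i a*cnj (w i b))"
 shows "psd T"
 unfolding psd_def
proof (intro conjI allI)
 fix a b show "T (b, a) = cnj (T (a, b))" by (simp add: assms mult.commute)
next
 fix N x
 have "Re (z*cnj z) >= 0" for z by (simp add: complex_mult_cnj)
 then show "0 <= Re (sesq N T x x)" by (simp only: sesq_gram[of T w I, OF assms] Re_sum sum_nonneg)
qed

text \<open>A centred Gaussian vector is determined by its covariance, so a combination of the
  \<open>w i\<close> may be resampled through the Cholesky factor. The Gram-Schmidt combinations of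
  the rows, divided by their norms, are orthonormal functionals of the noise, and both sides are the
  same measurable function of such an orthonormal family.\<close>

theorem nn_integral_same_covariance:
 fixes w :: "'i => nat => complex"
 assumes I: "finite I" and supp: "!!i a. i : I ==> N <= a ==> w i a = 0"
  and T: "!!a b. T (a, b) = (\<Sum>i\<in>I. w i a*cnj (w i b))"
  and F [measurable]: "F : borel_measurable cgauss"
 shows "(\<E> x. F (%a. \<Sum>i\<in>I. x i*w i a)) = (\<E> r. F (%a. \<Sum>k\<le>a. chol T a k * r k))"
proof -
 have psd: "psd T" using T by (rule psd_gram)
 \<comment> \<open>Only nondegenerate directions are kept. In the others \<open>u\<close> vanishes
   on all of \<open>I\<close> by \<open>u0\<close>, so they drop out of the expansion of
   \<open>w\<close>.\<close>
 define K where "K = {k. k < N \<and> gs_norm T k ~= 0}"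
 have finK: "finite K" by (simp add: K_def)
 define d :: "nat => complex" where "d k = of_real (sqrt (Re (gs_norm T k)))" for k
 have d: "d k*cnj (d k) = gs_norm T k" for k
  using gs_norm_nonneg[OF psd, of k] gs_norm_real[OF psd, of k]
  unfolding d_def by (metis complex_cnj_complex_of_real of_real_mult real_sqrt_mult_self abs_of_nonneg)
 have d0: "d k ~= 0" if "k : K" for k using d[of k] that by (auto simp: K_def)
 define u where "u k i = (\<Sum>b<N. gram_schmidt T k b*w i b)" for k i
 define W where "W k i = u k i/d k" for k i
 have uu: "(\<Sum>i\<in>I. u k i*cnj (u l i)) = sesq N T (gram_schmidt T k) (gram_schmidt T l)" for k l
  by (simp add: u_def sesq_gram[of T w I, OF T])
 have orth: "(\<Sum>i\<in>I. W k i*cnj (W l i)) = (if k = l then 1 else 0)" if "k : K" "l : K" for k l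
 proof -
  have "(\<Sum>i\<in>I. W k i*cnj (W l i)) = sesq N T (gram_schmidt T k) (gram_schmidt T l)/(d k*cnj (d l))"
   by (simp add: W_def uu[symmetric] sum_divide_distrib)
  also have "... = (if k = l then 1 else 0)"
   using that d0[of k] by (auto simp: d gs_norm_sesq[symmetric] K_def gram_schmidt_orthogonal'[OF psd])
  finally show ?thesis .
 qed
 have u0: "u k i = 0" if "k < N" "k \<notin> K" "i : I" for k i
 proof -
  have "gs_norm T k = 0" using that by (auto simp: K_def)
  then have "(\<Sum>i\<in>I. u k i*cnj (u k i)) = 0" using that(1) by (simp add: uu gs_norm_sesq[of k N])
  then have "(\<Sum>i\<in>I. nsq (u k i)) = 0"
   by (simp only: complex_norm_square[symmetric] of_real_sum[symmetric] of_real_eq_0_iff)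
  then show ?thesis using I that(3) by (simp add: sum_nonneg_eq_0_iff)
 qed
 have w: "w i a = (\<Sum>k\<in>K. chol T a k*W k i)" if i: "i : I" and a: "a < N" for i a
 proof -
  have "w i a = (\<Sum>b<N. if b = a then w i b else 0)" using a by simp
  also have "... = (\<Sum>b<N. unit_seq a b*w i b)" by (intro sum.cong) (auto simp: unit_seq_def)
  also have "... = (\<Sum>b<N. \<Sum>j\<le>a. gs_ratio T a j*(gram_schmidt T j b*w i b))"
   unfolding unit_seq_expansion[of a _ T] by (simp add: sum_distrib_right mult.assoc)
  also have "... = (\<Sum>j\<le>a. gs_ratio T a j*u j i)"
   by (subst sum.swap) (simp add: u_def sum_distrib_left)
  also have "... = (\<Sum>j\<in>{..a} \<inter> K. gs_ratio T a j*u j i)"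
   using a u0 i by (intro sum.mono_neutral_right) auto
  also have "... = (\<Sum>j\<in>{..a} \<inter> K. chol T a j*W j i)"
   using d0 by (intro sum.cong) (auto simp: chol_eq[OF psd] W_def d_def[symmetric])
  also have "... = (\<Sum>k\<in>K. chol T a k*W k i)"
   using finK by (intro sum.mono_neutral_left) (auto dest: chol_nonzero[OF psd])
  finally show ?thesis .
 qed
 have T0: "T (a, b) = 0" if "N <= a" for a b using supp that by (simp add: T)
 define \<Phi> where "\<Phi> t = F (%a. if a < N then \<Sum>k\<in>K. chol T a k * t k else 0)" for t
 have [measurable]: "(%t a. if a < N then \<Sum>k\<in>K. chol T a k * t k else 0) : measurable (Pi\<^sub>M K (%_. stdc)) cgauss"
 proof (rule measurable_into_cgauss)
  fix a
  have "(%t. t k) : borel_measurable (Pi\<^sub>M K (%_. stdc))" if "k : K" for k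
   using measurable_component_singleton[OF that, of "%_. stdc"]
   by (simp add: measurable_cong_sets[OF refl sets_std_complex_gaussian])
  then show "(%t. if a < N then \<Sum>k\<in>K. chol T a k * t k else 0) : borel_measurable (Pi\<^sub>M K (%_. stdc))"
   by (cases "a < N") (auto intro!: borel_measurable_sum borel_measurable_times)
 qed
 have [measurable]: "\<Phi> : borel_measurable (Pi\<^sub>M K (%_. stdc))"
  unfolding \<Phi>_def by measurable
 have rm: "(%x. \<lambda>k\<in>K. \<Sum>i\<in>J. V k i*x i) : measurable cgauss (Pi\<^sub>M K (%_. stdc))"
  for V :: "nat => 'j => complex" and J
  by (rule measurable_restrict) (simp add: measurable_cong_sets[OF refl sets_std_complex_gaussian])
 have eq: "(\<E> x. \<Phi> (\<lambda>k\<in>K. \<Sum>i\<in>J. V k i*x i)) = (\<integral>\<^sup>+t. \<Phi> t \<partial>Pi\<^sub>M K (%_. stdc))"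
  if "finite J" "!!k l. k : K ==> l : K ==> (\<Sum>i\<in>J. V k i*cnj (V l i)) = (if k = l then 1 else 0)"
  for V :: "nat => 'j => complex" and J
  by (subst distr_cgauss_orthonormal[OF that(1) finK that(2), symmetric], assumption+)
    (subst nn_integral_distr[OF rm], auto)
 have "(\<E> x. F (%a. \<Sum>i\<in>I. x i*w i a)) = (\<E> x. \<Phi> (\<lambda>k\<in>K. \<Sum>i\<in>I. W k i*x i))"
 proof (intro nn_integral_cong)
  fix x :: "'i => complex"
  have "(\<Sum>i\<in>I. x i*w i a) = (if a < N then \<Sum>k\<in>K. chol T a k*(\<lambda>k\<in>K. \<Sum>i\<in>I. W k i*x i) k else 0)" for a
  proof (cases "a < N")
   case True
   then have "(\<Sum>i\<in>I. x i*w i a) = (\<Sum>i\<in>I. \<Sum>k\<in>K. chol T a k*(W k i*x i))"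
    by (simp add: w sum_distrib_left ac_simps)
   also have "... = (\<Sum>k\<in>K. chol T a k*(\<Sum>i\<in>I. W k i*x i))"
    by (subst sum.swap) (simp add: sum_distrib_left)
   finally show ?thesis using True by simp
  qed (use supp in simp)
  then show "F (%a. \<Sum>i\<in>I. x i*w i a) = \<Phi> (\<lambda>k\<in>K. \<Sum>i\<in>I. W k i*x i)"
   unfolding \<Phi>_def by (intro arg_cong[where f=F] ext)
 qed
 also have "... = (\<integral>\<^sup>+t. \<Phi> t \<partial>Pi\<^sub>M K (%_. stdc))"
  by (rule eq[OF I orth])
 also have "... = (\<E> r. \<Phi> (\<lambda>k\<in>K. \<Sum>i\<in>K. (if i = k then 1 else 0) * r i))"
 proof (rule eq[symmetric, OF finK])
  fix k l assume "k : K" "l : K"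
  have "(\<Sum>i\<in>K. (if i = k then 1 else 0)*cnj (if i = l then 1 else 0)) = (\<Sum>i\<in>K. if i = k then (if k = l then 1 else 0) else (0::complex))"
   by (intro sum.cong) auto
  then show "(\<Sum>i\<in>K. (if i = k then 1 else 0)*cnj (if i = l then 1 else 0)) = (if k = l then 1 else (0::complex))"
   using \<open>k \<in> K\<close> finK by simp
 qed
 also have "... = (\<E> r. F (%a. \<Sum>k\<le>a. chol T a k * r k))"
 proof (intro nn_integral_cong)
  fix r :: "nat => complex"
  have "(if a < N then \<Sum>k\<in>K. chol T a k*(\<lambda>k\<in>K. \<Sum>i\<in>K. (if i = k then 1 else 0) * r i) k else 0)
    = (\<Sum>k\<le>a. chol T a k * r k)" for a
  proof (cases "a < N")
   case True
   have "(\<Sum>i\<in>K. (if i = k then 1 else 0) * r i) = r k" if "k : K" for k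
   proof -
    have "(\<Sum>i\<in>K. (if i = k then 1 else 0) * r i) = (\<Sum>i\<in>K. if i = k then r k else 0)"
     by (intro sum.cong) auto
    then show ?thesis using finK that by simp
   qed
   then have "(\<Sum>k\<in>K. chol T a k*(\<lambda>k\<in>K. \<Sum>i\<in>K. (if i = k then 1 else 0) * r i) k) = (\<Sum>k\<in>K. chol T a k * r k)"
    by (intro sum.cong) auto
   also have "... = (\<Sum>k\<in>{..a} \<inter> K. chol T a k * r k)"
    using finK by (intro sum.mono_neutral_right) (auto dest: chol_nonzero[OF psd])
   also have "... = (\<Sum>k\<le>a. chol T a k * r k)"
    using True by (intro sum.mono_neutral_left) (auto simp: chol_def K_def)
   finally show ?thesis using True by simp
  next
   case False
   then have "chol T a k = 0" for k using T0[of a] by (simp add: chol_def gs_coeff_def)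
   then show ?thesis using False by simp
  qed
  then show "\<Phi> (\<lambda>k\<in>K. \<Sum>i\<in>K. (if i = k then 1 else 0) * r i) = F (%a. \<Sum>k\<le>a. chol T a k * r k)"
   unfolding \<Phi>_def by (intro arg_cong[where f=F] ext)
 qed
 finally show ?thesis .
qed

lemma chol_sq_sum:
 assumes "psd T"
 shows "(\<Sum>k\<le>a. nsq (chol T a k)) = Re (T (a, a))"
proof -
 have "complex_of_real (\<Sum>k\<le>a. nsq (chol T a k)) = T (a, a)"
  using chol_factorization[OF assms, of a "Suc a" a]
  by (simp add: complex_norm_square lessThan_Suc_atMost del: of_real_power)
 then show ?thesis by (metis Re_complex_of_real)
qed

lemma distr_cgauss_reindex:
 fixes p :: "'k => 'i"
 assumes p: "inj p"
 shows "distr cgauss cgauss (%x k. x (p k)) = cgauss"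
proof -
 have "distr (Pi\<^sub>M UNIV (%_. stdc)) (Pi\<^sub>M UNIV (%_. stdc)) (%x. \<lambda>k\<in>UNIV. x (p k))
   = (Pi\<^sub>M UNIV (%_. stdc))"
  using p by (intro distr_PiM_reindex) (auto intro: std.prob_space_axioms)
 then show ?thesis by (simp add: cgauss_def restrict_UNIV)
qed

lemma nn_integral_cgauss_reindex:
 assumes p: "inj p" and F [measurable]: "F : borel_measurable cgauss"
 shows "(\<E> x. F (%k. x (p k))) = (\<E> x. F x)"
proof -
 have [measurable]: "(%x k. x (p k)) : measurable cgauss cgauss"
  by (rule measurable_into_cgauss) measurable
 have "(\<E> x. F x) = (\<integral>\<^sup>+x. F x \<partial>distr cgauss cgauss (%x k. x (p k)))"
  by (simp add: distr_cgauss_reindex[OF p])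
 also have "... = (\<E> x. F (%k. x (p k)))" by (subst nn_integral_distr) auto
 finally show ?thesis ..
qed

section \<open>Characteristic polynomials and the cofactors of the last row\<close>

definition ginibre_mat :: "nat => (nat \<times> nat => complex) => complex mat" where
 "ginibre_mat n g = mat n n g"

definition cp_mat :: "nat => (nat \<times> nat => complex) => complex poly mat" where
 "cp_mat n g = char_poly_matrix (ginibre_mat n g)"

definition cp_poly :: "nat => (nat \<times> nat => complex) => complex poly" where
 "cp_poly n g = det (cp_mat n g)"

text \<open>These cofactors do not involve the last row of the matrix. Given the other rows, the
  determinant is therefore an affine function of an independent Gaussian row, with these polynomials
  as coefficients.\<close>

definition row_cofactor :: "nat => (nat \<times> nat => complex) => nat => complex poly" where
 "row_cofactor n g j = cofactor (cp_mat n g) (n-1) j"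

definition cp_coeff :: "nat => (nat \<times> nat => complex) => nat => complex" where
 "cp_coeff n g a = coeff (cp_poly n g) a"

text \<open>Conditional covariance matrix of the coefficients of the characteristic polynomial,
  given all rows but the last.\<close>

definition cofactor_gram :: "nat => (nat \<times> nat => complex) => nat \<times> nat => complex" where
 "cofactor_gram n g = (%(a, b). \<Sum>j<n. coeff (row_cofactor n g j) a*cnj (coeff (row_cofactor n g j) b))"

definition shift :: "(nat => complex) => nat => complex" where
 "shift x a = (if a = 0 then 0 else x (a-1))"

lemma ginibre_mat_carrier [simp]: "ginibre_mat n g : carrier_mat n n"
 by (simp add: ginibre_mat_def)

lemma cp_mat_carrier [simp]: "cp_mat n g : carrier_mat n n"
 by (simp add: cp_mat_def)

lemma cp_mat_entry: "i < n ==> j < n ==> cp_mat n g $$ (i, j) = (if i = j then [:0, 1:] else 0)-[:g (i, j):]"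
 by (auto simp: cp_mat_def char_poly_matrix_def ginibre_mat_def)

lemma cp_poly_nonzero: "cp_poly n g ~= 0"
proof -
 have "coeff (cp_poly n g) n = 1"
  using degree_monic_char_poly[of "ginibre_mat n g" n] by (simp add: cp_poly_def cp_mat_def char_poly_def)
 then show ?thesis by auto
qed

lemma row_cofactor_last: "row_cofactor (Suc n) g n = cp_poly n g"
proof -
 have "mat_delete (cp_mat (Suc n) g) n n = cp_mat n g"
  by (rule eq_matI) (auto simp: mat_delete_def cp_mat_entry carrier_matD[OF cp_mat_carrier])
 then show ?thesis
  by (simp add: row_cofactor_def cofactor_def cp_poly_def flip: power_add mult_2)
qed

text \<open>All sizes are cut out of one infinite array \<open>g\<close>. The congruence lemmas
  record which entries are read, that is, what is independent of what.\<close>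

lemma row_cofactor_cong:
 assumes "!!i k. i < n ==> k <= n ==> g (i, k) = h (i, k)"
 shows "row_cofactor (Suc n) g j = row_cofactor (Suc n) h j"
proof -
 have "mat_delete (cp_mat (Suc n) g) n j = mat_delete (cp_mat (Suc n) h) n j"
  by (rule eq_matI) (auto simp: mat_delete_def cp_mat_entry carrier_matD[OF cp_mat_carrier] assms)
 then show ?thesis by (simp add: row_cofactor_def cofactor_def)
qed

lemma cp_poly_cong:
 assumes "!!i k. i < n ==> k < n ==> g (i, k) = h (i, k)"
 shows "cp_poly n g = cp_poly n h"
proof -
 have "cp_mat n g = cp_mat n h"
  by (rule eq_matI) (auto simp: cp_mat_entry carrier_matD[OF cp_mat_carrier] assms)
 then show ?thesis by (simp add: cp_poly_def)
qed

text \<open>The last column of the adjugate identity for \<open>cp_mat (Suc n) g\<close>, whose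
  product with its adjugate is the determinant times the unit matrix.\<close>

lemma cofactor_orthogonality:
 assumes "i < Suc n"
 shows "(\<Sum>k<Suc n. cp_mat (Suc n) g $$ (i, k) * row_cofactor (Suc n) g k) = (if i = n then cp_poly (Suc n) g else 0)"
proof -
 let ?A = "cp_mat (Suc n) g"
 have d: "dim_row ?A = Suc n" "dim_col ?A = Suc n" using carrier_matD[OF cp_mat_carrier] by auto
 have "(?A*adj_mat ?A) $$ (i, n) = (\<Sum>k<Suc n. ?A $$ (i, k) * row_cofactor (Suc n) g k)"
  using assms d by (simp add: times_mat_def scalar_prod_def adj_mat_def row_cofactor_def atLeast0LessThan)
 moreover have "(?A*adj_mat ?A) $$ (i, n) = (if i = n then cp_poly (Suc n) g else 0)"
  using assms by (subst adj_mat(2)[OF cp_mat_carrier]) (auto simp: cp_poly_def)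
 ultimately show ?thesis by simp
qed

text \<open>Laplace expansion along the last row. The variable on the diagonal meets the cofactor
  \<open>cp_poly n g\<close>, which accounts for the shifted polynomial.\<close>

lemma cp_poly_Suc:
 "cp_poly (Suc n) g = pCons 0 (cp_poly n g)-(\<Sum>j\<le>n. smult (g (n, j)) (row_cofactor (Suc n) g j))"
proof -
 have "cp_poly (Suc n) g = (\<Sum>k<Suc n. cp_mat (Suc n) g $$ (n, k) * row_cofactor (Suc n) g k)"
  by (simp add: cofactor_orthogonality del: sum.lessThan_Suc)
 also have "... = (\<Sum>k<Suc n. (if k = n then pCons 0 (cp_poly n g) else 0)-smult (g (n, k)) (row_cofactor (Suc n) g k))"
  by (intro sum.cong refl) (auto simp: cp_mat_entry row_cofactor_last algebra_simps)
 also have "... = pCons 0 (cp_poly n g)-(\<Sum>j\<le>n. smult (g (n, j)) (row_cofactor (Suc n) g j))"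
  by (simp add: sum_subtractf lessThan_Suc_atMost del: sum.lessThan_Suc)
 finally show ?thesis .
qed

lemma cp_coeff_Suc:
 "cp_coeff (Suc n) g a = shift (cp_coeff n g) a-(\<Sum>j\<le>n. g (n, j)*coeff (row_cofactor (Suc n) g j) a)"
 by (simp add: cp_coeff_def cp_poly_Suc coeff_sum coeff_pCons shift_def split: nat.split)

text \<open>Expansion along a wrong row vanishes. Isolating the last term, whose cofactor is
  \<open>cp_poly n g\<close>, leaves a linear system with matrix \<open>cp_mat n g\<close> for the
  other cofactors, driven by the last column.\<close>

lemma row_cofactor_system:
 assumes "i < n"
 shows "(\<Sum>k<n. cp_mat n g $$ (i, k) * row_cofactor (Suc n) g k) = smult (g (i, n)) (cp_poly n g)"
proof -
 have "0 = (\<Sum>k<Suc n. cp_mat (Suc n) g $$ (i, k) * row_cofactor (Suc n) g k)"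
  using assms by (subst cofactor_orthogonality) auto
 also have "... = (\<Sum>k<n. cp_mat (Suc n) g $$ (i, k) * row_cofactor (Suc n) g k)-smult (g (i, n)) (cp_poly n g)"
  using assms by (simp add: cp_mat_entry row_cofactor_last)
 also have "(\<Sum>k<n. cp_mat (Suc n) g $$ (i, k) * row_cofactor (Suc n) g k) = (\<Sum>k<n. cp_mat n g $$ (i, k) * row_cofactor (Suc n) g k)"
  using assms by (intro sum.cong) (auto simp: cp_mat_entry)
 finally show ?thesis by simp
qed

text \<open>The adjugate turns the system into multiplication by the nonzero polynomial
  \<open>cp_poly n g\<close>, which is injective. A candidate for the cofactors thus only has to
  satisfy the system.\<close>

lemma cp_mat_unique:
 assumes "!!i. i < n ==> (\<Sum>k<n. cp_mat n g $$ (i, k)*x k) = (\<Sum>k<n. cp_mat n g $$ (i, k)*y k)" and j: "j < n"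
 shows "x j = y j"
proof -
 let ?A = "cp_mat n g"
 define v where "v = vec n (%k. x k-y k)"
 have v: "v : carrier_vec n" by (simp add: v_def)
 have d: "dim_row ?A = n" "dim_col ?A = n" using carrier_matD[OF cp_mat_carrier] by auto
 have "?A *\<^sub>v v = 0\<^sub>v n"
  using d assms(1) by (intro eq_vecI) (simp_all add: v_def scalar_prod_def atLeast0LessThan right_diff_distrib sum_subtractf)
 moreover have "(adj_mat ?A * ?A) *\<^sub>v v = adj_mat ?A *\<^sub>v (?A *\<^sub>v v)"
  by (rule assoc_mult_mat_vec[OF adj_mat(1)[OF cp_mat_carrier] cp_mat_carrier v])
 moreover have "adj_mat ?A *\<^sub>v 0\<^sub>v n = 0\<^sub>v n"
  using adj_mat(1)[OF cp_mat_carrier, of n g] by (intro eq_vecI) auto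
 ultimately have "(cp_poly n g \<cdot>\<^sub>m 1\<^sub>m n) *\<^sub>v v = 0\<^sub>v n"
  by (simp add: adj_mat(3)[OF cp_mat_carrier] cp_poly_def)
 then have "((cp_poly n g \<cdot>\<^sub>m 1\<^sub>m n) *\<^sub>v v) $ j = 0" using j by simp
 moreover have "((cp_poly n g \<cdot>\<^sub>m 1\<^sub>m n) *\<^sub>v v) $ j = (\<Sum>k<n. if k = j then cp_poly n g*(x j-y j) else 0)"
 proof -
  have "((cp_poly n g \<cdot>\<^sub>m 1\<^sub>m n) *\<^sub>v v) $ j = (\<Sum>k<n. cp_poly n g*(if k = j then 1 else 0)*(x k-y k))"
   using j by (simp add: v_def scalar_prod_def atLeast0LessThan eq_commute[of j])
  also have "... = (\<Sum>k<n. if k = j then cp_poly n g*(x j-y j) else 0)"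
   by (intro sum.cong) auto
  finally show ?thesis .
 qed
 ultimately show ?thesis using j cp_poly_nonzero[of n g] by simp
qed

section \<open>Conjugation by a unitary matrix and the recursion for the Gram matrix\<close>

definition unitary_on :: "nat => (nat => nat => complex) => bool" where
 "unitary_on n U \<longleftrightarrow> (\<forall>i<n. \<forall>j<n. (\<Sum>k<n. U k i*cnj (U k j)) = (if i = j then 1 else 0)) \<and>
   (\<forall>i<n. \<forall>j<n. (\<Sum>k<n. U i k*cnj (U j k)) = (if i = j then 1 else 0))"

lemma unitary_onI:
 assumes "!!i j. i < n ==> j < n ==> (\<Sum>k<n. U k i*cnj (U k j)) = (if i = j then 1 else 0)"
 shows "unitary_on n U"
proof -
 define P where "P = mat n n (%(i, k). cnj (U k i))"
 define Q where "Q = mat n n (%(k, j). U k j)"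
 have PQ: "P : carrier_mat n n" "Q : carrier_mat n n" by (auto simp: P_def Q_def)
 have "P*Q = 1\<^sub>m n"
 proof (rule eq_matI)
  fix i j assume "i < dim_row (1\<^sub>m n)" "j < dim_col (1\<^sub>m n)"
  then show "(P*Q) $$ (i, j) = 1\<^sub>m n $$ (i, j)"
   using assms[of j i] by (simp add: P_def Q_def scalar_prod_def atLeast0LessThan mult.commute)
 qed (use PQ in auto)
 then have QP: "Q*P = 1\<^sub>m n" by (rule mat_mult_left_right_inverse[OF PQ])
 have "(\<Sum>k<n. U i k*cnj (U j k)) = (if i = j then 1 else 0)" if "i < n" "j < n" for i j
 proof -
  have "(Q*P) $$ (i, j) = (\<Sum>k<n. U i k*cnj (U j k))"
   using that by (simp add: P_def Q_def scalar_prod_def atLeast0LessThan)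
  then show ?thesis using that by (simp add: QP)
 qed
 with assms show ?thesis by (simp add: unitary_on_def)
qed

text \<open>The matrix consists of the images of the unit sequences under the rotation that pushes
  \<open>c\<close> into its last coordinate. \<open>\<theta>\<close> is the surviving coordinate, so
  its modulus is the length of \<open>c\<close>.\<close>

lemma exists_unitary_last_axis:
 fixes c :: "nat => complex"
 assumes n: "n > 0"
 shows "\<exists>U \<theta>. unitary_on n U \<and> (\<forall>i<n. c i = \<theta>*cnj (U (n-1) i)) \<and> (norm \<theta>)\<^sup>2 = (\<Sum>i<n. nsq (c i))"
proof -
 obtain f where f: "f : rots {..<n}" and fc: "\<forall>j\<in>{..<n}-{n-1}. f c j = 0"
  using rots_eliminate[of "{..<n}-{n-1}" "n-1" "{..<n}" c] n by auto
 define U where "U k i = f (unit_seq i) k" for k i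
 define \<theta> where "\<theta> = f c (n-1)"
 note inner = rots_inner[OF f finite_lessThan]
 have "(\<Sum>k<n. U k i*cnj (U k j)) = (if i = j then 1 else 0)" if "i < n" "j < n" for i j
 proof -
  have "(\<Sum>k<n. U k i*cnj (U k j)) = (\<Sum>k<n. unit_seq i k*cnj (unit_seq j k))"
   unfolding U_def by (rule inner)
  also have "... = (\<Sum>k<n. if k = i then (if i = j then 1 else 0) else 0)"
   by (intro sum.cong) (auto simp: unit_seq_def)
  finally show ?thesis using that by simp
 qed
 then have "unitary_on n U" by (rule unitary_onI)
 moreover have "c i = \<theta>*cnj (U (n-1) i)" if "i < n" for i
 proof -
  have "c i = (\<Sum>k<n. if k = i then c k else 0)" using that by simp
  also have "... = (\<Sum>k<n. c k*cnj (unit_seq i k))" by (intro sum.cong) (auto simp: unit_seq_def)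
  also have "... = (\<Sum>k<n. f c k*cnj (U k i))" unfolding U_def by (rule inner[symmetric])
  also have "... = (\<Sum>k<n. if k = n-1 then \<theta>*cnj (U (n-1) i) else 0)"
   using fc by (intro sum.cong) (auto simp: \<theta>_def)
  finally show ?thesis using n by simp
 qed
 moreover have "(norm \<theta>)\<^sup>2 = (\<Sum>i<n. nsq (c i))"
 proof -
  have "complex_of_real (\<Sum>i<n. nsq (c i)) = (\<Sum>i<n. c i*cnj (c i))"
   by (simp add: complex_norm_square del: of_real_power)
  also have "... = (\<Sum>i<n. f c i*cnj (f c i))" by (rule inner[symmetric])
  also have "... = (\<Sum>k<n. if k = n-1 then \<theta>*cnj \<theta> else 0)"
   using fc by (intro sum.cong) (auto simp: \<theta>_def)
  also have "... = complex_of_real ((norm \<theta>)^2)" using n by (simp add: complex_norm_square del: of_real_power)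
  finally show ?thesis by (metis of_real_eq_iff)
 qed
 ultimately show ?thesis by blast
qed

definition conjugate_block :: "nat => (nat => nat => complex) => (nat \<times> nat => complex) => nat \<times> nat => complex" where
 "conjugate_block n U h = (%(i, j). \<Sum>(k, l)\<in>{..<n} \<times> {..<n}. cnj (U k i)*U l j*h (k, l))"

lemma conjugate_block_eq: "conjugate_block n U h (i, j) = (\<Sum>k<n. \<Sum>l<n. cnj (U k i)*U l j*h (k, l))"
 by (simp add: conjugate_block_def sum.cartesian_product)

lemma cp_poly_conjugate:
 assumes U: "unitary_on n U"
 shows "cp_poly n (conjugate_block n U h) = cp_poly n h"
proof -
 define P where "P = mat n n (%(i, k). cnj (U k i))"
 define Q where "Q = mat n n (%(k, j). U k j)"
 have PQ: "P : carrier_mat n n" "Q : carrier_mat n n" by (auto simp: P_def Q_def)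
 have 1: "P*Q = 1\<^sub>m n"
  using U PQ by (intro eq_matI) (auto simp: P_def Q_def scalar_prod_def atLeast0LessThan unitary_on_def mult.commute[of "cnj _"])
 then have 2: "Q*P = 1\<^sub>m n" by (rule mat_mult_left_right_inverse[OF PQ])
 have "ginibre_mat n (conjugate_block n U h) = P*ginibre_mat n h*Q"
 proof (rule eq_matI)
  fix i j assume "i < dim_row (P*ginibre_mat n h*Q)" "j < dim_col (P*ginibre_mat n h*Q)"
  then have ij: "i < n" "j < n" using PQ by auto
  have "(P*ginibre_mat n h*Q) $$ (i, j) = (\<Sum>l<n. (\<Sum>k<n. cnj (U k i)*h (k, l))*U l j)"
   using ij PQ by (simp add: P_def Q_def ginibre_mat_def scalar_prod_def atLeast0LessThan)
  also have "... = conjugate_block n U h (i, j)"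
   unfolding conjugate_block_eq by (subst sum.swap) (simp add: sum_distrib_left sum_distrib_right ac_simps)
  finally show "ginibre_mat n (conjugate_block n U h) $$ (i, j) = (P*ginibre_mat n h*Q) $$ (i, j)"
   using ij by (simp add: ginibre_mat_def)
 qed (use PQ in \<open>auto simp: ginibre_mat_def\<close>)
 then have "similar_mat (ginibre_mat n (conjugate_block n U h)) (ginibre_mat n h)"
  using PQ 1 2 by (intro similar_matI[of _ _ P Q n]) auto
 then show ?thesis
  using char_poly_similar by (auto simp: cp_poly_def cp_mat_def char_poly_def)
qed

lemma unitary_on_cols:
 "unitary_on n U ==> i < n ==> j < n ==> (\<Sum>k<n. U k i*cnj (U k j)) = (if i = j then 1 else 0)"
 by (simp add: unitary_on_def)

lemma unitary_on_rows:
 "unitary_on n U ==> i < n ==> j < n ==> (\<Sum>k<n. U i k*cnj (U j k)) = (if i = j then 1 else 0)"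
 by (simp add: unitary_on_def)

lemma smult_sum_left: "smult (sum f I) p = (\<Sum>i\<in>I. smult (f i) p)"
 by (induction I rule: infinite_finite_induct) (simp_all add: smult_add_left)

lemma smult_sum_right: "smult c (sum f I) = (\<Sum>i\<in>I. smult c (f i))"
 by (induction I rule: infinite_finite_induct) (simp_all add: smult_add_right)

lemma cp_mat_conjugate:
 assumes U: "unitary_on n U" and ij: "i < n" "j < n"
  and g: "!!i k. i < n ==> k < n ==> g (i, k) = conjugate_block n U h (i, k)"
 shows "cp_mat n g $$ (i, j) = (\<Sum>k<n. \<Sum>l<n. smult (cnj (U k i)) (smult (U l j) (cp_mat n h $$ (k, l))))"
proof -
 have "(\<Sum>k<n. \<Sum>l<n. smult (cnj (U k i)) (smult (U l j) (cp_mat n h $$ (k, l))))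
   = (\<Sum>k<n. \<Sum>l<n. (if l = k then smult (cnj (U k i)*U k j) [:0, 1:] else 0)-[:cnj (U k i)*U l j*h (k, l):])"
  by (intro sum.cong refl) (auto simp: cp_mat_entry smult_diff_right mult.assoc)
 also have "... = (\<Sum>k<n. smult (cnj (U k i)*U k j) [:0, 1:])-(\<Sum>k<n. \<Sum>l<n. [:cnj (U k i)*U l j*h (k, l):])"
  by (simp add: sum_subtractf)
 also have "(\<Sum>k<n. smult (cnj (U k i)*U k j) [:0, 1:]) = smult (\<Sum>k<n. U k j*cnj (U k i)) [:0, 1:]"
  by (simp only: smult_sum_left mult.commute)
 also have "... = (if i = j then [:0, 1:] else 0)" using ij by (simp add: unitary_on_cols[OF U])
 also have "(\<Sum>k<n. \<Sum>l<n. [:cnj (U k i)*U l j*h (k, l):]) = [:g (i, j):]"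
  unfolding g[OF ij] conjugate_block_eq
  by (rule poly_eqI) (simp add: coeff_sum coeff_pCons split: nat.split)
 finally show ?thesis using ij by (simp add: cp_mat_entry)
qed

text \<open>The right-hand side is guessed and then checked against
  \<open>row_cofactor_system\<close>. The last column is \<open>t\<close> times a unit vector which
  \<open>U\<close> maps to the last axis, so after conjugation the system is the one solved by the
  last row cofactors of \<open>h\<close>, scaled by \<open>t\<close> and mixed by
  \<open>U\<close>.\<close>

lemma row_cofactor_conjugate:
 assumes U: "unitary_on (Suc m) U"
  and g: "!!i k. i < Suc m ==> k < Suc m ==> g (i, k) = conjugate_block (Suc m) U h (i, k)"
  and c: "!!i. i < Suc m ==> g (i, Suc m) = t*cnj (U m i)" and j: "j < Suc m"
 shows "row_cofactor (Suc (Suc m)) g j = (\<Sum>k<Suc m. smult (t*cnj (U k j)) (row_cofactor (Suc m) h k))"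
proof -
 let ?n = "Suc m"
 define y where "y k = row_cofactor ?n h k" for k
 define x where "x j = (\<Sum>k<?n. smult (t*cnj (U k j)) (y k))" for j
 have Ux: "(\<Sum>j<?n. smult (U l j) (x j)) = smult t (y l)" if l: "l < ?n" for l
 proof -
  have "(\<Sum>j<?n. smult (U l j) (x j)) = (\<Sum>j<?n. \<Sum>k<?n. smult (t*(U l j*cnj (U k j))) (y k))"
   unfolding x_def smult_sum_right smult_smult by (simp only: ac_simps)
  also have "... = (\<Sum>k<?n. \<Sum>j<?n. smult (t*(U l j*cnj (U k j))) (y k))" by (rule sum.swap)
  also have "... = (\<Sum>k<?n. smult (t*(\<Sum>j<?n. U l j*cnj (U k j))) (y k))"
   by (simp only: sum_distrib_left smult_sum_left)
  also have "... = (\<Sum>k<?n. if k = l then smult t (y l) else 0)"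
   using l by (intro sum.cong refl) (auto simp: unitary_on_rows[OF U] simp del: sum.lessThan_Suc)
  finally show ?thesis using l by (simp del: sum.lessThan_Suc)
 qed
 have "(\<Sum>j<?n. cp_mat ?n g $$ (i, j) * row_cofactor (Suc ?n) g j) = (\<Sum>j<?n. cp_mat ?n g $$ (i, j)*x j)"
  if i: "i < ?n" for i
 proof -
  have "(\<Sum>j<?n. cp_mat ?n g $$ (i, j)*x j)
    = (\<Sum>j<?n. \<Sum>k<?n. \<Sum>l<?n. smult (cnj (U k i)) (cp_mat ?n h $$ (k, l)) * smult (U l j) (x j))"
   using i by (intro sum.cong refl)
    (simp add: cp_mat_conjugate[OF U i _ g] sum_distrib_right mult.commute[of "U _ _" "cnj _"] del: sum.lessThan_Suc)
  also have "... = (\<Sum>k<?n. \<Sum>j<?n. \<Sum>l<?n. smult (cnj (U k i)) (cp_mat ?n h $$ (k, l)) * smult (U l j) (x j))"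
   by (rule sum.swap)
  also have "... = (\<Sum>k<?n. \<Sum>l<?n. smult (cnj (U k i)) (cp_mat ?n h $$ (k, l))*(\<Sum>j<?n. smult (U l j) (x j)))"
   unfolding sum_distrib_left by (intro sum.cong refl sum.swap)
  also have "... = (\<Sum>k<?n. smult (t*cnj (U k i)) (\<Sum>l<?n. cp_mat ?n h $$ (k, l)*y l))"
   by (intro sum.cong refl) (simp add: Ux smult_sum_right mult.commute del: sum.lessThan_Suc)
  also have "... = (\<Sum>k<?n. if k = m then smult (t*cnj (U m i)) (cp_poly ?n h) else 0)"
   unfolding y_def by (intro sum.cong refl) (auto simp: cofactor_orthogonality simp del: sum.lessThan_Suc)
  also have "... = smult (g (i, ?n)) (cp_poly ?n h)" using c[OF i] by (simp del: sum.lessThan_Suc)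
  also have "cp_poly ?n h = cp_poly ?n g"
   using cp_poly_conjugate[OF U, of h] cp_poly_cong[of ?n g "conjugate_block ?n U h"] g by simp
  also have "smult (g (i, ?n)) (cp_poly ?n g) = (\<Sum>j<?n. cp_mat ?n g $$ (i, j) * row_cofactor (Suc ?n) g j)"
   using i by (rule row_cofactor_system[symmetric])
  finally show ?thesis ..
 qed
 from cp_mat_unique[OF this j] show ?thesis by (simp only: x_def y_def)
qed

lemma unitary_on_gram:
 assumes U: "unitary_on n U"
 shows "(\<Sum>j<n. (\<Sum>k<n. cnj (U k j) * v k)*cnj (\<Sum>k<n. cnj (U k j)*w k)) = (\<Sum>k<n. v k*cnj (w k))"
proof -
 have "(\<Sum>j<n. (\<Sum>k<n. cnj (U k j) * v k)*cnj (\<Sum>k<n. cnj (U k j)*w k))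
   = (\<Sum>j<n. \<Sum>k<n. \<Sum>l<n. v k*cnj (w l)*(U l j*cnj (U k j)))"
  by (simp add: sum_product ac_simps)
 also have "... = (\<Sum>k<n. \<Sum>j<n. \<Sum>l<n. v k*cnj (w l)*(U l j*cnj (U k j)))" by (rule sum.swap)
 also have "... = (\<Sum>k<n. \<Sum>l<n. v k*cnj (w l)*(\<Sum>j<n. U l j*cnj (U k j)))"
  unfolding sum_distrib_left by (intro sum.cong refl sum.swap)
 also have "... = (\<Sum>k<n. \<Sum>l<n. if l = k then v k*cnj (w k) else 0)"
  by (intro sum.cong refl) (auto simp: unitary_on_rows[OF U])
 finally show ?thesis by simp
qed

text \<open>The cofactor of the corner entry is the old polynomial and gives the rank one term. The
  others are unitary mixtures of the old cofactors times \<open>t\<close>; the unitary matrix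
  cancels in the Gram matrix and only \<open>nsq t\<close> remains.\<close>

lemma cofactor_gram_conjugate:
 assumes U: "unitary_on n U"
  and g: "!!i k. i < n ==> k < n ==> g (i, k) = conjugate_block n U h (i, k)"
  and c: "!!i. i < n ==> g (i, n) = t*cnj (U (n-1) i)"
 shows "cofactor_gram (Suc n) g (a, b)
  = cp_coeff n h a*cnj (cp_coeff n h b) + of_real (nsq t)*cofactor_gram n h (a, b)"
proof -
 have "cp_poly n h = cp_poly n g"
  using cp_poly_conjugate[OF U, of h] cp_poly_cong[of n g "conjugate_block n U h"] g by simp
 then have 1: "cofactor_gram (Suc n) g (a, b) = cp_coeff n h a*cnj (cp_coeff n h b)
   + (\<Sum>j<n. coeff (row_cofactor (Suc n) g j) a*cnj (coeff (row_cofactor (Suc n) g j) b))"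
  by (simp add: cofactor_gram_def row_cofactor_last cp_coeff_def)
 show ?thesis
 proof (cases n)
  case (Suc m)
  have co: "coeff (row_cofactor (Suc n) g j) a = t*(\<Sum>k<n. cnj (U k j)*coeff (row_cofactor n h k) a)" if "j < n" for j a
   using row_cofactor_conjugate[of m U g h t j] U g c that
   by (simp add: Suc coeff_sum sum_distrib_left mult.assoc del: sum.lessThan_Suc)
  have "(\<Sum>j<n. coeff (row_cofactor (Suc n) g j) a*cnj (coeff (row_cofactor (Suc n) g j) b))
   = (t*cnj t)*(\<Sum>j<n. (\<Sum>k<n. cnj (U k j)*coeff (row_cofactor n h k) a)*cnj (\<Sum>k<n. cnj (U k j)*coeff (row_cofactor n h k) b))"
   unfolding sum_distrib_left by (intro sum.cong refl) (simp add: co ac_simps del: cnj_sum)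
  then show ?thesis
   unfolding 1 unitary_on_gram[OF U] by (simp add: cofactor_gram_def complex_norm_square del: of_real_power)
 qed (use 1 in \<open>simp add: cofactor_gram_def\<close>)
qed

section \<open>Measurability of the coefficients\<close>

definition poly_measurable :: "'a measure => ('a => complex poly) => bool" where
 "poly_measurable M f \<longleftrightarrow> (\<forall>a. (%x. coeff (f x) a) : borel_measurable M)"

lemma poly_measurable_const: "poly_measurable M (%x. p)"
 by (simp add: poly_measurable_def)

lemma poly_measurable_sum: "(!!i. i : I ==> poly_measurable M (f i)) ==> poly_measurable M (%x. \<Sum>i\<in>I. f i x)"
 by (auto simp: poly_measurable_def coeff_sum intro!: borel_measurable_sum)

lemma poly_measurable_mult: "poly_measurable M f ==> poly_measurable M g ==> poly_measurable M (%x. f x*g x)"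
 by (auto simp: poly_measurable_def coeff_mult intro!: borel_measurable_sum borel_measurable_times)

lemma poly_measurable_prod: "(!!i. i : I ==> poly_measurable M (f i)) ==> poly_measurable M (%x. \<Prod>i\<in>I. f i x)"
 by (induction I rule: infinite_finite_induct) (auto intro: poly_measurable_mult poly_measurable_const)

lemma poly_measurable_det:
 assumes "!!x. A x : carrier_mat n n" "!!i j. i < n ==> j < n ==> poly_measurable M (%x. A x $$ (i, j))"
 shows "poly_measurable M (%x. det (A x))"
 unfolding det_def'[OF assms(1)]
 by (intro poly_measurable_sum poly_measurable_mult poly_measurable_const poly_measurable_prod assms(2))
   (auto simp: permutes_in_image[of _ "{0..<n}", simplified atLeast0LessThan[symmetric], THEN iffD2] permutes_def dest: permutes_in_image)

lemma poly_measurable_cp_mat: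
 assumes "i < n" "j < n"
 shows "poly_measurable cgauss (%g. cp_mat n g $$ (i, j))"
 using assms by (auto simp: poly_measurable_def cp_mat_entry coeff_pCons split: nat.split)

lemma measurable_cp_coeff [measurable]: "(%g. cp_coeff n g a) : borel_measurable cgauss"
proof -
 have "poly_measurable cgauss (%g. cp_poly n g)"
  unfolding cp_poly_def by (rule poly_measurable_det[of _ n]) (auto intro: poly_measurable_cp_mat)
 then show ?thesis by (simp add: poly_measurable_def cp_coeff_def)
qed

lemma measurable_coeff_row_cofactor [measurable]:
 "(%g. coeff (row_cofactor n g j) a) : borel_measurable cgauss"
proof -
 have "poly_measurable cgauss (%g. row_cofactor n g j)"
  unfolding row_cofactor_def cofactor_def
 proof (intro poly_measurable_mult poly_measurable_const poly_measurable_det[of _ "n-1"])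
  show "mat_delete (cp_mat n g) (n-1) j : carrier_mat (n-1) (n-1)" for g
   by (rule mat_delete_carrier) simp
  fix i k assume "i < n-1" "k < n-1"
  then show "poly_measurable cgauss (%g. mat_delete (cp_mat n g) (n-1) j $$ (i, k))"
   by (auto simp: mat_delete_def carrier_matD[OF cp_mat_carrier] intro!: poly_measurable_cp_mat)
 qed
 then show ?thesis by (simp add: poly_measurable_def)
qed

lemma measurable_cofactor_gram [measurable]: "(%g. cofactor_gram n g p) : borel_measurable cgauss"
 unfolding cofactor_gram_def by (cases p) simp

lemma measurable_cp_coeff_seq [measurable]: "(%g. cp_coeff n g) : measurable cgauss cgauss"
 by (rule measurable_into_cgauss) measurable

lemma measurable_cofactor_gram_seq [measurable]: "(%g. cofactor_gram n g) : measurable cgauss cgauss"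
 by (rule measurable_into_cgauss) measurable

section \<open>The law of one bordering step\<close>

definition gauss_seq :: "(nat \<times> nat => complex) => (nat => complex) => nat => complex" where
 "gauss_seq T r a = (\<Sum>k\<le>a. chol T a k * r k)"

definition col_norm :: "nat => (nat => complex) => real" where
 "col_norm n c = (\<Sum>i<n. nsq (c i))"

definition next_gram :: "(nat => complex) => (nat \<times> nat => complex) => real => nat \<times> nat => complex" where
 "next_gram q T b = (%p. q (fst p)*cnj (q (snd p)) + of_real b*T p)"

lemma measurable_gauss_seq [measurable (raw)]:
 assumes [measurable]: "T : measurable M cgauss" "r : measurable M cgauss"
 shows "(%x. gauss_seq (T x) (r x)) : measurable M cgauss"
proof (rule measurable_into_cgauss)
 have [measurable]: "(%x. T x p) : borel_measurable M" "(%x. r x k) : borel_measurable M" for p k by measurable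
 show "(%x. gauss_seq (T x) (r x) a) : borel_measurable M" for a
  unfolding gauss_seq_def by measurable
qed

lemma measurable_shift [measurable (raw)]:
 assumes [measurable]: "q : measurable M cgauss"
 shows "(%x. shift (q x)) : measurable M cgauss"
proof (rule measurable_into_cgauss)
 show "(%x. shift (q x) a) : borel_measurable M" for a
  unfolding shift_def by (cases "a = 0") auto
qed

lemma measurable_next_gram [measurable (raw)]:
 assumes [measurable]: "q : measurable M cgauss" "T : measurable M cgauss" "b : borel_measurable M"
 shows "(%x. next_gram (q x) (T x) (b x)) : measurable M cgauss"
proof (rule measurable_into_cgauss)
 have [measurable]: "(%x. T x p) : borel_measurable M" "(%x. q x k) : borel_measurable M" for p k by measurable
 show "(%x. next_gram (q x) (T x) (b x) p) : borel_measurable M" for p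
  unfolding next_gram_def by measurable
qed

lemma measurable_cgauss_add [measurable (raw)]:
 assumes [measurable]: "f : measurable M cgauss" "g : measurable M cgauss"
 shows "(%x a. f x a+(g x a :: complex)) : measurable M cgauss"
proof (rule measurable_into_cgauss)
 have [measurable]: "(%x. f x p) : borel_measurable M" "(%x. g x k) : borel_measurable M" for p k by measurable
 show "(%x. f x p+g x p) : borel_measurable M" for p by measurable
qed

lemma measurable_col_norm [measurable]: "col_norm n : borel_measurable cgauss"
 unfolding col_norm_def by measurable

lemma measurable_cgauss_mix [measurable (raw)]:
 assumes [measurable]: "f : measurable M cgauss" "g : measurable M cgauss"
 shows "(%x i. if i : J then f x i else g x i) : measurable M cgauss"
proof (rule measurable_into_cgauss)
 have [measurable]: "(%x. f x p) : borel_measurable M" "(%x. g x k) : borel_measurable M" for p k by measurable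
 show "(%x. if i : J then f x i else g x i) : borel_measurable M" for i by (cases "i : J") auto
qed

lemma coeff_row_cofactor_beyond:
 assumes "Suc n <= a" "j <= n"
 shows "coeff (row_cofactor (Suc n) g j) a = 0"
proof -
 let ?D = "mat_delete (cp_mat (Suc n) g) n j"
 have "degree (det ?D) <= 1*n"
 proof (rule degree_det_le)
  show "?D : carrier_mat n n" using mat_delete_carrier[OF cp_mat_carrier, of "Suc n" g n j] by simp
  fix i k assume "i < n" "k < n"
  then show "degree (?D $$ (i, k)) <= 1"
   by (auto simp: mat_delete_def cp_mat_entry carrier_matD[OF cp_mat_carrier])
 qed
 moreover have "coeff ((-1)^m * p) a = 0 \<longleftrightarrow> coeff p a = 0" for m and p :: "complex poly"
  by (cases "even m") auto
 ultimately show ?thesis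
  using assms coeff_eq_0[of "det ?D" a] by (simp add: row_cofactor_def cofactor_def)
qed

text \<open>Row \<open>n\<close> is resampled with the rest of the array fixed. Neither the
  cofactors nor the smaller polynomial read it, so the new polynomial is a mean plus a Gaussian
  combination of cofactors, which is replaced by a Cholesky sample of the same covariance.\<close>

lemma nn_integral_fresh_row:
 fixes F :: "(nat => complex) => (nat \<times> nat => complex) => ennreal"
 assumes F [measurable]: "case_prod F : borel_measurable (cgauss \<Otimes>\<^sub>M cgauss)"
 shows "(\<E> g. F (cp_coeff (Suc n) g) (cofactor_gram (Suc n) g))
  = (\<E> g r. F (%a. shift (cp_coeff n g) a+gauss_seq (cofactor_gram (Suc n) g) r a) (cofactor_gram (Suc n) g))"
proof -
 define J where "J = {n} \<times> (UNIV :: nat set)"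
 define mix :: "(nat \<times> nat => complex) => _" where "mix h g i = (if i : J then h i else g i)" for h g :: "nat \<times> nat => complex" and i
 have co: "row_cofactor (Suc n) (mix h g) j = row_cofactor (Suc n) g j" for h g j
  by (rule row_cofactor_cong) (auto simp: mix_def J_def)
 have cp: "cp_coeff n (mix h g) = cp_coeff n g" for h g
  unfolding cp_coeff_def by (intro ext arg_cong2[where f=coeff] cp_poly_cong refl) (auto simp: mix_def J_def)
 have gr: "cofactor_gram (Suc n) (mix h g) = cofactor_gram (Suc n) g" for h g
  by (simp add: cofactor_gram_def co)
 have "(\<E> g. F (cp_coeff (Suc n) g) (cofactor_gram (Suc n) g))
  = (\<E> g h. F (cp_coeff (Suc n) (mix h g)) (cofactor_gram (Suc n) (mix h g)))"
  unfolding mix_def by (rule nn_integral_cgauss_mix) measurable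
 also have "... = (\<E> g r. F (%a. shift (cp_coeff n g) a+gauss_seq (cofactor_gram (Suc n) g) r a) (cofactor_gram (Suc n) g))"
 proof (intro nn_integral_cong[of cgauss])
  fix g :: "nat \<times> nat => complex"
  define w where "w p a =-coeff (row_cofactor (Suc n) g (snd p)) a" for p :: "nat \<times> nat" and a
  define I where "I = {n} \<times> {..n}"
  define F' where "F' x = F (%a. shift (cp_coeff n g) a+x a) (cofactor_gram (Suc n) g)" for x
  have [measurable]: "F' : borel_measurable cgauss" unfolding F'_def by measurable
  have eq: "cp_coeff (Suc n) (mix h g) = (%a. shift (cp_coeff n g) a+(\<Sum>i\<in>I. h i*w i a))" for h
  proof
   fix a
   have "(\<Sum>i\<in>I. h i*w i a) = (\<Sum>j\<le>n. h (n, j)*w (n, j) a)"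
    unfolding I_def by (simp add: sum.cartesian_product')
   then show "cp_coeff (Suc n) (mix h g) a = shift (cp_coeff n g) a+(\<Sum>i\<in>I. h i*w i a)"
    by (simp add: cp_coeff_Suc co cp w_def sum_negf) (simp add: mix_def J_def)
  qed
  have "(\<E> h. F (cp_coeff (Suc n) (mix h g)) (cofactor_gram (Suc n) (mix h g)))
   = (\<E> h. F' (%a. \<Sum>i\<in>I. h i*w i a))"
   unfolding gr eq F'_def ..
  also have "... = (\<E> r. F' (%a. \<Sum>k\<le>a. chol (cofactor_gram (Suc n) g) a k * r k))"
  proof (rule nn_integral_same_covariance[of I "Suc n"])
   show "finite I" by (simp add: I_def)
   show "w i a = 0" if "i : I" "Suc n <= a" for i a
    using that coeff_row_cofactor_beyond[of n a "snd i" g] by (auto simp: w_def I_def)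
   show "cofactor_gram (Suc n) g (a, b) = (\<Sum>i\<in>I. w i a*cnj (w i b))" for a b
    unfolding I_def by (simp add: sum.cartesian_product' w_def cofactor_gram_def lessThan_Suc_atMost)
  qed measurable
  finally show "(\<E> h. F (cp_coeff (Suc n) (mix h g)) (cofactor_gram (Suc n) (mix h g)))
   = (\<E> r. F (%a. shift (cp_coeff n g) a+gauss_seq (cofactor_gram (Suc n) g) r a) (cofactor_gram (Suc n) g))"
   by (simp add: F'_def gauss_seq_def)
 qed
 finally show ?thesis .
qed

text \<open>As a linear map on the entries of the block, conjugation has the orthonormal rows
  \<open>W\<close>. The locality assumption confines \<open>F\<close> to the block, so that only
  finitely many coordinates are transformed.\<close>

lemma nn_integral_conjugate_block:
 assumes U: "unitary_on n U" and F: "F : borel_measurable cgauss"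
  and loc: "!!h h'. (!!i j. i < n ==> j < n ==> h (i, j) = h' (i, j)) ==> F h = F h'"
 shows "(\<E> h. F (conjugate_block n U h)) = (\<E> h. F h)"
proof -
 define I where "I = {..<n} \<times> {..<n}"
 have fI: "finite I" by (simp add: I_def)
 define W where "W p q = cnj (U (fst q) (fst p))*U (snd q) (snd p)" for p q :: "nat \<times> nat"
 define V where "V p q = (if q = p then 1 else (0::complex))" for p q :: "nat \<times> nat"
 define \<Phi> where "\<Phi> t = F (%p. if p : I then t p else 0)" for t
 let ?P = "Pi\<^sub>M I (%_. stdc)"
 have [measurable]: "(%t p. if p : I then t p else 0) : measurable ?P cgauss"
 proof (rule measurable_into_cgauss)
  fix p
  have "(%t. t p) : borel_measurable ?P" if "p : I"
   using measurable_component_singleton[OF that, of "%_. stdc"]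
   by (simp add: measurable_cong_sets[OF refl sets_std_complex_gaussian])
  then show "(%t. if p : I then t p else 0) : borel_measurable ?P" by (cases "p : I") auto
 qed
 have [measurable]: "\<Phi> : borel_measurable ?P" unfolding \<Phi>_def using F by measurable
 have rm: "(%x. \<lambda>k\<in>I. \<Sum>i\<in>I. V k i*x i) : measurable cgauss ?P" for V
  by (rule measurable_restrict) (simp add: measurable_cong_sets[OF refl sets_std_complex_gaussian])
 have eq: "(\<E> x. \<Phi> (\<lambda>k\<in>I. \<Sum>i\<in>I. V k i*x i)) = (\<integral>\<^sup>+t. \<Phi> t \<partial>?P)"
  if "!!k l. k : I ==> l : I ==> (\<Sum>i\<in>I. V k i*cnj (V l i)) = (if k = l then 1 else 0)" for V
  by (subst distr_cgauss_orthonormal[OF fI fI that, symmetric], assumption+)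
    (subst nn_integral_distr[OF rm], auto)
 have "(\<E> h. F (conjugate_block n U h)) = (\<E> x. \<Phi> (\<lambda>k\<in>I. \<Sum>i\<in>I. W k i*x i))"
  unfolding \<Phi>_def by (intro nn_integral_cong loc) (auto simp: I_def conjugate_block_def W_def case_prod_beta)
 also have "... = (\<integral>\<^sup>+t. \<Phi> t \<partial>?P)"
 proof (rule eq)
  fix p q assume pq: "p : I" "q : I"
  have "(\<Sum>i\<in>I. W p i*cnj (W q i))
   = (\<Sum>k<n. U k (fst q)*cnj (U k (fst p)))*(\<Sum>l<n. U l (snd p)*cnj (U l (snd q)))"
   unfolding I_def sum_product by (simp add: sum.cartesian_product' W_def ac_simps)
  also have "... = (if p = q then 1 else 0)"
   using pq by (auto simp: I_def unitary_on_cols[OF U] prod_eq_iff)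
  finally show "(\<Sum>i\<in>I. W p i*cnj (W q i)) = (if p = q then 1 else 0)" .
 qed
 also have "... = (\<E> x. \<Phi> (\<lambda>k\<in>I. \<Sum>i\<in>I. V k i*x i))"
 proof (rule eq[symmetric])
  fix k l assume "k : I" "l : I"
  have "(\<Sum>i\<in>I. V k i*cnj (V l i)) = (\<Sum>i\<in>I. if i = k then (if k = l then 1 else 0) else (0::complex))"
   by (intro sum.cong) (auto simp: V_def)
  then show "(\<Sum>i\<in>I. V k i*cnj (V l i)) = (if k = l then 1 else (0::complex))"
   using \<open>k \<in> I\<close> fI by simp
 qed
 also have "... = (\<E> h. F h)"
  unfolding \<Phi>_def
 proof (intro nn_integral_cong loc)
  fix h :: "nat \<times> nat => complex" and i j assume "i < n" "j < n"
  then have p: "(i, j) : I" by (simp add: I_def)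
  have "(\<Sum>q\<in>I. V (i, j) q*h q) = (\<Sum>q\<in>I. if q = (i, j) then h (i, j) else 0)"
   by (intro sum.cong) (auto simp: V_def)
  then show "(if (i, j) : I then (\<lambda>k\<in>I. \<Sum>i\<in>I. V k i*h i) (i, j) else 0) = h (i, j)"
   using p fI by simp
 qed
 finally show ?thesis .
qed

text \<open>With the last column fixed, a unitary matrix depending on that column alone sends it to
  the last axis. The block is independent of the column and may be replaced by its conjugate, after
  which the column enters only through its length.\<close>

lemma nn_integral_fresh_column:
 fixes H :: "(nat => complex) => (nat \<times> nat => complex) => ennreal"
 assumes H [measurable]: "case_prod H : borel_measurable (cgauss \<Otimes>\<^sub>M cgauss)"
 shows "(\<E> g. H (cp_coeff n g) (cofactor_gram (Suc n) g))
  = (\<E> g c. H (cp_coeff n g) (next_gram (cp_coeff n g) (cofactor_gram n g) (col_norm n c)))"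
proof -
 define J where "J = {..<n} \<times> {..<n}"
 define mix :: "(nat \<times> nat => complex) => _" where "mix h g i = (if i : J then h i else g i)" for h g :: "nat \<times> nat => complex" and i
 have cp: "cp_coeff n (mix h g) = cp_coeff n h" for h g
  unfolding cp_coeff_def by (intro ext arg_cong2[where f=coeff] cp_poly_cong refl) (auto simp: mix_def J_def)
 have [measurable]: "(%h. mix h g) : measurable cgauss cgauss" for g unfolding mix_def by measurable
 interpret pp: pair_prob_space "cgauss :: (nat \<times> nat => complex) measure" "cgauss :: (nat \<times> nat => complex) measure" ..
 have [measurable]: "(%g::nat \<times> nat => complex. %i. g (i, n)) : measurable cgauss cgauss"
  by (rule measurable_into_cgauss) measurable
 have "(\<E> g. H (cp_coeff n g) (cofactor_gram (Suc n) g))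
  = (\<E> g h. H (cp_coeff n (mix h g)) (cofactor_gram (Suc n) (mix h g)))"
  unfolding mix_def by (rule nn_integral_cgauss_mix) measurable
 also have "... = (\<E> g h. H (cp_coeff n h) (next_gram (cp_coeff n h) (cofactor_gram n h) (col_norm n (%i. g (i, n)))))"
 proof (rule nn_integral_cong)
  fix g :: "nat \<times> nat => complex"
  obtain U t where U: "unitary_on n U" and c: "!!i. i < n ==> g (i, n) = t*cnj (U (n-1) i)"
   and t: "nsq t = (\<Sum>i<n. nsq (g (i, n)))"
  proof (cases "n = 0")
   case True
   then show ?thesis by (intro that[of _ 0]) (auto simp: unitary_on_def)
  next
   case False
   then show ?thesis using exists_unitary_last_axis[of n "%i. g (i, n)"] that by blast
  qed
  define \<Psi> where "\<Psi> h = H (cp_coeff n (mix h g)) (cofactor_gram (Suc n) (mix h g))" for h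
  have [measurable]: "\<Psi> : borel_measurable cgauss" unfolding \<Psi>_def by measurable
  have "(\<E> h. \<Psi> h) = (\<E> h. \<Psi> (conjugate_block n U h))"
  proof (rule nn_integral_conjugate_block[OF U, symmetric])
   fix h h' :: "nat \<times> nat => complex"
   assume "!!i j. i < n ==> j < n ==> h (i, j) = h' (i, j)"
   then have "mix h g = mix h' g" by (auto simp: mix_def J_def fun_eq_iff)
   then show "\<Psi> h = \<Psi> h'" by (simp add: \<Psi>_def)
  qed measurable
  also have "... = (\<E> h. H (cp_coeff n h) (next_gram (cp_coeff n h) (cofactor_gram n h) (col_norm n (%i. g (i, n)))))"
  proof (rule nn_integral_cong)
   fix h :: "nat \<times> nat => complex"
   let ?g = "mix (conjugate_block n U h) g"
   have "cofactor_gram (Suc n) ?g (a, b)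
     = cp_coeff n h a*cnj (cp_coeff n h b) + of_real (nsq t)*cofactor_gram n h (a, b)" for a b
    using c by (intro cofactor_gram_conjugate[OF U]) (auto simp: mix_def J_def)
   then have "cofactor_gram (Suc n) ?g = next_gram (cp_coeff n h) (cofactor_gram n h) (col_norm n (%i. g (i, n)))"
    by (auto simp: next_gram_def col_norm_def t)
   moreover have "cp_coeff n ?g = cp_coeff n h"
    unfolding cp by (simp add: cp_coeff_def fun_eq_iff cp_poly_conjugate[OF U])
   ultimately show "\<Psi> (conjugate_block n U h)
     = H (cp_coeff n h) (next_gram (cp_coeff n h) (cofactor_gram n h) (col_norm n (%i. g (i, n))))"
    by (simp add: \<Psi>_def)
  qed
  finally show "(\<E> h. H (cp_coeff n (mix h g)) (cofactor_gram (Suc n) (mix h g)))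
   = (\<E> h. H (cp_coeff n h) (next_gram (cp_coeff n h) (cofactor_gram n h) (col_norm n (%i. g (i, n)))))"
   by (simp add: \<Psi>_def)
 qed
 also have "... = (\<E> h g. H (cp_coeff n h) (next_gram (cp_coeff n h) (cofactor_gram n h) (col_norm n (%i. g (i, n)))))"
  by (rule pp.Fubini') measurable
 also have "... = (\<E> h c. H (cp_coeff n h) (next_gram (cp_coeff n h) (cofactor_gram n h) (col_norm n c)))"
  by (intro nn_integral_cong nn_integral_cgauss_reindex[where p="%i. (i, n)"]) (auto simp: inj_def)
 finally show ?thesis .
qed

text \<open>The row is integrated out before the column, because the sample produced by the fresh
  row has the full new Gram matrix as covariance, and this already contains the new column.\<close>

theorem nn_integral_ginibre_step:
 fixes F :: "(nat => complex) => (nat \<times> nat => complex) => ennreal"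
 assumes F [measurable]: "case_prod F : borel_measurable (cgauss \<Otimes>\<^sub>M cgauss)"
 shows "(\<E> g. F (cp_coeff (Suc n) g) (cofactor_gram (Suc n) g))
  = (\<E> g c r. (let T = next_gram (cp_coeff n g) (cofactor_gram n g) (col_norm n c) in
     F (%a. shift (cp_coeff n g) a+gauss_seq T r a) T))"
proof -
 define H where "H q T = (\<E> r. F (%a. shift q a+gauss_seq T r a) T)" for q T
 have [measurable]: "case_prod H : borel_measurable (cgauss \<Otimes>\<^sub>M cgauss)" unfolding H_def by measurable
 show ?thesis
  unfolding nn_integral_fresh_row[OF F] Let_def
  using nn_integral_fresh_column[of H n] by (simp add: H_def)
qed

section \<open>Explicit Gaussian moments\<close>

declare measurable_cgauss_component [measurable del]

lemma measurable_std_borel: "f : borel_measurable borel ==> f : borel_measurable stdc"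
 by (simp cong: measurable_cong_sets)

lemma nn_integral_half_normal_exp:
 assumes t: "t > -1"
 shows "(\<H> x. ennreal (exp (- t*x\<^sup>2))) = ennreal (1/sqrt (1+t))"
proof -
 define \<sigma> where "\<sigma> = sqrt (1/(2*(1+t)))"
 have \<sigma>: "\<sigma> > 0" "\<sigma>\<^sup>2 = 1/(2*(1+t))" using t by (auto simp: \<sigma>_def)
 interpret prob_space "density lborel (normal_density 0 \<sigma>)" by (rule prob_space_normal_density) fact
 have eq: "normal_density 0 (sqrt (1/2)) x*exp (- t*x\<^sup>2) = 1/sqrt (1+t)*normal_density 0 \<sigma> x" for x
 proof -
  have "exp (- (x\<^sup>2))*exp (- (t*x\<^sup>2)) = exp (- (x\<^sup>2*(1+t)))"
   by (simp add: exp_add[symmetric] algebra_simps)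
  moreover have "2 * pi * \<sigma>\<^sup>2 = pi/(1+t)" using t by (simp add: \<sigma> field_simps)
  then have "sqrt (2 * pi * \<sigma>\<^sup>2) = sqrt pi/sqrt (1+t)"
   by (simp only: real_sqrt_divide)
  moreover have "x\<^sup>2/(2 * \<sigma>\<^sup>2) = x\<^sup>2*(1+t)" using t by (simp add: \<sigma>)
  ultimately show ?thesis using t by (simp add: normal_density_def field_simps)
 qed
 have "(\<H> x. ennreal (exp (- t*x\<^sup>2)))
   = (\<L> x. ennreal (normal_density 0 (sqrt (1/2)) x*exp (- t*x\<^sup>2)))"
  by (subst nn_integral_density) (auto simp: ennreal_mult)
 also have "... = (\<L> x. ennreal (1/sqrt (1+t))*ennreal (normal_density 0 \<sigma> x))"
  unfolding eq using t by (intro nn_integral_cong ennreal_mult) auto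
 also have "... = ennreal (1/sqrt (1+t))*(\<L> x. ennreal (normal_density 0 \<sigma> x))"
  by (rule nn_integral_cmult) auto
 also have "(\<L> x. ennreal (normal_density 0 \<sigma> x)) = 1"
  using emeasure_space_1 by (simp add: emeasure_density)
 finally show ?thesis by simp
qed

lemma nn_integral_std_exp:
 assumes t: "t > -1"
 shows "(\<G> w. ennreal (exp (- t*nsq w))) = ennreal (1/(1+t))"
proof -
 have "(\<G> w. ennreal (exp (- t*nsq w)))
   = (\<H> x y. ennreal (exp (- t*x\<^sup>2))*ennreal (exp (- t*y\<^sup>2)))"
  by (subst nn_integral_std) (auto simp: cmod_def exp_add[symmetric] ennreal_mult[symmetric] algebra_simps)
 also have "... = ennreal (1/sqrt (1+t))*ennreal (1/sqrt (1+t))"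
 proof -
  have "(\<H> y. ennreal (exp (- t*x\<^sup>2))*ennreal (exp (- t*y\<^sup>2)))
    = ennreal (exp (- t*x\<^sup>2))*ennreal (1/sqrt (1+t))" for x
   by (subst nn_integral_cmult, measurable) (simp only: nn_integral_half_normal_exp[OF t])
  then show ?thesis
   by (simp only:) (subst nn_integral_multc, measurable, simp only: nn_integral_half_normal_exp[OF t])
 qed
 also have "... = ennreal (1/(1+t))"
  using t by (simp add: ennreal_mult[symmetric])
 finally show ?thesis .
qed

lemma nn_integral_half_normal_sq: "(\<H> x. ennreal (x\<^sup>2)) = ennreal (1/2)"
proof -
 have "has_bochner_integral lborel (%x. normal_density 0 (sqrt (1/2)) x*x\<^sup>2) (1/2)"
  using normal_moment_even[of "sqrt (1/2)" 0 1] by (simp add: fact_2)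
 then have "(\<L> x. ennreal (normal_density 0 (sqrt (1/2)) x*x\<^sup>2)) = ennreal (1/2)"
  by (subst nn_integral_eq_integral) (auto simp only: has_bochner_integral_iff intro!: AE_I2 mult_nonneg_nonneg normal_density_nonneg zero_le_power2)
 then show ?thesis by (subst nn_integral_density) (auto simp: ennreal_mult)
qed

lemma nn_integral_std_sq: "(\<G> w. ennreal (nsq w)) = 1"
proof -
 interpret a: prob_space half_normal by (rule prob_space_half_normal)
 have "(\<G> w. ennreal (nsq w))
   = (\<H> x y. ennreal (x\<^sup>2)+ennreal (y\<^sup>2))"
  by (subst nn_integral_std) (auto simp: cmod_def)
 also have "... = ennreal (1/2)+ennreal (1/2)"
  using a.emeasure_space_1 by (simp add: nn_integral_add nn_integral_half_normal_sq)
 also have "... = 1" by (subst ennreal_plus[symmetric]) simp_all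
 finally show ?thesis .
qed

text \<open>A crude absolute constant (the exact moment is 2), obtained from
  \<open>x\<^sup>2 <= 8*exp (x/2)\<close> and the exponential moment at parameter -1/2, which equals
  2.\<close>

lemma nn_integral_std_fourth: "(\<G> w. ennreal ((norm w)^4)) <= 16"
proof -
 have "x\<^sup>2 <= 8*exp (x/2)" if "x >= 0" for x :: real
  using exp_lower_Taylor_quadratic[of "x/2"] that by (simp add: power2_eq_square field_simps)
 from this[of "nsq w" for w :: complex]
 have "(norm w)^4 <= 8*exp (- (-1/2)*nsq w)" for w :: complex
  by (simp flip: power_mult)
 then have "(\<G> w. ennreal ((norm w)^4))
   <= (\<G> w. 8*ennreal (exp (- (-1/2)*nsq w)))"
  by (intro nn_integral_mono) (simp add: ennreal_mult'[symmetric] ennreal_leI flip: ennreal_numeral)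
 also have "... = 8*ennreal (1/(1+(-1/2)))"
  by (subst nn_integral_cmult, measurable) (subst nn_integral_std_exp, auto)
 also have "... = 16" by (simp flip: ennreal_numeral ennreal_mult)
 finally show ?thesis .
qed

lemma nn_integral_std_uminus:
 assumes [measurable]: "f : borel_measurable borel"
 shows "(\<G> w. f (- w)) = (\<G> w. f w)"
 using nn_integral_std_phase[of f "-1"] assms by simp

text \<open>Averaging over \<open>w\<close> and \<open>- w\<close> and the parallelogram law remove
  the cross term without any question of integrability.\<close>

lemma nn_integral_std_shift_sq:
 "(\<G> w. ennreal (nsq (m + of_real s*w))) = ennreal (nsq m+s\<^sup>2)"
proof -
 define X where "X = (\<G> w. ennreal (nsq (m + of_real s*w)))"
 have par: "nsq (m+v)+nsq (m +-v) = 2*nsq m+2*nsq v" for v :: complex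
  unfolding cmod_power2 by (simp add: power2_eq_square algebra_simps)
 have "X = (\<G> w. ennreal (nsq (m + of_real s*(- w))))"
  unfolding X_def by (rule nn_integral_std_uminus[symmetric]) measurable
 then have "X+X = (\<G> w. ennreal (nsq (m + of_real s*w))+ennreal (nsq (m + of_real s*(- w))))"
  by (subst nn_integral_add) (measurable, simp add: X_def)
 also have "... = (\<G> w. ennreal (2*nsq m)+ennreal (2 * s\<^sup>2)*ennreal (nsq w))"
 proof (rule nn_integral_cong)
  fix w :: complex
  have "nsq (m + of_real s*w)+nsq (m + of_real s*(- w)) = 2*nsq m+2 * s\<^sup>2*nsq w"
   using par[of "of_real s*w"] by (simp add: norm_mult power_mult_distrib)
  then show "ennreal (nsq (m + of_real s*w))+ennreal (nsq (m + of_real s*(- w)))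
    = ennreal (2*nsq m)+ennreal (2 * s\<^sup>2)*ennreal (nsq w)"
   by (simp only: ennreal_plus[symmetric] ennreal_mult[symmetric] zero_le_power2 zero_le_mult_iff zero_le_numeral simp_thms)
 qed
 also have "... = ennreal (2*nsq m)+ennreal (2 * s\<^sup>2)"
  using std.emeasure_space_1
  by (subst nn_integral_add; (measurable; fail)?) (subst nn_integral_cmult; (measurable; fail)?; simp add: nn_integral_std_sq)
 also have "... = ennreal (2*(nsq m+s\<^sup>2))" by (simp add: ennreal_plus[symmetric] del: ennreal_plus)
 finally have XX: "X+X = ennreal (2*(nsq m+s\<^sup>2))" .
 then have "X+X < \<top>" by (simp only: ennreal_less_top)
 then have "X ~= \<top>" by auto
 then obtain x where x: "X = ennreal x" "x >= 0" by (cases X) auto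
 have "x+x = 2*(nsq m+s\<^sup>2)"
  using XX x by (simp add: ennreal_plus[symmetric] ennreal_inj del: ennreal_plus)
 then have "x = nsq m+s\<^sup>2" by simp
 then show ?thesis using x by (simp only: X_def)
qed

lemma nn_integral_linear_functional:
 fixes l :: "nat => complex"
 assumes [measurable]: "f : borel_measurable borel"
 shows "(\<E> r. f (\<Sum>k<N. l k * r k))
  = (\<G> w. f (of_real (sqrt (\<Sum>k<N. nsq (l k)))*w))"
proof -
 \<comment> \<open>Only index 0 is occupied: a scalar is treated as a Gaussian vector of dimension
   one, so that the covariance theorem yields its law.\<close>
 define w where "w i a = (if a = 0 then l i else 0)" for i a :: nat
 define T where "T p = (\<Sum>i<N. w i (fst p)*cnj (w i (snd p)))" for p :: "nat \<times> nat"
 define s where "s = (\<Sum>k<N. nsq (l k))"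
 have s: "s >= 0" by (simp add: s_def sum_nonneg)
 have T00: "T (0, 0) = of_real s"
  by (simp add: T_def w_def s_def complex_norm_square del: of_real_power)
 have "(\<E> r. f (\<Sum>k<N. l k * r k)) = (\<E> r. f (\<Sum>i<N. r i*w i 0))"
  by (simp add: w_def mult.commute)
 also have "... = (\<E> r. f (\<Sum>k\<le>0. chol T 0 k * r k))"
  by (rule nn_integral_same_covariance[of "{..<N}" 1 w T "%x. f (x 0)"]) (auto simp: w_def T_def)
 also have "chol T 0 0 = of_real (sqrt s)"
 proof -
  have "s/sqrt s = sqrt s" using s by (simp add: real_div_sqrt)
  moreover have "chol T 0 0 = of_real (s/sqrt s)"
   by (simp add: chol_def gs_coeff_def gs_norm_def gram_schmidt_diag T00)
  ultimately show ?thesis by simp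
 qed
 then have "(\<E> r. f (\<Sum>k\<le>0. chol T 0 k * r k)) = (\<E> r. f (of_real (sqrt s) * r (0::nat)))" by simp
 also have "... = (\<G> w. f (of_real (sqrt s)*w))"
  by (rule nn_integral_cgauss_component) measurable
 finally show ?thesis by (simp add: s_def)
qed

lemma nn_integral_gauss_functional:
 assumes T: "psd T" and [measurable]: "f : borel_measurable borel"
 shows "(\<E> r. f (\<Sum>a<N. l a*gauss_seq T r a))
  = (\<G> w. f (of_real (sqrt (Re (sesq N T l l)))*w))"
proof -
 define m where "m k = (\<Sum>a<N. l a*chol T a k)" for k
 have g: "gauss_seq T r a = (\<Sum>k<N. chol T a k * r k)" if "a < N" for a r
  unfolding gauss_seq_def using that by (intro sum.mono_neutral_left) (auto dest: chol_nonzero[OF T])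
 have "(\<Sum>a<N. l a*gauss_seq T r a) = (\<Sum>k<N. m k * r k)" for r
 proof -
  have "(\<Sum>a<N. l a*gauss_seq T r a) = (\<Sum>a<N. \<Sum>k<N. l a*chol T a k * r k)"
   by (simp add: g sum_distrib_left mult.assoc)
  also have "... = (\<Sum>k<N. m k * r k)" by (subst sum.swap) (simp add: m_def sum_distrib_right)
  finally show ?thesis .
 qed
 moreover have "(\<Sum>k<N. nsq (m k)) = Re (sesq N T l l)"
 proof -
  have "complex_of_real (\<Sum>k<N. nsq (m k)) = (\<Sum>k<N. m k*cnj (m k))"
   by (simp add: complex_norm_square del: of_real_power)
  also have "... = (\<Sum>k<N. \<Sum>a<N. \<Sum>b<N. l a*cnj (l b)*(chol T a k*cnj (chol T b k)))"
   by (simp add: m_def sum_product ac_simps)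
  also have "... = (\<Sum>a<N. \<Sum>k<N. \<Sum>b<N. l a*cnj (l b)*(chol T a k*cnj (chol T b k)))"
   by (rule sum.swap)
  also have "... = (\<Sum>a<N. \<Sum>b<N. \<Sum>k<N. l a*cnj (l b)*(chol T a k*cnj (chol T b k)))"
   by (intro sum.cong refl sum.swap)
  also have "... = sesq N T l l"
   unfolding sesq_def by (intro sum.cong refl) (simp add: sum_distrib_left[symmetric] chol_factorization[OF T, symmetric])
  finally show ?thesis by (metis Re_complex_of_real)
 qed
 ultimately show ?thesis by (simp add: nn_integral_linear_functional)
qed

lemma nn_integral_gauss_seq:
 assumes T: "psd T" and [measurable]: "f : borel_measurable borel"
 shows "(\<E> r. f (gauss_seq T r a))
  = (\<G> w. f (of_real (sqrt (Re (T (a, a))))*w))"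
proof -
 have "(\<Sum>b<Suc a. unit_seq a b*gauss_seq T r b) = gauss_seq T r a" for r
  by (simp add: unit_seq_def)
 then show ?thesis
  using nn_integral_gauss_functional[OF assms, where N="Suc a" and l="unit_seq a"]
  by (simp add: sesq_unit del: sum.lessThan_Suc)
qed

lemma psd_diag: "psd T ==> 0 <= Re (T (a, a))"
 using sesq_self_nonneg[of T "Suc a" "unit_seq a"] by (simp add: sesq_unit)

lemma nn_integral_gauss_seq_fourth:
 assumes T: "psd T"
 shows "(\<E> r. ennreal ((norm (gauss_seq T r a))^4)) <= ennreal (16*(Re (T (a, a)))^2)"
proof -
 have "(\<E> r. ennreal ((norm (gauss_seq T r a))^4))
   = (\<G> w. ennreal ((Re (T (a, a)))^2)*ennreal ((norm w)^4))"
 proof (subst nn_integral_gauss_seq[OF T], simp, rule nn_integral_cong)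
  fix w :: complex
  have "(sqrt (Re (T (a, a))))^4 = ((sqrt (Re (T (a, a))))^2)^2" by (simp flip: power_mult)
  then show "ennreal (norm (complex_of_real (sqrt (Re (T (a, a))))*w)^4) = ennreal ((Re (T (a, a)))^2)*ennreal (norm w^4)"
   using psd_diag[OF T, of a] by (simp add: norm_mult power_mult_distrib ennreal_mult)
 qed
 also have "... = ennreal ((Re (T (a, a)))^2)*(\<G> w. ennreal ((norm w)^4))"
  by (rule nn_integral_cmult) measurable
 also have "... <= ennreal ((Re (T (a, a)))^2)*16"
  by (intro mult_left_mono nn_integral_std_fourth) simp
 also have "... = ennreal (16*(Re (T (a, a)))^2)"
  by (simp add: ennreal_mult mult.commute)
 finally show ?thesis .
qed

text \<open>Cauchy-Schwarz for nonnegative integrals, from the arithmetic-geometric inequality with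
  the optimal ratio \<open>t = B/A\<close>. The degenerate case is separate because this ratio must
  be positive and finite.\<close>

lemma nn_integral_mult_le:
 fixes X Y :: "'a => real"
 assumes [measurable]: "X : borel_measurable M" "Y : borel_measurable M"
  and X: "(\<integral>\<^sup>+x. ennreal ((X x)^2) \<partial>M) <= ennreal (A\<^sup>2)" and Y: "(\<integral>\<^sup>+x. ennreal ((Y x)^2) \<partial>M) <= ennreal (B\<^sup>2)"
  and AB: "0 <= A" "0 <= B"
 shows "(\<integral>\<^sup>+x. ennreal (\<bar>X x*Y x\<bar>) \<partial>M) <= ennreal (A*B)"
proof (cases "A = 0 \<or> B = 0")
 case True
 then have "AE x in M. X x*Y x = 0"
 proof
  assume "A = 0"
  then have "AE x in M. ennreal ((X x)^2) = 0" using X by (subst nn_integral_0_iff_AE[symmetric]) auto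
  then show ?thesis by eventually_elim auto
 next
  assume "B = 0"
  then have "AE x in M. ennreal ((Y x)^2) = 0" using Y by (subst nn_integral_0_iff_AE[symmetric]) auto
  then show ?thesis by eventually_elim auto
 qed
 then have "AE x in M. ennreal (\<bar>X x*Y x\<bar>) = 0" by eventually_elim simp
 then have "(\<integral>\<^sup>+x. ennreal (\<bar>X x*Y x\<bar>) \<partial>M) = (\<integral>\<^sup>+x. 0 \<partial>M)"
  by (rule nn_integral_cong_AE)
 then show ?thesis using AB by simp
next
 case False
 then have pos: "A > 0" "B > 0" using AB by auto
 define t where "t = B/A"
 have t: "t > 0" using pos by (simp add: t_def)
 have "ennreal (\<bar>x*y\<bar>) <= ennreal (t/2)*ennreal (x\<^sup>2)+ennreal (1/(2*t))*ennreal (y\<^sup>2)" for x y :: real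
 proof -
  have "0 <= (t * \<bar>x\<bar>-\<bar>y\<bar>)^2" by simp
  also have "... = 2*t*(t/2*x\<^sup>2+1/(2*t)*y\<^sup>2-\<bar>x*y\<bar>)"
   using t by (simp add: power2_diff power_mult_distrib abs_mult algebra_simps power2_eq_square)
  finally have "\<bar>x*y\<bar> <= t/2*x\<^sup>2+1/(2*t)*y\<^sup>2"
   using t by (simp add: zero_le_mult_iff)
  then show ?thesis using t by (simp add: ennreal_mult[symmetric] ennreal_plus[symmetric] ennreal_leI del: ennreal_plus)
 qed
 then have "(\<integral>\<^sup>+x. ennreal (\<bar>X x*Y x\<bar>) \<partial>M)
   <= (\<integral>\<^sup>+x. ennreal (t/2)*ennreal ((X x)^2)+ennreal (1/(2*t))*ennreal ((Y x)^2) \<partial>M)"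
  by (intro nn_integral_mono)
 also have "... = ennreal (t/2)*(\<integral>\<^sup>+x. ennreal ((X x)^2) \<partial>M)+ennreal (1/(2*t))*(\<integral>\<^sup>+x. ennreal ((Y x)^2) \<partial>M)"
  by (subst nn_integral_add) (auto simp: nn_integral_cmult)
 also have "... <= ennreal (t/2)*ennreal (A\<^sup>2)+ennreal (1/(2*t))*ennreal (B\<^sup>2)"
  by (intro add_mono mult_left_mono X Y) auto
 also have "... = ennreal (t/2*A\<^sup>2+1/(2*t)*B\<^sup>2)"
  using t by (simp add: ennreal_mult[symmetric] ennreal_plus[symmetric] del: ennreal_plus)
 also have "t/2*A\<^sup>2+1/(2*t)*B\<^sup>2 = A*B"
  using pos by (simp add: t_def field_simps power2_eq_square)
 finally show ?thesis .
qed

section \<open>Inverse moments of the squared length of a Gaussian column\<close>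

lemma nn_integral_col_norm_exp:
 assumes t: "t > -1"
 shows "(\<E> c. ennreal (exp (- t*col_norm n c))) = ennreal (1/(1+t)^n)"
proof (induction n)
 case 0
 then show ?case using cgauss.emeasure_space_1 by (simp add: col_norm_def)
next
 case (Suc n)
 have eq: "col_norm (Suc n) (c(n := a)) = col_norm n c+nsq a" for c a
  by (simp add: col_norm_def)
 have "(\<E> c. ennreal (exp (- t*col_norm (Suc n) c)))
  = (\<E> c. \<G> a. ennreal (exp (- t*col_norm (Suc n) (c(n := a)))))"
  by (rule nn_integral_cgauss_refresh) measurable
 also have "... = (\<E> c. \<G> a. ennreal (exp (- t*col_norm n c))*ennreal (exp (- t*nsq a)))"
  unfolding eq by (intro nn_integral_cong) (simp add: ennreal_mult[symmetric] exp_add[symmetric] algebra_simps)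
 also have "... = (\<E> c. ennreal (exp (- t*col_norm n c))*ennreal (1/(1+t)))"
  by (rule nn_integral_cong) (subst nn_integral_cmult, measurable, simp only: nn_integral_std_exp[OF t])
 also have "... = ennreal (1/(1+t)^n)*ennreal (1/(1+t))"
  by (subst nn_integral_multc, measurable) (simp only: Suc.IH)
 also have "... = ennreal (1/(1+t)^Suc n)"
  using t by (simp add: ennreal_mult[symmetric] mult.commute)
 finally show ?case .
qed

lemma col_norm_nonneg: "0 <= col_norm n c"
 by (simp add: col_norm_def sum_nonneg)

text \<open>The Laplace transform dominates the mass of the zero set for every positive
  \<open>t\<close> and tends to 0.\<close>

lemma AE_col_norm_pos:
 assumes n: "n >= 1"
 shows "AE c in cgauss. 0 < col_norm n c"
proof -
 have [measurable]: "{c : space cgauss. col_norm n c = 0} : sets cgauss" by measurable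
 have 1: "ennreal (measure cgauss {c : space cgauss. col_norm n c = 0}) <= ennreal (1/(1+t)^n)" if "t > 0" for t
 proof -
  have "emeasure cgauss {c : space cgauss. col_norm n c = 0} = (\<E> c. indicator {c : space cgauss. col_norm n c = 0} c)"
   by (subst nn_integral_indicator, measurable)
  also have "... <= (\<E> c. ennreal (exp (- t*col_norm n c)))"
   by (intro nn_integral_mono) (auto simp: indicator_def)
  also have "... = ennreal (1/(1+t)^n)" using that by (intro nn_integral_col_norm_exp) auto
  finally show ?thesis by (simp add: cgauss.emeasure_eq_measure)
 qed
 have "measure cgauss {c : space cgauss. col_norm n c = 0} <= 0"
 proof (rule tendsto_lowerbound)
  show "((%t::real. 1/(1+t)^n) \<longlongrightarrow> 0) at_top" using n by real_asymp
  show "\<forall>\<^sub>F t in at_top. measure cgauss {c : space cgauss. col_norm n c = 0} <= 1/(1+t)^n"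
   using eventually_gt_at_top[of 0] by eventually_elim (use 1 in \<open>simp add: ennreal_le_iff\<close>)
 qed simp
 then have "measure cgauss {c : space cgauss. col_norm n c = 0} = 0"
  using measure_nonneg[of cgauss] by (intro antisym) auto
 then have "emeasure cgauss {c : space cgauss. col_norm n c = 0} = 0" by (simp add: cgauss.emeasure_eq_measure)
 then have "AE c in cgauss. c \<notin> {c : space cgauss. col_norm n c = 0}"
  by (intro AE_not_in null_setsI) measurable
 then show ?thesis by eventually_elim (use col_norm_nonneg[of n] in \<open>auto simp: less_le\<close>)
qed

lemma DERIV_inverse_power:
 assumes "t >= 0"
 shows "((%t::real. 1/((real k+1)*(1+t)^(k+1))) has_real_derivative-1/(1+t)^(k+2)) (at t)"
proof -
 define y where "y = 1+t"
 have y: "y > 0" "1+t = y" using assms by (auto simp: y_def)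
 have "((%t. inverse ((real k+1)*(1+t)^(k+1))) has_real_derivative
   - (inverse ((real k+1)*(1+t)^(k+1))*((real k+1)*((real k+1)*(1+t)^k))*inverse ((real k+1)*(1+t)^(k+1)))) (at t)"
 proof (rule DERIV_inverse')
  have "((%t. (1+t)^(k+1)) has_real_derivative real (k+1)*(1+t)^k) (at t)"
  proof -
   have "((%t. 1+t) has_real_derivative 1) (at t)" by (auto intro!: derivative_eq_intros)
   from DERIV_power[OF this, of "k+1"] show ?thesis by simp
  qed
  from DERIV_cmult[OF this, of "real k+1"]
  show "((%t. (real k+1)*(1+t)^(k+1)) has_real_derivative (real k+1)*((real k+1)*(1+t)^k)) (at t)"
   by (simp add: add.commute)
  show "(real k+1)*(1+t)^(k+1) ~= 0" using assms by simp
 qed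
 also note y(2)
 also have "- (inverse ((real k+1)*y^(k+1))*((real k+1)*((real k+1)*y^k))*inverse ((real k+1)*y^(k+1)))
   =-1/y^(k+2)"
 proof -
  define c where "c = real k+1"
  have "c > 0" "y^k > 0" using y by (auto simp: c_def)
  then show ?thesis unfolding c_def[symmetric] using y(1) by (simp add: field_simps)
 qed
 finally show ?thesis by (simp add: y divide_inverse)
qed

text \<open>\<open>1/b\<close> is the integral of \<open>exp (- t*b)\<close>, and Tonelli reduces
  the claim to the Laplace transform. The squared length is Gamma distributed, and its inverse has
  finite mean only from dimension 2 on.\<close>

lemma nn_integral_inverse_col_norm:
 "(\<E> c. ennreal (1/col_norm (m+2) c)) = ennreal (1/(real m+1))"
proof -
 let ?n = "m+2"
 interpret p: pair_sigma_finite "cgauss :: (nat => complex) measure" "lborel :: real measure" ..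
 have 1: "(\<L> t. ennreal (exp (- t*b))*indicator {0..} t) = ennreal (1/b)" if "b > 0" for b :: real
 proof -
  have "(\<L> t. ennreal (exp (- t*b))*indicator {0..} t) = ennreal (0-(- exp (- 0*b)/b))"
   using that by (intro nn_integral_FTC_atLeast) (auto intro!: derivative_eq_intros, real_asymp)
  then show ?thesis by simp
 qed
 have "(\<E> c. ennreal (1/col_norm ?n c))
   = (\<E> c. \<L> t. ennreal (exp (- t*col_norm ?n c))*indicator {0..} t)"
 proof (rule nn_integral_cong_AE)
  have "AE c in cgauss. 0 < col_norm ?n c" by (rule AE_col_norm_pos) simp
  then show "AE c in cgauss. ennreal (1/col_norm ?n c) = (\<L> t. ennreal (exp (- t*col_norm ?n c))*indicator {0..} t)"
   by eventually_elim (simp only: 1)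
 qed
 also have "... = (\<L> t. \<E> c. ennreal (exp (- t*col_norm ?n c))*indicator {0..} t)"
  by (rule p.Fubini'[symmetric]) measurable
 also have "... = (\<L> t. ennreal (1/(1+t)^?n)*indicator {0..} t)"
  by (intro nn_integral_cong) (subst nn_integral_multc, auto simp only: nn_integral_col_norm_exp split: split_indicator, auto simp: nn_integral_col_norm_exp[simplified])
 also have "... = ennreal (0-(- 1/((real m+1)*(1+0)^(m+1))))"
 proof (rule nn_integral_FTC_atLeast)
  show "((%t::real.-1/((real m+1)*(1+t)^(m+1))) \<longlongrightarrow> 0) at_top" by real_asymp
  fix t :: real assume t: "0 <= t"
  show "((%t.-1/((real m+1)*(1+t)^(m+1))) has_real_derivative 1/(1+t)^?n) (at t)"
   using DERIV_minus[OF DERIV_inverse_power[OF t, of m]] by simp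
 qed auto
 finally show ?thesis by simp
qed

text \<open>The same computation with \<open>t*exp (- t*b)\<close>. Finiteness requires dimension at
  least 3, which is the origin of the threshold \<open>n < 3\<close> in the weights of the
  chain.\<close>

lemma nn_integral_inverse_col_norm_sq:
 "(\<E> c. ennreal (1/(col_norm (m+3) c)^2)) = ennreal (1/((real m+1)*(real m+2)))"
proof -
 let ?n = "m+3"
 interpret p: pair_sigma_finite "cgauss :: (nat => complex) measure" "lborel :: real measure" ..
 have 1: "(\<L> t. ennreal (t*exp (- t*b))*indicator {0..} t) = ennreal (1/b\<^sup>2)" if "b > 0" for b :: real
 proof -
  have "(\<L> t. ennreal (t*exp (- t*b))*indicator {0..} t) = ennreal (0-(- (0/b+1/b\<^sup>2)*exp (- 0*b)))"
  proof (rule nn_integral_FTC_atLeast)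
   show "((%t.-(t/b+1/b\<^sup>2)*exp (- t*b)) \<longlongrightarrow> 0) at_top" using that by real_asymp
   show "((%t.-(t/b+1/b\<^sup>2)*exp (- t*b)) has_real_derivative t*exp (- t*b)) (at t)" for t
    using that by (auto intro!: derivative_eq_intros simp: field_simps power2_eq_square)
  qed auto
  then show ?thesis by simp
 qed
 have "(\<E> c. ennreal (1/(col_norm ?n c)^2))
   = (\<E> c. \<L> t. ennreal (t*exp (- t*col_norm ?n c))*indicator {0..} t)"
 proof (rule nn_integral_cong_AE)
  have "AE c in cgauss. 0 < col_norm ?n c" by (rule AE_col_norm_pos) simp
  then show "AE c in cgauss. ennreal (1/(col_norm ?n c)^2) = (\<L> t. ennreal (t*exp (- t*col_norm ?n c))*indicator {0..} t)"
   by eventually_elim (simp only: 1)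
 qed
 also have "... = (\<L> t. \<E> c. ennreal (t*exp (- t*col_norm ?n c))*indicator {0..} t)"
  by (rule p.Fubini'[symmetric]) measurable
 also have "... = (\<L> t. ennreal (t/(1+t)^?n)*indicator {0..} t)"
 proof (rule nn_integral_cong)
  fix t :: real
  show "(\<E> c. ennreal (t*exp (- t*col_norm ?n c))*indicator {0..} t) = ennreal (t/(1+t)^?n)*indicator {0..} t"
  proof (cases "t >= 0")
   case True
   then have "(\<E> c. ennreal (t*exp (- t*col_norm ?n c))*indicator {0..} t)
     = (\<E> c. ennreal t*ennreal (exp (- t*col_norm ?n c)))"
    by (intro nn_integral_cong) (simp add: ennreal_mult)
   also have "... = ennreal t*ennreal (1/(1+t)^?n)"
    using True by (subst nn_integral_cmult) (auto simp only: nn_integral_col_norm_exp, auto)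
   finally show ?thesis using True by (simp add: ennreal_mult[symmetric])
  qed auto
 qed
 also have "... = ennreal (0-(1/((real m+2)*(1+0)^(m+2))-1/((real m+1)*(1+0)^(m+1))))"
 proof (rule nn_integral_FTC_atLeast)
  show "((%t::real. 1/((real m+2)*(1+t)^(m+2))-1/((real m+1)*(1+t)^(m+1))) \<longlongrightarrow> 0) at_top" by real_asymp
  fix t :: real assume t: "0 <= t"
  define y where "y = 1+t"
  have y: "y > 0" "t = y-1" "1+t = y" using t by (auto simp: y_def)
  have "- 1/y^(m+1+2) --1/y^(m+2) = (y-1)/y^?n"
  proof -
   have "y^(m+1+2) = y*y^(m+2)" "y^?n = y*y^(m+2)" by (simp_all add: eval_nat_numeral)
   moreover have "y^(m+2) > 0" using y by simp
   ultimately show ?thesis using y(1) by (simp add: field_simps del: power_Suc power_add)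
  qed
  then show "((%t. 1/((real m+2)*(1+t)^(m+2))-1/((real m+1)*(1+t)^(m+1))) has_real_derivative t/(1+t)^?n) (at t)"
   using DERIV_diff[OF DERIV_inverse_power[OF t, of "m+1"] DERIV_inverse_power[OF t, of m]]
   by (simp add: y(3)) (simp add: y(2) add.commute)
 qed auto
 also have "0-(1/((real m+2)*(1+0)^(m+2))-1/((real m+1)*(1+0)^(m+1))) = 1/((real m+1)*(real m+2))"
  by (simp add: field_simps)
 finally show ?thesis .
qed

section \<open>First and second moments of Gaussian sequences\<close>

lemma distr_cgauss_phase: "norm t = 1 ==> distr cgauss cgauss (phase i t) = cgauss"
 using distr_cgauss_rots[OF rots_phase[OF rots_id, of i UNIV t]] by simp

lemma integral_cgauss_phase:
 fixes f :: "('i => complex) => 'b::{banach, second_countable_topology}"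
 assumes [measurable]: "f : borel_measurable cgauss" and t: "norm t = 1"
 shows "(\<M> x. f (phase i t x)) = (\<M> x. f x)"
proof -
 have "(\<M> x. f x) = (\<integral>x. f x \<partial>distr cgauss cgauss (phase i t))"
  by (simp add: distr_cgauss_phase[OF t])
 also have "... = (\<M> x. f (phase i t x))" by (rule integral_distr) measurable
 finally show ?thesis ..
qed

lemma nn_integral_cgauss_sq: "(\<E> r. ennreal (nsq (r k))) = 1"
 using nn_integral_cgauss_component[of "%w. ennreal (nsq w)" k] nn_integral_std_sq by simp

lemma integrable_cgauss_sq: "integrable cgauss (%r. nsq (r k))"
 by (rule integrableI_nonneg) (measurable, simp_all add: nn_integral_cgauss_sq)

lemma integral_cgauss_sq: "(\<M> r. nsq (r k)) = 1"
 by (subst integral_eq_nn_integral) (measurable, simp_all add: nn_integral_cgauss_sq)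

lemma cgauss_product_bound: "norm (u * v) <= nsq u+nsq v" for u v :: complex
proof -
 have "0 <= (norm u-norm v)^2" by simp
 then have "2*(norm u*norm v) <= nsq u+nsq v" by (simp add: power2_diff mult.assoc)
 moreover have "0 <= norm u*norm v" by simp
 ultimately show ?thesis unfolding norm_mult by linarith
qed

lemma integrable_cgauss_mult:
 "integrable cgauss (%r. r k * r l)" "integrable cgauss (%r. r k*cnj (r l))"
proof -
 have i: "integrable cgauss (%r. nsq (r k)+nsq (r l))"
  by (intro Bochner_Integration.integrable_add integrable_cgauss_sq)
 show "integrable cgauss (%r. r k * r l)"
 proof (rule Bochner_Integration.integrable_bound[OF i])
  show "AE r in cgauss. norm (r k * r l) <= norm (nsq (r k)+nsq (r l))"
   using cgauss_product_bound by (auto intro!: AE_I2)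
 qed measurable
 show "integrable cgauss (%r. r k*cnj (r l))"
 proof (rule Bochner_Integration.integrable_bound[OF i])
  show "AE r in cgauss. norm (r k*cnj (r l)) <= norm (nsq (r k)+nsq (r l))"
   using cgauss_product_bound[of _ "cnj _"] by (auto intro!: AE_I2)
 qed measurable
qed

lemma integrable_cgauss_component: "integrable cgauss (%r. r k)"
proof (rule Bochner_Integration.integrable_bound)
 show "integrable cgauss (%r. 1+nsq (r k))"
  by (intro Bochner_Integration.integrable_add integrable_cgauss_sq) simp
 have "x <= 1+x\<^sup>2" if "x >= 0" for x :: real
  using sum_squares_bound[of 1 x] that by (simp add: power2_eq_square)
 then show "AE r in cgauss. norm (r k) <= norm (1+nsq (r k))" by auto
qed measurable

lemma integral_cgauss_component: "(\<M> r. r k) = 0"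
proof -
 have "(\<M> r. phase k (-1) r k) = (\<M> r. r k)"
  by (rule integral_cgauss_phase) auto
 then show ?thesis by (simp add: phase_def)
qed

lemma integral_cgauss_mult_cnj: "(\<M> r. r k*cnj (r l)) = (if k = l then 1 else 0)"
proof (cases "k = l")
 case True
 have "(\<M> r. r k*cnj (r k)) = (\<M> r. complex_of_real (nsq (r k)))"
  by (simp only: complex_norm_square)
 also have "... = 1" by (simp only: integral_complex_of_real integral_cgauss_sq of_real_1)
 finally show ?thesis using True by simp
next
 case False
 have "(\<M> r. phase k (-1) r k*cnj (phase k (-1) r l)) = (\<M> r. r k*cnj (r l))"
  by (rule integral_cgauss_phase[where f="%r. r k*cnj (r l)"]) auto
 then show ?thesis using False by (simp add: phase_def)
qed

text \<open>Phase invariance: the phase \<open>\<i>\<close> flips the sign of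
  \<open>r k * r k\<close>, the phase -1 that of a mixed product. This is the source of the isotropy
  required of a complex Gaussian field.\<close>

lemma integral_cgauss_mult: "(\<M> r. r k * r l) = 0"
proof (cases "k = l")
 case True
 have "(\<M> r. phase k \<i> r k * phase k \<i> r k) = (\<M> r. r k * r k)"
  by (rule integral_cgauss_phase[where f="%r. r k * r k"]) auto
 moreover have "phase k \<i> r k * phase k \<i> r k =-(r k * r k)" for r :: "'a => complex"
 proof -
  have "phase k \<i> r k * phase k \<i> r k = (\<i> * \<i>)*(r k * r k)" by (simp add: phase_def ac_simps del: i_squared)
  then show ?thesis by simp
 qed
 ultimately show ?thesis using True by simp
next
 case False
 have "(\<M> r. phase k (-1) r k * phase k (-1) r l) = (\<M> r. r k * r l)"
  by (rule integral_cgauss_phase[where f="%r. r k * r l"]) auto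
 then show ?thesis using False by (simp add: phase_def)
qed

lemma integrable_gauss_seq: "integrable cgauss (%r. gauss_seq T r a)"
 unfolding gauss_seq_def by (intro Bochner_Integration.integrable_sum integrable_mult_right integrable_cgauss_component)

lemma integral_gauss_seq: "(\<M> r. gauss_seq T r a) = 0"
 unfolding gauss_seq_def
 by (subst Bochner_Integration.integral_sum) (auto intro: integrable_cgauss_component simp: integral_cgauss_component)

lemma gauss_seq_mult:
 "gauss_seq T r a*gauss_seq T r b = (\<Sum>k\<le>a. \<Sum>l\<le>b. chol T a k*chol T b l*(r k * r l))"
 "gauss_seq T r a*cnj (gauss_seq T r b) = (\<Sum>k\<le>a. \<Sum>l\<le>b. chol T a k*cnj (chol T b l)*(r k*cnj (r l)))"
 by (simp_all add: gauss_seq_def sum_product ac_simps)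

lemma integrable_gauss_seq_mult:
 "integrable cgauss (%r. gauss_seq T r a*gauss_seq T r b)"
 "integrable cgauss (%r. gauss_seq T r a*cnj (gauss_seq T r b))"
 unfolding gauss_seq_mult
 by (intro Bochner_Integration.integrable_sum integrable_mult_right integrable_cgauss_mult)+

lemma integral_gauss_seq_mult: "(\<M> r. gauss_seq T r a*gauss_seq T r b) = 0"
 unfolding gauss_seq_mult
 by (simp add: Bochner_Integration.integral_sum integrable_cgauss_mult integral_cgauss_mult)

lemma integral_gauss_seq_mult_cnj:
 assumes T: "psd T"
 shows "(\<M> r. gauss_seq T r a*cnj (gauss_seq T r b)) = T (a, b)"
proof -
 have "(\<M> r. gauss_seq T r a*cnj (gauss_seq T r b))
   = (\<Sum>k\<le>a. \<Sum>l\<le>b. chol T a k*cnj (chol T b l)*(if k = l then 1 else 0))"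
  unfolding gauss_seq_mult
  by (simp add: Bochner_Integration.integral_sum integrable_cgauss_mult integral_cgauss_mult_cnj)
 also have "... = (\<Sum>k\<le>a. chol T a k*cnj (chol T b k))"
 proof (rule sum.cong[OF refl])
  fix k
  have "(\<Sum>l\<le>b. chol T a k*cnj (chol T b l)*(if k = l then 1 else 0)) = (\<Sum>l\<le>b. if l = k then chol T a k*cnj (chol T b k) else 0)"
   by (intro sum.cong) auto
  then show "(\<Sum>l\<le>b. chol T a k*cnj (chol T b l)*(if k = l then 1 else 0)) = chol T a k*cnj (chol T b k)"
   using chol_beyond[OF T, of b k] by (cases "k <= b") auto
 qed
 also have "... = T (a, b)" using chol_factorization[OF T, of a "Suc a" b] by (simp add: lessThan_Suc_atMost)
 finally show ?thesis .
qed

declare measurable_cgauss_component [measurable]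

section \<open>Independence of disjoint blocks of noise\<close>

lemma nn_integral_cgauss_fresh:
 fixes G :: "('i => complex) => ('i => complex) => ennreal"
 assumes G [measurable]: "case_prod G : borel_measurable (cgauss \<Otimes>\<^sub>M cgauss)"
  and loc: "!!w w' h h'. (!!i. i \<notin> J ==> w i = w' i) ==> (!!i. i : J ==> h i = h' i) ==> G w h = G w' h'"
 shows "(\<E> w. G w w) = (\<E> w h. G w h)"
proof -
 have "(\<E> w. G w w)
   = (\<E> w h. G (%i. if i : J then h i else w i) (%i. if i : J then h i else w i))"
  by (rule nn_integral_cgauss_mix) measurable
 also have "... = (\<E> w h. G w h)"
  by (intro nn_integral_cong loc) auto
 finally show ?thesis .
qed

lemma measurable_cgauss_reindex:
 assumes [measurable]: "f : measurable M cgauss"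
 shows "(%x k. f x (p k)) : measurable M cgauss"
proof (rule measurable_into_cgauss)
 show "(%x. f x (p k)) : borel_measurable M" for k by measurable
qed

lemma nn_integral_cgauss_split2:
 fixes \<Phi> :: "('k => complex) => ('l => complex) => ennreal" and p :: "'k => 'i" and q :: "'l => 'i"
 assumes \<Phi> [measurable]: "case_prod \<Phi> : borel_measurable (cgauss \<Otimes>\<^sub>M cgauss)"
  and p: "inj p" and q: "inj q" and disj: "range p \<inter> range q = {}"
 shows "(\<E> h. \<Phi> (%k. h (p k)) (%l. h (q l))) = (\<E> c r. \<Phi> c r)"
proof -
 note measurable_cgauss_reindex[where p=p, measurable] measurable_cgauss_reindex[where p=q, measurable]
 have "(\<E> h. \<Phi> (%k. h (p k)) (%l. h (q l)))
   = (\<E> h h'. \<Phi> (%k. h (p k)) (%l. h' (q l)))"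
 proof (rule nn_integral_cgauss_fresh[of "%h h'. \<Phi> (%k. h (p k)) (%l. h' (q l))" "range q"])
  fix w w' h h' :: "'i => complex"
  assume "!!i. i \<notin> range q ==> w i = w' i" "!!i. i : range q ==> h i = h' i"
  moreover have "p k \<notin> range q" for k using disj by blast
  ultimately have "(%k. w (p k)) = (%k. w' (p k))" "(%l. h (q l)) = (%l. h' (q l))"
   by auto
  then show "\<Phi> (%k. w (p k)) (%l. h (q l)) = \<Phi> (%k. w' (p k)) (%l. h' (q l))" by simp
 qed measurable
 also have "... = (\<E> h r. \<Phi> (%k. h (p k)) r)"
  by (intro nn_integral_cong nn_integral_cgauss_reindex q) measurable
 also have "... = (\<E> c r. \<Phi> c r)"
  by (rule nn_integral_cgauss_reindex[OF p]) measurable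
 finally show ?thesis .
qed

section \<open>The normalised Markov chain\<close>

type_synonym noise = "nat \<times> bool \<times> nat => complex"

text \<open>At time \<open>n\<close> the flag \<open>False\<close> selects the noise standing for
  the new column, \<open>True\<close> the noise standing for the new row. Disjoint indices make the
  two independent.\<close>

definition noise_col :: "nat => noise => nat => complex" where
 "noise_col n w = (%i. w (n, False, i))"

definition noise_row :: "nat => noise => nat => complex" where
 "noise_row n w = (%i. w (n, True, i))"

text \<open>Both weights come from \<open>next_gram\<close>, which gives 1 to the rank one term and
  \<open>b\<close> to the old kernel, divided by a common factor. For \<open>n >= 3\<close> this
  factor is \<open>n*b/(n-1)\<close>: since \<open>1/b\<close> has mean \<open>1/(n-1)\<close>, the
  new weight has mean \<open>1/n\<close> while the old weight is the constant
  \<open>1 - 1/n\<close>. For \<open>n < 3\<close> the required inverse moments are infinite, and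
  the bounded convex weights are used instead.\<close>

definition new_weight :: "nat => real => real" where
 "new_weight n b = (if n < 3 then 1/(1+b) else (real n-1)/(real n*b))"

definition old_weight :: "nat => real => real" where
 "old_weight n b = (if n < 3 then b/(1+b) else 1-1/real n)"

definition step_mean :: "nat => real => (nat => complex) => nat => complex" where
 "step_mean n b z = (%a. of_real (sqrt (new_weight n b)) * shift z a)"

definition step_kernel :: "nat => real => (nat => complex) => (nat \<times> nat => complex) => nat \<times> nat => complex" where
 "step_kernel n b z K = (%p. of_real (old_weight n b)*K p + of_real (new_weight n b)*(z (fst p)*cnj (z (snd p))))"

definition step_value :: "(nat => complex) => (nat \<times> nat => complex) => (nat => complex) => nat => complex" where
 "step_value m K r = (%a. m a+gauss_seq K r a)"

text \<open>The state is the conditional mean and kernel before the row noise of time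
  \<open>n\<close> is used. The value is then sampled, and the column noise of time \<open>n\<close>
  fixes the weights. The start is the polynomial 1 of the empty matrix, with zero kernel.\<close>

primrec chain :: "nat => noise => (nat => complex) \<times> (nat \<times> nat => complex)" where
 "chain 0 w = (unit_seq 0, %_. 0)"
| "chain (Suc n) w = (let (m, K) = chain n w; z = step_value m K (noise_row n w); b = col_norm n (noise_col n w)
   in (step_mean n b z, step_kernel n b z K))"

definition mean :: "nat => noise => nat => complex" where
 "mean n w = fst (chain n w)"

definition kern_mat :: "nat => noise => nat \<times> nat => complex" where
 "kern_mat n w = snd (chain n w)"

definition value_seq :: "nat => noise => nat => complex" where
 "value_seq n w = step_value (mean n w) (kern_mat n w) (noise_row n w)"

lemma mean_0 [simp]: "mean 0 w = unit_seq 0" and kern_mat_0 [simp]: "kern_mat 0 w = (%_. 0)"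
 by (simp_all add: mean_def kern_mat_def)

lemma mean_Suc: "mean (Suc n) w = step_mean n (col_norm n (noise_col n w)) (value_seq n w)"
 and kern_mat_Suc: "kern_mat (Suc n) w = step_kernel n (col_norm n (noise_col n w)) (value_seq n w) (kern_mat n w)"
 by (simp_all add: mean_def kern_mat_def value_seq_def Let_def case_prod_beta)

lemma measurable_noise_col [measurable]: "noise_col n : measurable cgauss cgauss"
 unfolding noise_col_def[abs_def] by (rule measurable_cgauss_reindex) measurable

lemma measurable_noise_row [measurable]: "noise_row n : measurable cgauss cgauss"
 unfolding noise_row_def[abs_def] by (rule measurable_cgauss_reindex) measurable

lemma measurable_new_weight [measurable]: "new_weight n : borel_measurable borel"
 unfolding new_weight_def by measurable

lemma measurable_old_weight [measurable]: "old_weight n : borel_measurable borel"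
 unfolding old_weight_def by measurable

abbreviation "next_kernel n m K c r \<equiv> step_kernel n (col_norm n c) (step_value m K r) K"
abbreviation "next_mean n m K c r \<equiv> step_mean n (col_norm n c) (step_value m K r)"

lemma measurable_step_value [measurable (raw)]:
 assumes [measurable]: "m : measurable M cgauss" "K : measurable M cgauss" "r : measurable M cgauss"
 shows "(%x. step_value (m x) (K x) (r x)) : measurable M cgauss"
 unfolding step_value_def by measurable

lemma measurable_step_mean [measurable (raw)]:
 assumes [measurable]: "b : borel_measurable M" "z : measurable M cgauss"
 shows "(%x. step_mean n (b x) (z x)) : measurable M cgauss"
proof (rule measurable_into_cgauss)
 fix a
 have [measurable]: "(%x. shift (z x) a) : borel_measurable M" by measurable
 show "(%x. step_mean n (b x) (z x) a) : borel_measurable M"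
  unfolding step_mean_def by measurable
qed

lemma measurable_step_kernel [measurable (raw)]:
 assumes [measurable]: "b : borel_measurable M" "z : measurable M cgauss" "K : measurable M cgauss"
 shows "(%x. step_kernel n (b x) (z x) (K x)) : measurable M cgauss"
proof (rule measurable_into_cgauss)
 fix p
 have [measurable]: "(%x. z x a) : borel_measurable M" "(%x. K x p) : borel_measurable M" for a by measurable
 show "(%x. step_kernel n (b x) (z x) (K x) p) : borel_measurable M"
  unfolding step_kernel_def by measurable
qed

lemma measurable_mean_kern: "mean n : measurable cgauss cgauss \<and> kern_mat n : measurable cgauss cgauss"
proof (induction n)
 case 0
 have "mean 0 = (%w. unit_seq 0)" "kern_mat 0 = (%w _. 0)" by (auto simp: fun_eq_iff)
 then show ?case by (auto intro: measurable_into_cgauss)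
next
 case (Suc n)
 then have [measurable]: "mean n : measurable cgauss cgauss" "kern_mat n : measurable cgauss cgauss" by auto
 have [measurable]: "value_seq n : measurable cgauss cgauss"
  unfolding value_seq_def[abs_def] by measurable
 show ?case unfolding mean_Suc[abs_def] kern_mat_Suc[abs_def] by measurable
qed

lemmas measurable_mean [measurable] = measurable_mean_kern[THEN conjunct1]
lemmas measurable_kern_mat [measurable] = measurable_mean_kern[THEN conjunct2]

lemma measurable_value_seq [measurable]: "value_seq n : measurable cgauss cgauss"
 unfolding value_seq_def[abs_def] by measurable

text \<open>Adaptedness of the chain. Together with \<open>nn_integral_chain_fresh\<close> it
  replaces filtrations and conditional expectations by Fubini.\<close>

lemma chain_past:
 assumes "!!m x. m < n ==> w (m, x) = w' (m, x)"
 shows "mean n w = mean n w' \<and> kern_mat n w = kern_mat n w'"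
 using assms
proof (induction n)
 case (Suc n)
 then have "mean n w = mean n w'" "kern_mat n w = kern_mat n w'" by auto
 moreover have "noise_col n w = noise_col n w'" "noise_row n w = noise_row n w'"
  using Suc.prems by (auto simp: noise_col_def noise_row_def)
 ultimately show ?case by (simp add: mean_Suc kern_mat_Suc value_seq_def)
qed simp

lemma nn_integral_chain_fresh:
 fixes G :: "noise => (nat => complex) => (nat => complex) => ennreal"
 assumes G [measurable]: "(%(w, c, r). G w c r) : borel_measurable (cgauss \<Otimes>\<^sub>M cgauss \<Otimes>\<^sub>M cgauss)"
  and past: "!!w w' c r. (!!m x. m < n ==> w (m, x) = w' (m, x)) ==> G w c r = G w' c r"
 shows "(\<E> w. G w (noise_col n w) (noise_row n w))
  = (\<E> w c r. G w c r)"
proof -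
 have [measurable]: "(%p. G (f p) (g p) (h p)) : borel_measurable M"
  if [measurable]: "f : measurable M cgauss" "g : measurable M cgauss" "h : measurable M cgauss" for f g h and M :: "'x measure"
  using measurable_compose[OF _ G, of "%p. (f p, g p, h p)" M] by simp
 have "(\<E> w. G w (noise_col n w) (noise_row n w))
   = (\<E> w h. G w (noise_col n h) (noise_row n h))"
 proof (rule nn_integral_cgauss_fresh[of "%w h. G w (noise_col n h) (noise_row n h)" "{n} \<times> UNIV"])
  fix w w' h h' :: noise
  assume 1: "!!i. i \<notin> {n} \<times> UNIV ==> w i = w' i" and 2: "!!i. i : {n} \<times> UNIV ==> h i = h' i"
  have "noise_col n h = noise_col n h'" "noise_row n h = noise_row n h'"
   using 2 by (auto simp: noise_col_def noise_row_def)
  then show "G w (noise_col n h) (noise_row n h) = G w' (noise_col n h') (noise_row n h')"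
   using past[of w w'] 1 by auto
 qed measurable
 also have "... = (\<E> w c r. G w c r)"
  unfolding noise_col_def noise_row_def
  by (intro nn_integral_cong nn_integral_cgauss_split2) (auto simp: inj_def, measurable)
 finally show ?thesis .
qed

lemma new_weight_pos: "b > 0 ==> new_weight n b > 0"
 by (auto simp: new_weight_def)

lemma new_weight_nonneg: "b >= 0 ==> new_weight n b >= 0"
 by (auto simp: new_weight_def)

lemma old_weight_nonneg: "b >= 0 ==> old_weight n b >= 0"
 by (auto simp: old_weight_def)

lemma old_weight_eq: "b > 0 \<or> n = 0 \<and> b = 0 ==> old_weight n b = b*new_weight n b"
 by (auto simp: old_weight_def new_weight_def field_simps)

lemma psd_cnj: "psd T ==> cnj (T (a, b)) = T (b, a)"
 unfolding psd_def by metis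

lemma sesq_rank_one:
 "sesq N (%p. z (fst p)*cnj (z (snd p))) x y = (\<Sum>a<N. x a*z a)*cnj (\<Sum>a<N. y a*z a)"
 using sesq_gram[of "%p. z (fst p)*cnj (z (snd p))" "%_::unit. z" UNIV N x y] by simp

lemma sesq_step_kernel:
 "Re (sesq N (step_kernel n b z K) x x)
   = old_weight n b * Re (sesq N K x x)+new_weight n b*nsq (\<Sum>a<N. x a*z a)"
proof -
 have "sesq N (step_kernel n b z K) x x
   = of_real (old_weight n b) * sesq N K x x + of_real (new_weight n b) * sesq N (%p. z (fst p)*cnj (z (snd p))) x x"
  unfolding sesq_def step_kernel_def sum_distrib_left sum.distrib[symmetric]
  by (intro sum.cong refl) (simp add: algebra_simps)
 also have "sesq N (%p. z (fst p)*cnj (z (snd p))) x x = of_real (nsq (\<Sum>a<N. x a*z a))"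
  unfolding sesq_rank_one complex_norm_square ..
 finally show ?thesis by (simp del: of_real_power)
qed

lemma psd_step_kernel:
 assumes K: "psd K" and b: "b >= 0"
 shows "psd (step_kernel n b z K)"
 unfolding psd_def
proof (intro conjI allI)
 fix a c
 show "step_kernel n b z K (c, a) = cnj (step_kernel n b z K (a, c))"
  using psd_cnj[OF K, of a c] by (simp add: step_kernel_def mult.commute[of "z c"])
 show "0 <= Re (sesq N (step_kernel n b z K) x x)" for N x
  using b sesq_self_nonneg[OF K] by (simp add: sesq_step_kernel old_weight_nonneg new_weight_nonneg)
qed

lemma psd_kern_mat: "psd (kern_mat n w)"
 by (induction n) (simp_all add: kern_mat_Suc psd_step_kernel col_norm_nonneg, simp add: psd_def sesq_def)

section \<open>The chain has the law of the Ginibre pair up to scaling\<close>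

definition scale_invariant :: "((nat => complex) => (nat \<times> nat => complex) => ennreal) => bool" where
 "scale_invariant F \<longleftrightarrow> (\<forall>s q T. s > 0 \<longrightarrow> F (%a. of_real s*q a) (%p. of_real (s\<^sup>2)*T p) = F q T)"

lemma scale_invariantD: "scale_invariant F ==> s > 0 ==> F (%a. of_real s*q a) (%p. of_real (s\<^sup>2)*T p) = F q T"
 unfolding scale_invariant_def by blast

lemma gauss_seq_scale: "s > 0 ==> gauss_seq (%p. of_real (s\<^sup>2)*T p) r a = of_real s*gauss_seq T r a"
 by (simp only: gauss_seq_def chol_scale sum_distrib_left mult.assoc)

text \<open>The normalised kernel is \<open>s\<^sup>2\<close> times \<open>next_gram\<close>, where
  \<open>s\<^sup>2\<close> is the new weight, and Cholesky samples scale by \<open>s\<close>; a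
  scale invariant functional does not see the factor. The case \<open>n = 0\<close> with
  \<open>b = 0\<close> is the first step, whose column is empty.\<close>

lemma step_scale:
 assumes F: "scale_invariant F" and b: "b > 0 \<or> n = 0 \<and> b = 0"
 shows "F (step_value (step_mean n b z) (step_kernel n b z K) r) (step_kernel n b z K)
  = F (%a. shift z a+gauss_seq (next_gram z K b) r a) (next_gram z K b)"
proof -
 define s where "s = sqrt (new_weight n b)"
 have w: "new_weight n b > 0" using b by (auto simp: new_weight_def)
 then have s: "s > 0" "s\<^sup>2 = new_weight n b" by (simp_all add: s_def)
 have K': "step_kernel n b z K = (%p. of_real (s\<^sup>2)*next_gram z K b p)"
  unfolding s(2) by (simp add: step_kernel_def next_gram_def old_weight_eq[OF b] fun_eq_iff algebra_simps)
 have "step_value (step_mean n b z) (step_kernel n b z K) r = (%a. of_real s*(shift z a+gauss_seq (next_gram z K b) r a))"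
  unfolding step_value_def K' gauss_seq_scale[OF s(1)] by (simp add: step_mean_def s_def distrib_left)
 then show ?thesis unfolding K' using scale_invariantD[OF F s(1)] by simp
qed

lemma AE_col_norm_admissible: "AE c in cgauss. 0 < col_norm n c \<or> n = 0 \<and> col_norm n c = 0"
proof (cases "n = 0")
 case False
 then show ?thesis using AE_col_norm_pos[of n] by (auto elim: eventually_mono)
qed (auto simp: col_norm_def)

lemma gauss_seq_zero [simp]: "gauss_seq (%_. 0) r = (%_. 0)"
 by (simp add: gauss_seq_def chol_def gs_coeff_def fun_eq_iff)

text \<open>Induction on \<open>n\<close> for all functionals at once: \<open>F'\<close> integrates
  one bordering step out of \<open>F\<close> and is again scale invariant, so the random factors of
  the earlier steps are absorbed by the induction hypothesis.\<close>

theorem ginibre_law: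
 assumes F: "case_prod F : borel_measurable (cgauss \<Otimes>\<^sub>M cgauss)" and inv: "scale_invariant F"
 shows "(\<E> g. F (cp_coeff n g) (cofactor_gram n g)) = (\<E> w. F (value_seq n w) (kern_mat n w))"
 using assms
proof (induction n arbitrary: F)
 case 0
 have "cp_coeff 0 g = unit_seq 0" for g
 proof -
  have "cp_poly 0 g = 1" by (simp add: cp_poly_def det_dim_zero[OF cp_mat_carrier])
  then show ?thesis by (auto simp: cp_coeff_def unit_seq_def fun_eq_iff one_pCons coeff_pCons split: nat.split)
 qed
 moreover have "cofactor_gram 0 g = (%_. 0)" for g by (auto simp: cofactor_gram_def)
 moreover have "value_seq 0 w = unit_seq 0" for w
  by (simp add: value_seq_def step_value_def)
 ultimately show ?case by (simp add: cgauss.emeasure_space_1[unfolded space_cgauss])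
next
 case (Suc n)
 note [measurable] = Suc.prems(1)
 define F' where "F' q T = (\<E> c r. F (%a. shift q a+gauss_seq (next_gram q T (col_norm n c)) r a) (next_gram q T (col_norm n c)))" for q T
 have [measurable]: "case_prod F' : borel_measurable (cgauss \<Otimes>\<^sub>M cgauss)" unfolding F'_def by measurable
 have inv': "scale_invariant F'"
  unfolding scale_invariant_def
 proof (intro allI impI)
  fix s :: real and q T assume s: "s > 0"
  have "next_gram (%a. of_real s*q a) (%p. of_real (s\<^sup>2)*T p) b = (%p. of_real (s\<^sup>2)*next_gram q T b p)" for b
   by (simp add: next_gram_def fun_eq_iff power2_eq_square algebra_simps)
  moreover have "shift (%a. of_real s*q a) a = of_real s * shift q a" for a by (simp add: shift_def)
  ultimately have "F (%a. shift (%a. of_real s*q a) a+gauss_seq (next_gram (%a. of_real s*q a) (%p. of_real (s\<^sup>2)*T p) b) r a)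
    (next_gram (%a. of_real s*q a) (%p. of_real (s\<^sup>2)*T p) b)
   = F (%a. of_real s*(shift q a+gauss_seq (next_gram q T b) r a)) (%p. of_real (s\<^sup>2)*next_gram q T b p)" for b r
   by (simp only: gauss_seq_scale[OF s] distrib_left)
  also have "... b r = F (%a. shift q a+gauss_seq (next_gram q T b) r a) (next_gram q T b)" for b r
   by (rule scale_invariantD[OF Suc.prems(2) s])
  finally show "F' (%a. of_real s*q a) (%p. of_real (s\<^sup>2)*T p) = F' q T" by (simp only: F'_def)
 qed
 have "(\<E> g. F (cp_coeff (Suc n) g) (cofactor_gram (Suc n) g)) = (\<E> g. F' (cp_coeff n g) (cofactor_gram n g))"
  unfolding nn_integral_ginibre_step[OF Suc.prems(1)] F'_def Let_def ..
 also have "... = (\<E> w. F' (value_seq n w) (kern_mat n w))"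
  by (rule Suc.IH) (measurable, rule inv')
 also have "... = (\<E> w c r. F (step_value (step_mean n (col_norm n c) (value_seq n w)) (step_kernel n (col_norm n c) (value_seq n w) (kern_mat n w)) r)
    (step_kernel n (col_norm n c) (value_seq n w) (kern_mat n w)))"
  unfolding F'_def
 proof (rule nn_integral_cong, rule nn_integral_cong_AE)
  fix w :: noise
  show "AE c in cgauss. (\<E> r. F (%a. shift (value_seq n w) a+gauss_seq (next_gram (value_seq n w) (kern_mat n w) (col_norm n c)) r a)
     (next_gram (value_seq n w) (kern_mat n w) (col_norm n c)))
    = (\<E> r. F (step_value (step_mean n (col_norm n c) (value_seq n w)) (step_kernel n (col_norm n c) (value_seq n w) (kern_mat n w)) r)
    (step_kernel n (col_norm n c) (value_seq n w) (kern_mat n w)))"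
   using AE_col_norm_admissible[of n]
   by eventually_elim (simp add: step_scale[OF Suc.prems(2)])
 qed
 also have "... = (\<E> w. F (value_seq (Suc n) w) (kern_mat (Suc n) w))"
 proof -
  \<comment> \<open>The transition from time \<open>n\<close> to \<open>Suc n\<close> uses the
    column noise of time \<open>n\<close> and the row noise of time \<open>Suc n\<close>; the row
    noise of time \<open>n\<close> has already gone into \<open>value_seq n\<close>.\<close>
  define J where "J = {(n, False, i) | i :: nat. True} \<union> {(Suc n, True, i) | i :: nat. True}"
  define G where "G w h = (let b = col_norm n (noise_col n h); K = step_kernel n b (value_seq n w) (kern_mat n w)
    in F (step_value (step_mean n b (value_seq n w)) K (noise_row (Suc n) h)) K)" for w h :: noise
  have "(\<E> w. F (value_seq (Suc n) w) (kern_mat (Suc n) w)) = (\<E> w. G w w)"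
   by (simp add: G_def value_seq_def[of "Suc n"] mean_Suc kern_mat_Suc Let_def)
  also have "... = (\<E> w h. G w h)"
  proof (rule nn_integral_cgauss_fresh[where J=J])
   show "case_prod G : borel_measurable (cgauss \<Otimes>\<^sub>M cgauss)" unfolding G_def Let_def by measurable
   fix w w' h h' :: noise
   assume 1: "!!i. i \<notin> J ==> w i = w' i" and 2: "!!i. i : J ==> h i = h' i"
   have "noise_col n h = noise_col n h'" "noise_row (Suc n) h = noise_row (Suc n) h'"
    using 2 by (auto simp: noise_col_def noise_row_def J_def)
   moreover have "mean n w = mean n w' \<and> kern_mat n w = kern_mat n w'"
    using 1 by (intro chain_past) (auto simp: J_def)
   moreover have "noise_row n w = noise_row n w'"
    using 1 by (auto simp: noise_row_def J_def)
   ultimately show "G w h = G w' h'" by (simp add: G_def value_seq_def)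
  qed
  also have "... = (\<E> w c r. F (step_value (step_mean n (col_norm n c) (value_seq n w)) (step_kernel n (col_norm n c) (value_seq n w) (kern_mat n w)) r)
    (step_kernel n (col_norm n c) (value_seq n w) (kern_mat n w)))"
   unfolding G_def Let_def noise_col_def noise_row_def
   by (intro nn_integral_cong nn_integral_cgauss_split2) (auto simp: inj_def, measurable)
  finally show ?thesis ..
 qed
 finally show ?case .
qed

section \<open>Weighted norms and uniform moment bounds\<close>

declare measurable_cgauss_component [measurable del]

text \<open>The weight \<open>R^(2*a)\<close> measures functions on the disc of radius
  \<open>R\<close>. The cutoff \<open>N\<close> keeps all quantities finite, and the bounds obtained
  below are uniform in it.\<close>

definition wtrace :: "real => nat => (nat \<times> nat => complex) => real" where
 "wtrace R N K = (\<Sum>a\<le>N. R^(2*a) * Re (K (a, a)))"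

definition wnorm2 :: "real => nat => (nat => complex) => real" where
 "wnorm2 R N x = (\<Sum>a\<le>N. R^(2*a)*nsq (x a))"

lemma wtrace_nonneg: "psd K ==> 0 <= wtrace R N K"
 by (auto simp: wtrace_def power_mult intro!: sum_nonneg mult_nonneg_nonneg psd_diag)

lemma wnorm2_nonneg: "0 <= wnorm2 R N x"
 by (auto simp: wnorm2_def power_mult intro!: sum_nonneg mult_nonneg_nonneg)

lemma emeasure_cgauss_UNIV [simp]: "emeasure cgauss UNIV = 1"
 using cgauss.emeasure_space_1 by simp

lemma even_power_nonneg: "0 <= (R::real)^(2*a)"
 by (simp add: power_mult)

lemma wnorm2_shift_le: "wnorm2 R N (shift x) <= R\<^sup>2*wnorm2 R N x"
proof (cases N)
 case 0
 then show ?thesis by (simp add: wnorm2_def shift_def)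
next
 case (Suc M)
 have "wnorm2 R N (shift x) = (\<Sum>a\<le>M. R^(2*Suc a)*nsq (x a))"
  unfolding wnorm2_def Suc by (subst sum.atMost_Suc_shift) (simp add: shift_def)
 also have "... = R\<^sup>2*wnorm2 R M x"
  by (simp add: wnorm2_def sum_distrib_left power2_eq_square ac_simps)
 also have "... <= R\<^sup>2*wnorm2 R N x"
  unfolding wnorm2_def Suc by (intro mult_left_mono sum_mono2) (auto intro!: mult_nonneg_nonneg even_power_nonneg)
 finally show ?thesis .
qed

lemma wtrace_step_kernel: "wtrace R N (step_kernel n b z K) = old_weight n b*wtrace R N K+new_weight n b*wnorm2 R N z"
proof -
 have "Re (step_kernel n b z K (a, a)) = old_weight n b * Re (K (a, a))+new_weight n b*nsq (z a)" for a
  by (simp add: step_kernel_def complex_mult_cnj cmod_power2)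
 then show ?thesis
  by (simp add: wtrace_def wnorm2_def sum_distrib_left sum.distrib[symmetric] algebra_simps)
qed

lemma wnorm2_scale: "wnorm2 R N (%a. c*x a) = nsq c*wnorm2 R N x"
 by (simp add: wnorm2_def norm_mult power_mult_distrib sum_distrib_left ac_simps)

lemma wnorm2_step_mean:
 assumes "b >= 0"
 shows "wnorm2 R N (step_mean n b z) <= new_weight n b*(R\<^sup>2*wnorm2 R N z)"
proof -
 have "wnorm2 R N (step_mean n b z) = new_weight n b*wnorm2 R N (shift z)"
  using new_weight_nonneg[OF assms, of n] by (simp add: step_mean_def wnorm2_scale)
 also have "... <= new_weight n b*(R\<^sup>2*wnorm2 R N z)"
  by (intro mult_left_mono wnorm2_shift_le new_weight_nonneg assms)
 finally show ?thesis .
qed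

lemma measurable_cgauss_app:
 "f : measurable M cgauss ==> (%x. f x i) : borel_measurable M"
 by (rule measurable_compose[OF _ measurable_cgauss_component])

lemma measurable_wnorm2 [measurable (raw)]:
 assumes "x : measurable M cgauss"
 shows "(%w. wnorm2 R N (x w)) : borel_measurable M"
 unfolding wnorm2_def
 by (intro borel_measurable_sum borel_measurable_times borel_measurable_const borel_measurable_power
   measurable_compose[OF _ borel_measurable_norm] measurable_cgauss_app assms)

lemma measurable_wtrace [measurable (raw)]:
 assumes "K : measurable M cgauss"
 shows "(%w. wtrace R N (K w)) : borel_measurable M"
 unfolding wtrace_def
 by (intro borel_measurable_sum borel_measurable_times borel_measurable_const measurable_compose[OF _ borel_measurable_Re] measurable_cgauss_app assms)

lemma nn_integral_step_value_sq:
 assumes K: "psd K"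
 shows "(\<E> r. ennreal (nsq (step_value m K r a))) = ennreal (nsq (m a)+Re (K (a, a)))"
proof -
 have "(\<E> r. ennreal (nsq (step_value m K r a)))
   = (\<G> w. ennreal ((norm (m a + of_real (sqrt (Re (K (a, a))))*w))^2))"
  unfolding step_value_def by (rule nn_integral_gauss_seq[OF K, where f="%w. ennreal (nsq (m a+w))"]) measurable
 also have "... = ennreal (nsq (m a)+Re (K (a, a)))"
  using psd_diag[OF K, of a] by (subst nn_integral_std_shift_sq) simp
 finally show ?thesis .
qed

lemma nn_integral_wnorm2_step_value:
 assumes K: "psd K"
 shows "(\<E> r. ennreal (wnorm2 R N (step_value m K r))) = ennreal (wnorm2 R N m+wtrace R N K)"
proof -
 have [measurable]: "(%r. step_value m K r a) : borel_measurable cgauss" for a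
  by (rule measurable_cgauss_app) measurable
 have "(\<E> r. ennreal (wnorm2 R N (step_value m K r)))
   = (\<E> r. (\<Sum>a\<le>N. ennreal (R^(2*a))*ennreal (nsq (step_value m K r a))))"
  by (intro nn_integral_cong) (simp add: wnorm2_def ennreal_mult[symmetric] even_power_nonneg sum_ennreal)
 also have "... = (\<Sum>a\<le>N. ennreal (R^(2*a))*ennreal (nsq (m a)+Re (K (a, a))))"
  by (subst nn_integral_sum) (auto simp: nn_integral_cmult nn_integral_step_value_sq[OF K])
 also have "... = (\<Sum>a\<le>N. ennreal (R^(2*a)*(nsq (m a)+Re (K (a, a)))))"
  using psd_diag[OF K] by (intro sum.cong refl ennreal_mult[symmetric]) (auto simp: even_power_nonneg)
 also have "... = ennreal (wnorm2 R N m+wtrace R N K)"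
  using psd_diag[OF K] by (subst sum_ennreal) (auto simp: even_power_nonneg wnorm2_def wtrace_def sum.distrib[symmetric] distrib_left)
 finally show ?thesis .
qed

lemma nn_integral_gauss_seq_prod:
 assumes K: "psd K"
 shows "(\<E> r. ennreal (nsq (gauss_seq K r a)*nsq (gauss_seq K r b))) <= ennreal (16*(Re (K (a, a)) * Re (K (b, b))))"
proof -
 have [measurable]: "(%r. gauss_seq K r a) : borel_measurable cgauss" for a
  by (rule measurable_cgauss_app) measurable
 have 4: "(\<E> r. ennreal ((nsq (gauss_seq K r a))^2)) <= ennreal ((4 * Re (K (a, a)))^2)" for a
  using nn_integral_gauss_seq_fourth[OF K, of a] by (simp add: power_mult_distrib flip: power_mult)
 have "(\<E> r. ennreal \<bar>(norm (gauss_seq K r a))\<^sup>2*nsq (gauss_seq K r b)\<bar>) <= ennreal ((4 * Re (K (a, a)))*(4 * Re (K (b, b))))"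
  using psd_diag[OF K] by (intro nn_integral_mult_le 4) auto
 then show ?thesis by (simp add: ac_simps)
qed

lemma wnorm2_sq: "(wnorm2 R N x)\<^sup>2 = (\<Sum>a\<le>N. \<Sum>b\<le>N. R^(2*a) * R^(2*b)*(nsq (x a)*nsq (x b)))"
 by (simp add: wnorm2_def power2_eq_square[of "sum _ _"] sum_product ac_simps)

lemma nn_integral_wnorm2_gauss_seq_sq:
 assumes K: "psd K"
 shows "(\<E> r. ennreal ((wnorm2 R N (gauss_seq K r))^2)) <= ennreal (16*(wtrace R N K)^2)"
proof -
 have [measurable]: "(%r. gauss_seq K r a) : borel_measurable cgauss" for a
  by (rule measurable_cgauss_app) measurable
 have "(\<E> r. ennreal ((wnorm2 R N (gauss_seq K r))^2))
   = (\<E> r. (\<Sum>a\<le>N. \<Sum>b\<le>N. ennreal (R^(2*a) * R^(2*b))*ennreal (nsq (gauss_seq K r a)*nsq (gauss_seq K r b))))"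
  unfolding wnorm2_sq
  by (intro nn_integral_cong) (simp add: ennreal_mult[symmetric] even_power_nonneg sum_ennreal sum_nonneg)
 also have "... = (\<Sum>a\<le>N. \<Sum>b\<le>N. ennreal (R^(2*a) * R^(2*b))*(\<E> r. ennreal (nsq (gauss_seq K r a)*nsq (gauss_seq K r b))))"
  by (simp add: nn_integral_sum nn_integral_cmult)
 also have "... <= (\<Sum>a\<le>N. \<Sum>b\<le>N. ennreal (R^(2*a) * R^(2*b))*ennreal (16*(Re (K (a, a)) * Re (K (b, b)))))"
  by (intro sum_mono mult_left_mono nn_integral_gauss_seq_prod[OF K]) auto
 also have "... = (\<Sum>a\<le>N. \<Sum>b\<le>N. ennreal (R^(2*a) * R^(2*b)*(16*(Re (K (a, a)) * Re (K (b, b))))))"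
  using psd_diag[OF K] by (intro sum.cong refl ennreal_mult[symmetric]) (auto simp: even_power_nonneg)
 also have "... = ennreal (\<Sum>a\<le>N. \<Sum>b\<le>N. R^(2*a) * R^(2*b)*(16*(Re (K (a, a)) * Re (K (b, b)))))"
  using psd_diag[OF K] by (simp add: sum_ennreal even_power_nonneg sum_nonneg)
 also have "(\<Sum>a\<le>N. \<Sum>b\<le>N. R^(2*a) * R^(2*b)*(16*(Re (K (a, a)) * Re (K (b, b))))) = 16*(wtrace R N K)^2"
  by (simp add: wtrace_def power2_eq_square sum_product sum_distrib_left ac_simps)
 finally show ?thesis .
qed

lemma wnorm2_add_le: "wnorm2 R N (%a. x a+y a) <= 2*wnorm2 R N x+2*wnorm2 R N y"
proof -
 have "nsq (x a+y a) <= 2*nsq (x a)+2*nsq (y a)" for a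
 proof -
  have "nsq (x a+y a) <= (norm (x a)+norm (y a))^2" by (intro power_mono norm_triangle_ineq) simp
  also have "... <= 2*nsq (x a)+2*nsq (y a)"
   using sum_squares_bound[of "norm (x a)" "norm (y a)"] by (simp add: power2_sum)
  finally show ?thesis .
 qed
 then have "wnorm2 R N (%a. x a+y a) <= (\<Sum>a\<le>N. R^(2*a)*(2*nsq (x a)+2*nsq (y a)))"
  unfolding wnorm2_def by (intro sum_mono mult_left_mono) (auto simp: even_power_nonneg)
 also have "... = 2*wnorm2 R N x+2*wnorm2 R N y"
  by (simp add: wnorm2_def distrib_left sum.distrib sum_distrib_left ac_simps)
 finally show ?thesis .
qed

lemma sq_sum_le: "(x+y)\<^sup>2 <= 2*x\<^sup>2+2*(y::real)^2"
 using sum_squares_bound[of x y] by (simp add: power2_sum)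

lemma nn_integral_wnorm2_step_value_sq:
 assumes K: "psd K"
 shows "(\<E> r. ennreal ((wnorm2 R N (step_value m K r))^2)) <= ennreal (8*(wnorm2 R N m)^2+128*(wtrace R N K)^2)"
proof -
 have "(wnorm2 R N (step_value m K r))\<^sup>2 <= 8*(wnorm2 R N m)^2+8*(wnorm2 R N (gauss_seq K r))^2" for r
 proof -
  have "(wnorm2 R N (step_value m K r))\<^sup>2 <= (2*wnorm2 R N m+2*wnorm2 R N (gauss_seq K r))^2"
   unfolding step_value_def by (intro power_mono wnorm2_add_le wnorm2_nonneg)
  also have "... <= 8*(wnorm2 R N m)^2+8*(wnorm2 R N (gauss_seq K r))^2"
   using sq_sum_le[of "2*wnorm2 R N m" "2*wnorm2 R N (gauss_seq K r)"] by (simp add: power_mult_distrib)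
  finally show ?thesis .
 qed
 then have "(\<E> r. ennreal ((wnorm2 R N (step_value m K r))^2))
   <= (\<E> r. ennreal (8*(wnorm2 R N m)^2)+8*ennreal ((wnorm2 R N (gauss_seq K r))^2))"
  by (intro nn_integral_mono) (simp add: ennreal_leI ennreal_plus[symmetric] ennreal_mult'[symmetric] flip: ennreal_numeral del: ennreal_plus)
 also have "... = ennreal (8*(wnorm2 R N m)^2)+8*(\<E> r. ennreal ((wnorm2 R N (gauss_seq K r))^2))"
  using cgauss.emeasure_space_1 by (subst nn_integral_add) (simp_all add: nn_integral_cmult)
 also have "... <= ennreal (8*(wnorm2 R N m)^2)+8*ennreal (16*(wtrace R N K)^2)"
  by (intro add_left_mono mult_left_mono nn_integral_wnorm2_gauss_seq_sq[OF K]) simp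
 also have "... = ennreal (8*(wnorm2 R N m)^2+128*(wtrace R N K)^2)"
  by (simp add: ennreal_plus[symmetric] ennreal_mult'[symmetric] flip: ennreal_numeral del: ennreal_plus)
 finally show ?thesis .
qed

lemma nn_integral_new_weight:
 assumes n: "n >= 3"
 shows "(\<E> c. ennreal (new_weight n (col_norm n c))) = ennreal (1/real n)"
proof -
 obtain m where m: "n = m+2" using n by (metis add.commute le_Suc_ex numeral_3_eq_3 add_2_eq_Suc le_add1 le_trans Suc_n_not_le_n nat_le_iff_add numeral_2_eq_2 Suc_leD)
 have eq: "ennreal (new_weight n (col_norm n c)) = ennreal ((real n-1)/real n)*ennreal (1/col_norm (m+2) c)" for c
  using n col_norm_nonneg[of n c] by (subst ennreal_mult[symmetric]) (auto simp: new_weight_def m)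
 have "(\<E> c. ennreal (new_weight n (col_norm n c))) = ennreal ((real n-1)/real n)*ennreal (1/(real m+1))"
  unfolding eq by (subst nn_integral_cmult) (auto simp only: nn_integral_inverse_col_norm, measurable)
 also have "... = ennreal (1/real n)"
  using n by (subst ennreal_mult[symmetric]) (auto simp: m field_simps)
 finally show ?thesis .
qed

lemma nn_integral_new_weight_sq:
 assumes n: "n >= 3"
 shows "(\<E> c. ennreal ((new_weight n (col_norm n c))^2)) <= ennreal (2/(real n)^2)"
proof -
 obtain m where m: "n = m+3" using n by (metis add.commute le_Suc_ex)
 have eq: "ennreal ((new_weight n (col_norm n c))^2) = ennreal (((real n-1)/real n)^2)*ennreal (1/(col_norm (m+3) c)^2)" for c
  using n by (subst ennreal_mult[symmetric]) (auto simp: new_weight_def m power_divide power_mult_distrib)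
 have "(\<E> c. ennreal ((new_weight n (col_norm n c))^2)) = ennreal (((real n-1)/real n)^2)*ennreal (1/((real m+1)*(real m+2)))"
  unfolding eq by (subst nn_integral_cmult) (auto simp only: nn_integral_inverse_col_norm_sq, measurable)
 also have "... = ennreal (((real n-1)/real n)^2*(1/((real m+1)*(real m+2))))"
  by (subst ennreal_mult[symmetric]) auto
 also have "((real n-1)/real n)\<^sup>2*(1/((real m+1)*(real m+2))) = (real m+2)/(real m+1)*(1/(real n)^2)"
 proof -
  define x y where "x = real m+1" and "y = real m+2"
  have "x > 0" "y > 0" "real n-1 = y" "real n > 0" by (auto simp: x_def y_def m)
  then show ?thesis unfolding x_def[symmetric] y_def[symmetric] by (simp add: power2_eq_square field_simps)
 qed
 also have "ennreal ... <= ennreal (2/(real n)^2)"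
 proof (rule ennreal_leI)
  have "(real m+2)/(real m+1)*(1/(real n)^2) <= 2*(1/(real n)^2)"
   by (intro mult_right_mono) (auto simp: field_simps)
  then show "(real m+2)/(real m+1)*(1/(real n)^2) <= 2/(real n)^2" by simp
 qed
 finally show ?thesis .
qed

text \<open>Squares of quadratic quantities, that is, fourth order in the coefficients. This order
  is needed because the martingale increments of the kernel are quadratic in the sampled values and
  are estimated in L2.\<close>

definition lyap :: "real => nat => (nat => complex) => (nat \<times> nat => complex) => real" where
 "lyap R N m K = (wtrace R N K)^2+(wnorm2 R N m)^2"

lemma lyap_nonneg: "0 <= lyap R N m K"
 by (simp add: lyap_def)

text \<open>The excess over 1 has to be summable in \<open>n\<close> for the product of the rates to
  stay bounded. The exponent 3/2 comes from splitting the cross term of kernel and mean in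
  \<open>lyap_step\<close>; the first three steps get a crude constant.\<close>

definition lyap_rate :: "real => nat => real" where
 "lyap_rate R n = (if n < 3 then 256*(2+R^4) else 1+(257+256 * R^4) * real n powr (-3/2))"

text \<open>The kernel part does not grow to first order, since
  \<open>U\<^sup>2+2*U/real n = 1-1/(real n)^2\<close>, and the new mean is built afresh with a
  contribution of order n^(-2). Only the cross term between the old kernel and the old mean is
  delicate.\<close>

lemma lyap_step:
 assumes K: "psd K"
 shows "(\<E> c r. ennreal (lyap R N (next_mean n m K c r) (next_kernel n m K c r)))
   <= ennreal (lyap_rate R n*lyap R N m K)"
proof -
 define \<kappa> where "\<kappa> = wtrace R N K"
 define \<theta> where "\<theta> = wnorm2 R N m"
 define \<zeta> where "\<zeta> r = wnorm2 R N (step_value m K r)" for r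
 have nn: "\<kappa> >= 0" "\<theta> >= 0" "!!r. \<zeta> r >= 0" using K by (auto simp: \<kappa>_def \<theta>_def \<zeta>_def wtrace_nonneg wnorm2_nonneg)
 have [measurable]: "\<zeta> : borel_measurable cgauss" unfolding \<zeta>_def by measurable
 have R4: "0 <= R^4" by simp
 define u where "u c = old_weight n (col_norm n c)" for c
 define v where "v c = new_weight n (col_norm n c)" for c
 have [measurable]: "u : borel_measurable cgauss" "v : borel_measurable cgauss" unfolding u_def v_def by measurable
 have uv: "u c >= 0" "v c >= 0" for c by (simp_all add: u_def v_def old_weight_nonneg new_weight_nonneg col_norm_nonneg)
 have b1: "lyap R N (next_mean n m K c r) (next_kernel n m K c r)
   <= (u c * \<kappa>+v c * \<zeta> r)^2+R^4*((v c)^2*(\<zeta> r)^2)" for c r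
 proof -
  have "(wnorm2 R N (next_mean n m K c r))\<^sup>2 <= (v c*(R\<^sup>2 * \<zeta> r))^2"
   unfolding v_def \<zeta>_def by (intro power_mono wnorm2_step_mean wnorm2_nonneg col_norm_nonneg)
  also have "... = R^4*((v c)^2*(\<zeta> r)^2)" by (simp add: power_mult_distrib flip: power_mult)
  finally show ?thesis by (simp add: lyap_def wtrace_step_kernel u_def v_def \<zeta>_def \<kappa>_def)
 qed
 have I1: "(\<E> r. ennreal (\<zeta> r)) = ennreal (\<theta>+\<kappa>)"
  unfolding \<zeta>_def \<theta>_def \<kappa>_def by (rule nn_integral_wnorm2_step_value[OF K])
 have I2: "(\<E> r. ennreal ((\<zeta> r)^2)) <= ennreal (8 * \<theta>\<^sup>2+128 * \<kappa>\<^sup>2)"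
  unfolding \<zeta>_def \<theta>_def \<kappa>_def by (rule nn_integral_wnorm2_step_value_sq[OF K])
 show ?thesis
 proof (cases "n < 3")
  case True
  have "u c <= 1" "v c <= 1" for c
   using col_norm_nonneg[of n c] True by (auto simp: u_def v_def old_weight_def new_weight_def)
  then have "u c * \<kappa> <= \<kappa>" "v c * \<zeta> r <= \<zeta> r" "(v c)\<^sup>2*(\<zeta> r)^2 <= (\<zeta> r)^2" for c r
   using nn uv[of c] by (auto intro!: mult_left_le_one_le simp: power_le_one)
  then have b2: "(u c * \<kappa>+v c * \<zeta> r)\<^sup>2+R^4*((v c)^2*(\<zeta> r)^2) <= 2 * \<kappa>\<^sup>2+(2+R^4)*(\<zeta> r)^2" for c r
  proof -
   have "(u c * \<kappa>+v c * \<zeta> r)\<^sup>2 <= (\<kappa>+\<zeta> r)^2"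
    using nn uv[of c] \<open>!!c r. u c * \<kappa> <= \<kappa>\<close> \<open>!!c r. v c * \<zeta> r <= \<zeta> r\<close> by (intro power_mono add_mono) auto
   also have "... <= 2 * \<kappa>\<^sup>2+2*(\<zeta> r)^2" by (rule sq_sum_le)
   finally show ?thesis
    using mult_left_mono[OF \<open>(v c)\<^sup>2 * (\<zeta> r)^2 <= (\<zeta> r)^2\<close> R4] by (simp add: distrib_right)
  qed
  have "(\<E> r. ennreal (lyap R N (next_mean n m K c r) (next_kernel n m K c r)))
    <= ennreal (lyap_rate R n*lyap R N m K)" for c
  proof -
   have "(\<E> r. ennreal (lyap R N (next_mean n m K c r) (next_kernel n m K c r)))
     <= (\<E> r. ennreal (2 * \<kappa>\<^sup>2)+ennreal (2+R^4)*ennreal ((\<zeta> r)^2))"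
    using order_trans[OF b1 b2] by (intro nn_integral_mono) (simp add: ennreal_leI ennreal_plus[symmetric] ennreal_mult[symmetric] del: ennreal_plus)
   also have "... = ennreal (2 * \<kappa>\<^sup>2)+ennreal (2+R^4)*(\<E> r. ennreal ((\<zeta> r)^2))"
    using cgauss.emeasure_space_1 by (subst nn_integral_add) (simp_all add: nn_integral_cmult)
   also have "... <= ennreal (2 * \<kappa>\<^sup>2)+ennreal (2+R^4)*ennreal (8 * \<theta>\<^sup>2+128 * \<kappa>\<^sup>2)"
    by (intro add_left_mono mult_left_mono I2) simp
   also have "... = ennreal (2 * \<kappa>\<^sup>2+(2+R^4)*(8 * \<theta>\<^sup>2+128 * \<kappa>\<^sup>2))"
    by (simp add: ennreal_plus[symmetric] ennreal_mult[symmetric] del: ennreal_plus)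
   also have "... <= ennreal (lyap_rate R n*lyap R N m K)"
   proof (rule ennreal_leI)
    have "2 * \<kappa>\<^sup>2+(2+R^4)*(8 * \<theta>\<^sup>2+128 * \<kappa>\<^sup>2) <= (2+R^4)*(256 * \<theta>\<^sup>2+256 * \<kappa>\<^sup>2)"
    proof -
     have "2 * \<kappa>\<^sup>2 <= (2+R^4)*(128 * \<kappa>\<^sup>2)" using mult_right_mono[of 2 "2+R^4" "\<kappa>\<^sup>2"] R4 by (auto simp: algebra_simps)
     moreover have "(2+R^4)*(8 * \<theta>\<^sup>2) <= (2+R^4)*(256 * \<theta>\<^sup>2)" by (intro mult_left_mono) auto
     ultimately show ?thesis by (simp add: distrib_left)
    qed
    then show "2 * \<kappa>\<^sup>2+(2+R^4)*(8 * \<theta>\<^sup>2+128 * \<kappa>\<^sup>2) <= lyap_rate R n*lyap R N m K"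
     using True by (simp add: lyap_rate_def lyap_def \<theta>_def[symmetric] \<kappa>_def[symmetric] algebra_simps)
   qed
   finally show ?thesis .
  qed
  then have "(\<E> c r. ennreal (lyap R N (next_mean n m K c r) (next_kernel n m K c r)))
    <= (\<integral>\<^sup>+c. ennreal (lyap_rate R n*lyap R N m K) \<partial>(cgauss :: (nat => complex) measure))" by (intro nn_integral_mono)
  then show ?thesis using cgauss.emeasure_space_1[where 'a=nat] by simp
 next
  case False
  then have n: "n >= 3" by simp
  define U where "U = 1-1/real n"
  have U: "u c = U" for c using False by (simp add: u_def old_weight_def U_def)
  have U0: "U >= 0" using n by (simp add: U_def)
  have "(\<E> c r. ennreal (lyap R N (next_mean n m K c r) (next_kernel n m K c r)))
   <= (\<E> c r. ennreal (U\<^sup>2 * \<kappa>\<^sup>2)+ennreal (2*U * \<kappa>)*ennreal (v c)*ennreal (\<zeta> r)+ennreal (1+R^4)*ennreal ((v c)^2)*ennreal ((\<zeta> r)^2))"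
  proof (intro nn_integral_mono)
   fix c r :: "nat => complex"
   have "(u c * \<kappa>+v c * \<zeta> r)\<^sup>2+R^4*((v c)^2*(\<zeta> r)^2) = U\<^sup>2 * \<kappa>\<^sup>2+2*U * \<kappa> * v c * \<zeta> r+(1+R^4)*(v c)^2*(\<zeta> r)^2"
    by (simp add: U power2_sum power_mult_distrib algebra_simps)
   then show "ennreal (lyap R N (next_mean n m K c r) (next_kernel n m K c r))
    <= ennreal (U\<^sup>2 * \<kappa>\<^sup>2)+ennreal (2*U * \<kappa>)*ennreal (v c)*ennreal (\<zeta> r)+ennreal (1+R^4)*ennreal ((v c)^2)*ennreal ((\<zeta> r)^2)"
    using b1[of c r] U0 nn uv[of c]
    by (simp add: ennreal_leI ennreal_plus[symmetric] ennreal_mult[symmetric] del: ennreal_plus)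
  qed
  also have "... = (\<E> c. ennreal (U\<^sup>2 * \<kappa>\<^sup>2)+ennreal (2*U * \<kappa>)*ennreal (v c)*ennreal (\<theta>+\<kappa>)
    + ennreal (1+R^4)*ennreal ((v c)^2)*(\<E> r. ennreal ((\<zeta> r)^2)))"
   using cgauss.emeasure_space_1[where 'a=nat] by (simp add: nn_integral_add nn_integral_cmult I1)
  also have "... = ennreal (U\<^sup>2 * \<kappa>\<^sup>2)+ennreal (2*U * \<kappa>)*ennreal (1/real n)*ennreal (\<theta>+\<kappa>)
    + ennreal (1+R^4)*(\<E> c. ennreal ((v c)^2))*(\<E> r. ennreal ((\<zeta> r)^2))"
   using cgauss.emeasure_space_1[where 'a=nat] nn_integral_new_weight[OF n]
   by (simp add: nn_integral_add nn_integral_cmult nn_integral_multc v_def[symmetric])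
  also have "... <= ennreal (U\<^sup>2 * \<kappa>\<^sup>2)+ennreal (2*U * \<kappa>)*ennreal (1/real n)*ennreal (\<theta>+\<kappa>)
    + ennreal (1+R^4)*ennreal (2/(real n)^2)*ennreal (8 * \<theta>\<^sup>2+128 * \<kappa>\<^sup>2)"
   using nn_integral_new_weight_sq[OF n] unfolding v_def[symmetric]
   by (intro add_left_mono mult_mono I2) auto
  also have "... = ennreal (U\<^sup>2 * \<kappa>\<^sup>2+2*U * \<kappa>*(1/real n)*(\<theta>+\<kappa>)+(1+R^4)*(2/(real n)^2)*(8 * \<theta>\<^sup>2+128 * \<kappa>\<^sup>2))"
   using U0 nn by (simp add: ennreal_plus[symmetric] ennreal_mult[symmetric] del: ennreal_plus)
  also have "... <= ennreal (lyap_rate R n*lyap R N m K)"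
  proof (rule ennreal_leI)
   define s where "s = sqrt (real n)"
   have s: "s >= 1" "s * s = real n" using n by (auto simp: s_def)
   then have s0: "s > 0" by linarith
   define e where "e = 1/(real n * s)"
   have e: "real n powr (-3/2) = e"
   proof -
    have "real n powr (3/2) = real n powr 1 * real n powr (1/2)" by (subst powr_add[symmetric]) simp
    then show ?thesis using n by (simp add: powr_minus e_def s_def powr_half_sqrt inverse_eq_divide)
   qed
   have e0: "e >= 0" using s0 by (simp add: e_def)
   have 1: "U\<^sup>2 * \<kappa>\<^sup>2+2*U * \<kappa>*(1/real n) * \<kappa> <= \<kappa>\<^sup>2"
   proof -
    have "U\<^sup>2+2*U/real n = 1-1/(real n)^2" using n by (simp add: U_def power2_eq_square field_simps)
    then have "U\<^sup>2+2*U/real n <= 1" by simp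
    then have "(U\<^sup>2+2*U/real n) * \<kappa>\<^sup>2 <= 1 * \<kappa>\<^sup>2" by (intro mult_right_mono) auto
    then show ?thesis by (simp add: algebra_simps power2_eq_square)
   qed
   have 2: "2*U * \<kappa>*(1/real n) * \<theta> <= e * \<kappa>\<^sup>2+\<theta>\<^sup>2"
   proof -
    have "2*U * \<kappa>*(1/real n) * \<theta> <= 2 * \<kappa>*(1/real n) * \<theta>"
     using nn n by (intro mult_right_mono) (auto simp: U_def divide_le_eq mult_left_le)
    \<comment> \<open>Weighted arithmetic-geometric inequality. The kernel may only receive the
      summable coefficient \<open>e\<close>, of order n^(-3/2), whereas the old mean is not carried
      over by the step and may take any coefficient up to 1.\<close>
    also have "... <= e * \<kappa>\<^sup>2+\<theta>\<^sup>2/s"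
    proof -
     have "0 <= (\<kappa>-s * \<theta>)^2*e" using e0 by simp
     also have "... = e * \<kappa>\<^sup>2+\<theta>\<^sup>2*(s * s*e)-2 * \<kappa>*(s*e) * \<theta>" by (simp add: power2_eq_square algebra_simps)
     also have "s * s*e = 1/s" using s s0 n by (simp add: e_def)
     also have "s*e = 1/real n" using s0 by (simp add: e_def)
     finally show ?thesis by simp
    qed
    also have "\<theta>\<^sup>2/s <= \<theta>\<^sup>2/1" using s by (intro divide_left_mono) auto
    finally show ?thesis by simp
   qed
   have "1/(real n)^2 <= e"
   proof -
    have "s*1 <= s * s" using s by (intro mult_left_mono) auto
    then have "real n * s <= real n * real n" using s by (intro mult_left_mono) auto
    then show ?thesis unfolding e_def power2_eq_square using s0 n by (intro divide_left_mono) auto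
   qed
   then have "(1+R^4)*(2*(1/(real n)^2))*(8 * \<theta>\<^sup>2+128 * \<kappa>\<^sup>2) <= (1+R^4)*(2*e)*(128 * \<theta>\<^sup>2+128 * \<kappa>\<^sup>2)"
    using e0 by (intro mult_mono) auto
   then have 3: "(1+R^4)*(2/(real n)^2)*(8 * \<theta>\<^sup>2+128 * \<kappa>\<^sup>2) <= 256*(1+R^4)*e*(\<theta>\<^sup>2+\<kappa>\<^sup>2)"
    by (simp add: algebra_simps)
   have "U\<^sup>2 * \<kappa>\<^sup>2+2*U * \<kappa>*(1/real n)*(\<theta>+\<kappa>)+(1+R^4)*(2/(real n)^2)*(8 * \<theta>\<^sup>2+128 * \<kappa>\<^sup>2)
     <= \<kappa>\<^sup>2+(e * \<kappa>\<^sup>2+\<theta>\<^sup>2)+256*(1+R^4)*e*(\<theta>\<^sup>2+\<kappa>\<^sup>2)"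
    using 1 2 3 by (simp only: distrib_left)
   also have "... <= (1+(257+256 * R^4)*e)*(\<kappa>\<^sup>2+\<theta>\<^sup>2)"
    using mult_nonneg_nonneg[OF e0 zero_le_power2[of \<theta>]] by (simp add: algebra_simps)
   finally show "U\<^sup>2 * \<kappa>\<^sup>2+2*U * \<kappa>*(1/real n)*(\<theta>+\<kappa>)+(1+R^4)*(2/(real n)^2)*(8 * \<theta>\<^sup>2+128 * \<kappa>\<^sup>2)
     <= lyap_rate R n*lyap R N m K"
    using False by (simp only: lyap_rate_def e lyap_def \<kappa>_def \<theta>_def if_False)
  qed
  finally show ?thesis .
 qed
qed

lemma measurable_lyap [measurable (raw)]:
 assumes "m : measurable M cgauss" "K : measurable M cgauss"
 shows "(%w. lyap R N (m w) (K w)) : borel_measurable M"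
 unfolding lyap_def using assms by measurable

lemma lyap_rate_ge_1: "1 <= lyap_rate R n"
 by (auto simp: lyap_rate_def)

lemma nn_integral_lyap_prod:
 "(\<E> w. ennreal (lyap R N (mean n w) (kern_mat n w))) <= ennreal (\<Prod>k<n. lyap_rate R k)"
proof (induction n)
 case 0
 have "wnorm2 R N (unit_seq 0) = (\<Sum>a\<le>N. if a = 0 then 1 else 0)"
  unfolding wnorm2_def by (intro sum.cong) (auto simp: unit_seq_def)
 then show ?case by (simp add: lyap_def wtrace_def)
next
 case (Suc n)
 have "(\<E> w. ennreal (lyap R N (mean (Suc n) w) (kern_mat (Suc n) w)))
   = (\<E> w c r. ennreal (lyap R N (next_mean n (mean n w) (kern_mat n w) c r)
     (next_kernel n (mean n w) (kern_mat n w) c r)))"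
  unfolding mean_Suc kern_mat_Suc value_seq_def
 proof (rule nn_integral_chain_fresh[where G="%w c r. ennreal (lyap R N (next_mean n (mean n w) (kern_mat n w) c r)
     (next_kernel n (mean n w) (kern_mat n w) c r))"])
  fix w w' :: noise and c r :: "nat => complex"
  assume "!!m x. m < n ==> w (m, x) = w' (m, x)"
  then have "mean n w = mean n w' \<and> kern_mat n w = kern_mat n w'" by (rule chain_past)
  then show "ennreal (lyap R N (next_mean n (mean n w) (kern_mat n w) c r)
     (next_kernel n (mean n w) (kern_mat n w) c r))
   = ennreal (lyap R N (next_mean n (mean n w') (kern_mat n w') c r)
     (next_kernel n (mean n w') (kern_mat n w') c r))" by simp
 qed measurable
 also have "... <= (\<E> w. ennreal (lyap_rate R n)*ennreal (lyap R N (mean n w) (kern_mat n w)))"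
  using lyap_step[OF psd_kern_mat] lyap_rate_ge_1[of R n]
  by (intro nn_integral_mono) (simp add: ennreal_mult[symmetric] lyap_nonneg)
 also have "... <= ennreal (lyap_rate R n)*ennreal (\<Prod>k<n. lyap_rate R k)"
  by (subst nn_integral_cmult) (measurable, intro mult_left_mono Suc.IH, simp)
 also have "... = ennreal (\<Prod>k<Suc n. lyap_rate R k)"
  using lyap_rate_ge_1[of R] by (subst ennreal_mult[symmetric]) (auto simp: mult.commute intro!: prod_ge_1 order_trans[OF zero_le_one])
 finally show ?case .
qed

text \<open>The product of the rates is at most the exponential of the sum of their excesses over 1,
  and this sum converges.\<close>

lemma lyap_bounded:
 obtains C where "C >= 0" "!!n N. (\<E> w. ennreal (lyap R N (mean n w) (kern_mat n w))) <= ennreal C"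
proof -
 define x where "x k = lyap_rate R k-1" for k
 have x0: "x k >= 0" for k using lyap_rate_ge_1[of R k] by (simp add: x_def)
 have "summable (%k. (257+256 * R^4) * real k powr (-3/2))"
  by (intro summable_mult) (simp add: summable_real_powr_iff)
 moreover have "eventually (%k. x k = (257+256 * R^4) * real k powr (-3/2)) sequentially"
  using eventually_ge_at_top[of 3] by eventually_elim (simp add: x_def lyap_rate_def)
 ultimately have sx: "summable x" by (simp add: summable_cong)
 have "(\<Prod>k<n. lyap_rate R k) <= exp (suminf x)" for n
 proof -
  have "(\<Prod>k<n. lyap_rate R k) <= (\<Prod>k<n. exp (x k))"
  proof (rule prod_mono)
   fix k show "0 <= lyap_rate R k \<and> lyap_rate R k <= exp (x k)"
    using exp_ge_add_one_self[of "x k"] lyap_rate_ge_1[of R k] by (simp add: x_def)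
  qed
  also have "... = exp (\<Sum>k<n. x k)" by (simp add: exp_sum)
  also have "... <= exp (suminf x)" using sum_le_suminf[OF sx] x0 by simp
  finally show ?thesis .
 qed
 then show ?thesis
  by (intro that[of "exp (suminf x)"] order_trans[OF nn_integral_lyap_prod ennreal_leI]) auto
qed

lemma nn_integral_value_sq:
 "(\<E> w. f w*(\<E> r. ennreal ((wnorm2 R N (step_value (mean n w) (kern_mat n w) r))^2)))
   <= (\<E> w. f w*ennreal (128*lyap R N (mean n w) (kern_mat n w)))"
proof (intro nn_integral_mono mult_left_mono order_trans[OF nn_integral_wnorm2_step_value_sq[OF psd_kern_mat]] ennreal_leI)
 show "8*(wnorm2 R N (mean n w))^2+128*(wtrace R N (kern_mat n w))^2 <= 128*lyap R N (mean n w) (kern_mat n w)" for w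
  by (simp add: lyap_def)
qed simp

text \<open>The mean is the shifted previous value times the square root of a weight of order
  \<open>1/n\<close>, so its squared norm is of order \<open>1/n\<close> in mean square.\<close>

lemma nn_integral_mean_sq:
 assumes n: "n >= 3" and C: "!!n N. (\<E> w. ennreal (lyap R N (mean n w) (kern_mat n w))) <= ennreal C"
 shows "(\<E> w. ennreal ((wnorm2 R N (mean (Suc n) w))^2)) <= ennreal (256 * R^4/(real n)^2*C)"
proof -
 have R4: "0 <= R^4" by simp
 let ?z = "%w. step_value (mean n w) (kern_mat n w)"
 have "(\<E> w. ennreal ((wnorm2 R N (mean (Suc n) w))^2))
   = (\<E> w c r. ennreal ((wnorm2 R N (step_mean n (col_norm n c) (?z w r)))^2))"
  unfolding mean_Suc value_seq_def
 proof (rule nn_integral_chain_fresh[where G="%w c r. ennreal ((wnorm2 R N (step_mean n (col_norm n c) (?z w r)))^2)"])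
  fix w w' :: noise and c r :: "nat => complex"
  assume "!!m x. m < n ==> w (m, x) = w' (m, x)"
  then have "mean n w = mean n w' \<and> kern_mat n w = kern_mat n w'" by (rule chain_past)
  then show "ennreal ((wnorm2 R N (step_mean n (col_norm n c) (?z w r)))^2) = ennreal ((wnorm2 R N (step_mean n (col_norm n c) (?z w' r)))^2)" by simp
 qed measurable
 also have "... <= (\<E> w c r. ennreal (R^4)*ennreal ((new_weight n (col_norm n c))^2)*ennreal ((wnorm2 R N (?z w r))^2))"
 proof (intro nn_integral_mono)
  fix w :: noise and c r :: "nat => complex"
  have "(wnorm2 R N (step_mean n (col_norm n c) (?z w r)))\<^sup>2 <= (new_weight n (col_norm n c)*(R\<^sup>2*wnorm2 R N (?z w r)))^2"
   by (intro power_mono wnorm2_step_mean wnorm2_nonneg col_norm_nonneg)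
  also have "... = R^4*(new_weight n (col_norm n c))^2*(wnorm2 R N (?z w r))^2"
   by (simp add: power_mult_distrib flip: power_mult)
  finally show "ennreal ((wnorm2 R N (step_mean n (col_norm n c) (?z w r)))^2)
    <= ennreal (R^4)*ennreal ((new_weight n (col_norm n c))^2)*ennreal ((wnorm2 R N (?z w r))^2)"
   by (simp add: ennreal_mult[symmetric] ennreal_leI)
 qed
 also have "... = (\<E> w. ennreal (R^4)*(\<E> c. ennreal ((new_weight n (col_norm n c))^2))
   * (\<E> r. ennreal ((wnorm2 R N (?z w r))^2)))"
  by (simp add: nn_integral_cmult nn_integral_multc)
 also have "... <= (\<E> w. ennreal (R^4)*ennreal (2/(real n)^2)*ennreal (128*lyap R N (mean n w) (kern_mat n w)))"
  by (rule order_trans[OF nn_integral_value_sq]) (intro nn_integral_mono mult_mono order_refl nn_integral_new_weight_sq[OF n], auto)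
 also have "... = (\<E> w. ennreal (256 * R^4/(real n)^2)*ennreal (lyap R N (mean n w) (kern_mat n w)))"
  by (intro nn_integral_cong) (simp add: ennreal_mult[symmetric] lyap_nonneg)
 also have "... <= ennreal (256 * R^4/(real n)^2)*ennreal C"
  by (subst nn_integral_cmult) (measurable, intro mult_left_mono C, simp)
 also have "... = ennreal (256 * R^4/(real n)^2*C)" by (rule ennreal_mult'[symmetric]) simp
 finally show ?thesis .
qed

text \<open>Pythagoras: a centred perturbation produces no cross term. As an inequality in
  \<open>ennreal\<close> the statement also covers an infinite second moment.\<close>

lemma (in prob_space) nn_integral_shift_sq_le:
 fixes f :: "'a => complex"
 assumes f: "integrable M f" "(\<integral>x. f x \<partial>M) = 0"
 shows "(\<integral>\<^sup>+x. ennreal (nsq (u+f x)) \<partial>M) <= ennreal (nsq u)+(\<integral>\<^sup>+x. ennreal (nsq (f x)) \<partial>M)"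
proof (cases "(\<integral>\<^sup>+x. ennreal (nsq (f x)) \<partial>M) = \<top>")
 case False
 have [measurable]: "f : borel_measurable M" using f(1) by auto
 have i2: "integrable M (%x. nsq (f x))"
  using False by (intro integrableI_nonneg) (auto simp: less_top)
 have i1: "integrable M (%x. 2 * Re (cnj u*f x))"
  using f(1) by (intro integrable_mult_right integrable_Re)
 have eq: "nsq (u+v) = nsq u+2 * Re (cnj u * v)+nsq v" for v
  unfolding cmod_power2 by (simp add: power2_eq_square algebra_simps)
 have "integrable M (%x. nsq (u+f x))"
  unfolding eq by (intro Bochner_Integration.integrable_add i1 i2) simp
 then have "(\<integral>\<^sup>+x. ennreal (nsq (u+f x)) \<partial>M) = ennreal (\<integral>x. nsq (u+f x) \<partial>M)"
  by (intro nn_integral_eq_integral) auto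
 also have "(\<integral>x. nsq (u+f x) \<partial>M) = (\<integral>x. nsq u+2 * Re (cnj u*f x)+nsq (f x) \<partial>M)"
  unfolding eq ..
 also have "(\<integral>x. nsq u+2 * Re (cnj u*f x)+nsq (f x) \<partial>M) = nsq u+(\<integral>x. nsq (f x) \<partial>M)"
 proof -
  have "(\<integral>x. 2 * Re (cnj u*f x) \<partial>M) = 2 * Re (cnj u*(\<integral>x. f x \<partial>M))"
   using f(1) by (simp only: integral_mult_right_zero integral_Re integrable_mult_right)
  then show ?thesis using i1 i2 f(2) by (simp add: prob_space)
 qed
 also have "ennreal ... = ennreal (nsq u)+(\<integral>\<^sup>+x. ennreal (nsq (f x)) \<partial>M)"
  using i2 by (subst nn_integral_eq_integral) (auto intro!: ennreal_plus integral_nonneg_AE)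
 finally show ?thesis by simp
qed simp

section \<open>Martingale structure of the kernel and L1 convergence\<close>

lemma psd_entry_bound:
 assumes "psd K"
 shows "nsq (K (a, b)) <= Re (K (a, a)) * Re (K (b, b))"
proof -
 define M where "M = Suc (max a b)"
 have d: "(\<Sum>k<M. nsq (chol K c k)) = Re (K (c, c))" if "c < M" for c
  unfolding chol_sq_sum[OF assms, symmetric] using that
  by (intro sum.mono_neutral_right) (auto dest: chol_nonzero[OF assms])
 have "norm (K (a, b)) = norm (\<Sum>k<M. chol K a k*cnj (chol K b k))"
  by (subst chol_factorization[OF assms, of a M]) (auto simp: M_def)
 also have "... <= (\<Sum>k<M. norm (chol K a k)*norm (chol K b k))"
  by (rule order_trans[OF norm_sum]) (simp add: norm_mult)
 finally have "nsq (K (a, b)) <= (\<Sum>k<M. norm (chol K a k)*norm (chol K b k))^2"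
  by (rule power_mono) simp
 also have "... <= (\<Sum>k<M. nsq (chol K a k))*(\<Sum>k<M. nsq (chol K b k))"
  by (rule Cauchy_Schwarz_ineq_sum)
 also have "... = Re (K (a, a)) * Re (K (b, b))"
 proof -
  have "a < M" "b < M" by (auto simp: M_def)
  then show ?thesis by (simp only: d)
 qed
 finally show ?thesis .
qed

lemma wnorm2_term_le: "a <= N ==> R^(2*a)*nsq (x a) <= wnorm2 R N x"
 unfolding wnorm2_def by (rule member_le_sum) (auto intro!: mult_nonneg_nonneg even_power_nonneg)

lemma wtrace_term_le: "psd K ==> a <= N ==> R^(2*a) * Re (K (a, a)) <= wtrace R N K"
 unfolding wtrace_def by (rule member_le_sum) (auto intro!: mult_nonneg_nonneg even_power_nonneg psd_diag)

lemma weighted_product_le: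
 fixes x :: "nat => complex"
 assumes "a <= N" "b <= N"
 shows "R^(2*(a+b))*nsq (x a*cnj (x b)) <= (wnorm2 R N x)^2"
proof -
 have "R^(2*(a+b))*nsq (x a*cnj (x b)) = (R^(2*a)*nsq (x a))*(R^(2*b)*nsq (x b))"
  by (simp add: norm_mult power_mult_distrib power_add algebra_simps)
 also have "... <= wnorm2 R N x*wnorm2 R N x"
  using assms by (intro mult_mono wnorm2_term_le wnorm2_nonneg) (auto intro!: mult_nonneg_nonneg even_power_nonneg)
 finally show ?thesis by (simp add: power2_eq_square)
qed

lemma weighted_entry_le:
 assumes K: "psd K" "a <= N" "b <= N"
 shows "R^(2*(a+b))*nsq (K (a, b)) <= (wtrace R N K)^2"
proof -
 have "R^(2*(a+b))*nsq (K (a, b)) <= R^(2*(a+b))*(Re (K (a, a)) * Re (K (b, b)))"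
  by (intro mult_left_mono psd_entry_bound K even_power_nonneg)
 also have "... = (R^(2*a) * Re (K (a, a)))*(R^(2*b) * Re (K (b, b)))"
  by (simp add: power_add algebra_simps)
 also have "... <= wtrace R N K*wtrace R N K"
  using K by (intro mult_mono wtrace_term_le wtrace_nonneg) (auto intro!: mult_nonneg_nonneg even_power_nonneg psd_diag)
 finally show ?thesis by (simp add: power2_eq_square)
qed

lemma integrable_step_value_prod: "integrable cgauss (%r. step_value m K r a*cnj (step_value m K r b))"
 unfolding step_value_def
 by (simp add: distrib_left distrib_right) (intro Bochner_Integration.integrable_add integrable_gauss_seq_mult integrable_mult_left integrable_mult_right integrable_gauss_seq integrable_cnj, auto)

lemma integral_step_value_prod:
 assumes K: "psd K"
 shows "(\<M> r. step_value m K r a*cnj (step_value m K r b)) = m a*cnj (m b)+K (a, b)"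
proof -
 have i: "integrable cgauss (%r. m a*cnj (gauss_seq K r b))" "integrable cgauss (%r. gauss_seq K r a*cnj (m b))"
  by (intro integrable_mult_left integrable_mult_right integrable_gauss_seq integrable_cnj)+
 have "(\<M> r. cnj (gauss_seq K r b)) = 0" by (simp add: integral_cnj integral_gauss_seq)
 then have z: "(\<M> r. m a*cnj (gauss_seq K r b)) = 0" "(\<M> r. gauss_seq K r a*cnj (m b)) = 0"
  by (simp_all add: integral_gauss_seq)
 have "(\<M> r. step_value m K r a*cnj (step_value m K r b))
  = (\<M> r. (m a*cnj (m b)+gauss_seq K r a*cnj (gauss_seq K r b))+(m a*cnj (gauss_seq K r b)+gauss_seq K r a*cnj (m b)))"
  by (simp add: step_value_def algebra_simps)
 also have "... = (\<M> r. m a*cnj (m b)+gauss_seq K r a*cnj (gauss_seq K r b))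
   + (\<M> r. m a*cnj (gauss_seq K r b)+gauss_seq K r a*cnj (m b))"
  by (intro Bochner_Integration.integral_add Bochner_Integration.integrable_add i integrable_gauss_seq_mult) simp
 also have "(\<M> r. m a*cnj (gauss_seq K r b)+gauss_seq K r a*cnj (m b)) = 0"
  by (subst Bochner_Integration.integral_add[OF i]) (simp only: z add_0)
 also have "(\<M> r. m a*cnj (m b)+gauss_seq K r a*cnj (gauss_seq K r b)) = m a*cnj (m b)+K (a, b)"
  by (subst Bochner_Integration.integral_add) (auto intro: integrable_gauss_seq_mult simp: integral_gauss_seq_mult_cnj[OF K] cgauss.prob_space[unfolded space_cgauss])
 finally show ?thesis by simp
qed

lemma integral_new_weight:
 assumes n: "n >= 3"
 shows "integrable cgauss (%c. new_weight n (col_norm n c))" "(\<M> c. new_weight n (col_norm n c)) = 1/real n"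
proof -
 show "integrable cgauss (%c. new_weight n (col_norm n c))"
  by (rule integrableI_nonneg) (measurable, simp_all add: nn_integral_new_weight[OF n] new_weight_nonneg col_norm_nonneg)
 show "(\<M> c. new_weight n (col_norm n c)) = 1/real n"
  by (subst integral_eq_nn_integral) (measurable, simp_all add: nn_integral_new_weight[OF n] new_weight_nonneg col_norm_nonneg)
qed

lemma nn_integral_new_weight_var:
 assumes n: "n >= 3"
 shows "(\<E> c. ennreal ((new_weight n (col_norm n c)-1/real n)^2)) <= ennreal (3/(real n)^2)"
proof -
 have "(\<E> c. ennreal ((new_weight n (col_norm n c)-1/real n)^2))
   <= (\<E> c. ennreal ((new_weight n (col_norm n c))^2)+ennreal (1/(real n)^2))"
 proof (rule nn_integral_mono)
  fix c :: "nat => complex"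
  have "0 <= new_weight n (col_norm n c)*(1/real n)" by (simp add: new_weight_nonneg col_norm_nonneg)
  then have "(new_weight n (col_norm n c)-1/real n)\<^sup>2 <= (new_weight n (col_norm n c))^2+1/(real n)^2"
   by (simp add: power2_diff power_divide)
  then show "ennreal ((new_weight n (col_norm n c)-1/real n)^2) <= ennreal ((new_weight n (col_norm n c))^2)+ennreal (1/(real n)^2)"
   by (simp add: ennreal_leI ennreal_plus[symmetric] del: ennreal_plus)
 qed
 also have "... = (\<E> c. ennreal ((new_weight n (col_norm n c))^2))+ennreal (1/(real n)^2)"
  by (simp add: nn_integral_add)
 also have "... <= ennreal (2/(real n)^2)+ennreal (1/(real n)^2)"
  by (intro add_right_mono nn_integral_new_weight_sq n)
 also have "... = ennreal (3/(real n)^2)" by (simp add: ennreal_plus[symmetric] del: ennreal_plus)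
 finally show ?thesis .
qed

lemma norm_add_sq_le: "nsq (u+v) <= 2*nsq u+2*nsq (v::complex)"
proof -
 have "nsq (u+v) <= (norm u+norm v)^2" by (intro power_mono norm_triangle_ineq) simp
 then show ?thesis using sq_sum_le[of "norm u" "norm v"] by linarith
qed

text \<open>Up to the drift \<open>m a*cnj (m b) / of_nat n\<close>, the increment of an entry is
  the sum of two centred terms: the fluctuation \<open>W r-E\<close> of the sampled product, with
  weight \<open>1/n\<close>, and the fluctuation of the new weight times \<open>W r\<close>. The
  arbitrary shift \<open>u\<close> stands for the past and yields orthogonality of the
  increments.\<close>

lemma martingale_step:
 assumes K: "psd K" and n: "n >= 3" and R: "R > 0" and ab: "a <= N" "b <= N"
 shows "(\<E> c r. ennreal (nsq (u+(next_kernel n m K c r (a, b)-K (a, b)-m a*cnj (m b) / of_nat n))))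
   <= ennreal (nsq u+700/((real n)^2 * R^(2*(a+b)))*lyap R N m K)"
proof -
 interpret p: pair_prob_space "cgauss :: (nat => complex) measure" "cgauss :: (nat => complex) measure" ..
 define W where "W r = step_value m K r a*cnj (step_value m K r b)" for r
 define E where "E = m a*cnj (m b)+K (a, b)"
 define v where "v c = new_weight n (col_norm n c)" for c
 define P where "P = R^(2*(a+b))"
 have P: "P > 0" using R by (simp add: P_def)
 have [measurable]: "(%r. step_value m K r a) : borel_measurable cgauss" for a
  by (rule measurable_cgauss_app) measurable
 have [measurable]: "W : borel_measurable cgauss" unfolding W_def by measurable
 have [measurable]: "v : borel_measurable cgauss" unfolding v_def by measurable
 have eq: "next_kernel n m K c r (a, b)-K (a, b)-m a*cnj (m b) / of_nat n
   = (W r-E) / of_nat n + of_real (v c-1/real n)*W r" for c r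
  using n by (simp add: step_kernel_def old_weight_def W_def E_def v_def diff_divide_distrib add_divide_distrib algebra_simps)
 have inner: "(\<E> c. ennreal (nsq (u' + of_real (v c-1/real n)*w)))
   <= ennreal (nsq u')+ennreal (3/(real n)^2)*ennreal (nsq w)" for u' w :: complex
 proof -
  have "integrable cgauss (%c. complex_of_real (v c-1/real n)*w)"
   unfolding v_def by (intro integrable_mult_left integrable_of_real Bochner_Integration.integrable_diff integral_new_weight n) simp
  moreover have "(\<M> c. complex_of_real (v c-1/real n)*w) = of_real ((\<M> c. v c)-1/real n)*w"
  proof -
   have "(\<M> c. v c-1/real n) = (\<M> c. v c)-1/real n"
    unfolding v_def by (subst Bochner_Integration.integral_diff) (auto intro: integral_new_weight n simp: cgauss.prob_space[unfolded space_cgauss])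
   then show ?thesis by (simp only: integral_mult_left_zero integral_complex_of_real)
  qed
  ultimately have "(\<E> c. ennreal (nsq (u' + of_real (v c-1/real n)*w)))
    <= ennreal (nsq u')+(\<E> c. ennreal (nsq (of_real (v c-1/real n)*w)))"
   using integral_new_weight(2)[OF n] by (intro cgauss.nn_integral_shift_sq_le) (auto simp: v_def)
  also have "(\<E> c. ennreal (nsq (of_real (v c-1/real n)*w)))
    = (\<E> c. ennreal ((v c-1/real n)^2)*ennreal (nsq w))"
   by (simp only: norm_mult norm_of_real power_mult_distrib power2_abs ennreal_mult zero_le_power2)
  also have "... = (\<E> c. ennreal ((v c-1/real n)^2))*ennreal (nsq w)"
   by (rule nn_integral_multc) measurable
  also have "... <= ennreal (3/(real n)^2)*ennreal (nsq w)"
   unfolding v_def by (intro mult_right_mono nn_integral_new_weight_var n) simp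
  finally show ?thesis by (simp add: add_left_mono)
 qed
 have E2: "nsq E <= 2/P*lyap R N m K"
 proof -
  have "P*nsq E <= P*(2*nsq (m a*cnj (m b))+2*nsq (K (a, b)))"
   unfolding E_def using P by (intro mult_left_mono norm_add_sq_le) auto
  also have "... <= 2*lyap R N m K"
   using weighted_product_le[OF ab, of R m] weighted_entry_le[OF K ab, of R]
   by (simp add: lyap_def P_def distrib_left)
  finally show ?thesis using P by (simp add: field_simps)
 qed
 have W2: "(\<E> r. ennreal (nsq (W r))) <= ennreal (128/P*lyap R N m K)"
 proof -
  have "(\<E> r. ennreal (nsq (W r))) <= (\<E> r. ennreal (1/P)*ennreal ((wnorm2 R N (step_value m K r))^2))"
  proof (rule nn_integral_mono)
   fix r
   have "P*nsq (W r) <= (wnorm2 R N (step_value m K r))^2"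
    unfolding P_def W_def by (rule weighted_product_le[OF ab])
   then have "nsq (W r) <= 1/P*(wnorm2 R N (step_value m K r))^2" using P by (simp add: field_simps)
   then show "ennreal (nsq (W r)) <= ennreal (1/P)*ennreal ((wnorm2 R N (step_value m K r))^2)"
    using P by (simp add: ennreal_mult[symmetric] ennreal_leI)
  qed
  also have "... = ennreal (1/P)*(\<E> r. ennreal ((wnorm2 R N (step_value m K r))^2))"
   by (rule nn_integral_cmult) measurable
  also have "... <= ennreal (1/P)*ennreal (8*(wnorm2 R N m)^2+128*(wtrace R N K)^2)"
   by (intro mult_left_mono nn_integral_wnorm2_step_value_sq K) simp
  also have "... = ennreal (1/P*(8*(wnorm2 R N m)^2+128*(wtrace R N K)^2))"
   using P by (intro ennreal_mult'[symmetric]) simp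
  also have "... <= ennreal (1/P*(128*lyap R N m K))"
   using P by (intro ennreal_leI mult_left_mono) (auto simp: lyap_def)
  finally show ?thesis by simp
 qed
 define F where "F r = (W r-E) / of_nat n" for r
 have [measurable]: "F : borel_measurable cgauss" unfolding F_def by measurable
 have iW: "integrable cgauss W" unfolding W_def by (rule integrable_step_value_prod)
 have iF: "integrable cgauss F"
  unfolding F_def using iW by (intro integrable_divide Bochner_Integration.integrable_diff) auto
 have F0: "(\<M> r. F r) = 0"
  unfolding F_def using iW integral_step_value_prod[OF K, of m a b]
  by (simp add: W_def[symmetric] E_def[symmetric] cgauss.prob_space[unfolded space_cgauss])
 \<comment> \<open>For fixed \<open>r\<close> the fluctuation of the weight is centred in
   \<open>c\<close>, so the integrals are exchanged and \<open>c\<close> is treated first; what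
   remains is centred in \<open>r\<close>.\<close>
 have "(\<E> c r. ennreal (nsq (u+(F r + of_real (v c-1/real n)*W r))))
   = (\<E> r c. ennreal (nsq ((u+F r) + of_real (v c-1/real n)*W r)))"
  unfolding add.assoc by (rule p.Fubini'[symmetric]) measurable
 also have "... <= (\<E> r. ennreal (nsq (u+F r))+ennreal (3/(real n)^2)*ennreal (nsq (W r)))"
  by (intro nn_integral_mono inner)
 also have "... = (\<E> r. ennreal (nsq (u+F r)))+ennreal (3/(real n)^2)*(\<E> r. ennreal (nsq (W r)))"
  by (simp add: nn_integral_add nn_integral_cmult)
 also have "... <= (ennreal (nsq u)+(\<E> r. ennreal (nsq (F r))))+ennreal (3/(real n)^2)*ennreal (128/P*lyap R N m K)"
  by (intro add_mono mult_left_mono W2 cgauss.nn_integral_shift_sq_le iF F0) simp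
 also have "(\<E> r. ennreal (nsq (F r))) <= ennreal (2/(real n)^2)*ennreal (128/P*lyap R N m K)+ennreal (2/(real n)^2*(2/P*lyap R N m K))"
 proof -
  have "(\<E> r. ennreal (nsq (F r))) <= (\<E> r. ennreal (2/(real n)^2)*ennreal (nsq (W r))+ennreal (2/(real n)^2*(2/P*lyap R N m K)))"
  proof (rule nn_integral_mono)
   fix r
   have "nsq (F r) = nsq (W r +-E)/(real n)^2" by (simp add: F_def norm_divide power_divide)
   also have "... <= (2*nsq (W r)+2*nsq (- E))/(real n)^2"
    by (intro divide_right_mono norm_add_sq_le) simp
   also have "... = 2/(real n)^2*nsq (W r)+2/(real n)^2*nsq E"
    by (simp add: add_divide_distrib)
   also have "... <= 2/(real n)^2*nsq (W r)+2/(real n)^2*(2/P*lyap R N m K)"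
    by (intro add_left_mono mult_left_mono E2) simp
   finally show "ennreal (nsq (F r)) <= ennreal (2/(real n)^2)*ennreal (nsq (W r))+ennreal (2/(real n)^2*(2/P*lyap R N m K))"
    using P lyap_nonneg[of R N m K] by (simp add: ennreal_mult[symmetric] ennreal_plus[symmetric] ennreal_leI del: ennreal_plus)
  qed
  also have "... = ennreal (2/(real n)^2)*(\<E> r. ennreal (nsq (W r)))+ennreal (2/(real n)^2*(2/P*lyap R N m K))"
   by (simp add: nn_integral_add nn_integral_cmult)
  also have "... <= ennreal (2/(real n)^2)*ennreal (128/P*lyap R N m K)+ennreal (2/(real n)^2*(2/P*lyap R N m K))"
   by (intro add_right_mono mult_left_mono W2) simp
  finally show ?thesis .
 qed
 then have "(ennreal (nsq u)+(\<E> r. ennreal (nsq (F r))))+ennreal (3/(real n)^2)*ennreal (128/P*lyap R N m K)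
  <= (ennreal (nsq u)+(ennreal (2/(real n)^2)*ennreal (128/P*lyap R N m K)+ennreal (2/(real n)^2*(2/P*lyap R N m K))))+ennreal (3/(real n)^2)*ennreal (128/P*lyap R N m K)"
  by (intro add_mono order_refl)
 also have "... = ennreal (nsq u+(2/(real n)^2*(128/P*lyap R N m K)+2/(real n)^2*(2/P*lyap R N m K))+3/(real n)^2*(128/P*lyap R N m K))"
  using P lyap_nonneg[of R N m K] by (simp add: ennreal_mult[symmetric] ennreal_plus[symmetric] del: ennreal_plus)
 also have "... <= ennreal (nsq u+700/((real n)^2*P)*lyap R N m K)"
 proof (rule ennreal_leI)
  \<comment> \<open>The contributions are 256 + 4 + 384 = 644, rounded up to 700.\<close>
  define x where "x = lyap R N m K/((real n)^2*P)"
  have "0 <= x" using P lyap_nonneg[of R N m K] by (simp add: x_def)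
  have eqs: "2/(real n)^2*(128/P*lyap R N m K) = 256*x" "2/(real n)^2*(2/P*lyap R N m K) = 4*x"
   "3/(real n)^2*(128/P*lyap R N m K) = 384*x" "700/((real n)^2*P)*lyap R N m K = 700*x"
   by (simp_all add: x_def)
  show "nsq u+(2/(real n)^2*(128/P*lyap R N m K)+2/(real n)^2*(2/P*lyap R N m K))+3/(real n)^2*(128/P*lyap R N m K)
   <= nsq u+700/((real n)^2*P)*lyap R N m K"
   unfolding eqs using \<open>0 <= x\<close> by linarith
 qed
 finally show ?thesis unfolding eq P_def F_def .
qed

text \<open>A kernel entry minus its accumulated drift. The sum starts at 3, where the new weights
  acquire mean \<open>1/n\<close>.\<close>

definition mart :: "nat => nat => nat => noise => complex" where
 "mart a b n w = kern_mat n w (a, b)-(\<Sum>j\<in>{3..<n}. mean j w a*cnj (mean j w b) / of_nat j)"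

lemma measurable_mean_app [measurable]: "(%w. mean n w a) : borel_measurable cgauss"
 by (rule measurable_cgauss_app) measurable

lemma measurable_kern_mat_app [measurable]: "(%w. kern_mat n w p) : borel_measurable cgauss"
 by (rule measurable_cgauss_app) measurable

lemma measurable_mart [measurable]: "mart a b n : borel_measurable cgauss"
 unfolding mart_def[abs_def] by measurable

lemma mart_past:
 assumes "!!k x. k < n ==> w (k, x) = w' (k, x)" "m <= n"
 shows "mart a b m w = mart a b m w'"
proof -
 have "mean j w = mean j w' \<and> kern_mat j w = kern_mat j w'" if "j <= n" for j
  using that assms(1) by (intro chain_past) auto
 then show ?thesis using assms(2) by (auto simp: mart_def intro!: sum.cong)
qed

text \<open>Orthogonality of increments, by induction on \<open>m\<close>: the difference
  accumulated so far depends on past noise only and serves as the shift \<open>u\<close> of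
  \<open>martingale_step\<close>.\<close>

lemma nn_integral_mart_diff:
 assumes R: "R > 0" and n: "n >= 3" "n <= m"
  and C: "!!n N. (\<E> w. ennreal (lyap R N (mean n w) (kern_mat n w))) <= ennreal C"
 shows "(\<E> w. ennreal (nsq (mart a b m w-mart a b n w)))
   <= ennreal (700 * \<bar>C\<bar>/R^(2*(a+b))*(\<Sum>j\<in>{n..<m}. 1/(real j)^2))"
 using n(2)
proof (induction m rule: dec_induct)
 case (step m)
 define N where "N = max a b"
 have ab: "a <= N" "b <= N" by (auto simp: N_def)
 have m: "m >= 3" using n step by simp
 let ?z = "%w. step_value (mean m w) (kern_mat m w)"
 define G where "G w c r = ennreal (nsq ((mart a b m w-mart a b n w)+(step_kernel m (col_norm m c) (?z w r) (kern_mat m w) (a, b)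
   - kern_mat m w (a, b)-mean m w a*cnj (mean m w b) / of_nat m)))" for w c r
 have "ennreal (nsq (mart a b (Suc m) w-mart a b n w)) = G w (noise_col m w) (noise_row m w)" for w
 proof -
  have "mart a b (Suc m) w-mart a b n w = (mart a b m w-mart a b n w)+(step_kernel m (col_norm m (noise_col m w)) (value_seq m w) (kern_mat m w) (a, b)
   - kern_mat m w (a, b)-mean m w a*cnj (mean m w b) / of_nat m)"
   using m by (simp add: mart_def kern_mat_Suc)
  then show ?thesis by (simp only: G_def value_seq_def)
 qed
 then have "(\<E> w. ennreal (nsq (mart a b (Suc m) w-mart a b n w))) = (\<E> w. G w (noise_col m w) (noise_row m w))"
  by simp
 also have "... = (\<E> w c r. G w c r)"
 proof (rule nn_integral_chain_fresh)
  have [measurable]: "(%x. step_kernel m (col_norm m (fst (snd x))) (?z (fst x) (snd (snd x))) (kern_mat m (fst x)) (a, b))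
    : borel_measurable (cgauss \<Otimes>\<^sub>M cgauss \<Otimes>\<^sub>M cgauss)"
   by (rule measurable_cgauss_app) measurable
  show "(%(w, c, r). G w c r) : borel_measurable (cgauss \<Otimes>\<^sub>M cgauss \<Otimes>\<^sub>M cgauss)"
   unfolding G_def case_prod_beta by measurable
  fix w w' :: noise and c r :: "nat => complex"
  assume past: "!!k x. k < m ==> w (k, x) = w' (k, x)"
  have "mean m w = mean m w' \<and> kern_mat m w = kern_mat m w'" using past by (rule chain_past)
  moreover have "mart a b m w = mart a b m w'" by (rule mart_past[of m]) (use past in auto)
  moreover have "mart a b n w = mart a b n w'" by (rule mart_past[of m]) (use past step in auto)
  ultimately show "G w c r = G w' c r" by (simp only: G_def)
 qed
 also have "... <= (\<E> w. ennreal (nsq (mart a b m w-mart a b n w))+ennreal (700/((real m)^2 * R^(2*(a+b))))*ennreal (lyap R N (mean m w) (kern_mat m w)))"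
  unfolding G_def
  by (intro nn_integral_mono order_trans[OF martingale_step[OF psd_kern_mat m R ab]])
    (use R in \<open>simp add: ennreal_mult[symmetric] lyap_nonneg\<close>)
 also have "... = (\<E> w. ennreal (nsq (mart a b m w-mart a b n w)))+ennreal (700/((real m)^2 * R^(2*(a+b))))*(\<E> w. ennreal (lyap R N (mean m w) (kern_mat m w)))"
  by (simp add: nn_integral_add nn_integral_cmult)
 also have "... <= ennreal (700 * \<bar>C\<bar>/R^(2*(a+b))*(\<Sum>j\<in>{n..<m}. 1/(real j)^2))+ennreal (700/((real m)^2 * R^(2*(a+b))))*ennreal \<bar>C\<bar>"
  by (intro add_mono mult_left_mono step.IH order_trans[OF C] ennreal_leI) auto
 also have "... = ennreal (700 * \<bar>C\<bar>/R^(2*(a+b))*(\<Sum>j\<in>{n..<m}. 1/(real j)^2)+700/((real m)^2 * R^(2*(a+b))) * \<bar>C\<bar>)"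
  using R by (simp add: ennreal_mult[symmetric] ennreal_plus[symmetric] sum_nonneg del: ennreal_plus)
 also have "700 * \<bar>C\<bar>/R^(2*(a+b))*(\<Sum>j\<in>{n..<m}. 1/(real j)^2)+700/((real m)^2 * R^(2*(a+b))) * \<bar>C\<bar>
   = 700 * \<bar>C\<bar>/R^(2*(a+b))*(\<Sum>j\<in>{n..<Suc m}. 1/(real j)^2)"
  using step.hyps by (simp add: distrib_left)
 finally show ?case .
qed simp

lemma sum_inverse_sq_le:
 assumes "2 <= n" "n <= m"
 shows "(\<Sum>j\<in>{n..<m}. 1/(real j)^2) <= 1/(real n-1)"
proof -
 have "(\<Sum>j\<in>{n..<m}. 1/(real j)^2) <= 1/(real n-1)-1/(real m-1)"
  using assms(2)
 proof (induction m rule: dec_induct)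
  case (step m)
  have m: "real m > 1" using assms step by simp
  have "1/(real m)^2 <= 1/(real m*(real m-1))"
   unfolding power2_eq_square using m by (intro divide_left_mono mult_left_mono) auto
  also have "... = 1/(real m-1)-1/(real (Suc m)-1)"
   using m by (simp add: field_simps)
  finally show ?case using step by simp
 qed simp
 also have "... <= 1/(real n-1)" using assms by simp
 finally show ?thesis .
qed

lemma nn_integral_norm_le_of_sq:
 fixes f :: "_ => complex"
 assumes [measurable]: "f : borel_measurable cgauss" and "(\<E> w. ennreal (nsq (f w))) <= ennreal (A\<^sup>2)" "0 <= A"
 shows "(\<E> w. ennreal (norm (f w))) <= ennreal A"
 using nn_integral_mult_le[of "%w. norm (f w)" cgauss "%_. 1" A 1] assms by simp

text \<open>The martingale part is of order n^(-1/2) in L2. A product of two means at time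
  \<open>j\<close> is of order \<open>1/j\<close>, so the drift terms are of order j^(-2) and sum to
  order \<open>1/n\<close>. As \<open>R\<close> is arbitrary, the bound decays faster than any
  geometric rate in the indices.\<close>

theorem kern_mat_cauchy:
 assumes R: "R > 0"
 obtains D where "D >= 0" "!!n m a b. 4 <= n ==> n <= m ==>
  (\<E> w. ennreal (norm (kern_mat m w (a, b)-kern_mat n w (a, b)))) <= ennreal (D/(sqrt (real n) * R^(a+b)))"
proof -
 obtain C where C: "C >= 0" "!!n N. (\<E> w. ennreal (lyap R N (mean n w) (kern_mat n w))) <= ennreal C"
  using lyap_bounded[of R] by blast
 define D where "D = sqrt (1400*C)+64 * R\<^sup>2 * sqrt C"
 have bound: "(\<E> w. ennreal (norm (kern_mat m w (a, b)-kern_mat n w (a, b)))) <= ennreal (D/(sqrt (real n) * R^(a+b)))"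
  if nm: "4 <= n" "n <= m" for n m a b
 proof -
  define s where "s = sqrt (real n)"
  have s: "s > 0" "s\<^sup>2 = real n" "s >= 1" using nm by (auto simp: s_def)
  have Rab: "R^(a+b) > 0" using R by simp
  have n1: "1/(real n-1) <= 2/real n" using nm by (simp add: field_simps)
  have M: "(\<E> w. ennreal (norm (mart a b m w-mart a b n w))) <= ennreal (sqrt (1400*C)/(s * R^(a+b)))"
  proof (rule nn_integral_norm_le_of_sq)
   have "(\<E> w. ennreal (nsq (mart a b m w-mart a b n w)))
     <= ennreal (700 * \<bar>C\<bar>/R^(2*(a+b))*(\<Sum>j\<in>{n..<m}. 1/(real j)^2))"
    using nm C by (intro nn_integral_mart_diff R) auto
   also have "... <= ennreal (700 * \<bar>C\<bar>/R^(2*(a+b))*(2/real n))"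
    using nm R order_trans[OF sum_inverse_sq_le n1, of m] by (intro ennreal_leI mult_left_mono) auto
   also have "700 * \<bar>C\<bar>/R^(2*(a+b))*(2/real n) = (sqrt (1400*C)/(s * R^(a+b)))^2"
    using C(1) s by (simp add: power_divide power_mult_distrib mult.commute flip: power_mult)
   finally show "(\<E> w. ennreal (nsq (mart a b m w-mart a b n w))) <= ennreal ((sqrt (1400*C)/(s * R^(a+b)))^2)" .
  qed (use s R C in \<open>auto intro!: divide_nonneg_pos\<close>, measurable)
  have mj: "(\<E> w. ennreal (norm (mean j w a*cnj (mean j w b) / of_nat j))) <= ennreal (32 * R\<^sup>2 * sqrt C/R^(a+b)*(1/(real j)^2))"
   if j: "j >= 4" for j
  proof -
   define N where "N = max a b"
   \<comment> \<open>With \<open>j >= 4\<close> the mean at time \<open>j\<close> was produced by a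
     step of index at least 3, where the moments of the weights are available.\<close>
   obtain k where k: "j = Suc k" "k >= 3" using j by (cases j) auto
   have "(\<E> w. ennreal (nsq (mean j w a*cnj (mean j w b))))
    <= (\<E> w. ennreal (1/R^(2*(a+b)))*ennreal ((wnorm2 R N (mean j w))^2))"
   proof (rule nn_integral_mono)
    fix w
    have "R^(2*(a+b))*nsq (mean j w a*cnj (mean j w b)) <= (wnorm2 R N (mean j w))^2"
     by (rule weighted_product_le) (auto simp: N_def)
    then have "nsq (mean j w a*cnj (mean j w b)) <= 1/R^(2*(a+b))*(wnorm2 R N (mean j w))^2"
     using R by (simp add: field_simps)
    then show "ennreal (nsq (mean j w a*cnj (mean j w b))) <= ennreal (1/R^(2*(a+b)))*ennreal ((wnorm2 R N (mean j w))^2)"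
     using R by (simp add: ennreal_mult[symmetric] ennreal_leI)
   qed
   also have "... = ennreal (1/R^(2*(a+b)))*(\<E> w. ennreal ((wnorm2 R N (mean j w))^2))"
    by (rule nn_integral_cmult) measurable
   also have "... <= ennreal (1/R^(2*(a+b)))*ennreal (256 * R^4/(real k)^2*C)"
    unfolding k(1) by (intro mult_left_mono nn_integral_mean_sq k C(2)) simp
   also have "... = ennreal ((16 * R\<^sup>2 * sqrt C/(real k * R^(a+b)))^2)"
    using R C(1) by (simp add: ennreal_mult[symmetric] power_divide power_mult_distrib flip: power_mult) (simp add: mult.commute mult.left_commute)
   finally have "(\<E> w. ennreal (norm (mean j w a*cnj (mean j w b)))) <= ennreal (16 * R\<^sup>2 * sqrt C/(real k * R^(a+b)))"
    using R C(1) by (intro nn_integral_norm_le_of_sq) auto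
   then have "ennreal (1/real j)*(\<E> w. ennreal (norm (mean j w a*cnj (mean j w b))))
     <= ennreal (1/real j)*ennreal (16 * R\<^sup>2 * sqrt C/(real k * R^(a+b)))"
    by (intro mult_left_mono) auto
   also have "... <= ennreal (32 * R\<^sup>2 * sqrt C/R^(a+b)*(1/(real j)^2))"
   proof -
    have "1/real k <= 2/real j" using k by (simp add: field_simps)
    then have "16 * R\<^sup>2 * sqrt C/R^(a+b)*(1/real j)*(1/real k) <= 16 * R\<^sup>2 * sqrt C/R^(a+b)*(1/real j)*(2/real j)"
     using R C(1) by (intro mult_left_mono) auto
    moreover have "1/real j*(16 * R\<^sup>2 * sqrt C/(real k * R^(a+b))) = 16 * R\<^sup>2 * sqrt C/R^(a+b)*(1/real j)*(1/real k)"
     by simp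
    moreover have "32 * R\<^sup>2 * sqrt C/R^(a+b)*(1/(real j)^2) = 16 * R\<^sup>2 * sqrt C/R^(a+b)*(1/real j)*(2/real j)"
     by (simp add: power2_eq_square)
    ultimately have "1/real j*(16 * R\<^sup>2 * sqrt C/(real k * R^(a+b))) <= 32 * R\<^sup>2 * sqrt C/R^(a+b)*(1/(real j)^2)"
     by linarith
    then show ?thesis using R C(1) by (subst ennreal_mult[symmetric]) (auto intro!: ennreal_leI)
   qed
   also have "ennreal (1/real j)*(\<E> w. ennreal (norm (mean j w a*cnj (mean j w b))))
     = (\<E> w. ennreal (norm (mean j w a*cnj (mean j w b) / of_nat j)))"
    by (subst nn_integral_cmult[symmetric]) (measurable, simp add: ennreal_mult[symmetric] norm_divide)
   finally show ?thesis .
  qed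
  have eq: "kern_mat m w (a, b)-kern_mat n w (a, b) = (mart a b m w-mart a b n w)+(\<Sum>j\<in>{n..<m}. mean j w a*cnj (mean j w b) / of_nat j)" for w
  proof -
   have "{3..<m} = {3..<n} \<union> {n..<m}" using nm by auto
   then show ?thesis by (simp add: mart_def sum.union_disjoint)
  qed
  have "(\<E> w. ennreal (norm (kern_mat m w (a, b)-kern_mat n w (a, b))))
    <= (\<E> w. ennreal (norm (mart a b m w-mart a b n w))+(\<Sum>j\<in>{n..<m}. ennreal (norm (mean j w a*cnj (mean j w b) / of_nat j))))"
  proof (rule nn_integral_mono)
   fix w
   have "norm (kern_mat m w (a, b)-kern_mat n w (a, b))
    <= norm (mart a b m w-mart a b n w)+(\<Sum>j\<in>{n..<m}. norm (mean j w a*cnj (mean j w b) / of_nat j))"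
    unfolding eq by (intro norm_triangle_mono norm_sum order_refl)
   then show "ennreal (norm (kern_mat m w (a, b)-kern_mat n w (a, b)))
    <= ennreal (norm (mart a b m w-mart a b n w))+(\<Sum>j\<in>{n..<m}. ennreal (norm (mean j w a*cnj (mean j w b) / of_nat j)))"
    by (subst sum_ennreal) (auto simp: ennreal_plus[symmetric] sum_nonneg intro!: ennreal_leI simp del: ennreal_plus)
  qed
  also have "... = (\<E> w. ennreal (norm (mart a b m w-mart a b n w)))+(\<Sum>j\<in>{n..<m}. \<E> w. ennreal (norm (mean j w a*cnj (mean j w b) / of_nat j)))"
   by (subst nn_integral_add, measurable, subst nn_integral_sum, measurable)
  also have "... <= ennreal (sqrt (1400*C)/(s * R^(a+b)))+(\<Sum>j\<in>{n..<m}. ennreal (32 * R\<^sup>2 * sqrt C/R^(a+b)*(1/(real j)^2)))"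
   using nm by (intro add_mono M sum_mono mj) auto
  also have "... = ennreal (sqrt (1400*C)/(s * R^(a+b))+32 * R\<^sup>2 * sqrt C/R^(a+b)*(\<Sum>j\<in>{n..<m}. 1/(real j)^2))"
   using R C(1) s by (subst sum_ennreal) (auto simp: ennreal_plus[symmetric] sum_distrib_left sum_nonneg simp del: ennreal_plus)
  also have "... <= ennreal (D/(s * R^(a+b)))"
  proof (rule ennreal_leI)
   have "1/real n <= 1/s"
    using s mult_left_mono[OF s(3), of s] by (intro divide_left_mono) (auto simp: power2_eq_square)
   then have "(\<Sum>j\<in>{n..<m}. 1/(real j)^2) <= 2/s"
    using sum_inverse_sq_le[of n m] n1 nm by simp
   then have "32 * R\<^sup>2 * sqrt C/R^(a+b)*(\<Sum>j\<in>{n..<m}. 1/(real j)^2) <= 32 * R\<^sup>2 * sqrt C/R^(a+b)*(2/s)"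
    using R C(1) by (intro mult_left_mono) auto
   then show "sqrt (1400*C)/(s * R^(a+b))+32 * R\<^sup>2 * sqrt C/R^(a+b)*(\<Sum>j\<in>{n..<m}. 1/(real j)^2) <= D/(s * R^(a+b))"
    by (simp add: D_def add_divide_distrib mult.commute)
  qed
  finally show ?thesis by (simp add: s_def)
 qed
 have "D >= 0" using C(1) by (simp add: D_def)
 then show ?thesis using bound by (rule that)
qed

lemma gauss_seq_vanish: "(!!b. K (a, b) = 0) ==> gauss_seq K r a = 0"
 by (simp add: gauss_seq_def chol_def gs_coeff_def)

lemma chain_degree:
 "(n < a \<longrightarrow> mean n w a = 0) \<and> (n <= a \<or> n <= b \<longrightarrow> kern_mat n w (a, b) = 0)"
proof (induction n arbitrary: a b)
 case 0
 then show ?case by (auto simp: unit_seq_def)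
next
 case (Suc n)
 have v: "value_seq n w a = 0" if "n < a" for a
  using Suc[of a] that gauss_seq_vanish[of "kern_mat n w" a] by (auto simp: value_seq_def step_value_def)
 have k: "kern_mat n w (a, b) = 0" if "n <= a \<or> n <= b" for a b
  using Suc[of a b] that by auto
 show ?case
  using v k by (auto simp: mean_Suc kern_mat_Suc step_mean_def step_kernel_def shift_def)
qed

lemma mean_beyond: "n < a ==> mean n w a = 0"
 using chain_degree by blast

lemma kern_mat_beyond: "n <= a \<or> n <= b ==> kern_mat n w (a, b) = 0"
 using chain_degree by blast

lemma value_seq_beyond: "n < a ==> value_seq n w a = 0"
 by (simp add: value_seq_def step_value_def mean_beyond gauss_seq_vanish kern_mat_beyond)

text \<open>The kernel does not reach the index \<open>n\<close>, so the leading coefficient has no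
  Gaussian part. It is a product of square roots of weights and cannot vanish when these are
  positive, which is what drives the lower bound \<open>pd_bound\<close>.\<close>

lemma value_seq_top: "value_seq n w n = mean n w n"
 by (simp add: value_seq_def step_value_def gauss_seq_vanish kern_mat_beyond)

section \<open>The limit kernel\<close>

definition kern_lim :: "noise => nat \<times> nat => complex" where
 "kern_lim w p = lim (%k. kern_mat (4^k) w p)"

lemma measurable_kern_lim_app [measurable]: "(%w. kern_lim w p) : borel_measurable cgauss"
 unfolding kern_lim_def by measurable

lemma measurable_kern_lim [measurable]: "kern_lim : measurable cgauss cgauss"
 by (rule measurable_into_cgauss) measurable

lemma sqrt_four_power: "sqrt (real (4^k)) = 2^k"
proof -
 have "(2::real)^k*2^k = 4^k" by (simp add: power_mult_distrib[symmetric])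
 then have "real (4^k) = (2^k)^2" by (simp add: power2_eq_square)
 then show ?thesis by simp
qed

text \<open>Along the times \<open>4^k\<close> the L1 bound is geometric with ratio 1/2, so the
  increments are summable almost surely. This is why \<open>kern_lim\<close> is taken along that
  subsequence; \<open>lim\<close> makes it a total measurable function.\<close>

lemma AE_kern_mat_convergent: "AE w in cgauss. convergent (%k. kern_mat (4^k) w p)"
proof -
 obtain a b where p: "p = (a, b)" by (cases p)
 obtain D where D: "D >= 0" "!!n m a b. 4 <= n ==> n <= m ==>
  (\<E> w. ennreal (norm (kern_mat m w (a, b)-kern_mat n w (a, b)))) <= ennreal (D/(sqrt (real n)*1^(a+b)))"
  by (rule kern_mat_cauchy[of "1::real"]) simp_all
 define d where "d k w = kern_mat (4^(Suc (Suc k))) w p-kern_mat (4^Suc k) w p" for k w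
 have [measurable]: "d k : borel_measurable cgauss" for k unfolding d_def by measurable
 have "(\<E> w. (\<Sum>k. ennreal (norm (d k w)))) = (\<Sum>k. \<E> w. ennreal (norm (d k w)))"
  by (rule nn_integral_suminf) measurable
 also have "... <= (\<Sum>k. ennreal (D/2*(1/2)^k))"
 proof (intro suminf_le summableI)
  fix k
  have "(\<E> w. ennreal (norm (d k w))) <= ennreal (D/(sqrt (real (4^Suc k))*1^(a+b)))"
   unfolding d_def p by (rule D(2)) auto
  then show "(\<E> w. ennreal (norm (d k w))) <= ennreal (D/2*(1/2)^k)"
   unfolding sqrt_four_power by (simp add: power_divide)
 qed
 also have "... < \<top>"
  using D(1) by (subst suminf_ennreal2) (auto intro!: summable_mult summable_geometric)
 finally have "(\<E> w. (\<Sum>k. ennreal (norm (d k w)))) ~= \<infinity>" by simp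
 then have "AE w in cgauss. (\<Sum>k. ennreal (norm (d k w))) ~= \<infinity>"
  by (rule nn_integral_PInf_AE[rotated]) measurable
 then show ?thesis
 proof eventually_elim
  case (elim w)
  then have "summable (%k. norm (d k w))" by (intro summable_suminf_not_top) auto
  then have "summable (%k. d k w)" by (rule summable_norm_cancel)
  then have "convergent (%n. \<Sum>k<n. d k w)" by (simp add: summable_iff_convergent)
  moreover have "(\<Sum>k<n. d k w) = kern_mat (4^Suc n) w p-kern_mat (4^Suc 0) w p" for n
   unfolding d_def by (rule sum_lessThan_telescope)
  ultimately have "convergent (%n. kern_mat (4^Suc n) w p-kern_mat (4^Suc 0) w p)" by simp
  then have "convergent (%n. kern_mat (4^Suc n) w p)"
   using convergent_add[OF _ convergent_const[of "kern_mat (4^Suc 0) w p"]] by fastforce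
  then show ?case using convergent_Suc_iff[of "%k. kern_mat (4^k) w p"] by simp
 qed
qed

lemma AE_kern_lim: "AE w in cgauss. \<forall>p. (%k. kern_mat (4^k) w p) ----> kern_lim w p"
 unfolding AE_all_countable kern_lim_def
 using AE_kern_mat_convergent by (auto simp: convergent_LIMSEQ_iff)

text \<open>Fatou's lemma along the subsequence passes the Cauchy bound to the limit, for every
  \<open>n >= 4\<close> and not only for powers of 4.\<close>

lemma kern_lim_L1:
 assumes R: "R > 0"
 obtains D where "D >= 0" "!!n a b. 4 <= n ==>
  (\<E> w. ennreal (norm (kern_mat n w (a, b)-kern_lim w (a, b)))) <= ennreal (D/(sqrt (real n) * R^(a+b)))"
proof -
 obtain D where D: "D >= 0" "!!n m a b. 4 <= n ==> n <= m ==>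
  (\<E> w. ennreal (norm (kern_mat m w (a, b)-kern_mat n w (a, b)))) <= ennreal (D/(sqrt (real n) * R^(a+b)))"
  using kern_mat_cauchy[OF R] by blast
 have "(\<E> w. ennreal (norm (kern_mat n w (a, b)-kern_lim w (a, b)))) <= ennreal (D/(sqrt (real n) * R^(a+b)))"
  if n: "4 <= n" for n a b
 proof -
  have "(\<E> w. ennreal (norm (kern_mat n w (a, b)-kern_lim w (a, b))))
    = (\<E> w. liminf (%k. ennreal (norm (kern_mat (4^k) w (a, b)-kern_mat n w (a, b)))))"
  proof (rule nn_integral_cong_AE)
   show "AE w in cgauss. ennreal (norm (kern_mat n w (a, b)-kern_lim w (a, b)))
     = liminf (%k. ennreal (norm (kern_mat (4^k) w (a, b)-kern_mat n w (a, b))))"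
    using AE_kern_lim
   proof eventually_elim
    case (elim w)
    then have "(%k. norm (kern_mat (4^k) w (a, b)-kern_mat n w (a, b))) ----> norm (kern_lim w (a, b)-kern_mat n w (a, b))"
     by (intro tendsto_intros) auto
    then have "(%k. ennreal (norm (kern_mat (4^k) w (a, b)-kern_mat n w (a, b)))) ----> ennreal (norm (kern_lim w (a, b)-kern_mat n w (a, b)))"
     by (rule tendsto_ennrealI)
    from lim_imp_Liminf[OF _ this] show ?case by (simp add: norm_minus_commute)
   qed
  qed
  also have "... <= liminf (%k. \<E> w. ennreal (norm (kern_mat (4^k) w (a, b)-kern_mat n w (a, b))))"
   by (rule nn_integral_liminf) measurable
  also have "... <= liminf (%k::nat. ennreal (D/(sqrt (real n) * R^(a+b))))"
  proof (rule Liminf_mono)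
   have "\<forall>\<^sub>F k in sequentially. n <= k" by (rule eventually_ge_at_top)
   then show "\<forall>\<^sub>F k in sequentially. (\<E> w. ennreal (norm (kern_mat (4^k) w (a, b)-kern_mat n w (a, b))))
     <= ennreal (D/(sqrt (real n) * R^(a+b)))"
   proof eventually_elim
    case (elim k)
    have "k < 4^k" by (rule less_exp[THEN order.strict_trans2]) (simp add: power_mono)
    then show ?case using n elim by (intro D(2)) auto
   qed
  qed
  also have "... = ennreal (D/(sqrt (real n) * R^(a+b)))" by (simp add: Liminf_const)
  finally show ?thesis .
 qed
 with D(1) show ?thesis by (rule that)
qed

text \<open>Finiteness for every \<open>R\<close> expresses that the power series with these
  coefficients is entire in both variables.\<close>

definition wsum :: "real => (nat \<times> nat => complex) => ennreal" where
 "wsum R T = (\<Sum>a. \<Sum>b. ennreal (R^(a+b)*norm (T (a, b))))"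

lemma measurable_wsum [measurable (raw)]:
 assumes "T : measurable M cgauss"
 shows "(%x. wsum R (T x)) : borel_measurable M"
proof -
 have [measurable]: "(%x. T x p) : borel_measurable M" for p by (rule measurable_cgauss_app) fact
 show ?thesis unfolding wsum_def by measurable
qed

lemma measurable_cgauss_diff [measurable (raw)]:
 assumes "f : measurable M cgauss" "g : measurable M cgauss"
 shows "(%x p. f x p-(g x p :: complex)) : measurable M cgauss"
proof (rule measurable_into_cgauss)
 have [measurable]: "(%x. f x p) : borel_measurable M" "(%x. g x p) : borel_measurable M" for p
  by (rule measurable_cgauss_app, fact)+
 show "(%x. f x p-g x p) : borel_measurable M" for p by measurable
qed

lemma wsum_triangle:
 assumes "R >= 0"
 shows "wsum R (%p. S p+T p) <= wsum R S+wsum R T"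
proof -
 have "wsum R (%p. S p+T p) <= (\<Sum>a. \<Sum>b. ennreal (R^(a+b)*norm (S (a, b)))+ennreal (R^(a+b)*norm (T (a, b))))"
  unfolding wsum_def
 proof (intro suminf_le summableI)
  fix a b
  have "R^(a+b)*norm (S (a, b)+T (a, b)) <= R^(a+b)*(norm (S (a, b))+norm (T (a, b)))"
   using assms by (intro mult_left_mono norm_triangle_ineq) auto
  then show "ennreal (R^(a+b)*norm (S (a, b)+T (a, b))) <= ennreal (R^(a+b)*norm (S (a, b)))+ennreal (R^(a+b)*norm (T (a, b)))"
   using assms by (simp add: ennreal_plus[symmetric] ennreal_leI distrib_left del: ennreal_plus)
 qed
 also have "... = wsum R S+wsum R T"
  by (simp add: wsum_def suminf_add[symmetric])
 finally show ?thesis .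
qed

lemma wsum_finite_support:
 assumes "!!a b. n <= a \<or> n <= b ==> T (a, b) = 0"
 shows "wsum R T < \<top>"
proof -
 have "(\<Sum>b. ennreal (R^(a+b)*norm (T (a, b)))) = (\<Sum>b<n. ennreal (R^(a+b)*norm (T (a, b))))" for a
  using assms by (intro suminf_finite) auto
 then have "wsum R T = (\<Sum>a<n. \<Sum>b<n. ennreal (R^(a+b)*norm (T (a, b))))"
  unfolding wsum_def by (simp only:) (intro suminf_finite, auto simp: assms)
 then show ?thesis by (simp add: ennreal_sum_less_top)
qed

text \<open>The entrywise bound is taken at radius \<open>2 * R\<close>. This leaves the factor
  \<open>(1/2)^(a+b)\<close>, whose double sum 4 appears in the constant.\<close>

lemma nn_integral_wsum_diff:
 assumes R: "R > 0"
 obtains D where "D >= 0" "!!n. 4 <= n ==>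
  (\<E> w. wsum R (%p. kern_mat n w p-kern_lim w p)) <= ennreal (D/sqrt (real n))"
proof -
 obtain D where D: "D >= 0" "!!n a b. 4 <= n ==>
  (\<E> w. ennreal (norm (kern_mat n w (a, b)-kern_lim w (a, b)))) <= ennreal (D/(sqrt (real n)*(2 * R)^(a+b)))"
  using kern_lim_L1[OF mult_pos_pos[OF zero_less_numeral R, of Num.One]] kern_lim_L1[OF mult_pos_pos[OF zero_less_numeral R]] by blast
 have "(\<E> w. wsum R (%p. kern_mat n w p-kern_lim w p)) <= ennreal (4*D/sqrt (real n))"
  if n: "4 <= n" for n
 proof -
  have half: "(\<Sum>a. ennreal (c*(1/2)^a)) = ennreal (2*c)" if "c >= 0" for c :: real
   using that suminf_mult[OF summable_geometric[of "1/2::real"], of c] suminf_geometric[of "1/2::real"]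
   by (subst suminf_ennreal2) (auto intro!: summable_mult summable_geometric)
  have "(\<E> w. wsum R (%p. kern_mat n w p-kern_lim w p))
    = (\<Sum>a. \<Sum>b. \<E> w. ennreal (R^(a+b)*norm (kern_mat n w (a, b)-kern_lim w (a, b))))"
   unfolding wsum_def by (simp add: nn_integral_suminf)
  also have "... <= (\<Sum>a. \<Sum>b. ennreal ((D/sqrt (real n)*(1/2)^a)*(1/2)^b))"
  proof (intro suminf_le summableI)
   fix a b
   have "(\<E> w. ennreal (R^(a+b)*norm (kern_mat n w (a, b)-kern_lim w (a, b))))
    = ennreal (R^(a+b))*(\<E> w. ennreal (norm (kern_mat n w (a, b)-kern_lim w (a, b))))"
    using R by (subst nn_integral_cmult[symmetric]) (measurable, simp add: ennreal_mult)
   also have "... <= ennreal (R^(a+b))*ennreal (D/(sqrt (real n)*(2 * R)^(a+b)))"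
    by (intro mult_left_mono D(2) n) simp
   also have "... = ennreal ((D/sqrt (real n)*(1/2)^a)*(1/2)^b)"
    using R D(1) by (subst ennreal_mult[symmetric]) (auto simp: power_mult_distrib power_add power_divide)
   finally show "(\<E> w. ennreal (R^(a+b)*norm (kern_mat n w (a, b)-kern_lim w (a, b))))
     <= ennreal ((D/sqrt (real n)*(1/2)^a)*(1/2)^b)" .
  qed
  also have "... = (\<Sum>a. ennreal ((2*(D/sqrt (real n)))*(1/2)^a))"
   using D(1) by (intro suminf_cong) (subst half, auto)
  also have "... = ennreal (2*(2*(D/sqrt (real n))))"
   using D(1) by (intro half) auto
  finally show ?thesis by simp
 qed
 moreover have "4*D >= 0" using D(1) by simp
 ultimately show ?thesis using that by blast
qed

lemma AE_wsum_kern_lim: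
 assumes R: "R > 0"
 shows "AE w in cgauss. wsum R (kern_lim w) < \<top>"
proof -
 obtain D where D: "D >= 0" "!!n. 4 <= n ==>
  (\<E> w. wsum R (%p. kern_mat n w p-kern_lim w p)) <= ennreal (D/sqrt (real n))"
  by (rule nn_integral_wsum_diff[OF R]) blast
 have "AE w in cgauss. wsum R (%p. kern_mat 4 w p-kern_lim w p) ~= \<infinity>"
  using D(2)[of 4] by (intro nn_integral_PInf_AE) (auto simp: top_unique)
 then show ?thesis
 proof eventually_elim
  case (elim w)
  have "wsum R (kern_lim w) = wsum R (%p. kern_mat 4 w p +-(kern_mat 4 w p-kern_lim w p))" by simp
  also have "... <= wsum R (kern_mat 4 w)+wsum R (%p.-(kern_mat 4 w p-kern_lim w p))"
   using R by (intro wsum_triangle) simp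
  also have "wsum R (%p.-(kern_mat 4 w p-kern_lim w p)) = wsum R (%p. kern_mat 4 w p-kern_lim w p)"
   unfolding wsum_def by (simp only: norm_minus_cancel)
  also have "wsum R (kern_mat 4 w)+wsum R (%p. kern_mat 4 w p-kern_lim w p) < \<top>"
   using elim wsum_finite_support[of 4 "kern_mat 4 w" R] kern_mat_beyond by (simp add: less_top)
  finally show ?case .
 qed
qed

lemma psd_limit:
 assumes "!!p. (%k. T k p) ----> L p" "!!k::nat. psd (T k)"
 shows "psd L"
 unfolding psd_def
proof (intro conjI allI)
 fix a b
 have "(%k. cnj (T k (a, b))) ----> cnj (L (a, b))" by (intro tendsto_intros assms)
 then have "(%k. T k (b, a)) ----> cnj (L (a, b))" using psd_cnj[OF assms(2)] by simp
 then show "L (b, a) = cnj (L (a, b))" using assms(1) LIMSEQ_unique by blast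
next
 fix N x
 have "(%k. Re (sesq N (T k) x x)) ----> Re (sesq N L x x)"
  unfolding sesq_def by (intro tendsto_intros assms)
 then show "0 <= Re (sesq N L x x)"
  by (rule LIMSEQ_le_const) (use assms(2) in \<open>auto intro!: sesq_self_nonneg\<close>)
qed

lemma AE_psd_kern_lim: "AE w in cgauss. psd (kern_lim w)"
 using AE_kern_lim by eventually_elim (rule psd_limit[OF _ psd_kern_mat], auto)

section \<open>Nondegeneracy: a pathwise lower bound and negative moments\<close>

primrec pd_bound :: "nat => noise => real" where
 "pd_bound 0 w = 1"
| "pd_bound (Suc n) w = (let b = col_norm n (noise_col n w); u = old_weight n b; v = new_weight n b;
   z = value_seq n w; s = (\<Sum>a<n. nsq (z a)); k = nsq (z n); e = pd_bound n w;
   t = min 1 (u*e/(2 * v * (s+1)))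
   in if n = 0 then v * k else min (v * t * k/2) (u*e/2))"

lemma measurable_value_seq_app [measurable]: "(%w. value_seq n w a) : borel_measurable cgauss"
 by (rule measurable_cgauss_app) measurable

lemma measurable_pd_bound [measurable]: "pd_bound n : borel_measurable cgauss"
proof (induction n)
 case 0
 have "pd_bound 0 = (%w. 1)" by (simp add: fun_eq_iff)
 then show ?case by simp
next
 case (Suc n)
 note [measurable] = Suc
 show ?case unfolding pd_bound.simps(2)[abs_def] Let_def by (cases "n = 0"; simp; measurable)
qed

lemma pd_bound_past:
 assumes "!!m x. m < n ==> w (m, x) = w' (m, x)"
 shows "pd_bound n w = pd_bound n w'"
 using assms
proof (induction n)
 case (Suc n)
 then have "pd_bound n w = pd_bound n w'" by auto
 moreover have "mean n w = mean n w' \<and> kern_mat n w = kern_mat n w'"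
  using Suc.prems by (intro chain_past) auto
 moreover have "noise_col n w = noise_col n w'" "noise_row n w = noise_row n w'"
  using Suc.prems by (auto simp: noise_col_def noise_row_def)
 ultimately show ?case by (simp add: value_seq_def)
qed simp

lemma pd_bound_nonneg: "0 <= pd_bound n w"
 by (induction n) (auto simp: Let_def new_weight_nonneg old_weight_nonneg col_norm_nonneg sum_nonneg min_def)

text \<open>The old kernel controls the first \<open>n\<close> coordinates. The rank one term
  controls coordinate \<open>n\<close> through the top coefficient of the value, at the price of a
  perturbation by the first \<open>n\<close>. Using only the fraction \<open>t\<close> of the rank
  one term keeps this price below half of what the old kernel provides. The resulting bound depends
  on past noise only and serves to start the negative moment estimates.\<close>

lemma pd_bound_lower:
 assumes "n <= N"
 shows "pd_bound n w*(\<Sum>a<n. nsq (x a)) <= Re (sesq N (kern_mat n w) x x)"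
 using assms
proof (induction n)
 case 0
 then show ?case by (simp add: sesq_def)
next
 case (Suc n)
 define b where "b = col_norm n (noise_col n w)"
 define u where "u = old_weight n b"
 define v where "v = new_weight n b"
 define z where "z = value_seq n w"
 define s where "s = (\<Sum>a<n. nsq (z a))"
 define k where "k = nsq (z n)"
 define e where "e = pd_bound n w"
 define t where "t = min 1 (u*e/(2 * v * (s+1)))"
 define X where "X = (\<Sum>a<n. nsq (x a))"
 define y where "y = (\<Sum>a<n. x a*z a)"
 have b0: "b >= 0" by (simp add: b_def col_norm_nonneg)
 have nn: "u >= 0" "v >= 0" "s >= 0" "k >= 0" "e >= 0" "X >= 0"
  using b0 by (auto simp: u_def v_def s_def k_def e_def X_def old_weight_nonneg new_weight_nonneg pd_bound_nonneg sum_nonneg)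
 have t: "0 <= t" "t <= 1" using nn by (auto simp: t_def)
 have zx: "(\<Sum>a<N. x a*z a) = y+x n*z n"
 proof -
  have "(\<Sum>a<N. x a*z a) = (\<Sum>a<Suc n. x a*z a)"
   using Suc.prems by (intro sum.mono_neutral_right) (auto simp: z_def value_seq_beyond not_less_eq)
  then show ?thesis by (simp add: y_def)
 qed
 have S: "Re (sesq N (kern_mat (Suc n) w) x x) = u * Re (sesq N (kern_mat n w) x x)+v * nsq (y+x n*z n)"
  by (simp add: kern_mat_Suc sesq_step_kernel u_def v_def b_def z_def[symmetric] zx)
 have pb: "pd_bound (Suc n) w = (if n = 0 then v * k else min (v * t * k/2) (u*e/2))"
  by (simp add: Let_def u_def v_def b_def z_def s_def k_def e_def t_def)
 have IH: "e*X <= Re (sesq N (kern_mat n w) x x)" using Suc by (simp add: e_def X_def)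
 show ?case
 proof (cases "n = 0")
  case True
  then show ?thesis unfolding S pb by (simp add: y_def sesq_def k_def norm_mult power_mult_distrib mult.commute)
 next
  case False
  have y2: "nsq y <= s*X"
  proof -
   have "norm y <= (\<Sum>a<n. norm (x a)*norm (z a))"
    unfolding y_def by (rule order_trans[OF norm_sum]) (simp add: norm_mult)
   then have "nsq y <= (\<Sum>a<n. norm (x a)*norm (z a))^2" by (rule power_mono) simp
   also have "... <= X * s" unfolding X_def s_def by (rule Cauchy_Schwarz_ineq_sum)
   finally show ?thesis by (simp add: mult.commute)
  qed
  have "nsq (x n) * k = nsq ((y+x n*z n) +-y)"
   by (simp add: k_def norm_mult power_mult_distrib)
  also have "... <= 2*nsq (y+x n*z n)+2*nsq (- y)" by (rule norm_add_sq_le)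
  finally have A: "nsq (x n) * k/2-s*X <= nsq (y+x n*z n)" using y2 by simp
  have "v * t*(nsq (x n) * k/2-s*X) <= v * nsq (y+x n*z n)"
  proof -
   have "v * t*(nsq (x n) * k/2-s*X) <= v * t*nsq (y+x n*z n)"
    using nn t by (intro mult_left_mono A) auto
   also have "... <= v * 1*nsq (y+x n*z n)"
    using nn t by (intro mult_right_mono mult_left_mono) auto
   finally show ?thesis by simp
  qed
  moreover have "v * t * s <= u*e/2"
  proof (cases "v = 0")
   case False
   then have "v * t * s <= v * (u*e/(2 * v * (s+1))) * s"
    using nn by (intro mult_right_mono mult_left_mono) (auto simp: t_def)
   also have "... = u*e/2*(s/(s+1))" using False nn by simp
   also have "... <= u*e/2*1" using nn by (intro mult_left_mono) auto
   finally show ?thesis by simp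
  qed (use nn in auto)
  then have "v * t * s*X <= u*e/2*X" using nn by (intro mult_right_mono) auto
  moreover have "u*(e*X) <= u * Re (sesq N (kern_mat n w) x x)" using nn IH by (intro mult_left_mono)
  ultimately have "v * t * k/2*nsq (x n)+u*e/2*X <= Re (sesq N (kern_mat (Suc n) w) x x)"
   unfolding S by (simp add: algebra_simps)
  moreover have "pd_bound (Suc n) w*(X+nsq (x n)) <= u*e/2*X+v * t * k/2*nsq (x n)"
   unfolding pb distrib_left using False nn by (intro add_mono mult_right_mono) auto
  ultimately show ?thesis by (simp add: X_def)
 qed
qed

lemma AE_col_norm_noise: "AE w in cgauss. \<forall>n\<ge>1. 0 < col_norm n (noise_col n w)"
proof -
 have "AE w in cgauss. 0 < col_norm n (noise_col n w)" if "n >= 1" for n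
 proof -
  have d: "distr cgauss cgauss (noise_col n) = cgauss"
   unfolding noise_col_def[abs_def] by (rule distr_cgauss_reindex) (auto simp: inj_def)
  have "AE c in distr cgauss cgauss (noise_col n). 0 < col_norm n c"
   unfolding d using that by (rule AE_col_norm_pos)
  then show ?thesis by (rule AE_distrD[rotated]) (simp add: noise_col_def[abs_def] measurable_into_cgauss)
 qed
 then show ?thesis unfolding AE_all_countable by (auto intro: AE_impI)
qed

lemma AE_pd_bound_pos: "AE w in cgauss. \<forall>n. 0 < pd_bound n w"
 using AE_col_norm_noise
proof eventually_elim
 case (elim w)
 define b where "b n = col_norm n (noise_col n w)" for n
 have v: "new_weight n (b n) > 0" for n
 proof (cases "n = 0")
  case True
  then show ?thesis by (simp add: new_weight_def b_def col_norm_def)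
 next
  case False
  then show ?thesis using elim by (auto intro!: new_weight_pos simp: b_def)
 qed
 have u: "old_weight n (b n) > 0" if "n ~= 0" for n
  using elim that v[of n] by (auto simp: b_def old_weight_eq)
 have top: "value_seq n w n ~= 0" for n
 proof (induction n)
  case 0
  then show ?case by (simp add: value_seq_top unit_seq_def)
 next
  case (Suc n)
  then show ?case using v[of n] by (simp add: value_seq_top[of "Suc n"] mean_Suc step_mean_def shift_def b_def)
 qed
 have "0 < pd_bound n w" for n
 proof (induction n)
  case (Suc n)
  define s where "s = (\<Sum>a<n. nsq (value_seq n w a))"
  have s: "s+1 > 0" by (simp add: s_def sum_nonneg add_nonneg_pos)
  show ?case
   using v[of n] u[of n] top[of n] Suc s
   by (auto simp: Let_def b_def[symmetric] s_def[symmetric])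
 qed simp
 then show ?case by blast
qed

text \<open>One-dimensional Anderson inequality. The reflection \<open>- a-x\<close> exchanges
  \<open>x\<close> and \<open>a+x\<close> up to sign; after symmetrisation the difference of the two
  sides is the integral of the increment of \<open>d\<close> times the increment of
  \<open>g\<close>, which have equal signs because both functions decrease in the square of the
  argument.\<close>

lemma nn_integral_half_normal_shift_le:
 fixes g :: "real => real"
 assumes [measurable]: "g : borel_measurable borel" and g0: "!!x. 0 <= g x"
  and anti: "!!x y. 0 <= x ==> x <= y ==> g y <= g x"
 shows "(\<H> x. ennreal (g ((a+x)^2))) <= (\<H> x. ennreal (g (x\<^sup>2)))"
proof -
 define d where "d = normal_density 0 (sqrt (1/2))"
 have [measurable]: "d : borel_measurable borel" unfolding d_def by measurable
 have d0: "d x >= 0" for x by (simp add: d_def)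
 have flip: "(\<L> x. ennreal (F x)) = (\<L> x. ennreal (F (- a-x)))"
  if [measurable]: "F : borel_measurable borel" for F
  by (subst nn_integral_real_affine[where t="- a" and c="- 1"]) auto
 define A where "A = (\<L> x. ennreal (d x*g ((a+x)^2)))"
 define B where "B = (\<L> x. ennreal (d x*g (x\<^sup>2)))"
 have sym: "d (- a-x) = d (a+x)" "(- a-x)\<^sup>2 = (a+x)^2" "(a+(- a-x))\<^sup>2 = x\<^sup>2" for x
  by (simp_all add: d_def normal_density_def power2_eq_square algebra_simps)
 have A': "A = (\<L> x. ennreal (d (a+x)*g (x\<^sup>2)))"
  unfolding A_def by (subst flip) (measurable, simp only: sym)
 have B': "B = (\<L> x. ennreal (d (a+x)*g ((a+x)^2)))"
  unfolding B_def by (subst flip) (measurable, simp only: sym)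
 have dle: "d x <= d y" if "y\<^sup>2 <= x\<^sup>2" for x y using that by (simp add: d_def normal_density_def divide_right_mono)
 have pt: "d x*g ((a+x)^2)+d (a+x)*g (x\<^sup>2) <= d x*g (x\<^sup>2)+d (a+x)*g ((a+x)^2)" for x
 proof -
  have "0 <= (d x-d (a+x))*(g (x\<^sup>2)-g ((a+x)^2))"
  proof (cases "x\<^sup>2 <= (a+x)^2")
   case True
   then show ?thesis using dle[OF True] anti[OF _ True] by (intro mult_nonneg_nonneg) auto
  next
   case False
   then have le: "(a+x)\<^sup>2 <= x\<^sup>2" by simp
   show ?thesis using dle[OF le] anti[OF _ le] by (intro mult_nonpos_nonpos) auto
  qed
  then show ?thesis by (simp add: algebra_simps)
 qed
 have "A+A = (\<L> x. ennreal (d x*g ((a+x)^2))+ennreal (d (a+x)*g (x\<^sup>2)))"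
  by (subst nn_integral_add) (measurable, simp only: A_def[symmetric] A'[symmetric])
 also have "... <= (\<L> x. ennreal (d x*g (x\<^sup>2))+ennreal (d (a+x)*g ((a+x)^2)))"
  using pt d0 g0 by (intro nn_integral_mono) (simp add: ennreal_plus[symmetric] ennreal_leI del: ennreal_plus)
 also have "... = B+B"
  by (subst nn_integral_add) (measurable, simp only: B_def[symmetric] B'[symmetric])
 finally have "2*A <= 2*B" by (simp add: mult_2)
 then have "A <= B" by (simp add: ennreal_mult_le_mult_iff)
 moreover have "(\<H> x. ennreal (h x)) = (\<L> x. ennreal (d x*h x))"
  if [measurable]: "h : borel_measurable borel" for h
  by (subst nn_integral_density) (auto simp: ennreal_mult' d_def)
 ultimately show ?thesis by (simp add: A_def B_def)
qed

lemma nn_integral_std_shift_le: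
 fixes g :: "real => real"
 assumes [measurable]: "g : borel_measurable borel" and g0: "!!x. 0 <= g x"
  and anti: "!!x y. 0 <= x ==> x <= y ==> g y <= g x"
 shows "(\<G> w. ennreal (g (nsq (e+w)))) <= (\<G> w. ennreal (g (nsq w)))"
proof -
 interpret a: prob_space half_normal by (rule prob_space_half_normal)
 interpret p: pair_prob_space half_normal half_normal ..
 have "(\<G> w. ennreal (g (nsq (e+w))))
   = (\<H> x y. ennreal (g ((Re e+x)^2+(Im e+y)^2)))"
  by (subst nn_integral_std) (auto simp: cmod_power2)
 also have "... <= (\<H> x y. ennreal (g ((Re e+x)^2+y\<^sup>2)))"
  by (rule nn_integral_mono, rule nn_integral_half_normal_shift_le[where g="%t. g (_+t)"]) (auto intro!: g0 anti)
 also have "... = (\<H> y x. ennreal (g ((Re e+x)^2+y\<^sup>2)))"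
  by (rule p.Fubini'[symmetric]) measurable
 also have "... <= (\<H> y x. ennreal (g (x\<^sup>2+y\<^sup>2)))"
  by (rule nn_integral_mono, rule nn_integral_half_normal_shift_le[where g="%t. g (t+_)"]) (auto intro!: g0 anti)
 also have "... = (\<H> x y. ennreal (g (x\<^sup>2+y\<^sup>2)))"
  by (rule p.Fubini') measurable
 also have "... = (\<G> w. ennreal (g (nsq w)))"
  by (subst nn_integral_std) (auto simp: cmod_power2)
 finally show ?thesis .
qed

text \<open>Second order Taylor bound for \<open>1/(1+x)^s\<close>. The linear term stands on the
  left so that the bound can be integrated in \<open>ennreal\<close>, where subtraction
  truncates.\<close>

lemma inverse_power_le:
 fixes x :: real
 assumes "x >= 0"
 shows "1/(1+x)^s+real s*x <= 1+real s*(real s+1)/2*x\<^sup>2"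
proof (induction s)
 case (Suc s)
 have "1/(1+x)^Suc s <= (1-real s*x+real s*(real s+1)/2*x\<^sup>2)/(1+x)"
 proof -
  have "1/(1+x)^Suc s = 1/(1+x)^s/(1+x)" by simp
  moreover have "1/(1+x)^s <= 1-real s*x+real s*(real s+1)/2*x\<^sup>2" using Suc by linarith
  ultimately show ?thesis using assms by (simp only:) (rule divide_right_mono, auto)
 qed
 also have "... <= 1-real (Suc s)*x+real (Suc s)*(real (Suc s)+1)/2*x\<^sup>2"
 proof -
  have "(1-real (Suc s)*x+real (Suc s)*(real (Suc s)+1)/2*x\<^sup>2)*(1+x)
    = 1-real s*x+real s*(real s+1)/2*x\<^sup>2+real (Suc s)*(real (Suc s)+1)/2*x^3"
   by (simp add: field_simps power2_eq_square power3_eq_cube)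
  moreover have "0 <= real (Suc s)*(real (Suc s)+1)/2*x^3" using assms by simp
  ultimately show ?thesis using assms by (subst pos_divide_le_eq) auto
 qed
 finally show ?case by simp
qed simp

text \<open>For \<open>s > 0\<close> the value at nonpositive arguments is infinity, which keeps the
  function decreasing and continuous and lets a finite expectation force positivity.\<close>

definition inv_pow :: "nat => real => ennreal" where
 "inv_pow s M = inverse (ennreal (max 0 M^s))"

lemma inv_pow_pos: "M > 0 ==> inv_pow s M = ennreal (1/M^s)"
 by (simp add: inv_pow_def inverse_ennreal inverse_eq_divide)

lemma inv_pow_nonpos: "M <= 0 ==> s > 0 ==> inv_pow s M = \<top>"
 by (simp add: inv_pow_def)

lemma inv_pow_antimono: "M <= M' ==> inv_pow s M' <= inv_pow s M"
proof (cases "M > 0")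
 case True
 assume "M <= M'"
 with True show ?thesis by (auto simp: inv_pow_pos intro!: ennreal_leI divide_left_mono power_mono)
qed (cases "s = 0"; simp add: inv_pow_def zero_power)

lemma measurable_quad_form [measurable (raw)]:
 assumes "T : measurable M cgauss"
 shows "(%x. Re (sesq N (T x) l l')) : borel_measurable M"
proof -
 have [measurable]: "(%x. T x p) : borel_measurable M" for p by (rule measurable_cgauss_app) fact
 show ?thesis unfolding sesq_def by measurable
qed

lemma continuous_inv_pow: "continuous_on UNIV (inv_pow s)"
 unfolding inv_pow_def[abs_def]
 by (intro continuous_on_inverse_ennreal continuous_on_ennreal continuous_intros)

lemma measurable_inv_pow [measurable]: "inv_pow s : borel_measurable borel"
 by (rule borel_measurable_continuous_onI continuous_inv_pow)+

text \<open>One step multiplies the value \<open>M\<close> of the form by \<open>u\<close> and by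
  one plus \<open>k\<close> times the squared modulus of a standard Gaussian shifted by
  \<open>e\<close>. The shift can only lower the negative moment, by
  \<open>nn_integral_std_shift_le\<close>. In the Taylor expansion the mean of \<open>k\<close> is
  \<open>y\<close> and contributes \<open>- s*y\<close>, which cancels to first order the loss
  \<open>(1/u)^s = (1+y)^s <= exp y^s\<close>; a summable error of order \<open>y\<^sup>2\<close>
  remains. The martingale normalisation is what makes the first orders match.\<close>

lemma small_ball_step:
 assumes K: "psd K" and n: "n >= 3" and s: "s > 0"
 shows "(\<E> c r. inv_pow s (Re (sesq N (next_kernel n m K c r) l l)))
  <= ennreal (exp (16 * real s*(real s+1)/(real n-1)^2))*inv_pow s (Re (sesq N K l l))"
proof (cases "Re (sesq N K l l) = 0")
 case True
 then show ?thesis by (simp add: inv_pow_nonpos s ennreal_mult_top)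
next
 case False
 define M where "M = Re (sesq N K l l)"
 have M: "M > 0" using False sesq_self_nonneg[OF K, of N l] by (simp add: M_def)
 define u where "u = 1-1/real n"
 define y where "y = 1/(real n-1)"
 have u: "u > 0" "u <= 1" and y: "y > 0" and uy: "1/u = 1+y" "1/(real n*u) = y"
  using n by (auto simp: u_def y_def field_simps)
 define v where "v c = new_weight n (col_norm n c)" for c
 have v0: "v c >= 0" for c by (simp add: v_def new_weight_nonneg col_norm_nonneg)
 have [measurable]: "v : borel_measurable cgauss" unfolding v_def by measurable
 define S where "S = real s*(real s+1)/2"
 define e where "e = (\<Sum>a<N. l a*m a) / of_real (sqrt M)"
 have inner: "(\<E> r. inv_pow s (Re (sesq N (next_kernel n m K c r) l l)))+ennreal (real s*y/(u*M)^s * real n * v c)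
   <= ennreal (1/(u*M)^s)*(1+ennreal (16*S*(real n)^2*y\<^sup>2)*ennreal ((v c)^2))" for c
 proof -
  define k where "k = v c/u"
  have k: "k >= 0" using u v0 by (simp add: k_def)
  define g where "g t = 1/(1+k*max 0 t)^s" for t
  have g0: "g t >= 0" for t using k by (simp add: g_def)
  have gm: "g : borel_measurable borel" unfolding g_def by measurable
  have anti: "g b <= g a" if "0 <= a" "a <= b" for a b
   unfolding g_def using that k
   by (intro divide_left_mono power_mono add_left_mono mult_left_mono mult_pos_pos zero_less_power add_pos_nonneg) auto
  have eq: "inv_pow s (Re (sesq N (next_kernel n m K c r) l l))
    = ennreal (1/(u*M)^s)*ennreal (g (nsq ((\<Sum>a<N. l a*m a)+(\<Sum>a<N. l a*gauss_seq K r a))/M))" for r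
  proof -
   define q where "q = nsq ((\<Sum>a<N. l a*m a)+(\<Sum>a<N. l a*gauss_seq K r a))"
   have "Re (sesq N (next_kernel n m K c r) l l) = u*M*(1+k*(q/M))"
    unfolding sesq_step_kernel using n M u
    by (simp add: M_def[symmetric] u_def[symmetric] v_def k_def q_def old_weight_def step_value_def distrib_left sum.distrib)
   moreover have "1+k*(q/M) > 0" using k M by (intro add_pos_nonneg) (auto simp: q_def)
   ultimately show ?thesis using u M k
    by (simp add: q_def[symmetric] inv_pow_pos ennreal_mult[symmetric] g_def power_mult_distrib max_absorb2)
     (simp add: q_def)
  qed
  have "(\<E> r. ennreal (g (nsq ((\<Sum>a<N. l a*m a)+(\<Sum>a<N. l a*gauss_seq K r a))/M)))
    = (\<G> w. ennreal (g (nsq ((\<Sum>a<N. l a*m a) + of_real (sqrt M)*w)/M)))"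
   unfolding M_def by (rule nn_integral_gauss_functional[OF K, where f="%w. ennreal (g (nsq ((\<Sum>a<N. l a*m a)+w)/Re (sesq N K l l)))"])
    (use gm in measurable)
  also have "... = (\<G> w. ennreal (g (nsq (e+w))))"
  proof (rule nn_integral_cong)
   fix w
   have "(\<Sum>a<N. l a*m a) + of_real (sqrt M)*w = of_real (sqrt M)*(e+w)"
    using M by (simp add: e_def distrib_left)
   then have "nsq ((\<Sum>a<N. l a*m a) + of_real (sqrt M)*w)/M = nsq (e+w)"
    using M by (simp add: norm_mult power_mult_distrib)
   then show "ennreal (g (nsq ((\<Sum>a<N. l a*m a) + of_real (sqrt M)*w)/M)) = ennreal (g (nsq (e+w)))" by simp
  qed
  also have "... <= (\<G> w. ennreal (g (nsq w)))"
   by (rule nn_integral_std_shift_le[OF gm g0 anti])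
  finally have I: "(\<E> r. ennreal (g (nsq ((\<Sum>a<N. l a*m a)+(\<Sum>a<N. l a*gauss_seq K r a))/M))) <= ..." .
  note [measurable] = gm
  have "(\<G> w. ennreal (g (nsq w)))+ennreal (real s * k)
    = (\<G> w. ennreal (g (nsq w))+ennreal (real s * k)*ennreal (nsq w))"
   by (subst nn_integral_add) (auto simp: nn_integral_cmult nn_integral_std_sq)
  also have "... <= (\<G> w. 1+ennreal (S * k\<^sup>2)*ennreal ((norm w)^4))"
  proof (rule nn_integral_mono)
   fix w :: complex
   define t where "t = nsq w"
   have t: "t >= 0" "(norm w)^4 = t\<^sup>2" by (auto simp: t_def)
   have "g t+real s * k*t <= 1+S * k\<^sup>2*t\<^sup>2"
    using inverse_power_le[of "k*t" s] k t by (simp add: g_def S_def power_mult_distrib mult.assoc)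
   then have "ennreal (g t+real s * k*t) <= ennreal (1+S * k\<^sup>2*t\<^sup>2)" by (rule ennreal_leI)
   then show "ennreal (g (nsq w))+ennreal (real s * k)*ennreal (nsq w) <= 1+ennreal (S * k\<^sup>2)*ennreal ((norm w)^4)"
    unfolding t t_def[symmetric] using t k g0
     by (simp add: ennreal_mult[symmetric] ennreal_plus[symmetric] S_def ennreal_1[symmetric] del: ennreal_plus ennreal_1)
  qed
  also have "... = 1+ennreal (S * k\<^sup>2)*(\<G> w. ennreal ((norm w)^4))"
   by (subst nn_integral_add) (auto simp: nn_integral_cmult std.emeasure_space_1[unfolded space_std_complex_gaussian])
  also have "... <= 1+ennreal (S * k\<^sup>2)*16"
   by (intro add_left_mono mult_left_mono nn_integral_std_fourth) auto
  finally have II: "(\<G> w. ennreal (g (nsq w)))+ennreal (real s * k) <= 1+ennreal (S * k\<^sup>2)*16" .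
  have [measurable]: "(%r. gauss_seq K r a) : borel_measurable cgauss" for a
   by (rule measurable_cgauss_app) measurable
  have k_eq: "k = real n*y * v c" unfolding k_def using uy u n by (simp add: field_simps)
  have "(\<E> r. inv_pow s (Re (sesq N (next_kernel n m K c r) l l)))+ennreal (real s*y/(u*M)^s * real n * v c)
    = ennreal (1/(u*M)^s)*((\<E> r. ennreal (g (nsq ((\<Sum>a<N. l a*m a)+(\<Sum>a<N. l a*gauss_seq K r a))/M)))+ennreal (real s * k))"
   unfolding eq distrib_left
   by (subst nn_integral_cmult, measurable) (use u M k in \<open>simp add: ennreal_mult'[symmetric] k_eq ac_simps\<close>)
  also have "... <= ennreal (1/(u*M)^s)*(1+ennreal (S * k\<^sup>2)*16)"
   by (intro mult_left_mono order.trans[OF _ II] add_right_mono I) simp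
  also have "ennreal (S * k\<^sup>2)*16 = ennreal (16*S*(real n)^2*y\<^sup>2)*ennreal ((v c)^2)"
   by (simp add: k_eq ennreal_mult[symmetric] S_def power_mult_distrib ac_simps flip: ennreal_numeral)
  finally show ?thesis .
 qed
 define I where "I = (\<E> c r. inv_pow s (Re (sesq N (next_kernel n m K c r) l l)))"
 define Q where "Q = 1/(u*M)^s"
 have Q: "Q > 0" using u M by (simp add: Q_def)
 have "I+ennreal (real s*y*Q) = (\<E> c. (\<E> r. inv_pow s (Re (sesq N (next_kernel n m K c r) l l)))+ennreal (real s*y/(u*M)^s * real n * v c))"
 proof -
  have "(\<E> c. ennreal (real s*y/(u*M)^s * real n * v c)) = ennreal (real s*y*Q * real n)*ennreal (1/real n)"
   unfolding nn_integral_new_weight[OF n, symmetric] v_def[symmetric]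
   by (subst nn_integral_cmult[symmetric], measurable)
    (use y Q v0 in \<open>simp add: Q_def ennreal_mult[symmetric] ac_simps\<close>)
  also have "... = ennreal (real s*y*Q)" using n y Q by (simp add: ennreal_mult[symmetric])
  moreover have "(%c. \<E> r. inv_pow s (Re (sesq N (next_kernel n m K c r) l l))) : borel_measurable cgauss"
  proof (rule cgauss.borel_measurable_nn_integral)
   have [measurable]: "(%x. step_kernel n (col_norm n (fst x)) (step_value m K (snd x)) K) : measurable (cgauss \<Otimes>\<^sub>M cgauss) cgauss"
    by measurable
   show "(%(c, r). inv_pow s (Re (sesq N (next_kernel n m K c r) l l))) : borel_measurable (cgauss \<Otimes>\<^sub>M cgauss)"
    unfolding case_prod_beta by measurable
  qed
  ultimately show ?thesis unfolding I_def by (subst nn_integral_add) auto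
 qed
 also have "... <= (\<E> c. ennreal Q*(1+ennreal (16*S*(real n)^2*y\<^sup>2)*ennreal ((v c)^2)))"
  unfolding Q_def by (intro nn_integral_mono inner)
 also have "... = ennreal Q*(1+ennreal (16*S*(real n)^2*y\<^sup>2)*(\<E> c. ennreal ((v c)^2)))"
  by (subst nn_integral_cmult, measurable, subst nn_integral_add) (auto simp: nn_integral_cmult)
 also have "... <= ennreal Q*(1+ennreal (16*S*(real n)^2*y\<^sup>2)*ennreal (2/(real n)^2))"
  unfolding v_def by (intro mult_left_mono add_left_mono nn_integral_new_weight_sq n) auto
 also have "... = ennreal (Q*(1+32*S*y\<^sup>2))"
  using n Q by (simp add: ennreal_mult[symmetric] S_def ennreal_plus[symmetric] ennreal_1[symmetric] del: ennreal_plus ennreal_1)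
 finally have I1: "I+ennreal (real s*y*Q) <= ennreal (Q*(1+32*S*y\<^sup>2))" .
 then have "I < \<top>" by (auto simp: less_top[symmetric] top_unique)
 then obtain i where i: "I = ennreal i" "i >= 0" by (cases I) auto
 have "i <= Q*(1+(- real s*y+32*S*y\<^sup>2))"
 proof -
  have "ennreal (i+real s*y*Q) <= ennreal (Q*(1+32*S*y\<^sup>2))"
   using I1 i y Q by (simp add: ennreal_plus)
  moreover have "Q*(1+32*S*y\<^sup>2) >= 0" using Q by (simp add: S_def)
  ultimately have "i+real s*y*Q <= Q*(1+32*S*y\<^sup>2)" by (simp only: ennreal_le_iff)
  then show ?thesis by (simp add: algebra_simps)
 qed
 also have "... <= Q*exp (- real s*y+32*S*y\<^sup>2)"
  using Q by (intro mult_left_mono exp_ge_add_one_self) auto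
 also have "Q = (1+y)^s/M^s"
  unfolding Q_def uy(1)[symmetric] by (simp add: power_mult_distrib power_divide)
 also have "(1+y)^s/M^s*exp (- real s*y+32*S*y\<^sup>2) <= exp y^s/M^s*exp (- real s*y+32*S*y\<^sup>2)"
  using y M by (intro mult_right_mono divide_right_mono power_mono exp_ge_add_one_self) auto
 also have "... = exp (16 * real s*(real s+1)/(real n-1)^2)*(1/M^s)"
  by (simp add: exp_of_nat_mult[symmetric] exp_add[symmetric] S_def y_def power_divide)
 finally show ?thesis unfolding I_def[symmetric] i(1) M_def[symmetric] inv_pow_pos[OF M]
  using M by (subst ennreal_mult[symmetric]) (auto intro: ennreal_leI)
qed

lemma measurable_kern_form [measurable]:
 "(%x. Re (sesq N (step_kernel n (col_norm n (fst (snd x))) (step_value (mean n (fst x)) (kern_mat n (fst x)) (snd (snd x))) (kern_mat n (fst x))) l l))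
  : borel_measurable (cgauss \<Otimes>\<^sub>M cgauss \<Otimes>\<^sub>M cgauss)"
proof (rule measurable_quad_form)
 show "(%x. step_kernel n (col_norm n (fst (snd x))) (step_value (mean n (fst x)) (kern_mat n (fst x)) (snd (snd x))) (kern_mat n (fst x)))
   : measurable (cgauss \<Otimes>\<^sub>M cgauss \<Otimes>\<^sub>M cgauss) cgauss" by measurable
qed

text \<open>Iteration of the one-step bound; the exponents are summable because
  \<open>1/(real n-1)^2\<close> is dominated by a telescoping difference. The weight
  \<open>f\<close> depends on noise before time \<open>k\<close> and later restricts to an event
  where the moment at time \<open>k\<close> is finite.\<close>

lemma small_ball_propagate:
 assumes f [measurable]: "f : borel_measurable cgauss" and s: "s > 0" and k: "k >= 3" and kn: "k <= n"
  and past: "!!w w'. (!!m x. m < k ==> w (m, x) = w' (m, x)) ==> f w = f w'"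
 shows "(\<E> w. f w*inv_pow s (Re (sesq N (kern_mat n w) l l)))
  <= ennreal (exp (16 * real s*(real s+1)))*(\<E> w. f w*inv_pow s (Re (sesq N (kern_mat k w) l l)))"
proof -
 define A where "A = 16 * real s*(real s+1)"
 have A: "A >= 0" by (simp add: A_def)
 define B where "B = (\<E> w. f w*inv_pow s (Re (sesq N (kern_mat k w) l l)))"
 have "(\<E> w. f w*inv_pow s (Re (sesq N (kern_mat n w) l l))) <= ennreal (exp (A*(1/(real k-2)-1/(real n-2))))*B"
  using kn
 proof (induction n rule: dec_induct)
  case base
  show ?case by (simp add: B_def)
 next
  case (step n)
  then have n: "n >= 3" using k by simp
  define e where "e = A/(real n-1)^2"
  have "(\<E> w. f w*inv_pow s (Re (sesq N (kern_mat (Suc n) w) l l)))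
    = (\<E> w c r. f w*inv_pow s (Re (sesq N (next_kernel n (mean n w) (kern_mat n w) c r) l l)))"
   unfolding kern_mat_Suc value_seq_def
  proof (rule nn_integral_chain_fresh[where G="%w c r. f w*inv_pow s (Re (sesq N (next_kernel n (mean n w) (kern_mat n w) c r) l l))"])
   fix w w' :: noise and c r :: "nat => complex"
   assume p: "!!m x. m < n ==> w (m, x) = w' (m, x)"
   have "f w = f w'" using p step.hyps by (intro past) auto
   then show "f w*inv_pow s (Re (sesq N (next_kernel n (mean n w) (kern_mat n w) c r) l l))
    = f w'*inv_pow s (Re (sesq N (next_kernel n (mean n w') (kern_mat n w') c r) l l))"
    using chain_past[of n w w'] p by simp
  qed (unfold case_prod_beta, measurable)
  also have "... = (\<E> w. f w*(\<E> c r. inv_pow s (Re (sesq N (next_kernel n (mean n w) (kern_mat n w) c r) l l))))"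
  proof (rule nn_integral_cong)
   fix w :: noise
   have [measurable]: "(%x. inv_pow s (Re (sesq N (step_kernel n (col_norm n (fst x)) (step_value (mean n w) (kern_mat n w) (snd x)) (kern_mat n w)) l l)))
    : borel_measurable (cgauss \<Otimes>\<^sub>M cgauss)"
    using measurable_compose[OF _ measurable_compose[OF measurable_kern_form[of N n l] measurable_inv_pow[of s]], of "%x. (w, x)" "cgauss \<Otimes>\<^sub>M cgauss"]
    by simp
   note meas = this
   have 1: "(%r. inv_pow s (Re (sesq N (next_kernel n (mean n w) (kern_mat n w) c r) l l))) : borel_measurable cgauss" for c
    using measurable_compose[OF _ meas, of "%r. (c, r)" cgauss] by simp
   have 2: "(%c. \<E> r. inv_pow s (Re (sesq N (next_kernel n (mean n w) (kern_mat n w) c r) l l))) : borel_measurable cgauss"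
    by (rule cgauss.borel_measurable_nn_integral) (unfold case_prod_beta, measurable)
   show "(\<E> c r. f w*inv_pow s (Re (sesq N (next_kernel n (mean n w) (kern_mat n w) c r) l l)))
    = f w*(\<E> c r. inv_pow s (Re (sesq N (next_kernel n (mean n w) (kern_mat n w) c r) l l)))"
    by (simp only: nn_integral_cmult[OF 1] nn_integral_cmult[OF 2])
  qed
  also have "... <= (\<E> w. f w*(ennreal (exp e)*inv_pow s (Re (sesq N (kern_mat n w) l l))))"
   unfolding e_def A_def by (intro nn_integral_mono mult_left_mono small_ball_step psd_kern_mat n s) auto
  also have "... = ennreal (exp e)*(\<E> w. f w*inv_pow s (Re (sesq N (kern_mat n w) l l)))"
   by (subst nn_integral_cmult[symmetric]) (auto simp: ac_simps)
  also have "... <= ennreal (exp e)*(ennreal (exp (A*(1/(real k-2)-1/(real n-2))))*B)"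
   by (intro mult_left_mono step.IH) simp
  also have "... = ennreal (exp (e+A*(1/(real k-2)-1/(real n-2))))*B"
   by (simp add: exp_add ennreal_mult mult.assoc)
  also have "... <= ennreal (exp (A*(1/(real k-2)-1/(real (Suc n)-2))))*B"
  proof -
   have "1/(real n-1)^2 <= 1/((real n-2)*(real n-1))"
    using n by (intro divide_left_mono) (auto simp: power2_eq_square)
   also have "... = 1/(real n-2)-1/(real (Suc n)-2)" using n by (simp add: field_simps)
   finally have "e <= A*(1/(real n-2)-1/(real (Suc n)-2))"
    using A mult_left_mono[of "1/(real n-1)^2" _ A] by (simp add: e_def)
   then show ?thesis by (intro mult_right_mono ennreal_leI) (auto simp: algebra_simps)
  qed
  finally show ?case .
 qed
 also have "... <= ennreal (exp A)*B"
 proof -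
  have "1/(real k-2)-1/(real n-2) <= 1"
  proof -
   have "1/(real k-2) <= 1" "1/(real n-2) >= 0" using k kn by auto
   then show ?thesis by linarith
  qed
  from mult_left_mono[OF this A] show ?thesis by (intro mult_right_mono ennreal_leI) auto
 qed
 finally show ?thesis by (simp add: A_def B_def)
qed

lemma small_ball_kern_lim:
 assumes f [measurable]: "f : borel_measurable cgauss" and s: "s > 0" and k: "k >= 3"
  and past: "!!w w'. (!!m x. m < k ==> w (m, x) = w' (m, x)) ==> f w = f w'"
  and fin: "!!w. f w < \<top>"
 shows "(\<E> w. f w*inv_pow s (Re (sesq N (kern_lim w) l l)))
  <= ennreal (exp (16 * real s*(real s+1)))*(\<E> w. f w*inv_pow s (Re (sesq N (kern_mat k w) l l)))"
proof -
 have "(\<E> w. f w*inv_pow s (Re (sesq N (kern_lim w) l l)))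
  = (\<E> w. liminf (%j. f w*inv_pow s (Re (sesq N (kern_mat (4^j) w) l l))))"
 proof (rule nn_integral_cong_AE, use AE_kern_lim in eventually_elim)
  case (elim w)
  have "(%j. Re (sesq N (kern_mat (4^j) w) l l)) ----> Re (sesq N (kern_lim w) l l)"
   unfolding sesq_def using elim by (intro tendsto_intros) auto
  then have "(%j. inv_pow s (Re (sesq N (kern_mat (4^j) w) l l))) ----> inv_pow s (Re (sesq N (kern_lim w) l l))"
   by (rule continuous_on_tendsto_compose[OF continuous_inv_pow]) auto
  then have "(%j. f w*inv_pow s (Re (sesq N (kern_mat (4^j) w) l l))) ----> f w*inv_pow s (Re (sesq N (kern_lim w) l l))"
   using fin by (intro ennreal_tendsto_cmult) auto
  then show ?case by (rule lim_imp_Liminf[symmetric, rotated]) simp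
 qed
 also have "... <= liminf (%j. \<E> w. f w*inv_pow s (Re (sesq N (kern_mat (4^j) w) l l)))"
  by (rule nn_integral_liminf) measurable
 also have "... <= ennreal (exp (16 * real s*(real s+1)))*(\<E> w. f w*inv_pow s (Re (sesq N (kern_mat k w) l l)))"
 proof (rule Liminf_le)
  have "\<forall>\<^sub>F j in sequentially. k <= 4^j"
  proof (rule eventually_sequentiallyI)
   show "k <= 4^j" if "k <= j" for j using that less_exp[of j] power_mono[of 2 "4::nat" j] by linarith
  qed
  then show "\<forall>\<^sub>F j in sequentially. (\<E> w. f w*inv_pow s (Re (sesq N (kern_mat (4^j) w) l l)))
    <= ennreal (exp (16 * real s*(real s+1)))*(\<E> w. f w*inv_pow s (Re (sesq N (kern_mat k w) l l)))"
   by eventually_elim (rule small_ball_propagate[OF f s k _ past])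
 qed simp
 finally show ?thesis .
qed

section \<open>The limiting form on sequences of exponential growth\<close>

definition wpart :: "real => (nat \<times> nat => complex) => nat => real" where
 "wpart R T N = (\<Sum>p\<in>{..<N} \<times> {..<N}. R^(fst p+snd p)*norm (T p))"

text \<open>The limit exists for sequences dominated by a geometric one as soon as
  \<open>wsum\<close> is finite at the corresponding radius; see \<open>bform_bound\<close>.\<close>

definition bform :: "(nat \<times> nat => complex) => (nat => complex) => (nat => complex) => complex" where
 "bform T x y = lim (%N. sesq N T x y)"

lemma wpart_le_wsum: "R >= 0 ==> ennreal (wpart R T N) <= wsum R T"
proof -
 assume R: "R >= 0"
 have "ennreal (wpart R T N) = (\<Sum>a<N. \<Sum>b<N. ennreal (R^(a+b)*norm (T (a, b))))"
  using R unfolding wpart_def sum.cartesian_product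
  by (subst sum_ennreal[symmetric]) (auto simp: case_prod_beta)
 also have "... <= (\<Sum>a<N. \<Sum>b. ennreal (R^(a+b)*norm (T (a, b))))"
  by (intro sum_mono sum_le_suminf summableI) auto
 also have "... <= wsum R T" unfolding wsum_def by (intro sum_le_suminf summableI) auto
 finally show ?thesis .
qed

lemma sesq_alt: "sesq N T x y = (\<Sum>p\<in>{..<N} \<times> {..<N}. x (fst p)*cnj (y (snd p))*T p)"
 by (simp add: sesq_def sum.cartesian_product case_prod_beta)

lemma sesq_diff_le:
 assumes "R >= 0" "N <= M" and x: "!!a. norm (x a) <= C * R^a" and y: "!!a. norm (y a) <= D * R^a"
 shows "norm (sesq M T x y-sesq N T x y) <= C*D*(wpart R T M-wpart R T N)"
proof -
 let ?S = "{..<M} \<times> {..<M}-{..<N} \<times> {..<N}"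
 have sub: "{..<N} \<times> {..<N} \<subseteq> {..<M} \<times> {..<M}" using assms(2) by auto
 have C: "C >= 0" using order.trans[OF norm_ge_zero x[of 0]] by simp
 have "norm (sesq M T x y-sesq N T x y) = norm (\<Sum>p\<in>?S. x (fst p)*cnj (y (snd p))*T p)"
  unfolding sesq_alt by (subst sum_diff[OF _ sub]) auto
 also have "... <= (\<Sum>p\<in>?S. C*D*(R^(fst p+snd p)*norm (T p)))"
 proof (rule sum_norm_le)
  fix p
  have "norm (x (fst p))*norm (y (snd p)) <= (C * R^fst p)*(D * R^snd p)"
   using C assms(1) by (intro mult_mono x y) auto
  then have "norm (x (fst p))*norm (y (snd p))*norm (T p) <= (C * R^fst p)*(D * R^snd p)*norm (T p)"
   by (rule mult_right_mono) simp
  then show "norm (x (fst p)*cnj (y (snd p))*T p) <= C*D*(R^(fst p+snd p)*norm (T p))"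
   by (simp add: norm_mult power_add ac_simps)
 qed
 also have "... = C*D*(wpart R T M-wpart R T N)"
  unfolding wpart_def sum_distrib_left[symmetric] by (subst sum_diff[OF _ sub]) auto
 finally show ?thesis .
qed

lemma wpart_zero [simp]: "wpart R T 0 = 0" and sesq_zero [simp]: "sesq 0 T x y = 0"
 by (simp_all add: wpart_def sesq_def)

lemma wpart_mono: "R >= 0 ==> N <= M ==> wpart R T N <= wpart R T M"
 unfolding wpart_def by (intro sum_mono2) auto

lemma convergent_wpart:
 assumes "R >= 0" "wsum R T < \<top>"
 obtains W where "wpart R T ----> W" "!!N. wpart R T N <= W" "ennreal W <= wsum R T"
proof -
 obtain W where W: "wsum R T = ennreal W" "W >= 0" using assms(2) by (cases "wsum R T") auto
 have "wpart R T N <= W" for N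
  using wpart_le_wsum[OF assms(1), of T N] W by simp
 then obtain L where L: "wpart R T ----> L" "\<forall>i. wpart R T i <= L"
  using wpart_mono[OF assms(1)] by (auto intro: incseq_convergent[of "wpart R T" W] simp: incseq_def)
 moreover have "L <= W" using L(1) \<open>!!N. wpart R T N <= W\<close> by (intro LIMSEQ_le_const2) auto
 ultimately show ?thesis using that W by (auto intro: ennreal_leI)
qed

lemma bform_tail:
 assumes R: "R >= 0" "wpart R T ----> W" and xy: "!!a. norm (x a) <= C * R^a" "!!a. norm (y a) <= D * R^a"
 shows "(%N. sesq N T x y) ----> bform T x y" "norm (bform T x y-sesq N T x y) <= C*D*(W-wpart R T N)"
proof -
 have C: "C >= 0" using order.trans[OF norm_ge_zero xy(1)[of 0]] by simp
 have D: "D >= 0" using order.trans[OF norm_ge_zero xy(2)[of 0]] by simp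
 have "Cauchy (%N. sesq N T x y)"
 proof (rule metric_CauchyI)
  fix e :: real assume e: "e > 0"
  have pos: "C*D+1 > 0" using C D by (intro add_nonneg_pos) auto
  have "Cauchy (wpart R T)" using R(2) by (intro LIMSEQ_imp_Cauchy)
  then obtain K where K: "!!m n. K <= m ==> K <= n ==> dist (wpart R T m) (wpart R T n) < e/(C*D+1)"
   using metric_CauchyD[of "wpart R T" "e/(C*D+1)"] e pos by auto
  have main: "dist (sesq m T x y) (sesq n T x y) < e" if "K <= n" "n <= m" for m n
  proof -
   have "norm (sesq m T x y-sesq n T x y) <= C*D*(wpart R T m-wpart R T n)"
    by (rule sesq_diff_le) (use R that xy in auto)
   also have "... <= C*D*(e/(C*D+1))"
    using K[of m n] that C D by (intro mult_left_mono) (auto simp: dist_real_def)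
   also have "... < (C*D+1)*(e/(C*D+1))"
    using C D e by (intro mult_strict_right_mono divide_pos_pos) (auto simp: add_nonneg_pos)
   also have "... = e" using pos by simp
   finally show ?thesis by (simp add: dist_norm)
  qed
  show "\<exists>K. \<forall>m\<ge>K. \<forall>n\<ge>K. dist (sesq m T x y) (sesq n T x y) < e"
   by (intro exI[of _ K] allI impI) (metis main dist_commute linear)
 qed
 then show l: "(%N. sesq N T x y) ----> bform T x y"
  unfolding bform_def by (simp add: Cauchy_convergent_iff convergent_LIMSEQ_iff)
 have "(%M. norm (sesq M T x y-sesq N T x y)) ----> norm (bform T x y-sesq N T x y)"
  by (intro tendsto_intros l)
 moreover have "(%M. C*D*(wpart R T M-wpart R T N)) ----> C*D*(W-wpart R T N)"
  by (intro tendsto_intros R)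
 ultimately show "norm (bform T x y-sesq N T x y) <= C*D*(W-wpart R T N)"
  by (rule LIMSEQ_le) (auto intro!: exI[of _ N] sesq_diff_le R xy)
qed

lemma bform_bound:
 assumes R: "R >= 0" "wsum R T <= ennreal W" "W >= 0" and xy: "!!a. norm (x a) <= C * R^a" "!!a. norm (y a) <= D * R^a"
 shows "(%N. sesq N T x y) ----> bform T x y" "norm (bform T x y) <= C*D*W"
proof -
 have fin: "wsum R T < \<top>" using R(2) by (auto simp: less_top[symmetric] top_unique)
 obtain V where V: "wpart R T ----> V" "ennreal V <= wsum R T"
  by (rule convergent_wpart[OF R(1) fin]) blast
 have CD: "C >= 0" "D >= 0" using order.trans[OF norm_ge_zero xy(1)[of 0]] order.trans[OF norm_ge_zero xy(2)[of 0]] by auto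
 show "(%N. sesq N T x y) ----> bform T x y" by (rule bform_tail(1)[OF R(1) V(1) xy])
 have "V <= W" using order.trans[OF V(2) R(2)] R(3) by simp
 then have "C*D*V <= C*D*W" using CD by (intro mult_left_mono) auto
 then show "norm (bform T x y) <= C*D*W" using bform_tail(2)[OF R(1) V(1) xy, of 0] by simp
qed

lemma measurable_bform [measurable]: "(%w. bform (kern_lim w) x y) : borel_measurable cgauss"
 unfolding bform_def sesq_def by measurable

text \<open>With \<open>z = x-y\<close> and \<open>z' = x+z\<close>, the parallelogram law bounds
  the form at \<open>y = x-z\<close>. The term in \<open>z\<close> is small by the Lipschitz
  assumption, so a degenerate parameter makes every nearby parameter nearly degenerate.\<close>

lemma bform_le:
 assumes T: "psd T" and R: "R >= 0" "wsum R T <= ennreal W" "W >= 0"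
  and x: "!!a. norm (x a) <= C * R^a" and y: "!!a. norm (y a) <= C * R^a"
  and d: "!!a. norm (x a-y a) <= C*h * R^a"
 shows "Re (bform T y y) <= 2 * Re (bform T x x)+2*(C\<^sup>2*h\<^sup>2*W)"
proof -
 define z where "z a = x a-y a" for a
 define z' where "z' a = x a+z a" for a
 have z: "norm (z a) <= C*h * R^a" for a using d by (simp add: z_def)
 have le: "Re (sesq N T y y) <= 2 * Re (sesq N T x x)+2 * Re (sesq N T z z)" for N
 proof -
  have "Re (sesq N T y y)+Re (sesq N T z' z') = 2 * Re (sesq N T x x)+2 * Re (sesq N T z z)"
   unfolding sesq_def z_def z'_def by (simp add: sum_distrib_left sum.distrib[symmetric] algebra_simps)
  then show ?thesis using sesq_self_nonneg[OF T, of N z'] by simp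
 qed
 have "Re (bform T y y) <= 2 * Re (bform T x x)+2 * Re (bform T z z)"
 proof (rule LIMSEQ_le)
  show "(%N. Re (sesq N T y y)) ----> Re (bform T y y)"
   by (intro tendsto_intros bform_bound(1)[OF R y y])
  show "(%N. 2 * Re (sesq N T x x)+2 * Re (sesq N T z z)) ----> 2 * Re (bform T x x)+2 * Re (bform T z z)"
   by (intro tendsto_intros bform_bound(1)[OF R x x] bform_bound(1)[OF R z z])
 qed (use le in auto)
 moreover have "Re (bform T z z) <= C*h*(C*h)*W"
  using bform_bound(2)[OF R z z] complex_Re_le_cmod[of "bform T z z"] by linarith
 ultimately show ?thesis by (simp add: power2_eq_square ac_simps)
qed

text \<open>Markov's inequality for the negative moment of order \<open>s\<close>, on the event
  \<open>u <= pd_bound k w\<close>, where the form at time \<open>k\<close> is at least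
  \<open>u * v\<close>. Since \<open>s\<close> is arbitrary, the probability is smaller than any
  prescribed power of \<open>t\<close>.\<close>

lemma small_ball_bform:
 assumes s: "s > 0" and k: "k >= 3" and R: "R > 0" and x: "!!a. norm (x a) <= C * R^a"
  and pos: "u > 0" "v > 0" "t > 0" and low: "v <= (\<Sum>a<k. nsq (x a))"
 shows "emeasure cgauss {w\<in>space cgauss. u <= pd_bound k w \<and> Re (bform (kern_lim w) x x) <= t}
   <= ennreal (exp (16 * real s*(real s+1))*t^s/(u * v)^s)"
proof -
 define f :: "noise => ennreal" where "f w = (if u <= pd_bound k w then 1 else 0)" for w
 have f [measurable]: "f : borel_measurable cgauss" unfolding f_def by measurable
 have past: "f w = f w'" if "!!m x. m < k ==> w (m, x) = w' (m, x)" for w w'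
  using pd_bound_past[of k w w'] that by (simp add: f_def)
 have fin: "f w < \<top>" for w by (simp add: f_def)
 define B where "B = exp (16 * real s*(real s+1))"
 define I where "I = (\<E> w. f w*inv_pow s (Re (bform (kern_lim w) x x)))"
 have "I = (\<E> w. liminf (%N. f w*inv_pow s (Re (sesq N (kern_lim w) x x))))"
  unfolding I_def
 proof (rule nn_integral_cong_AE, use AE_wsum_kern_lim[OF R] in eventually_elim)
  case (elim w)
  obtain W where W: "wpart R (kern_lim w) ----> W"
   by (rule convergent_wpart[OF less_imp_le[OF R] elim]) blast
  have "(%N. sesq N (kern_lim w) x x) ----> bform (kern_lim w) x x"
   by (rule bform_tail(1)[OF less_imp_le[OF R] W x x])
  then have "(%N. Re (sesq N (kern_lim w) x x)) ----> Re (bform (kern_lim w) x x)" by (rule tendsto_Re)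
  then have "(%N. inv_pow s (Re (sesq N (kern_lim w) x x))) ----> inv_pow s (Re (bform (kern_lim w) x x))"
   by (rule continuous_on_tendsto_compose[OF continuous_inv_pow]) auto
  then have "(%N. f w*inv_pow s (Re (sesq N (kern_lim w) x x))) ----> f w*inv_pow s (Re (bform (kern_lim w) x x))"
   using fin by (intro ennreal_tendsto_cmult) auto
  then show ?case by (rule lim_imp_Liminf[symmetric, rotated]) simp
 qed
 also have "... <= liminf (%N. \<E> w. f w*inv_pow s (Re (sesq N (kern_lim w) x x)))"
  by (rule nn_integral_liminf) measurable
 also have "... <= ennreal (B*(1/(u * v)^s))"
 proof (rule Liminf_le)
  show "\<forall>\<^sub>F N in sequentially. (\<E> w. f w*inv_pow s (Re (sesq N (kern_lim w) x x))) <= ennreal (B*(1/(u * v)^s))"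
  proof (rule eventually_sequentiallyI)
   fix N assume N: "k <= N"
   have "(\<E> w. f w*inv_pow s (Re (sesq N (kern_lim w) x x)))
     <= ennreal B*(\<E> w. f w*inv_pow s (Re (sesq N (kern_mat k w) x x)))"
    unfolding B_def by (rule small_ball_kern_lim[OF f s k past fin])
   also have "... <= ennreal B*(\<E> (w::noise). ennreal (1/(u * v)^s))"
   proof (rule mult_left_mono, rule nn_integral_mono)
    fix w :: noise
    show "f w*inv_pow s (Re (sesq N (kern_mat k w) x x)) <= ennreal (1/(u * v)^s)"
    proof (cases "u <= pd_bound k w")
     case True
     have "u * v <= pd_bound k w*(\<Sum>a<k. nsq (x a))"
      using True pos low by (intro mult_mono) auto
     also have "... <= Re (sesq N (kern_mat k w) x x)" by (rule pd_bound_lower[OF N])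
     finally have "inv_pow s (Re (sesq N (kern_mat k w) x x)) <= inv_pow s (u * v)" by (rule inv_pow_antimono)
     then show ?thesis using True pos by (simp add: f_def inv_pow_pos)
    qed (simp add: f_def)
   qed simp
   also have "... = ennreal (B*(1/(u * v)^s))" using pos by (simp add: B_def ennreal_mult[symmetric])
   finally show "(\<E> w. f w*inv_pow s (Re (sesq N (kern_lim w) x x))) <= ennreal (B*(1/(u * v)^s))" .
  qed
 qed simp
 finally have I: "I <= ennreal (B*(1/(u * v)^s))" .
 have "emeasure cgauss {w\<in>space cgauss. u <= pd_bound k w \<and> Re (bform (kern_lim w) x x) <= t}
   = (\<E> w. indicator {w\<in>space cgauss. u <= pd_bound k w \<and> Re (bform (kern_lim w) x x) <= t} w)"
  by (rule nn_integral_indicator[symmetric]) measurable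
 also have "... <= (\<E> w. ennreal (t^s)*(f w*inv_pow s (Re (bform (kern_lim w) x x))))"
 proof (rule nn_integral_mono)
  fix w :: noise
  have "1 = ennreal (t^s)*inv_pow s t" using pos by (simp add: inv_pow_pos ennreal_mult[symmetric])
  also have "... <= ennreal (t^s)*inv_pow s (Re (bform (kern_lim w) x x))" if "Re (bform (kern_lim w) x x) <= t"
   using that by (intro mult_left_mono inv_pow_antimono) auto
  finally show "indicator {w\<in>space cgauss. u <= pd_bound k w \<and> Re (bform (kern_lim w) x x) <= t} w
    <= ennreal (t^s)*(f w*inv_pow s (Re (bform (kern_lim w) x x)))"
   by (auto simp: indicator_def f_def)
 qed
 also have "... = ennreal (t^s)*I" unfolding I_def by (rule nn_integral_cmult) measurable
 also have "... <= ennreal (t^s)*ennreal (B*(1/(u * v)^s))" by (intro mult_left_mono I) simp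
 also have "... = ennreal (B*t^s/(u * v)^s)" using pos by (simp add: ennreal_mult[symmetric] B_def)
 finally show ?thesis by (simp add: B_def)
qed

section \<open>Simultaneous nondegeneracy over Lipschitz families\<close>

text \<open>
 The zero set of the limiting form within a \<open>D\<close>-parameter Lipschitz family is handled by an
 \<open>\<epsilon>\<close>-net: the net has \<open>O(j ^ D)\<close> points, each of them bad with probability \<open>O(j powr (-2 (D + 1)))\<close>.
\<close>

lemma AE_bform_family:
 fixes L :: "(nat => real) => nat => complex"
 assumes k: "k >= 3" and R: "R > 0" and C: "C > 0" and s: "s > 0"
  and bound: "!!p a. (!!i. i < D ==> \<bar>p i\<bar> <= real B) ==> norm (L p a) <= C * R^a"
  and lip: "!!p q h a. (!!i. i < D ==> \<bar>p i\<bar> <= real B) ==> (!!i. i < D ==> \<bar>q i\<bar> <= real B) ==>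
    0 <= h ==> h <= 1 ==> (!!i. i < D ==> \<bar>p i-q i\<bar> <= h) ==> norm (L p a-L q a) <= C*h * R^a"
 shows "AE u in cgauss. \<forall>p. (\<forall>i<D. \<bar>p i\<bar> <= real B) \<longrightarrow> (\<exists>a<k. s <= norm (L p a)) \<longrightarrow> Re (bform (kern_lim u) (L p) (L p)) ~= 0"
proof -
 define box where "box = {p. (\<forall>i<D. \<bar>p i\<bar> <= real B) \<and> (\<exists>a<k. s <= norm (L p a))}"
 \<comment> \<open>Grid of mesh \<open>1/j\<close>: a cell is recorded by the integer parts of its
   scaled parameters.\<close>
 define code where "code j p = (\<lambda>i\<in>{..<D}. \<lfloor>real j * p i\<rfloor>)" for j and p :: "nat => real"
 define cells where "cells j = code j ` box" for j
 \<comment> \<open>The net point is chosen inside the admissible family and not at a grid corner, so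
   that it inherits the lower bound \<open>s\<close> on some coefficient below
   \<open>k\<close>.\<close>
 define rep where "rep j c = (SOME p. p : box \<and> code j p = c)" for j c
 have rep: "rep j c : box \<and> code j (rep j c) = c" if "c : cells j" for j c
  using that unfolding cells_def rep_def by (intro someI_ex[of "%p. p : box \<and> code j p = c"]) auto
 have cells: "cells j \<subseteq> PiE {..<D} (%_. {- int (j*B)..int (j*B)})" for j
 proof
  fix c assume "c : cells j"
  then obtain p where p: "p : box" "c = code j p" by (auto simp: cells_def)
  have "\<lfloor>real j * p i\<rfloor> : {- int (j*B)..int (j*B)}" if "i < D" for i
  proof -
   have "\<bar>real j * p i\<bar> <= real (j*B)" using p(1) that by (auto simp: box_def abs_mult intro!: mult_left_mono)
   then show ?thesis by (auto simp: le_floor_iff floor_le_iff)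
  qed
  then show "c : PiE {..<D} (%_. {- int (j*B)..int (j*B)})" by (auto simp: p(2) code_def)
 qed
 have fin: "finite (cells j)" for j by (rule finite_subset[OF cells]) (intro finite_PiE, auto)
 have card: "real (card (cells j)) <= (2 * real B+1)^D * real j^D" if "j >= 1" for j
 proof -
  have "card (cells j) <= card (PiE {..<D} (%_. {- int (j*B)..int (j*B)}))"
   by (intro card_mono cells finite_PiE) auto
  also have "... = (2*j*B+1)^D" by (simp add: card_PiE nat_add_distrib nat_mult_distrib ac_simps)
  also have "... <= (2*j*B+j)^D" using that by (intro power_mono) auto
  finally have "real (card (cells j)) <= real ((2*j*B+j)^D)" by linarith
  also have "... = (2 * real B+1)^D * real j^D" by (simp add: power_mult_distrib[symmetric] algebra_simps)
  finally show ?thesis .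
 qed
 \<comment> \<open>Countably many values of \<open>w\<close> exhaust an event of full measure; on
   each piece the size of the kernel and the initial lower bound are controlled uniformly.\<close>
 define good where "good w u \<longleftrightarrow> psd (kern_lim u) \<and> wsum R (kern_lim u) <= ennreal (real w) \<and> 1/real w <= pd_bound k u" for w u
 define bad where "bad u \<longleftrightarrow> (\<exists>p\<in>box. Re (bform (kern_lim u) (L p) (L p)) = 0)" for u
 have "AE u in cgauss. \<not> (good w u \<and> bad u)" if w: "w >= 1" for w :: nat
 proof -
  \<comment> \<open>By \<open>bform_le\<close>, a degenerate parameter forces the form at the net
    point of its cell below \<open>t j\<close>.\<close>
  define t where "t j = 2*(C\<^sup>2*(1/real j)^2 * real w)" for j
  define E where "E j c = {u\<in>space cgauss. 1/real w <= pd_bound k u \<and> Re (bform (kern_lim u) (L (rep j c)) (L (rep j c))) <= t j}" for j c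
  have [measurable]: "E j c : sets cgauss" for j c unfolding E_def by measurable
  define N where "N = (\<Inter>j\<in>{1..}. \<Union>c\<in>cells j. E j c)"
  have Nm [measurable]: "N : sets cgauss"
   unfolding N_def using fin by (intro sets.countable_INT' sets.finite_UN) auto
  define S where "S = D+1"
  define Q where "Q = (2 * real B+1)^D*(exp (16 * real S*(real S+1))*(2*C\<^sup>2 * real w)^S/(1/real w * s\<^sup>2)^S)"
  have Nj: "emeasure cgauss N <= ennreal (Q/real j)" if j: "j >= 1" for j
  proof -
   have t: "t j > 0" using C j w by (simp add: t_def)
   have Ele: "emeasure cgauss (E j c) <= ennreal (exp (16 * real S*(real S+1))*t j^S/(1/real w * s\<^sup>2)^S)" if c: "c : cells j" for c
    unfolding E_def
   proof (rule small_ball_bform[OF _ k R])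
    have b: "rep j c : box" using rep[OF c] by simp
    show "norm (L (rep j c) a) <= C * R^a" for a using b by (intro bound) (auto simp: box_def)
    obtain a where a: "a < k" "s <= norm (L (rep j c) a)" using b by (auto simp: box_def)
    have "s\<^sup>2 <= nsq (L (rep j c) a)" using a s by (intro power_mono) auto
    also have "... <= (\<Sum>a<k. nsq (L (rep j c) a))" using a by (intro member_le_sum) auto
    finally show "s\<^sup>2 <= (\<Sum>a<k. nsq (L (rep j c) a))" .
   qed (use t s w in \<open>auto simp: S_def\<close>)
   have "emeasure cgauss N <= emeasure cgauss (\<Union>c\<in>cells j. E j c)"
    using fin j by (intro emeasure_mono sets.finite_UN) (auto simp: N_def)
   also have "... <= (\<Sum>c\<in>cells j. emeasure cgauss (E j c))"
    using fin by (intro emeasure_subadditive_finite) auto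
   also have "... <= (\<Sum>c\<in>cells j. ennreal (exp (16 * real S*(real S+1))*t j^S/(1/real w * s\<^sup>2)^S))"
    by (intro sum_mono Ele)
   also have "... = ennreal (real (card (cells j))*(exp (16 * real S*(real S+1))*t j^S/(1/real w * s\<^sup>2)^S))"
    using t by (subst ennreal_mult) (auto simp: ennreal_of_nat_eq_real_of_nat)
   also have "... <= ennreal (((2 * real B+1)^D * real j^D)*(exp (16 * real S*(real S+1))*t j^S/(1/real w * s\<^sup>2)^S))"
    using t by (intro ennreal_leI mult_right_mono card j) auto
   also have "((2 * real B+1)^D * real j^D)*(exp (16 * real S*(real S+1))*t j^S/(1/real w * s\<^sup>2)^S)
     = Q*(real j^D*(1/(real j)^2)^S)"
   proof -
    have "t j = 2*C\<^sup>2 * real w*(1/(real j)^2)" by (simp add: t_def power_divide)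
    then have "t j^S = (2*C\<^sup>2 * real w)^S*(1/(real j)^2)^S" by (simp only: power_mult_distrib)
    then show ?thesis unfolding Q_def by simp
   qed
   also have "... <= Q*(1/real j)"
   proof (rule mult_left_mono)
    have "real j^D*(1/(real j)^2)^S = 1/real j^(D+2)"
     using j by (simp add: S_def power_divide power_mult[symmetric] power_add[symmetric] divide_simps) (simp add: mult_2)
    also have "... <= 1/real j^1" using j by (intro divide_left_mono power_increasing) auto
    finally show "real j^D*(1/(real j)^2)^S <= 1/real j" by simp
   qed (simp add: Q_def)
   finally show ?thesis using ennreal_leI by simp
  qed
  have "(%j. ennreal (Q/real j)) ----> ennreal 0"
   by (intro tendsto_ennrealI) real_asymp
  then have "emeasure cgauss N <= ennreal 0"
   by (rule LIMSEQ_le_const) (use Nj in \<open>auto intro!: exI[of _ 1]\<close>)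
  then have "N : null_sets cgauss" by (auto simp: null_sets_def)
  moreover have "{u\<in>space cgauss. \<not> \<not> (good w u \<and> bad u)} \<subseteq> N"
  proof (safe, unfold N_def, safe)
   fix u :: noise and j :: nat assume g: "good w u" and b: "bad u" and j: "j >= 1"
   from b obtain p where p: "p : box" "Re (bform (kern_lim u) (L p) (L p)) = 0" by (auto simp: bad_def)
   define q where "q = rep j (code j p)"
   have c: "code j p : cells j" using p by (simp add: cells_def)
   have q: "q : box" "code j q = code j p" using rep[OF c] by (auto simp: q_def)
   have "\<bar>p i-q i\<bar> <= 1/real j" if "i < D" for i
   proof -
    have "\<lfloor>real j*q i\<rfloor> = \<lfloor>real j * p i\<rfloor>" using fun_cong[OF q(2), of i] that by (simp add: code_def)
    then have "\<bar>real j * p i-real j*q i\<bar> <= 1" by linarith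
    then have "real j * \<bar>p i-q i\<bar> <= 1" by (simp add: abs_mult right_diff_distrib[symmetric])
    then show ?thesis using j by (simp add: field_simps)
   qed
   then have "norm (L p a-L q a) <= C*(1/real j) * R^a" for a
    using p q j by (intro lip) (auto simp: box_def)
   then have "Re (bform (kern_lim u) (L q) (L q)) <= 2 * Re (bform (kern_lim u) (L p) (L p))+2*(C\<^sup>2*(1/real j)^2 * real w)"
    using g R p q by (intro bform_le[where R=R] bound) (auto simp: good_def box_def)
   then have "u : E j (code j p)" using g p by (simp add: E_def t_def good_def q_def)
   then show "u : (\<Union>c\<in>cells j. E j c)" using c by blast
  qed
  ultimately show ?thesis by (rule AE_I')
 qed
 then have "AE u in cgauss. \<forall>w::nat. w >= 1 \<longrightarrow> \<not> (good w u \<and> bad u)" by (auto simp: AE_all_countable)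
 then show ?thesis
  using AE_psd_kern_lim AE_wsum_kern_lim[OF R] AE_pd_bound_pos
 proof eventually_elim
  case (elim u)
  obtain W where W: "wsum R (kern_lim u) = ennreal W" using elim(3) by (cases "wsum R (kern_lim u)") auto
  obtain w where w: "real w >= max 1 (max W (1/pd_bound k u))" using real_arch_simple by blast
  then have "1/real w <= pd_bound k u" using elim(4) by (simp add: field_simps)
  then have "good w u" using elim w W by (auto simp: good_def intro!: ennreal_leI)
  then have "\<not> bad u" using elim(1) w by auto
  then show ?case by (auto simp: bad_def box_def)
 qed
qed

text \<open>The family consists of all vectors of length \<open>d\<close>, with \<open>2*d\<close>
  real parameters; \<open>d+3\<close> respects the requirement \<open>k >= 3\<close>. Countably many
  bounds \<open>B\<close> and thresholds \<open>1/real (Suc j)\<close> exhaust the nonzero vectors.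
  The result makes all Gram-Schmidt norms of the limit nonzero.\<close>

lemma AE_kern_lim_finite_sections:
 "AE w in cgauss. \<forall>d v. (\<exists>a<d. v a ~= 0) \<longrightarrow> Re (bform (kern_lim w) (%a. if a < d then v a else 0) (%a. if a < d then v a else 0)) ~= 0"
proof -
 define L :: "nat => (nat => real) => nat => complex"
  where "L d p a = (if a < d then Complex (p a) (p (d+a)) else 0)" for d p a
 have "AE w in cgauss. \<forall>p. (\<forall>i<2*d. \<bar>p i\<bar> <= real B) \<longrightarrow> (\<exists>a<d+3. 1/real (Suc j) <= norm (L d p a)) \<longrightarrow> Re (bform (kern_lim w) (L d p) (L d p)) ~= 0"
  for d B j :: nat
 proof (rule AE_bform_family[where R=1 and C="2 * real B+2"])
  have Lle: "norm (L d p a) <= 2*h" if "!!i. i < 2*d ==> \<bar>p i\<bar> <= h" "0 <= h" for p a h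
  proof (cases "a < d")
   case True
   then have "norm (Complex (p a) (p (d+a))) <= \<bar>p a\<bar>+\<bar>p (d+a)\<bar>" "\<bar>p a\<bar> <= h" "\<bar>p (d+a)\<bar> <= h"
    using that(1)[of a] that(1)[of "d+a"] cmod_le[of "Complex (p a) (p (d+a))"] by auto
   then show ?thesis using True by (simp add: L_def)
  qed (use that in \<open>simp add: L_def\<close>)
  show "norm (L d p a) <= (2 * real B+2)*1^a" if "!!i. i < 2*d ==> \<bar>p i\<bar> <= real B" for p a
   using Lle[of p "real B" a] that by simp
  show "norm (L d p a-L d q a) <= (2 * real B+2)*h*1^a"
   if "0 <= h" "!!i. i < 2*d ==> \<bar>p i-q i\<bar> <= h" for p q h a
  proof -
   have "L d p a-L d q a = L d (%i. p i-q i) a" by (simp add: L_def complex_eq_iff)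
   then have "norm (L d p a-L d q a) <= 2*h" using Lle[of "%i. p i-q i" h a] that by simp
   also have "... <= (2 * real B+2)*h" using that by (intro mult_right_mono) auto
   finally show ?thesis by simp
  qed
 qed auto
 then have "AE w in cgauss. \<forall>d B j. \<forall>p. (\<forall>i<2*d. \<bar>p i\<bar> <= real B) \<longrightarrow> (\<exists>a<d+3. 1/real (Suc j) <= norm (L d p a)) \<longrightarrow> Re (bform (kern_lim w) (L d p) (L d p)) ~= 0"
  unfolding AE_all_countable by blast
 then show ?thesis
 proof eventually_elim
  case (elim w)
  show ?case
  proof (intro allI impI)
   fix d and v :: "nat => complex" assume "\<exists>a<d. v a ~= 0"
   then obtain a where a: "a < d" "v a ~= 0" by blast
   define p where "p i = (if i < d then Re (v i) else Im (v (i-d)))" for i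
   have L: "L d p = (%a. if a < d then v a else 0)" by (auto simp: L_def p_def fun_eq_iff)
   obtain B :: nat where B: "real B >= (\<Sum>i<2*d. \<bar>p i\<bar>)" using real_arch_simple by blast
   have "\<bar>p i\<bar> <= real B" if "i < 2*d" for i
    using B member_le_sum[of i "{..<2*d}" "%i. \<bar>p i\<bar>"] that by simp
   moreover obtain j where "1/real (Suc j) <= norm (L d p a)"
    using reals_Archimedean[of "norm (L d p a)"] a by (auto simp: L inverse_eq_divide intro: less_imp_le)
   ultimately have "Re (bform (kern_lim w) (L d p) (L d p)) ~= 0"
    using elim a by (meson trans_less_add1)
   then show "Re (bform (kern_lim w) (%a. if a < d then v a else 0) (%a. if a < d then v a else 0)) ~= 0"
    unfolding L .
  qed
 qed
qed

definition point_seq :: "nat => (nat => complex) => (nat => complex) => nat => complex" where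
 "point_seq m c z a = (\<Sum>i<m. c i*z i^a)"

text \<open>Vandermonde: distinct point evaluations are independent on polynomials of degree less than \<open>m\<close>.\<close>

lemma point_seq_nonzero:
 assumes inj: "inj_on z {..<m}" and i: "i < m" "c i ~= 0"
 obtains a where "a < m" "point_seq m c z a ~= 0"
proof -
 \<comment> \<open>Unnormalised Lagrange polynomial of the point \<open>z i\<close>, of degree less
   than \<open>m\<close>: pairing its coefficients with \<open>point_seq\<close> isolates
   \<open>c i\<close>.\<close>
 define q where "q = (\<Prod>j\<in>{..<m}-{i}. [:- z j, 1:])"
 have deg: "degree q < m"
 proof -
  have "degree q <= (\<Sum>j\<in>{..<m}-{i}. degree [:- z j, 1:])"
   unfolding q_def using degree_prod_sum_le[of "{..<m}-{i}" "%j. [:- z j, 1:]"] by (simp add: o_def)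
  also have "... = card ({..<m}-{i})" by simp
  also have "... < m" using i by (simp add: card_Diff_subset)
  finally show ?thesis .
 qed
 have q0: "poly q (z j) = 0" if "j < m" "j ~= i" for j
  unfolding q_def poly_prod using that by (intro prod_zero) auto
 have qi: "poly q (z i) ~= 0"
  unfolding q_def poly_prod using inj i by (auto simp: inj_on_def)
 have "(\<Sum>a\<le>degree q. coeff q a * point_seq m c z a) = (\<Sum>j<m. c j * poly q (z j))"
  unfolding point_seq_def poly_altdef sum_distrib_left by (subst sum.swap) (simp add: ac_simps)
 also have "... = c i * poly q (z i)"
  using i q0 by (subst sum.remove[of _ i]) auto
 finally have "(\<Sum>a\<le>degree q. coeff q a * point_seq m c z a) ~= 0" using i qi by simp
 then obtain a where "a <= degree q" "coeff q a * point_seq m c z a ~= 0" by (meson sum.not_neutral_contains_not_neutral atMost_iff)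
 then show ?thesis using that[of a] deg by auto
qed

lemma norm_power_diff_le:
 fixes x y :: complex
 assumes "norm x <= r" "norm y <= r" "norm (x-y) <= h"
 shows "norm (x^a-y^a) <= real a * r^(a-1)*h"
proof (cases "a = 0")
 case False
 have r: "0 <= r" using assms(1) norm_ge_zero order_trans by blast
 have "norm (x^a-y^a) = norm (x-y)*norm (\<Sum>i<a. y^(a-Suc i)*x^i)"
  using power_diff_sumr2[of x a y] by (simp add: norm_mult)
 moreover have "norm (\<Sum>i<a. y^(a-Suc i)*x^i) <= (\<Sum>i<a. r^(a-1))"
 proof (rule sum_norm_le)
  fix i assume "i : {..<a}"
  then have "r^(a-1) = r^(a-Suc i) * r^i" by (simp add: power_add[symmetric])
  then show "norm (y^(a-Suc i)*x^i) <= r^(a-1)"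
   using assms r by (auto simp: norm_mult norm_power intro!: mult_mono power_mono)
 qed
 then have "norm (x-y)*norm (\<Sum>i<a. y^(a-Suc i)*x^i) <= h*(\<Sum>i<a. r^(a-1))"
  using assms(3) order.trans[OF norm_ge_zero assms(3)] by (intro mult_mono) auto
 ultimately show ?thesis by (simp add: ac_simps)
qed simp

text \<open>Points and coefficients vary together, which gives \<open>4*m\<close> real parameters,
  because one null set must serve all configurations. The radius is twice a bound for the points:
  the spare factor \<open>2^a\<close> absorbs the factor \<open>a\<close> in the Lipschitz constant
  of the power \<open>a\<close>.\<close>

lemma AE_kern_lim_points:
 "AE w in cgauss. \<forall>m c z. inj_on z {..<m} \<longrightarrow> (\<exists>i<m. c i ~= 0) \<longrightarrow> Re (bform (kern_lim w) (point_seq m c z) (point_seq m c z)) ~= 0"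
proof -
 define pc pz :: "nat => (nat => real) => nat => complex"
  where "pc m p i = Complex (p i) (p (m+i))" and "pz m p i = Complex (p (2*m+i)) (p (3*m+i))" for m p i
 define L where "L m p = point_seq m (pc m p) (pz m p)" for m p
 have "AE w in cgauss. \<forall>p. (\<forall>i<4*m. \<bar>p i\<bar> <= real B) \<longrightarrow> (\<exists>a<m+3. 1/real (Suc j) <= norm (L m p a)) \<longrightarrow> Re (bform (kern_lim w) (L m p) (L m p)) ~= 0"
  for m B j :: nat
 proof (rule AE_bform_family[where R="2*(2 * real B+1)" and C="real m*(4 * real B+4)+1"])
  define r where "r = 2 * real B+1"
  have r: "r >= 1" by (simp add: r_def)
  have cle: "norm (pc m p i) <= 2*h \<and> norm (pz m p i) <= 2*h" if "!!i. i < 4*m ==> \<bar>p i\<bar> <= h" "i < m" for p i h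
   using that(1)[of i] that(1)[of "m+i"] that(1)[of "2*m+i"] that(1)[of "3*m+i"] that(2)
    cmod_le[of "pc m p i"] cmod_le[of "pz m p i"] by (simp add: pc_def pz_def)
  have two: "r^a <= (2 * r)^a" for a using r by (intro power_mono) auto
  show "norm (L m p a) <= (real m*(4 * real B+4)+1)*(2*(2 * real B+1))^a" if "!!i. i < 4*m ==> \<bar>p i\<bar> <= real B" for p a
  proof -
   have "norm (L m p a) <= (\<Sum>i<m. (2 * real B) * r^a)"
    unfolding L_def point_seq_def
   proof (rule sum_norm_le)
    fix i assume "i : {..<m}"
    then have "norm (pc m p i) <= 2 * real B" "norm (pz m p i) <= r" using cle[of p "real B" i] that by (auto simp: r_def)
    then show "norm (pc m p i * pz m p i^a) <= 2 * real B * r^a"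
     by (auto simp: norm_mult norm_power intro!: mult_mono power_mono)
   qed
   also have "... = (real m*(2 * real B)) * r^a" by simp
   also have "... <= (real m*(4 * real B+4)+1)*(2 * r)^a"
    using r by (intro mult_mono two order.trans[OF mult_left_mono[of "2 * real B" "4 * real B+4"]]) auto
   finally show ?thesis by (simp add: r_def)
  qed
  show "norm (L m p a-L m q a) <= (real m*(4 * real B+4)+1)*h*(2*(2 * real B+1))^a"
   if p: "!!i. i < 4*m ==> \<bar>p i\<bar> <= real B" and q: "!!i. i < 4*m ==> \<bar>q i\<bar> <= real B" and h: "0 <= h"
    and d: "!!i. i < 4*m ==> \<bar>p i-q i\<bar> <= h" for p q h a
  proof -
   have "norm (L m p a-L m q a) = norm (\<Sum>i<m. (pc m p i-pc m q i) * pz m p i^a+pc m q i*(pz m p i^a-pz m q i^a))"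
    unfolding L_def point_seq_def sum_subtractf[symmetric] by (simp add: algebra_simps)
   also have "... <= (\<Sum>i<m. (4 * real B+4)*h*(2 * r)^a)"
   proof (rule sum_norm_le)
    fix i assume "i : {..<m}"
    then have i: "i < m" by simp
    have e: "pc m p i-pc m q i = pc m (%i. p i-q i) i" "pz m p i-pz m q i = pz m (%i. p i-q i) i"
     by (auto simp: pc_def pz_def complex_eq_iff)
    have 1: "norm (pc m p i-pc m q i) <= 2*h" "norm (pz m p i-pz m q i) <= 2*h"
     unfolding e using cle[of "%i. p i-q i" h i] d i by auto
    have 2: "norm (pc m q i) <= 2 * real B" "norm (pz m p i) <= r" "norm (pz m q i) <= r"
     using cle[of p "real B" i] cle[of q "real B" i] p q i by (auto simp: r_def)
    have 3: "norm (pz m p i^a-pz m q i^a) <= 2^a * r^a*(2*h)"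
    proof -
     have "norm (pz m p i^a-pz m q i^a) <= real a * r^(a-1)*(2*h)"
      by (rule norm_power_diff_le) (use 1 2 in auto)
     also have "... <= 2^a * r^a*(2*h)"
      using r h of_nat_less_two_power[of a, where 'a=real]
      by (intro mult_right_mono mult_mono power_increasing) (auto intro: less_imp_le)
     finally show ?thesis .
    qed
    have "norm ((pc m p i-pc m q i) * pz m p i^a+pc m q i*(pz m p i^a-pz m q i^a))
      <= 2*h * r^a+2 * real B*(2^a * r^a*(2*h))"
     unfolding norm_mult[symmetric]
     by (rule order.trans[OF norm_triangle_ineq], unfold norm_mult norm_power,
       rule add_mono[OF mult_mono[OF 1(1) power_mono[OF 2(2)]] mult_mono[OF 2(1) 3]])
       (use h in simp_all)
    also have "... <= 2*h*(2 * r)^a+2 * real B*((2 * r)^a*(2*h))"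
     unfolding power_mult_distrib[symmetric] using h r two by (intro add_mono mult_left_mono mult_right_mono) auto
    also have "... <= (4 * real B+4)*h*(2 * r)^a"
     using h r by (simp add: algebra_simps)
    finally show "norm ((pc m p i-pc m q i) * pz m p i^a+pc m q i*(pz m p i^a-pz m q i^a)) <= (4 * real B+4)*h*(2 * r)^a" .
   qed
   also have "... = real m*(4 * real B+4)*(h*(2 * r)^a)" by simp
   also have "... <= (real m*(4 * real B+4)+1)*(h*(2 * r)^a)"
    using h r by (intro mult_right_mono) auto
   finally show ?thesis by (simp add: r_def mult.assoc)
  qed
 qed (auto simp: add_nonneg_pos)
 then have "AE w in cgauss. \<forall>m B j. \<forall>p. (\<forall>i<4*m. \<bar>p i\<bar> <= real B) \<longrightarrow> (\<exists>a<m+3. 1/real (Suc j) <= norm (L m p a)) \<longrightarrow> Re (bform (kern_lim w) (L m p) (L m p)) ~= 0"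
  unfolding AE_all_countable by blast
 then show ?thesis
 proof eventually_elim
  case (elim w)
  show ?case
  proof (intro allI impI)
   fix m and c z :: "nat => complex" assume inj: "inj_on z {..<m}" and "\<exists>i<m. c i ~= 0"
   then obtain i where i: "i < m" "c i ~= 0" by blast
   obtain a where a: "a < m" "point_seq m c z a ~= 0" using point_seq_nonzero[of z m i c] inj i by blast
   define p where "p i = (if i < m then Re (c i) else if i < 2*m then Im (c (i-m)) else if i < 3*m then Re (z (i-2*m)) else Im (z (i-3*m)))" for i
   have L: "L m p = point_seq m c z"
   proof -
    have "pc m p i = c i" "pz m p i = z i" if "i < m" for i
     using that by (auto simp: pc_def pz_def p_def complex_eq_iff)
    then show ?thesis unfolding L_def point_seq_def by (intro ext sum.cong) auto
   qed
   obtain B :: nat where B: "real B >= (\<Sum>i<4*m. \<bar>p i\<bar>)" using real_arch_simple by blast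
   have "\<bar>p i\<bar> <= real B" if "i < 4*m" for i
    using B member_le_sum[of i "{..<4*m}" "%i. \<bar>p i\<bar>"] that by simp
   moreover obtain j where "1/real (Suc j) <= norm (L m p a)"
    using reals_Archimedean[of "norm (L m p a)"] a by (auto simp: L inverse_eq_divide intro: less_imp_le)
   ultimately have "Re (bform (kern_lim w) (L m p) (L m p)) ~= 0"
    using elim a by (meson trans_less_add1)
   then show "Re (bform (kern_lim w) (point_seq m c z) (point_seq m c z)) ~= 0" unfolding L .
  qed
 qed
qed

section \<open>The Borel sets of uniform convergence on compact sets\<close>

lemma space_borel_of_ucc [simp]: "space (ucc_borel) = entire"
 unfolding borel_of_def topspace_ucc_topology
 by (rule space_measure_of) (auto simp: openin_ucc_topology)

lemma sets_borel_of_ucc: "sets (ucc_borel) = sigma_sets entire {U. openin ucc_topology U}"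
 unfolding borel_of_def topspace_ucc_topology
 by (rule sets_measure_of) (auto simp: openin_ucc_topology)

lemma continuous_map_ucc_measurable:
 assumes "continuous_map ucc_topology euclidean \<Phi>"
 shows "\<Phi> : borel_measurable (ucc_borel)"
proof (rule borel_measurableI)
 fix S :: "'a set" assume "open S"
 then have "openin ucc_topology {x : entire. \<Phi> x : S}"
  using assms unfolding continuous_map_def topspace_ucc_topology by simp
 moreover have "\<Phi> -` S \<inter> entire = {x : entire. \<Phi> x : S}" by auto
 ultimately show "\<Phi> -` S \<inter> space (ucc_borel) : sets (ucc_borel)"
  by (auto simp: sets_borel_of_ucc)
qed

lemma measurable_evaluation [measurable]: "(%f. f z) : borel_measurable (ucc_borel)"
proof (rule continuous_map_ucc_measurable, unfold continuous_map_def topspace_ucc_topology, intro conjI allI impI)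
 fix U :: "complex set" assume U: "openin euclidean U"
 show "openin ucc_topology {f : entire. f z : U}"
  unfolding openin_ucc_topology
 proof (intro conjI ballI)
  fix f assume f: "f : {f : entire. f z : U}"
  then obtain e where e: "e > 0" "!!w. dist w (f z) < e ==> w : U"
   using U by (auto simp: open_dist)
  show "\<exists>C e. compact C \<and> 0 < e \<and> {g : entire. \<forall>z\<in>C. dist (g z) (f z) < e} \<subseteq> {f : entire. f z : U}"
   by (rule exI[of _ "{z}"], rule exI[of _ e]) (use e in auto)
 qed auto
qed auto

lemma entire_power_series:
 assumes "f : entire"
 obtains c where "!!z. (%n. c n*z^n) sums f z"
proof -
 have "(%n. (deriv ^^ n) f 0/fact n*z^n) sums f z" for z
  using holomorphic_power_series[of f 0 "norm z+1" z] assms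
  by (auto simp: entire_def intro: holomorphic_on_subset)
 then show ?thesis by (rule that)
qed

lemma power_series_summable_norm:
 fixes c :: "nat => complex"
 assumes "!!z. (%n. c n*z^n) sums f z" "R >= 0"
 shows "summable (%n. norm (c n) * R^n)"
proof -
 have "summable (%n. norm (c n*(of_real R)^n))"
  by (rule powser_insidea[of c "of_real (R+1)"]) (use assms sums_summable[OF assms(1)] in auto)
 then show ?thesis using assms(2) by (simp add: norm_mult norm_power)
qed

definition list_poly :: "complex list => complex => complex" where
 "list_poly l z = (\<Sum>i<length l. l ! i*z^i)"

text \<open>Truncation of the power series followed by rounding of the coefficients. Each error
  takes half of \<open>e\<close>, and \<open>d\<close> is the rounding accuracy that achieves
  this.\<close>

lemma list_poly_dense:
 assumes D: "!!x e. e > 0 ==> \<exists>y\<in>D. dist y x < e" and f: "f : entire" and e: "e > 0" and R: "R >= 1"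
 obtains l where "l : lists D" "!!z. norm z <= R ==> dist (f z) (list_poly l z) <= e"
proof -
 obtain c where c: "!!z. (%n. c n*z^n) sums f z" by (rule entire_power_series[OF f]) blast
 have sm: "summable (%n. norm (c n) * R^n)" using power_series_summable_norm[of c f R] c R by auto
 have "\<exists>N. \<forall>n\<ge>N. norm (\<Sum>i. norm (c (i+n)) * R^(i+n)) < e/2"
  by (rule suminf_exist_split) (use sm e in auto)
 then obtain n where "norm (\<Sum>i. norm (c (i+n)) * R^(i+n)) < e/2" by blast
 then have n: "(\<Sum>i. norm (c (i+n)) * R^(i+n)) < e/2" unfolding real_norm_def by linarith
 define d where "d = e/(2*(real n+1) * R^n)"
 have d: "d > 0" using e R by (simp add: d_def)
 define y where "y i = (SOME y. y : D \<and> dist y (c i) < d)" for i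
 have y: "y i : D" "dist (y i) (c i) < d" for i
  using someI_ex[of "%y. y : D \<and> dist y (c i) < d"] D[OF d, of "c i"] by (auto simp: y_def)
 show ?thesis
 proof (rule that[of "map y [0..<n]"])
  show "map y [0..<n] : lists D" using y by auto
  fix z :: complex assume z: "norm z <= R"
  have "f z-(\<Sum>i<n. c i*z^i) = (\<Sum>i. c (i+n)*z^(i+n))"
  proof -
   have "summable (%i. c i*z^i)" "f z = (\<Sum>i. c i*z^i)" using c[of z] by (auto simp: sums_iff)
   then show ?thesis using suminf_minus_initial_segment[of "%i. c i*z^i" n] by simp
  qed
  also have "norm ... <= (\<Sum>i. norm (c (i+n)) * R^(i+n))"
  proof (rule order.trans[OF summable_norm suminf_le])
   have s: "summable (%i. norm (c (i+n)) * R^(i+n))" using summable_ignore_initial_segment[OF sm] R by simp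
   show le: "norm (c (i+n)*z^(i+n)) <= norm (c (i+n)) * R^(i+n)" for i
    using z by (auto simp: norm_mult norm_power intro!: mult_left_mono power_mono)
   show "summable (%i. norm (c (i+n)*z^(i+n)))" "summable (%i. norm (c (i+n)*z^(i+n)))"
    by (rule summable_comparison_test'[OF s, of 0], use le in auto)+
   show "summable (%i. norm (c (i+n)) * R^(i+n))" by (rule s)
  qed
  finally have 1: "norm (f z-(\<Sum>i<n. c i*z^i)) < e/2" using n by simp
  have "norm ((\<Sum>i<n. c i*z^i)-(\<Sum>i<n. y i*z^i)) <= (\<Sum>i<n. d * R^n)"
   unfolding sum_subtractf[symmetric] left_diff_distrib[symmetric]
  proof (rule sum_norm_le)
   fix i assume "i : {..<n}"
   then have "norm z^i <= R^n" using z R by (intro order.trans[OF power_mono power_increasing]) auto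
   then show "norm ((c i-y i)*z^i) <= d * R^n"
    using y(2)[of i] d by (auto simp: norm_mult norm_power dist_norm norm_minus_commute intro!: mult_mono)
  qed
  also have "... = e/2*(real n/(real n+1))" using R by (simp add: d_def)
  also have "... <= e/2*1" using e by (intro mult_left_mono) auto
  finally have "norm (f z-(\<Sum>i<n. y i*z^i)) <= e"
   using 1 norm_triangle_ineq[of "f z-(\<Sum>i<n. c i*z^i)" "(\<Sum>i<n. c i*z^i)-(\<Sum>i<n. y i*z^i)"] by simp
  then show "dist (f z) (list_poly (map y [0..<n]) z) <= e" by (simp add: list_poly_def dist_norm)
 qed
qed

text \<open>Point evaluations generate the Borel sets by separability: each open set is a countable
  union of sets \<open>B k m l\<close> around polynomials with coefficients in a countable dense set
  \<open>D\<close>, and membership in such a set is tested at the points of \<open>D\<close> in a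
  disc. \<open>D\<close> thus serves both as set of coefficients and as set of sample
  points.\<close>

lemma measurable_ucc:
 assumes X: "!!z. (%x. X x z) : borel_measurable M" and ent: "!!x. x : space M ==> X x : entire"
 shows "X : measurable M (ucc_borel)"
proof -
 note [measurable] = X
 obtain D :: "complex set" where Dc: "countable D" and Dd: "!!U. open U ==> U ~= {} ==> \<exists>d\<in>D. d : U"
  by (rule countable_dense_setE) blast
 have near: "\<exists>y\<in>D. dist y x < e" if "e > 0" for x e
  using Dd[of "ball x e"] that by (auto simp: dist_commute)
 define B where "B k m l = {g : entire. \<forall>z\<in>D \<inter> ball 0 (real (Suc k)). dist (g z) (list_poly l z) <= 1/real (Suc m)}" for k m :: nat and l
 \<comment> \<open>Continuity extends the closed inequality from the dense sample points to the
   whole open disc.\<close>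
 have full: "dist (g z) (list_poly l z) <= 1/real (Suc m)" if g: "g : B k m l" and z: "z : ball 0 (real (Suc k))" for g z k m l
 proof (rule ccontr)
  assume c: "\<not> dist (g z) (list_poly l z) <= 1/real (Suc m)"
  define U where "U = ball 0 (real (Suc k)) \<inter> (%z. dist (g z) (list_poly l z)) -` {1/real (Suc m)<..}"
  have "continuous_on UNIV g" using g by (auto simp: B_def entire_def intro: holomorphic_on_imp_continuous_on)
  then have "continuous_on UNIV (%z. dist (g z) (list_poly l z))"
   unfolding list_poly_def by (intro continuous_intros) auto
  then have "open U" unfolding U_def by (intro open_Int open_vimage) auto
  moreover have "z : U" using z c by (auto simp: U_def)
  ultimately obtain d where "d : D" "d : U" using Dd[of U] by blast
  then show False using g by (force simp: U_def B_def)
 qed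
 have Bm: "X -` B k m l \<inter> space M : sets M" for k m l
 proof -
  have "X -` B k m l \<inter> space M = {x : space M. \<forall>z\<in>D \<inter> ball 0 (real (Suc k)). dist (X x z) (list_poly l z) <= 1/real (Suc m)}"
   using ent by (auto simp: B_def)
  also have "... = space M-(\<Union>z\<in>D \<inter> ball 0 (real (Suc k)). {x : space M. \<not> dist (X x z) (list_poly l z) <= 1/real (Suc m)})"
   by blast
  also have "... : sets M"
   using Dc by (intro sets.Diff sets.countable_UN'') auto
  finally show ?thesis .
 qed
 show ?thesis
  unfolding borel_of_def topspace_ucc_topology
 proof (rule measurable_measure_of)
  show "X : space M \<rightarrow> entire" using ent by auto
  fix U assume "U : {U. openin ucc_topology U}"
  then have U: "U \<subseteq> entire" "!!f. f : U ==> \<exists>C e. compact C \<and> 0 < e \<and> {g : entire. \<forall>z\<in>C. dist (g z) (f z) < e} \<subseteq> U"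
   by (auto simp: openin_ucc_topology)
  define I where "I = {(k, m, l). l : lists D \<and> B k m l \<subseteq> U}"
  have "I \<subseteq> UNIV \<times> UNIV \<times> lists D" by (auto simp: I_def)
  moreover have "countable (UNIV \<times> UNIV \<times> lists D :: (nat \<times> nat \<times> complex list) set)" using Dc by auto
  ultimately have cI: "countable I" by (rule countable_subset)
  have "U = (\<Union>(k, m, l)\<in>I. B k m l)"
  proof
   show "(\<Union>(k, m, l)\<in>I. B k m l) \<subseteq> U" by (auto simp: I_def)
   show "U \<subseteq> (\<Union>(k, m, l)\<in>I. B k m l)"
   proof
    fix f assume f: "f : U"
    obtain C e where Ce: "compact C" "0 < e" "{g : entire. \<forall>z\<in>C. dist (g z) (f z) < e} \<subseteq> U" using U(2)[OF f] by blast
    obtain m where m: "1/real (Suc m) < e/2" using reals_Archimedean[of "e/2"] Ce(2) by (auto simp: inverse_eq_divide)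
    obtain r where r: "!!z. z : C ==> norm z <= r" using compact_imp_bounded[OF Ce(1)] by (auto simp: bounded_iff)
    obtain k :: nat where "real k >= r" using real_arch_simple by blast
    then have k: "norm z < real (Suc k)" if "z : C" for z using r[OF that] by simp
    obtain l where l: "l : lists D" "!!z. norm z <= real (Suc k) ==> dist (f z) (list_poly l z) <= 1/real (Suc m)"
     by (rule list_poly_dense[OF near, of f "1/real (Suc m)" "real (Suc k)"]) (use f U(1) in auto)
    have "g : U" if g: "g : B k m l" for g
    proof -
     have "dist (g z) (f z) < e" if z: "z : C" for z
      using full[OF g, of z] l(2)[of z] k[OF z] m dist_triangle2[of "g z" "f z" "list_poly l z"] by simp
     then show ?thesis using Ce(3) g by (auto simp: B_def)
    qed
    then have "(k, m, l) : I" using l by (auto simp: I_def)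
    moreover have "f : B k m l" using l f U(1) by (auto simp: B_def)
    ultimately show "f : (\<Union>(k, m, l)\<in>I. B k m l)" by blast
   qed
  qed
  then have "X -` U \<inter> space M = (\<Union>(k, m, l)\<in>I. X -` B k m l \<inter> space M)" by auto
  also have "... : sets M" using cI Bm by (intro sets.countable_UN'') auto
  finally show "X -` U \<inter> space M : sets M" .
 qed (auto simp: openin_ucc_topology)
qed

section \<open>Entire functions from coefficient sequences\<close>

definition wseq :: "real => (nat => complex) => ennreal" where
 "wseq R x = (\<Sum>a. ennreal (norm (x a) * R^a))"

text \<open>The default 0 makes \<open>ent x\<close> entire for every sequence, so that it is a
  total measurable map. Integer radii keep the convergence test countable.\<close>

definition ent :: "(nat => complex) => complex => complex" where
 "ent x z = (if \<forall>R::nat. wseq (real R) x < \<top> then (\<Sum>a. x a*z^a) else 0)"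

lemma measurable_wseq [measurable (raw)]:
 assumes "x : measurable M cgauss"
 shows "(%w. wseq R (x w)) : borel_measurable M"
proof -
 have [measurable]: "(%w. x w a) : borel_measurable M" for a by (rule measurable_cgauss_app) fact
 show ?thesis unfolding wseq_def by measurable
qed

lemma wseq_mono: "0 <= R ==> R <= R' ==> wseq R x <= wseq R' x"
 unfolding wseq_def by (intro suminf_le ennreal_leI mult_left_mono power_mono) auto

lemma wseq_sums:
 assumes "R >= 0" "wseq R x < \<top>" "norm z <= R"
 shows "summable (%a. norm (x a*z^a))" "(%a. x a*z^a) sums (\<Sum>a. x a*z^a)"
  "ennreal (norm (\<Sum>a. x a*z^a)) <= wseq R x"
proof -
 have s: "summable (%a. norm (x a) * R^a)"
  using assms(1,2) unfolding wseq_def by (intro summable_suminf_not_top) (auto simp: less_top)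
 have le: "norm (x a*z^a) <= norm (x a) * R^a" for a
  using assms by (auto simp: norm_mult norm_power intro!: mult_left_mono power_mono)
 show sn: "summable (%a. norm (x a*z^a))" by (rule summable_comparison_test'[OF s, of 0]) (use le in auto)
 then show "(%a. x a*z^a) sums (\<Sum>a. x a*z^a)" by (rule summable_sums[OF summable_norm_cancel])
 have "norm (\<Sum>a. x a*z^a) <= (\<Sum>a. norm (x a) * R^a)"
  by (rule order.trans[OF summable_norm[OF sn] suminf_le[OF le sn s]])
 moreover have "wseq R x = ennreal (\<Sum>a. norm (x a) * R^a)"
  unfolding wseq_def by (rule suminf_ennreal2[OF _ s]) (intro mult_nonneg_nonneg norm_ge_zero zero_le_power assms(1))
 ultimately show "ennreal (norm (\<Sum>a. x a*z^a)) <= wseq R x" by (simp only: ennreal_leI)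
qed

lemma wseq_all:
 assumes "\<forall>R::nat. wseq (real R) x < \<top>" "r >= 0"
 shows "wseq r x < \<top>"
proof -
 obtain R :: nat where "r <= real R" using real_arch_simple by blast
 then have "wseq r x <= wseq (real R) x" using assms(2) by (intro wseq_mono)
 then show ?thesis using assms(1) order.strict_trans1 by blast
qed

lemma ent_sums:
 assumes "\<forall>R::nat. wseq (real R) x < \<top>"
 shows "(%a. x a*z^a) sums ent x z"
 unfolding ent_def using assms wseq_sums(2)[of "norm z" x z] wseq_all[OF assms, of "norm z"] by simp

lemma ent_entire: "ent x : entire"
proof (cases "\<forall>R::nat. wseq (real R) x < \<top>")
 case True
 have "ent x holomorphic_on ball 0 r" if "r > 0" for r
 proof (rule power_series_holomorphic[of 0 r x "ent x"])
  show "(%n. x n*(w-0)^n) sums ent x w" for w using ent_sums[OF True] by simp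
 qed
 then have "ent x field_differentiable (at z)" for z
  using holomorphic_on_imp_differentiable_at[of "ent x" "ball 0 (norm z+1)" z] by (simp add: add_nonneg_pos)
 then show ?thesis unfolding entire_def holomorphic_on_def by (auto intro: field_differentiable_at_within)
next
 case False
 then have "ent x = (%z. 0)" unfolding ent_def by (simp only: if_False)
 then show ?thesis by (simp add: entire_def)
qed

lemma measurable_ent [measurable (raw)]:
 assumes [measurable]: "x : measurable M cgauss"
 shows "(%w. ent (x w)) : measurable M (ucc_borel)"
proof (rule measurable_ucc)
 have [measurable]: "(%w. x w a) : borel_measurable M" for a by (rule measurable_cgauss_app) measurable
 show "(%w. ent (x w) z) : borel_measurable M" for z unfolding ent_def by measurable
qed (rule ent_entire)

lemma wseq_triangle: "wseq R (%a. x a+y a) <= wseq R x+wseq R y" if "R >= 0"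
proof -
 have "ennreal (norm (x a+y a) * R^a) <= ennreal (norm (x a) * R^a)+ennreal (norm (y a) * R^a)" for a
  using that mult_right_mono[OF norm_triangle_ineq[of "x a" "y a"], of "R^a"]
  by (simp add: ennreal_plus[symmetric] distrib_right ennreal_leI del: ennreal_plus)
 then have "wseq R (%a. x a+y a) <= (\<Sum>a. ennreal (norm (x a) * R^a)+ennreal (norm (y a) * R^a))"
  unfolding wseq_def by (intro suminf_le) auto
 also have "... = wseq R x+wseq R y" unfolding wseq_def by (rule suminf_add[symmetric]) auto
 finally show ?thesis .
qed

lemma limitin_ent:
 assumes x: "\<forall>R::nat. wseq (real R) x < \<top>"
  and lim: "!!R::nat. (%n. wseq (real R) (%a. y n a-x a)) ----> 0"
  and y: "!!n. \<forall>R::nat. wseq (real R) (y n) < \<top>"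
 shows "limitin ucc_topology (%n. ent (y n)) (ent x) sequentially"
 unfolding limitin_ucc_topology
proof (intro conjI allI impI)
 fix C :: "complex set" assume "compact C"
 then obtain r where r: "!!z. z : C ==> norm z <= r" using compact_imp_bounded[of C] by (auto simp: bounded_iff)
 obtain R :: nat where R: "r <= real R" using real_arch_simple by blast
 show "uniform_limit C (%n. ent (y n)) (ent x) sequentially"
 proof (rule uniform_limitI)
  fix e :: real assume e: "e > 0"
  have "\<forall>\<^sub>F n in sequentially. wseq (real R) (%a. y n a-x a) < ennreal e"
   using order_tendstoD(2)[OF lim, of "ennreal e"] e by simp
  then show "\<forall>\<^sub>F n in sequentially. \<forall>z\<in>C. dist (ent (y n) z) (ent x z) < e"
  proof eventually_elim
   case (elim n)
   show ?case
   proof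
    fix z assume "z : C"
    then have z: "norm z <= real R" using r R order_trans by blast
    have "(%a. (y n a-x a)*z^a) sums (ent (y n) z-ent x z)"
     using sums_diff[OF ent_sums[OF y, of n z] ent_sums[OF x, of z]] by (simp add: left_diff_distrib)
    then have "ent (y n) z-ent x z = (\<Sum>a. (y n a-x a)*z^a)" by (rule sums_unique)
    moreover have "ennreal (norm (\<Sum>a. (y n a-x a)*z^a)) <= wseq (real R) (%a. y n a-x a)"
     using elim by (intro wseq_sums(3) z) (auto intro: order.strict_trans)
    ultimately have "ennreal (norm (ent (y n) z-ent x z)) < ennreal e" using elim by simp
    then show "dist (ent (y n) z) (ent x z) < e" by (simp add: dist_norm ennreal_less_iff)
   qed
  qed
 qed
qed (auto simp: ent_entire)

text \<open>A quadratic counterpart of \<open>wseq\<close>, whose Gaussian expectation involves only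
  the diagonal of the covariance. The extra \<open>2^a\<close> pays for the comparison with
  \<open>wseq\<close> and with partial sums, against the summable \<open>(1/2)^a\<close>.\<close>

definition esq :: "real => (nat => complex) => ennreal" where
 "esq R x = (\<Sum>a. ennreal (2^a * R^(2*a)*nsq (x a)))"

lemma measurable_esq [measurable (raw)]:
 assumes "x : measurable M cgauss"
 shows "(%w. esq R (x w)) : borel_measurable M"
proof -
 have [measurable]: "(%w. x w a) : borel_measurable M" for a by (rule measurable_cgauss_app) fact
 show ?thesis unfolding esq_def by measurable
qed

lemma suminf_half: "(\<Sum>a. ennreal ((1/2)^a)) = 2"
proof -
 have "(%a. (1/2)^a) sums (2::real)" using geometric_sums[of "1/2::real"] by simp
 then show ?thesis by (subst suminf_ennreal_eq) auto
qed

lemma power_double: "(R::real)^(2*a) = (R^a)^2"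
 by (simp add: power_mult[symmetric] mult.commute)

lemma wseq_le_esq: "R >= 0 ==> wseq R x <= 2+esq R x"
proof -
 assume R: "R >= 0"
 have "ennreal (norm (x a) * R^a) <= ennreal ((1/2)^a)+ennreal (2^a * R^(2*a)*nsq (x a))" for a
 proof -
  define t e where "t = norm (x a) * R^a" and "e = (1/2 :: real)^a"
  have te: "t >= 0" "e > 0" using R by (auto simp: t_def e_def)
  have "0 <= t\<^sup>2/e" using te by simp
  have "t <= e+t\<^sup>2/e"
  proof (cases "t <= e")
   case False
   then have "t*e <= t*t" using te by (intro mult_left_mono) auto
   then have "t <= t\<^sup>2/e" using te by (simp add: pos_le_divide_eq power2_eq_square)
   then show ?thesis using te by linarith
  qed (use \<open>0 <= t\<^sup>2 / e\<close> in linarith)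
  also have "t\<^sup>2/e = 2^a * R^(2*a)*nsq (x a)"
   unfolding power_double by (simp add: t_def e_def power_mult_distrib power_divide ac_simps)
  finally show ?thesis using te by (simp add: t_def e_def ennreal_plus[symmetric] ennreal_leI del: ennreal_plus)
 qed
 then have "wseq R x <= (\<Sum>a. ennreal ((1/2)^a)+ennreal (2^a * R^(2*a)*nsq (x a)))"
  unfolding wseq_def by (intro suminf_le) auto
 also have "... = 2+esq R x" unfolding esq_def by (subst suminf_add[symmetric]) (auto simp: suminf_half)
 finally show ?thesis .
qed

lemma partial_sum_sq_le:
 assumes "R >= 0" "norm z <= R"
 shows "ennreal (nsq (\<Sum>a<N. z^a*x a)) <= 2*esq R x"
proof -
 define u v where "u a = sqrt ((1/2)^a)" and "v a = sqrt (2^a)*(R^a*norm (x a))" for a :: nat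
 have uv: "u a * v a = R^a*norm (x a)" for a
 proof -
  have "u a * v a = sqrt ((1/2)^a*2^a)*(R^a*norm (x a))" unfolding u_def v_def real_sqrt_mult by simp
  then show ?thesis by (simp add: power_mult_distrib[symmetric])
 qed
 have "norm (\<Sum>a<N. z^a*x a) <= (\<Sum>a<N. u a * v a)"
  unfolding uv using assms by (intro sum_norm_le) (auto simp: norm_mult norm_power intro!: mult_right_mono power_mono)
 then have "nsq (\<Sum>a<N. z^a*x a) <= (\<Sum>a<N. u a * v a)^2" by (intro power_mono) auto
 also have "... <= (\<Sum>a<N. (u a)^2)*(\<Sum>a<N. (v a)^2)" by (rule Cauchy_Schwarz_ineq_sum)
 finally have "ennreal (nsq (\<Sum>a<N. z^a*x a)) <= ennreal (\<Sum>a<N. (u a)^2)*ennreal (\<Sum>a<N. (v a)^2)"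
  by (simp add: ennreal_mult[symmetric] sum_nonneg ennreal_leI)
 also have "... <= 2*esq R x"
 proof (rule mult_mono)
  have "(\<Sum>a<N. ennreal ((1/2)^a)) <= 2"
   unfolding suminf_half[symmetric] by (intro sum_le_suminf summableI) auto
  then show "ennreal (\<Sum>a<N. (u a)^2) <= 2" by (simp add: u_def)
  have "(\<Sum>a<N. ennreal (2^a * R^(2*a)*nsq (x a))) <= esq R x"
   unfolding esq_def by (intro sum_le_suminf summableI) auto
  moreover have "(v a)\<^sup>2 = 2^a * R^(2*a)*nsq (x a)" for a
   unfolding power_double by (simp add: v_def power_mult_distrib ac_simps)
  ultimately show "ennreal (\<Sum>a<N. (v a)^2) <= esq R x" by (subst sum_ennreal[symmetric]) auto
 qed auto
 finally show ?thesis .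
qed

lemma measurable_gauss_seq_app [measurable]: "(%r. gauss_seq T r a) : borel_measurable cgauss"
 by (rule measurable_cgauss_app) measurable

lemma nn_integral_esq:
 assumes T: "psd T" and R: "R >= 1"
 shows "(\<E> r. esq R (gauss_seq T r)) <= wsum (2 * R) T"
proof -
 have "(\<E> r. esq R (gauss_seq T r)) = (\<Sum>a. \<E> r. ennreal (2^a * R^(2*a)*nsq (gauss_seq T r a)))"
  unfolding esq_def by (rule nn_integral_suminf) measurable
 also have "... <= wsum (2 * R) T"
  unfolding wsum_def
 proof (intro suminf_le summableI)
  fix a
  have "(\<E> r. ennreal (2^a * R^(2*a)*nsq (gauss_seq T r a)))
    = ennreal (2^a * R^(2*a))*(\<E> r. ennreal (nsq (gauss_seq T r a)))"
   using R by (subst nn_integral_cmult[symmetric]) (auto simp: ennreal_mult[symmetric])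
  also have "(\<E> r. ennreal (nsq (gauss_seq T r a))) = ennreal (Re (T (a, a)))"
   using nn_integral_step_value_sq[OF T, of "%_. 0" a] by (simp add: step_value_def)
  also have "ennreal (2^a * R^(2*a))*ennreal (Re (T (a, a))) <= ennreal ((2 * R)^(a+a)*norm (T (a, a)))"
  proof -
   have "2^a * R^(2*a) <= (2 * R)^(a+a)"
   proof -
    have "1*(2^a * R^(2*a)) <= 2^a*(2^a * R^(2*a))" using R by (intro mult_right_mono) auto
    also have "... = (2 * R)^(a+a)" unfolding mult_2[of a] power_add power_mult_distrib by (simp add: ac_simps)
    finally show ?thesis by simp
   qed
   then show ?thesis
    using R psd_diag[OF T, of a] complex_Re_le_cmod[of "T (a, a)"]
    by (subst ennreal_mult[symmetric]) (auto intro!: ennreal_leI mult_mono)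
  qed
  also have "... <= (\<Sum>b. ennreal ((2 * R)^(a+b)*norm (T (a, b))))"
   using sum_le_suminf[of "%b. ennreal ((2 * R)^(a+b)*norm (T (a, b)))" "{a}"] by simp
  finally show "(\<E> r. ennreal (2^a * R^(2*a)*nsq (gauss_seq T r a))) <= ..." .
 qed
 finally show ?thesis .
qed

lemma AE_esq_finite:
 assumes T: "psd T" "\<forall>R::nat. wsum (real R) T < \<top>"
 shows "AE r in cgauss. \<forall>R::nat. esq (real R) (gauss_seq T r) < \<top>"
proof -
 have "AE r in cgauss. esq (real R) (gauss_seq T r) < \<top>" for R :: nat
 proof -
  have "(\<E> r. esq (real (Suc R)) (gauss_seq T r)) <= wsum (real (2*Suc R)) T"
   using nn_integral_esq[OF T(1), of "real (Suc R)"] by simp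
  also have "... < \<infinity>" using T(2)[rule_format, of "2*Suc R"] by simp
  finally have "(\<E> r. esq (real (Suc R)) (gauss_seq T r)) ~= \<infinity>" by simp
  then have "AE r in cgauss. esq (real (Suc R)) (gauss_seq T r) ~= \<infinity>"
   by (rule nn_integral_PInf_AE[rotated]) measurable
  then show ?thesis
  proof eventually_elim
   case (elim r)
   have "esq (real R) (gauss_seq T r) <= esq (real (Suc R)) (gauss_seq T r)"
    unfolding esq_def by (intro suminf_le ennreal_leI mult_right_mono mult_left_mono power_mono) auto
   then show ?case using elim by (auto simp: less_top[symmetric] top_unique)
  qed
 qed
 then show ?thesis by (simp add: AE_all_countable)
qed

lemma wseq_finite:
 assumes "\<forall>R::nat. esq (real R) x < \<top>"
 shows "\<forall>R::nat. wseq (real R) x < \<top>"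
proof
 fix R :: nat
 have "wseq (real R) x <= 2+esq (real R) x" by (rule wseq_le_esq) simp
 also have "... < \<top>" using assms by simp
 finally show "wseq (real R) x < \<top>" .
qed

section \<open>Gaussian analytic functions with a given coefficient covariance\<close>

definition kern :: "(nat \<times> nat => complex) => complex => complex => complex" where
 "kern T z w = bform T (%a. z^a) (%a. w^a)"

definition gauss_law :: "(nat \<times> nat => complex) => (complex => complex) measure" where
 "gauss_law T = distr cgauss (ucc_borel) (%r. ent (gauss_seq T r))"

lemma sets_gauss_law [simp]: "sets (gauss_law T) = sets (ucc_borel)"
 and space_gauss_law [simp]: "space (gauss_law T) = entire"
 by (simp_all add: gauss_law_def)

text \<open>The sample is jointly measurable in kernel and noise, so its law depends measurably on
  the kernel. This is what a regular conditional law requires.\<close>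

lemma measurable_gauss_law [measurable]: "gauss_law : measurable cgauss (prob_algebra (ucc_borel))"
proof (rule measurable_prob_algebraI)
 show "prob_space (gauss_law T)" for T
  unfolding gauss_law_def by (rule cgauss.prob_space_distr) measurable
 have "(%T. distr cgauss (ucc_borel) (%r. ent (gauss_seq T r))) : measurable cgauss (subprob_algebra (ucc_borel))"
 proof (rule measurable_distr2[where M=cgauss])
  show "(%(T, r). ent (gauss_seq T r)) : measurable (cgauss \<Otimes>\<^sub>M cgauss) (ucc_borel)"
   unfolding case_prod_beta by measurable
  show "(%T. cgauss) : measurable cgauss (subprob_algebra cgauss)"
   by (intro measurable_const) (simp add: space_subprob_algebra prob_space_imp_subprob_space[OF cgauss.prob_space_axioms])
 qed
 then show "gauss_law : measurable cgauss (subprob_algebra (ucc_borel))"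
  unfolding gauss_law_def[abs_def] .
qed

lemma AE_gauss_partial_sums:
 assumes T: "psd T" "\<forall>R::nat. wsum (real R) T < \<top>"
 shows "AE r in cgauss. \<forall>z. (%N. \<Sum>a<N. z^a*gauss_seq T r a) ----> ent (gauss_seq T r) z"
 using AE_esq_finite[OF T]
proof eventually_elim
 case (elim r)
 show ?case using ent_sums[OF wseq_finite[OF elim]] by (simp add: sums_def mult.commute)
qed

lemma integrable_enn2real:
 assumes "f : borel_measurable M" "(\<integral>\<^sup>+x. f x \<partial>M) < \<top>"
 shows "integrable M (%x. enn2real (f x))"
proof (rule integrableI_bounded)
 have "(\<integral>\<^sup>+x. ennreal (norm (enn2real (f x))) \<partial>M) <= (\<integral>\<^sup>+x. f x \<partial>M)"
  by (intro nn_integral_mono) (auto simp: ennreal_enn2real_if)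
 then show "(\<integral>\<^sup>+x. ennreal (norm (enn2real (f x))) \<partial>M) < \<infinity>" using assms(2) by (simp add: order.strict_trans1)
qed (use assms(1) in measurable)

lemma power_seq_le: "norm z <= R ==> norm (z^a :: complex) <= 1 * R^a"
 by (simp add: norm_power power_mono)

lemma wsum_tail:
 assumes "\<forall>R::nat. wsum (real R) T < \<top>"
 obtains W where "wpart (real R) T ----> W"
 by (rule convergent_wpart[of "real R" T]) (use assms in auto)

text \<open>Partial sums of the power series have covariance \<open>sesq N T\<close> and vanishing
  pseudo-covariance; dominated convergence with a multiple of \<open>esq\<close> as majorant passes
  to the limit.\<close>

lemma gauss_covariance:
 assumes T: "psd T" "\<forall>R::nat. wsum (real R) T < \<top>"
 shows "(\<M> r. ent (gauss_seq T r) z*cnj (ent (gauss_seq T r) w)) = kern T z w"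
  and "(\<M> r. ent (gauss_seq T r) z*ent (gauss_seq T r) w) = 0"
proof -
 obtain R :: nat where R0: "real R >= max 1 (max (norm z) (norm w))" using real_arch_simple by blast
 then have R: "real R >= 1" "norm z <= real R" "norm w <= real R" by auto
 define S where "S z N r = (\<Sum>a<N. z^a*gauss_seq T r a)" for z N r
 have [measurable]: "S z N : borel_measurable cgauss" for z N unfolding S_def by measurable
 have [measurable]: "(%r. ent (gauss_seq T r) z) : borel_measurable cgauss" for z
  by (rule measurable_compose[OF measurable_ent measurable_evaluation]) measurable
 define E where "E r = 2*esq (real R) (gauss_seq T r)" for r
 have Em [measurable]: "E : borel_measurable cgauss" unfolding E_def by measurable
 have "(\<E> r. E r) = 2*(\<E> r. esq (real R) (gauss_seq T r))"
  unfolding E_def by (rule nn_integral_cmult) measurable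
 also have "... <= 2*wsum (real (2 * R)) T" using nn_integral_esq[OF T(1) R(1)] by (intro mult_left_mono) auto
 also have "... < \<top>" using T(2)[rule_format, of "2 * R"] by (simp add: ennreal_mult_less_top)
 finally have iE: "integrable cgauss (%r. enn2real (E r))" by (rule integrable_enn2real[OF Em])
 have dom: "AE r in cgauss. norm (S z N r)*norm (S w N r) <= enn2real (E r)" for N
  using AE_esq_finite[OF T]
 proof eventually_elim
  case (elim r)
  have fin: "E r < \<top>" using elim by (simp add: E_def ennreal_mult_less_top)
  have b: "nsq (S x N r) <= enn2real (E r)" if "norm x <= real R" for x
  proof -
   have "ennreal (nsq (S x N r)) <= E r"
    unfolding S_def E_def using that by (intro partial_sum_sq_le) auto
   from enn2real_mono[OF this fin] show ?thesis by simp
  qed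
  have "2*(norm (S z N r)*norm (S w N r)) <= nsq (S z N r)+nsq (S w N r)"
   using sum_squares_bound[of "norm (S z N r)" "norm (S w N r)"] by simp
  then show ?case using b[OF R(2)] b[OF R(3)] by linarith
 qed
 have lim: "AE r in cgauss. (%N. S x N r) ----> ent (gauss_seq T r) x" for x
  using AE_gauss_partial_sums[OF T] by eventually_elim (simp add: S_def)
 have "(%N. \<M> r. S z N r*cnj (S w N r)) ----> (\<M> r. ent (gauss_seq T r) z*cnj (ent (gauss_seq T r) w))"
 proof (rule integral_dominated_convergence[OF _ _ iE])
  show "AE r in cgauss. (%N. S z N r*cnj (S w N r)) ----> ent (gauss_seq T r) z*cnj (ent (gauss_seq T r) w)"
   using lim[of z] lim[of w] by eventually_elim (intro tendsto_intros)
 qed (use dom in \<open>auto simp: norm_mult\<close>)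
 moreover have "(\<M> r. S z N r*cnj (S w N r)) = sesq N T (%a. z^a) (%a. w^a)" for N
 proof -
  have "S z N r*cnj (S w N r) = (\<Sum>a<N. \<Sum>b<N. z^a*cnj (w^b)*(gauss_seq T r a*cnj (gauss_seq T r b)))" for r
   unfolding S_def cnj_sum sum_product by (simp add: ac_simps)
  then show ?thesis
   unfolding sesq_def
   by (simp add: Bochner_Integration.integral_sum Bochner_Integration.integrable_sum integrable_gauss_seq_mult integral_gauss_seq_mult_cnj[OF T(1)] del: complex_cnj_power)
 qed
 moreover obtain W where W: "wpart (real R) T ----> W" by (rule wsum_tail[OF T(2)])
 moreover have "(%N. sesq N T (%a. z^a) (%a. w^a)) ----> kern T z w"
  unfolding kern_def by (rule bform_tail(1)[OF _ W power_seq_le[OF R(2)] power_seq_le[OF R(3)]]) simp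
 ultimately show "(\<M> r. ent (gauss_seq T r) z*cnj (ent (gauss_seq T r) w)) = kern T z w"
  by (simp add: LIMSEQ_unique)
 have "(%N. \<M> r. S z N r*S w N r) ----> (\<M> r. ent (gauss_seq T r) z*ent (gauss_seq T r) w)"
 proof (rule integral_dominated_convergence[OF _ _ iE])
  show "AE r in cgauss. (%N. S z N r*S w N r) ----> ent (gauss_seq T r) z*ent (gauss_seq T r) w"
   using lim[of z] lim[of w] by eventually_elim (intro tendsto_intros)
 qed (use dom in \<open>auto simp: norm_mult\<close>)
 moreover have "(\<M> r. S z N r*S w N r) = 0" for N
 proof -
  have "S z N r*S w N r = (\<Sum>a<N. \<Sum>b<N. z^a*w^b*(gauss_seq T r a*gauss_seq T r b))" for r
   unfolding S_def sum_product by (simp add: ac_simps)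
  then show ?thesis
   by (simp add: Bochner_Integration.integral_sum Bochner_Integration.integrable_sum integrable_gauss_seq_mult integral_gauss_seq_mult)
 qed
 ultimately show "(\<M> r. ent (gauss_seq T r) z*ent (gauss_seq T r) w) = 0"
  by (simp add: LIMSEQ_unique)
qed

lemma distributed_Re_std: "distributed stdc lborel Re (normal_density 0 (sqrt (1/2)))"
proof -
 interpret prob_space half_normal by (rule prob_space_half_normal)
 have "distr stdc lborel Re = half_normal"
 proof (rule measure_eqI)
  fix A assume "A : sets (distr stdc lborel Re)"
  then have A [measurable]: "A : sets borel" by simp
  have "emeasure (distr stdc lborel Re) A = (\<G> w. indicator A (Re w))"
   by (subst nn_integral_indicator[symmetric], simp, subst nn_integral_distr) (auto simp: measurable_std_borel)
  also have "... = emeasure half_normal A"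
   by (subst nn_integral_std) (auto simp: emeasure_space_1[simplified])
  finally show "emeasure (distr stdc lborel Re) A = emeasure half_normal A" .
 qed simp
 then show ?thesis unfolding distributed_def by (auto simp: measurable_std_borel)
qed

lemma distr_gauss_functional:
 assumes T: "psd T"
 shows "distr cgauss borel (%r. \<Sum>a<N. l a*gauss_seq T r a)
  = distr stdc borel (%w. of_real (sqrt (Re (sesq N T l l)))*w)"
proof (rule measure_eqI)
 fix A assume "A : sets (distr cgauss borel (%r. \<Sum>a<N. l a*gauss_seq T r a))"
 then have A [measurable]: "A : sets borel" by simp
 have [measurable]: "(%w. complex_of_real (sqrt (Re (sesq N T l l)))*w) : measurable stdc borel"
  by (rule measurable_std_borel) measurable
 show "emeasure (distr cgauss borel (%r. \<Sum>a<N. l a*gauss_seq T r a)) A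
   = emeasure (distr stdc borel (%w. of_real (sqrt (Re (sesq N T l l)))*w)) A"
  using nn_integral_gauss_functional[OF T, where f="indicator A" and N=N and l=l]
  by (simp add: nn_integral_indicator[symmetric] nn_integral_distr del: nn_integral_indicator)
qed simp

text \<open>For partial sums the functional is a scalar Gaussian governed by
  \<open>sesq N T l l\<close>. Samples and variances converge, so the characteristic functions agree
  in the limit and the law is that of \<open>\<sigma> * Re w\<close>; the point mass arises for
  \<open>\<sigma> = 0\<close>.\<close>

lemma gauss_functional_normal:
 assumes T: "psd T" "\<forall>R::nat. wsum (real R) T < \<top>" and S: "finite S"
 shows "centered_normal (gauss_law T) (%f. Re (\<Sum>z\<in>S. c z*f z))"
proof -
 define l where "l a = (\<Sum>z\<in>S. c z*z^a)" for a
 define X where "X f = Re (\<Sum>z\<in>S. c z*f z)" for f :: "complex => complex"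
 have Xm [measurable]: "X : borel_measurable (ucc_borel)" unfolding X_def by measurable
 define \<sigma> where "\<sigma> = sqrt (Re (bform T l l))"
 have em [measurable]: "(%r. ent (gauss_seq T r)) : measurable cgauss (ucc_borel)" by measurable
 have XL: "distr (gauss_law T) borel X = distr cgauss borel (%r. X (ent (gauss_seq T r)))"
  unfolding gauss_law_def by (subst distr_distr) (auto simp: o_def)
 have dX: "distr (gauss_law T) borel X = distr stdc borel (%w. \<sigma> * Re w)"
 proof (rule Levy_uniqueness)
  have [measurable]: "(%w. c * Re w) : borel_measurable stdc" for c by (rule measurable_std_borel) measurable
  show "real_distribution (distr stdc borel (%w. \<sigma> * Re w))" by (rule std.real_distribution_distr) measurable
  show "real_distribution (distr (gauss_law T) borel X)" unfolding XL by (rule cgauss.real_distribution_distr) measurable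
  show "char (distr (gauss_law T) borel X) = char (distr stdc borel (%w. \<sigma> * Re w))"
  proof
   fix t
   define F where "F w = iexp (t * Re w)" for w :: complex
   have [measurable]: "F : borel_measurable borel" unfolding F_def by measurable
   have nF: "norm (F w) = 1" for w by (simp add: F_def)
   have cF: "continuous_on UNIV F" unfolding F_def by (intro continuous_intros)
   define s where "s N = sqrt (Re (sesq N T l l))" for N
   have "(%N. \<M> r. F (\<Sum>a<N. l a*gauss_seq T r a)) ----> (\<M> r. iexp (t*X (ent (gauss_seq T r))))"
   proof (rule integral_dominated_convergence[where w="%_. 1"])
    show "AE r in cgauss. (%N. F (\<Sum>a<N. l a*gauss_seq T r a)) ----> iexp (t*X (ent (gauss_seq T r)))"
     using AE_gauss_partial_sums[OF T]
    proof eventually_elim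
     case (elim r)
     have "(\<Sum>a<N. l a*gauss_seq T r a) = (\<Sum>z\<in>S. c z*(\<Sum>a<N. z^a*gauss_seq T r a))" for N
      unfolding l_def sum_distrib_left sum_distrib_right by (subst sum.swap) (simp add: ac_simps)
     moreover have "(%N. F (\<Sum>z\<in>S. c z*(\<Sum>a<N. z^a*gauss_seq T r a))) ----> F (\<Sum>z\<in>S. c z*ent (gauss_seq T r) z)"
      using elim by (intro continuous_on_tendsto_compose[OF cF] tendsto_intros) auto
     ultimately show ?case by (simp add: F_def X_def)
    qed
   qed (use nF in \<open>simp_all add: F_def\<close>)
   moreover have "(\<M> r. F (\<Sum>a<N. l a*gauss_seq T r a)) = (\<integral>w. F (of_real (s N)*w) \<partial>stdc)" for N
   proof -
    have [measurable]: "(%w. complex_of_real (s N)*w) : measurable stdc borel" by (rule measurable_std_borel) measurable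
    have "(\<M> r. F (\<Sum>a<N. l a*gauss_seq T r a)) = (\<integral>x. F x \<partial>distr cgauss borel (%r. \<Sum>a<N. l a*gauss_seq T r a))"
     by (rule integral_distr[symmetric]) measurable
    also have "... = (\<integral>w. F (of_real (s N)*w) \<partial>stdc)"
     unfolding distr_gauss_functional[OF T(1)] s_def[symmetric] by (rule integral_distr) measurable
    finally show ?thesis .
   qed
   moreover have "(%N. \<integral>w. F (of_real (s N)*w) \<partial>stdc) ----> (\<integral>w. F (of_real \<sigma>*w) \<partial>stdc)"
   proof (rule integral_dominated_convergence[where w="%_. 1"])
    obtain R :: nat where R: "!!z. z : S ==> norm z <= real R"
    proof -
     obtain R :: nat where "real R >= (\<Sum>z\<in>S. norm z)" using real_arch_simple by blast
     then show ?thesis using that member_le_sum[of _ S norm] S by (meson norm_ge_zero order_trans)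
    qed
    have l: "norm (l a) <= (\<Sum>z\<in>S. norm (c z)) * real R^a" for a
     unfolding l_def sum_distrib_right using R
     by (intro sum_norm_le) (auto simp: norm_mult norm_power intro!: mult_left_mono power_mono)
    obtain W where W: "wpart (real R) T ----> W" by (rule wsum_tail[OF T(2)])
    have "(%N. sesq N T l l) ----> bform T l l" by (rule bform_tail(1)[OF _ W l l]) simp
    then have "s ----> \<sigma>" unfolding s_def \<sigma>_def by (intro tendsto_intros)
    then show "AE w in std_complex_gaussian. (%N. F (of_real (s N)*w)) ----> F (of_real \<sigma>*w)"
     by (intro AE_I2 continuous_on_tendsto_compose[OF cF] tendsto_intros) auto
   qed (use nF in \<open>auto intro!: measurable_std_borel\<close>)
   ultimately have "(\<M> r. iexp (t*X (ent (gauss_seq T r)))) = (\<integral>w. F (of_real \<sigma>*w) \<partial>stdc)"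
    by (simp add: LIMSEQ_unique)
   then show "char (distr (gauss_law T) borel X) t = char (distr stdc borel (%w. \<sigma> * Re w)) t"
    unfolding XL char_def by (subst (1 2) integral_distr) (auto simp: F_def intro!: measurable_std_borel)
  qed
 qed
 have XM [measurable]: "X : borel_measurable (gauss_law T)" unfolding gauss_law_def by measurable
 show ?thesis
  unfolding centered_normal_def X_def[symmetric]
 proof (intro conjI XM)
  have "\<sigma> >= 0 \<or> \<sigma> < 0" by linarith
  show "(AE f in gauss_law T. X f = 0) \<or> (\<exists>\<sigma>>0. distributed (gauss_law T) lborel X (normal_density 0 \<sigma>))"
  proof (cases "\<sigma> = 0")
   case True
   then have "AE x in distr (gauss_law T) borel X. x = 0" unfolding dX by (subst AE_distr_iff) auto
   then have "AE f in gauss_law T. X f = 0" by (rule AE_distrD[OF XM])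
   then show ?thesis ..
  next
   case False
   have d: "distributed stdc lborel (%w. 0+\<sigma> * Re w) (normal_density (0+\<sigma>*0) (\<bar>\<sigma>\<bar> * sqrt (1/2)))"
    by (rule std.normal_density_affine[OF distributed_Re_std]) (use False in auto)
   have "distr (gauss_law T) lborel X = distr (gauss_law T) borel X" by (rule distr_cong) auto
   also have "... = distr stdc lborel (%w. \<sigma> * Re w)" unfolding dX by (rule distr_cong) auto
   also have "... = density lborel (normal_density 0 (\<bar>\<sigma>\<bar> * sqrt (1/2)))"
    using d by (simp add: distributed_def)
   finally have "distributed (gauss_law T) lborel X (normal_density 0 (\<bar>\<sigma>\<bar> * sqrt (1/2)))"
    unfolding distributed_def by simp
   moreover have "\<bar>\<sigma>\<bar> * sqrt (1/2) > 0" using False by simp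
   ultimately show ?thesis by blast
  qed
 qed
qed

lemma gauss_law_field:
 assumes T: "psd T" "\<forall>R::nat. wsum (real R) T < \<top>"
 shows "complex_gaussian_field (gauss_law T) (%z f. f z) (kern T)"
  and "gaussian_analytic_function (gauss_law T) (%z f. f z) (kern T)"
proof -
 have em [measurable]: "(%r. ent (gauss_seq T r)) : measurable cgauss (ucc_borel)" by measurable
 show "complex_gaussian_field (gauss_law T) (%z f. f z) (kern T)"
  unfolding complex_gaussian_field_def
 proof (intro conjI allI impI)
  show "prob_space (gauss_law T)" unfolding gauss_law_def by (rule cgauss.prob_space_distr) measurable
  show "(%f. f z) : borel_measurable (gauss_law T)" for z unfolding gauss_law_def by measurable
  show "centered_normal (gauss_law T) (%f. Re (\<Sum>z\<in>S. c z*f z))" if "finite S" for S c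
   by (rule gauss_functional_normal[OF T that])
  show "(\<integral>f. f z*f w \<partial>gauss_law T) = 0" for z w
   unfolding gauss_law_def by (subst integral_distr) (simp_all add: gauss_covariance[OF T])
  show "(\<integral>f. f z*cnj (f w) \<partial>gauss_law T) = kern T z w" for z w
   unfolding gauss_law_def by (subst integral_distr) (simp_all add: gauss_covariance[OF T])
 qed
 then show "gaussian_analytic_function (gauss_law T) (%z f. f z) (kern T)"
  unfolding gaussian_analytic_function_def
  by (auto intro!: AE_I2 simp: entire_def)
qed

lemma ennreal_term_le_suminf: "f a <= (\<Sum>b::nat. f b :: ennreal)"
 using sum_le_suminf[of f "{a}"] by simp

lemma wsum_term_le: "wsum R T >= (\<Sum>b. ennreal (R^(a+b)*norm (T (a, b))))"
 unfolding wsum_def by (rule ennreal_term_le_suminf[of "%a. \<Sum>b. ennreal (R^(a+b)*norm (T (a, b)))"])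

text \<open>The kernel as an iterated power series. This form allows the Taylor coefficients to be
  recovered in one variable at a time.\<close>

lemma kern_sums:
 assumes T: "\<forall>R::nat. wsum (real R) T < \<top>"
 shows "(%b. T (a, b)*cnj (w^b)) sums (\<Sum>b. T (a, b)*cnj (w^b))" (is ?row)
  and "(%a. (\<Sum>b. T (a, b)*cnj (w^b))*z^a) sums kern T z w"
proof -
 have row: "(%b. T (a, b)*cnj (w^b)) sums (\<Sum>b. T (a, b)*cnj (w^b))" for a
 proof -
  obtain R :: nat where R: "real R >= max 1 (norm w)" using real_arch_simple by blast
  have "wsum (real R) T < \<top>" using T by blast
  then have "(\<Sum>b. ennreal (real R^(a+b)*norm (T (a, b)))) ~= \<top>"
   using wsum_term_le[where T=T and a=a and R="real R"] by (auto simp: less_top top_unique)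
  then have s: "summable (%b. real R^(a+b)*norm (T (a, b)))" by (intro summable_suminf_not_top) auto
  have "norm (T (a, b)*cnj (w^b)) <= real R^(a+b)*norm (T (a, b))" for b
  proof -
   have "1*norm w^b <= real R^a * real R^b" using R by (intro mult_mono power_mono one_le_power) auto
   then show ?thesis by (simp add: norm_mult norm_power power_add mult_right_mono mult.commute[of "norm (T (a, b))"])
  qed
  then have "summable (%b. T (a, b)*cnj (w^b))" by (intro summable_comparison_test'[OF s, of 0]) auto
  then show ?thesis by (rule summable_sums)
 qed
 then show ?row .
 obtain R :: nat where R: "real R >= max (norm z) (norm w)" using real_arch_simple by blast
 obtain W where W: "wpart (real R) T ----> W" by (rule wsum_tail[OF T])
 let ?x = "%a. z^a" and ?y = "%a. w^a"
 have b: "norm (?x a) <= 1 * real R^a" "norm (?y a) <= 1 * real R^a" for a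
  using R power_seq_le[of z "real R" a] power_seq_le[of w "real R" a] by auto
 have "(%N. (\<Sum>a<N. (\<Sum>b. T (a, b)*cnj (w^b))*z^a)-sesq N T ?x ?y) ----> 0"
 proof (rule Lim_null_comparison)
  show "(%N. 1*1*(W-wpart (real R) T N)) ----> 0" using tendsto_diff[OF tendsto_const W, of W] by simp
  show "\<forall>\<^sub>F N in sequentially. norm ((\<Sum>a<N. (\<Sum>b. T (a, b)*cnj (w^b))*z^a)-sesq N T ?x ?y) <= 1*1*(W-wpart (real R) T N)"
  proof (rule always_eventually, rule)
   fix N
   \<comment> \<open>Cutting only the first variable at \<open>N\<close> keeps whole rows; the
     difference from the square truncation is still bounded by the tail of
     \<open>wpart\<close>.\<close>
   define x' where "x' a = (if a < N then z^a else 0)" for a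
   have x': "norm (x' a) <= 1 * real R^a" for a using b(1)[of a] by (simp add: x'_def)
   have "(%M. sesq M T x' ?y) ----> bform T x' ?y" by (rule bform_tail(1)[OF _ W x' b(2)]) simp
   moreover have "(%M. sesq M T x' ?y) ----> (\<Sum>a<N. (\<Sum>b. T (a, b)*cnj (w^b))*z^a)"
   proof (rule Lim_transform_eventually)
    show "(%M. \<Sum>a<N. (\<Sum>b<M. T (a, b)*cnj (w^b))*z^a) ----> (\<Sum>a<N. (\<Sum>b. T (a, b)*cnj (w^b))*z^a)"
     using row by (intro tendsto_intros) (auto simp: sums_def)
    show "\<forall>\<^sub>F M in sequentially. (\<Sum>a<N. (\<Sum>b<M. T (a, b)*cnj (w^b))*z^a) = sesq M T x' ?y"
    proof (rule eventually_sequentiallyI)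
     fix M assume "N <= M"
     then have "sesq M T x' ?y = (\<Sum>a<N. \<Sum>b<M. x' a*cnj (?y b)*T (a, b))"
      unfolding sesq_def by (intro sum.mono_neutral_right) (auto simp: x'_def)
     also have "... = (\<Sum>a<N. (\<Sum>b<M. T (a, b)*cnj (w^b))*z^a)"
      unfolding sum_distrib_right by (intro sum.cong) (auto simp: x'_def)
     finally show "(\<Sum>a<N. (\<Sum>b<M. T (a, b)*cnj (w^b))*z^a) = sesq M T x' ?y" ..
    qed
   qed
   ultimately have e: "bform T x' ?y = (\<Sum>a<N. (\<Sum>b. T (a, b)*cnj (w^b))*z^a)" by (rule LIMSEQ_unique)
   have "sesq N T x' ?y = sesq N T ?x ?y" unfolding sesq_def x'_def by (intro sum.cong) auto
   then show "norm ((\<Sum>a<N. (\<Sum>b. T (a, b)*cnj (w^b))*z^a)-sesq N T ?x ?y) <= 1*1*(W-wpart (real R) T N)"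
    using bform_tail(2)[OF _ W x' b(2), of N] by (simp add: e)
  qed
 qed
 from tendsto_add[OF this bform_tail(1)[OF _ W b(1) b(2)]]
 show "(%a. (\<Sum>b. T (a, b)*cnj (w^b))*z^a) sums kern T z w" by (simp add: sums_def kern_def)
qed

section \<open>Recovering the coefficients from the kernel\<close>

text \<open>
 Taylor coefficients are recovered from the values at \<open>1 / (n + 1)\<close> by successive limits. This
 makes the conditional law a measurable function of the kernel.
\<close>

fun taylor_coeff :: "(nat => complex) => nat => complex" where
 "taylor_coeff s a = lim (%n. (s n-(\<Sum>i<a. taylor_coeff s i*(1 / of_nat (Suc n))^i))/(1 / of_nat (Suc n))^a)"

declare taylor_coeff.simps [simp del]

lemma measurable_taylor_coeff [measurable (raw)]:
 assumes [measurable]: "!!n. (%x. s x n) : borel_measurable M"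
 shows "(%x. taylor_coeff (s x) a) : borel_measurable M"
proof (induction a rule: less_induct)
 case (less a)
 then have [measurable]: "(%x. \<Sum>i<a. taylor_coeff (s x) i*(1 / of_nat (Suc n))^i) : borel_measurable M" for n
  by (intro borel_measurable_sum borel_measurable_times borel_measurable_const) auto
 show ?case by (subst taylor_coeff.simps) measurable
qed

lemma taylor_coeff_eq:
 assumes s: "!!n. (%a. c a*(1 / of_nat (Suc n))^a) sums s n"
 shows "taylor_coeff s a = c a"
proof (induction a rule: less_induct)
 case (less a)
 define h where "h n = (1 / of_nat (Suc n) :: complex)" for n
 define G where "G x = (\<Sum>p. c (p+a)*x^p)" for x
 have "summable (%p. c (p+a)*1^p)"
  using sums_summable[OF s[of 0]] summable_iff_shift[of c a] by simp
 then have "isCont G 0" unfolding G_def by (rule isCont_powser) simp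
 moreover have "h ----> 0" unfolding h_def by (rule lim_1_over_n[THEN LIMSEQ_Suc])
 ultimately have "(%n. G (h n)) ----> G 0" by (rule isCont_tendsto_compose)
 moreover have "G 0 = c a" unfolding G_def using powser_zero[of "%p. c (p+a)"] by simp
 moreover have "G (h n) = (s n-(\<Sum>i<a. taylor_coeff s i*h n^i))/h n^a" for n
 proof -
  have h0: "h n ~= 0" by (simp add: h_def del: of_nat_Suc)
  have "(%p. c (p+a)*h n^(p+a)) sums (s n-(\<Sum>i<a. c i*h n^i))"
   using s[of n] by (intro sums_split_initial_segment) (simp add: h_def)
  then have "(%p. c (p+a)*h n^(p+a)/h n^a) sums ((s n-(\<Sum>i<a. c i*h n^i))/h n^a)" by (rule sums_divide)
  then have "G (h n) = (s n-(\<Sum>i<a. c i*h n^i))/h n^a"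
   using h0 unfolding G_def by (simp add: power_add sums_iff)
  then show ?thesis using less by simp
 qed
 ultimately show ?case by (subst taylor_coeff.simps) (simp add: h_def[symmetric] limI del: of_nat_Suc)
qed

text \<open>The inner limits act on the first argument, the outer ones on the second. At the real
  points \<open>1 / of_nat (Suc m)\<close> conjugation is trivial, so the antianalytic variable is
  treated like the analytic one.\<close>

definition kernel_coeffs :: "(complex \<times> complex => complex) => nat \<times> nat => complex" where
 "kernel_coeffs k = (%(a, b). taylor_coeff (%m. taylor_coeff (%n. k (1 / of_nat (Suc n), 1 / of_nat (Suc m))) a) b)"

lemma measurable_kernel_coeffs: "kernel_coeffs : measurable kernel_space cgauss"
proof (rule measurable_into_cgauss)
 fix p :: "nat \<times> nat"
 have [measurable]: "(%k. k q) : borel_measurable kernel_space" for q by (rule measurable_component_singleton) simp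
 show "(%k. kernel_coeffs k p) : borel_measurable kernel_space"
  unfolding kernel_coeffs_def case_prod_beta by measurable
qed

lemma kernel_coeffs_kern:
 assumes "\<forall>R::nat. wsum (real R) T < \<top>"
 shows "kernel_coeffs (case_prod (kern T)) = T"
proof -
 have "taylor_coeff (%n. kern T (1 / of_nat (Suc n)) (1 / of_nat (Suc m))) a = (\<Sum>b. T (a, b)*cnj ((1 / of_nat (Suc m))^b))" for a m
  by (rule taylor_coeff_eq) (rule kern_sums(2)[OF assms])
 moreover have "taylor_coeff (%m. \<Sum>b. T (a, b)*cnj ((1 / of_nat (Suc m))^b)) b = T (a, b)" for a b
 proof (rule taylor_coeff_eq)
  show "(%b. T (a, b)*(1 / of_nat (Suc n))^b) sums (\<Sum>b. T (a, b)*cnj ((1 / of_nat (Suc n))^b))" for n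
   using kern_sums(1)[OF assms, of a "1 / of_nat (Suc n)"] by (simp del: of_nat_Suc)
 qed
 ultimately show ?thesis by (auto simp: kernel_coeffs_def fun_eq_iff simp del: of_nat_Suc)
qed

section \<open>Kernels with the required properties\<close>

definition nice :: "(nat \<times> nat => complex) => bool" where
 "nice T \<longleftrightarrow> psd T \<and> (\<forall>R::nat. wsum (real R) T < \<top>) \<and>
   (\<forall>m c z. inj_on z {..<m} \<longrightarrow> (\<exists>i<m. c i ~= 0) \<longrightarrow> Re (bform T (point_seq m c z) (point_seq m c z)) ~= 0)"

lemma kern_hermitian: "psd T ==> kern T w z = cnj (kern T z w)" if T: "\<forall>R::nat. wsum (real R) T < \<top>"
proof -
 assume p: "psd T"
 obtain R :: nat where R: "real R >= max (norm z) (norm w)" using real_arch_simple by blast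
 obtain W where W: "wpart (real R) T ----> W" by (rule wsum_tail[OF T])
 have b: "norm (z^a) <= 1 * real R^a" "norm (w^a) <= 1 * real R^a" for a
  using R power_seq_le[of z "real R" a] power_seq_le[of w "real R" a] by auto
 have "(%N. cnj (sesq N T (%a. z^a) (%a. w^a))) ----> cnj (kern T z w)"
  unfolding kern_def by (intro tendsto_intros bform_tail(1)[OF _ W b]) simp
 moreover have "(%N. sesq N T (%a. w^a) (%a. z^a)) ----> kern T w z"
  unfolding kern_def by (intro bform_tail(1)[OF _ W b(2) b(1)]) simp
 ultimately show "kern T w z = cnj (kern T z w)"
  using sesq_cnj[OF p, of _ "%a. w^a" "%a. z^a"] by (simp add: LIMSEQ_unique)
qed

lemma power_series_entire:
 assumes "!!z. (%a. c a*z^a) sums f z"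
 shows "f holomorphic_on UNIV"
proof -
 have "wseq (real R) c < \<top>" for R :: nat
  unfolding wseq_def using power_series_summable_norm[of c f "real R"] assms
  by (subst suminf_ennreal2) auto
 then have "f = ent c" using ent_sums[of c] assms by (auto simp: fun_eq_iff intro: sums_unique2)
 then show ?thesis using ent_entire[of c] by (simp add: entire_def)
qed

text \<open>The form at \<open>point_seq m d z\<close> is the double sum of the kernel over the
  points, so the nonvanishing clause of \<open>nice\<close> upgrades semidefiniteness to strict
  positivity. Analyticity comes from the power series, and antianalyticity from Hermitian
  symmetry.\<close>

lemma nice_kernel:
 assumes "nice T"
 shows "hermitian_kernel (kern T)" "positive_definite_kernel (kern T)" "analytic_antianalytic_kernel (kern T)"
proof -
 from assms have p: "psd T" and W: "\<forall>R::nat. wsum (real R) T < \<top>"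
  and nz: "!!m c z. inj_on z {..<m} ==> \<exists>i<m. c i ~= 0 ==> Re (bform T (point_seq m c z) (point_seq m c z)) ~= 0"
  by (auto simp: nice_def)
 show "hermitian_kernel (kern T)" unfolding hermitian_kernel_def using kern_hermitian[OF W p] by blast
 have 1: "(%z. kern T z w) holomorphic_on UNIV" for w by (rule power_series_entire, rule kern_sums(2)[OF W])
 then show "analytic_antianalytic_kernel (kern T)"
  unfolding analytic_antianalytic_kernel_def kern_hermitian[OF W p, symmetric] by blast
 show "positive_definite_kernel (kern T)"
  unfolding positive_definite_kernel_def
 proof (intro allI impI)
  fix S and c :: "complex => complex" assume S: "finite S \<and> (\<exists>z\<in>S. c z ~= 0)"
  define m where "m = card S"
  obtain z where z: "bij_betw z {..<m} S"
   using ex_bij_betw_nat_finite[of S] S by (auto simp: m_def atLeast0LessThan)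
  define d where "d i = c (z i)" for i
  let ?p = "point_seq m d z"
  have inj: "inj_on z {..<m}" using z by (simp add: bij_betw_def)
  have "\<exists>i<m. d i ~= 0" using S z unfolding d_def bij_betw_def by (metis imageE lessThan_iff)
  then have ne: "Re (bform T ?p ?p) ~= 0" by (rule nz[OF inj])
  obtain R :: nat where R: "real R >= (\<Sum>i<m. norm (z i))" using real_arch_simple by blast
  have zR: "norm (z i) <= real R" if "i < m" for i
   using R member_le_sum[of i "{..<m}" "%i. norm (z i)"] that by simp
  have pb: "norm (?p a) <= (\<Sum>i<m. norm (d i)) * real R^a" for a
   unfolding point_seq_def sum_distrib_right using zR
   by (intro sum_norm_le) (auto simp: norm_mult norm_power intro!: mult_left_mono power_mono)
  obtain W' where W': "wpart (real R) T ----> W'" by (rule wsum_tail[OF W])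
  have l: "(%N. sesq N T ?p ?p) ----> bform T ?p ?p" by (rule bform_tail(1)[OF _ W' pb pb]) simp
  have "(%N. \<Sum>i<m. \<Sum>j<m. d i*cnj (d j) * sesq N T (%a. z i^a) (%a. z j^a))
    ----> (\<Sum>i<m. \<Sum>j<m. d i*cnj (d j) * kern T (z i) (z j))"
   unfolding kern_def
  proof (intro tendsto_intros)
   fix i j assume "i : {..<m}" "j : {..<m}"
   then show "(%N. sesq N T (%a. z i^a) (%a. z j^a)) ----> bform T (%a. z i^a) (%a. z j^a)"
    using zR by (intro bform_tail(1)[OF _ W' power_seq_le power_seq_le]) auto
  qed
  moreover have "sesq N T ?p ?p = (\<Sum>i<m. \<Sum>j<m. d i*cnj (d j) * sesq N T (%a. z i^a) (%a. z j^a))" for N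
   unfolding point_seq_def sesq_sum_left sesq_sum_right sesq_scale_left sesq_scale_right by (simp add: mult.assoc sum_distrib_left)
  ultimately have "bform T ?p ?p = (\<Sum>i<m. \<Sum>j<m. d i*cnj (d j) * kern T (z i) (z j))"
   using l by (simp add: LIMSEQ_unique)
  also have "... = (\<Sum>i<m. \<Sum>w\<in>S. d i*cnj (c w) * kern T (z i) w)"
   unfolding d_def by (intro sum.cong refl sum.reindex_bij_betw[OF z])
  also have "... = (\<Sum>x\<in>S. \<Sum>w\<in>S. c x*cnj (c w) * kern T x w)"
   unfolding d_def by (rule sum.reindex_bij_betw[OF z])
  finally have e: "bform T ?p ?p = ..." .
  have "0 <= Re (bform T ?p ?p)"
   by (rule LIMSEQ_le_const[OF tendsto_Re[OF l]]) (auto intro: sesq_self_nonneg[OF p])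
  then show "0 < Re (\<Sum>z\<in>S. \<Sum>w\<in>S. c z*cnj (c w) * kern T z w)" using ne e by simp
 qed
qed

lemma sesq_scale_kernel: "sesq N (%p. of_real c*T p) x y = of_real c * sesq N T x y"
 by (simp add: sesq_def sum_distrib_left ac_simps)

lemma wsum_scale: "c >= 0 ==> wsum R (%p. of_real c*T p) = ennreal c*wsum R T"
proof -
 assume c: "c >= 0"
 have "ennreal (R^(a+b)*norm (of_real c*T (a, b))) = ennreal c*ennreal (R^(a+b)*norm (T (a, b)))" for a b
  using c by (simp add: ennreal_mult'[symmetric] norm_mult ac_simps)
 then show ?thesis unfolding wsum_def by (simp only: ennreal_suminf_cmult)
qed

lemma psd_scale: "c >= 0 ==> psd T ==> psd (%p. of_real c*T p)"
 using psd_cnj[of T] sesq_self_nonneg[of T]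
 unfolding psd_def[of "%p. of_real c*T p"] sesq_scale_kernel by simp

lemma nice_scale:
 assumes T: "nice T" and c: "c > 0"
 shows "nice (%p. of_real c*T p)"
 unfolding nice_def
proof (intro conjI allI impI)
 have p: "psd T" and W: "\<forall>R::nat. wsum (real R) T < \<top>" using T by (auto simp: nice_def)
 show "psd (%p. of_real c*T p)" using c p by (intro psd_scale) auto
 show "wsum (real R) (%p. of_real c*T p) < \<top>" for R :: nat
  using W c by (subst wsum_scale) (auto simp: ennreal_mult_less_top)
 fix m and d z :: "nat => complex" assume *: "inj_on z {..<m}" "\<exists>i<m. d i ~= 0"
 let ?p = "point_seq m d z"
 obtain R :: nat where R: "real R >= (\<Sum>i<m. norm (z i))" using real_arch_simple by blast
 have zR: "norm (z i) <= real R" if "i < m" for i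
  using R member_le_sum[of i "{..<m}" "%i. norm (z i)"] that by simp
 have pb: "norm (?p a) <= (\<Sum>i<m. norm (d i)) * real R^a" for a
  unfolding point_seq_def sum_distrib_right using zR
  by (intro sum_norm_le) (auto simp: norm_mult norm_power intro!: mult_left_mono power_mono)
 obtain W' where W': "wpart (real R) T ----> W'" by (rule wsum_tail[OF W])
 have "(%N. of_real c * sesq N T ?p ?p) ----> of_real c*bform T ?p ?p"
  by (intro tendsto_intros bform_tail(1)[OF _ W' pb pb]) simp
 then have "bform (%p. of_real c*T p) ?p ?p = of_real c*bform T ?p ?p"
  unfolding bform_def[of "%p. of_real c*T p"] sesq_scale_kernel by (rule limI)
 then show "Re (bform (%p. of_real c*T p) ?p ?p) ~= 0"
  using T * c by (auto simp: nice_def)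
qed

text \<open>A Gram-Schmidt vector has coefficient 1 at its own index, so its norm is a finite
  section evaluated at a nonzero vector. The last two clauses serve the normalisation and the
  continuity of the Cholesky factor.\<close>

lemma AE_nice_kern_lim: "AE w in cgauss. nice (kern_lim w) \<and> 0 < Re (kern_lim w (0, 0)) \<and> (\<forall>k. gs_norm (kern_lim w) k ~= 0)"
proof -
 have "AE w in cgauss. \<forall>R::nat. wsum (real R) (kern_lim w) < \<top>"
  unfolding AE_all_countable
 proof
  fix R :: nat
  have "0 < real (Suc R)" by simp
  from AE_wsum_kern_lim[OF this] show "AE w in cgauss. wsum (real R) (kern_lim w) < \<top>"
  proof eventually_elim
   case (elim w)
   have "wsum (real R) (kern_lim w) <= wsum (real (Suc R)) (kern_lim w)"
    unfolding wsum_def by (intro suminf_le summableI ennreal_leI mult_right_mono power_mono) auto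
   then show ?case using elim by (auto simp: less_top[symmetric] top_unique)
  qed
 qed
 then show ?thesis
  using AE_psd_kern_lim AE_kern_lim_finite_sections AE_kern_lim_points
 proof eventually_elim
  case (elim w)
  let ?T = "kern_lim w"
  have n: "nice ?T" using elim by (auto simp: nice_def)
  have fs: "Re (sesq d ?T v v) ~= 0" if "a < d" "v a ~= 0" for d v a
  proof -
   define u where "u a = (if a < d then v a else 0)" for a
   have "sesq N ?T u u = sesq d ?T v v" if "d <= N" for N
    using sesq_extend[of d u d u N ?T] that by (simp add: u_def sesq_def)
   then have "(%N. sesq N ?T u u) ----> sesq d ?T v v"
    by (intro tendsto_eventually eventually_sequentiallyI[of d])
   then have "bform ?T u u = sesq d ?T v v" unfolding bform_def by (rule limI)
   moreover have "Re (bform ?T u u) ~= 0" using elim(3) that unfolding u_def by blast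
   ultimately show ?thesis by simp
  qed
  have "Re (?T (0, 0)) ~= 0" using fs[of 0 1 "%_. 1"] by (simp add: sesq_def)
  moreover have "0 <= Re (?T (0, 0))" using psd_diag[OF elim(2)] .
  moreover have "gs_norm ?T k ~= 0" for k
  proof -
   have "Re (gs_norm ?T k) ~= 0"
    unfolding gs_norm_sesq[OF lessI] by (rule fs[of k]) (simp_all add: gram_schmidt_diag)
   then show ?thesis by auto
  qed
  ultimately show ?case using n by auto
 qed
qed

section \<open>Convergence of the normalised samples\<close>

lemma gauss_seq_le:
 assumes "psd T"
 shows "nsq (gauss_seq T r a) <= Re (T (a, a))*(\<Sum>k\<le>a. nsq (r k))"
proof -
 have "norm (gauss_seq T r a) <= (\<Sum>k\<le>a. norm (chol T a k)*norm (r k))"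
  unfolding gauss_seq_def by (rule sum_norm_le) (simp add: norm_mult)
 then have "nsq (gauss_seq T r a) <= (\<Sum>k\<le>a. norm (chol T a k)*norm (r k))^2" by (rule power_mono) simp
 also have "... <= (\<Sum>k\<le>a. nsq (chol T a k))*(\<Sum>k\<le>a. nsq (r k))" by (rule Cauchy_Schwarz_ineq_sum)
 finally show ?thesis by (simp add: chol_sq_sum[OF assms])
qed

text \<open>The series with terms \<open>(1/2)^k*nsq (r k)\<close> has mean 2 and is therefore
  finite almost surely.\<close>

lemma AE_noise_growth: "AE r in cgauss. \<exists>V::real. V >= 0 \<and> (\<forall>a. (\<Sum>k\<le>a. nsq (r k :: complex)) <= V*2^a)"
proof -
 have [measurable]: "(%r. ennreal ((1/2)^k*nsq (r k :: complex))) : borel_measurable cgauss" for k :: nat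
  by (rule measurable_compose[OF measurable_cgauss_component[of k]]) measurable
 have "(\<E> r. (\<Sum>k. ennreal ((1/2)^k*nsq (r k :: complex)))) = (\<Sum>k. \<E> r. ennreal ((1/2)^k*nsq (r k :: complex)))"
  by (rule nn_integral_suminf) measurable
 also have "... = (\<Sum>k. ennreal ((1/2)^k))"
 proof (rule suminf_cong)
  fix k
  have "(\<E> r. ennreal ((1/2)^k*nsq (r k :: complex))) = (\<G> w. ennreal ((1/2)^k)*ennreal (nsq w))"
   by (subst nn_integral_cgauss_component[of "%w. ennreal ((1/2)^k*nsq w)"]) (auto simp: ennreal_mult)
  also have "... = ennreal ((1/2)^k)" by (subst nn_integral_cmult) (auto simp: nn_integral_std_sq measurable_std_borel)
  finally show "(\<E> r. ennreal ((1/2)^k*nsq (r k :: complex))) = ennreal ((1/2)^k)" .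
 qed
 also have "... = 2" by (rule suminf_half)
 finally have "(\<E> r. (\<Sum>k. ennreal ((1/2)^k*nsq (r k :: complex)))) ~= \<infinity>" by (simp only: infinity_ennreal_def) simp
 then have "AE r in cgauss. (\<Sum>k. ennreal ((1/2)^k*nsq (r k :: complex))) ~= \<infinity>"
  by (rule nn_integral_PInf_AE[rotated]) measurable
 then show ?thesis
 proof eventually_elim
  case (elim r)
  obtain V where V: "(\<Sum>k. ennreal ((1/2)^k*nsq (r k))) = ennreal V" "V >= 0"
   using elim unfolding infinity_ennreal_def less_top less_top_ennreal by blast
  have "(\<Sum>k\<le>a. nsq (r k)) <= V*2^a" for a
  proof -
   have "ennreal (\<Sum>k\<le>a. (1/2)^k*nsq (r k)) = (\<Sum>k<Suc a. ennreal ((1/2)^k*nsq (r k)))"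
    by (subst sum_ennreal) (auto simp: lessThan_Suc_atMost)
   also have "... <= ennreal V" unfolding V(1)[symmetric] by (intro sum_le_suminf summableI) auto
   finally have "(\<Sum>k\<le>a. (1/2)^k*nsq (r k)) <= V" using V(2) by simp
   moreover have "(\<Sum>k\<le>a. nsq (r k)) <= (\<Sum>k\<le>a. 2^a*((1/2)^k*nsq (r k)))"
   proof (rule sum_mono)
    fix k assume "k : {..a}"
    then have "(2::real)^k*(1/2)^k <= 2^a*(1/2)^k" by (intro mult_right_mono power_increasing) auto
    then have "1 <= (2::real)^a*(1/2)^k" by (simp add: power_mult_distrib[symmetric])
    from mult_right_mono[OF this, of "nsq (r k)"]
    show "nsq (r k) <= 2^a*((1/2)^k*nsq (r k))" by simp
   qed
   ultimately show ?thesis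
    using mult_left_mono[of "\<Sum>k\<le>a. (1/2)^k*nsq (r k)" V "2^a"]
    by (simp add: sum_distrib_left mult.commute)
  qed
  then show ?case using V(2) by blast
 qed
qed

text \<open>With the noise \<open>r\<close> frozen, the sample is continuous in the kernel: each
  coefficient converges by \<open>tendsto_chol\<close>, and Tannery's theorem sums them under the
  geometric majorant \<open>M\<close>.\<close>

lemma wseq_gauss_seq_limit:
 fixes R :: nat
 assumes p: "!!j. psd (K j)" "psd T" and lim: "!!R::nat. (%j. wsum (real R) (%p. K j p-T p)) ----> 0"
  and W: "\<forall>R::nat. wsum (real R) T < \<top>" and gs: "!!k. gs_norm T k ~= 0"
  and V: "V >= 0" "!!a. (\<Sum>k\<le>a. nsq (r k)) <= V*2^a"
 shows "(%j. wseq (real R) (%a. gauss_seq (K j) r a-gauss_seq T r a)) ----> 0" "!!p. (%j. K j p) ----> T p"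
  "wseq (real R) (gauss_seq T r) < \<top>"
proof -
 show Kp: "(%j. K j p) ----> T p" for p
 proof -
  obtain a b where ab: "p = (a, b)" by (cases p)
  have "(%j. ennreal (norm (K j p-T p))) ----> 0"
  proof (rule tendsto_sandwich[OF _ _ tendsto_const lim[of 1]])
   show "\<forall>\<^sub>F j in sequentially. ennreal (norm (K j p-T p)) <= wsum (real 1) (%p. K j p-T p)"
   proof (rule always_eventually, rule)
    fix j
    have "ennreal (norm (K j p-T p)) <= (\<Sum>b. ennreal (norm (K j (a, b)-T (a, b))))"
     using ennreal_term_le_suminf[of "%b. ennreal (real 1^(a+b)*norm (K j (a, b)-T (a, b)))" b]
     unfolding ab of_nat_1 power_one mult_1 .
    also have "... <= wsum (real 1) (%p. K j p-T p)"
     using wsum_term_le[of "real 1" a "%p. K j p-T p"] unfolding of_nat_1 power_one mult_1 .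
    finally show "ennreal (norm (K j p-T p)) <= wsum (real 1) (%p. K j p-T p)" .
   qed
  qed simp
  then have "(%j. ennreal (norm (K j p-T p))) ----> ennreal 0" by simp
  then have "(%j. norm (K j p-T p)) ----> 0" by (rule tendsto_ennrealD) auto
  then show ?thesis unfolding tendsto_norm_zero_iff by (rule LIM_zero_cancel)
 qed
 \<comment> \<open>Budget of radii: the diagonal of the kernel at radius \<open>R'\<close> bounds
   the coefficient times \<open>R'^a\<close>, the noise costs a factor of at most
   \<open>2^a\<close>, and the ratio of \<open>R\<close> to \<open>R'\<close>, below 1/4, leaves
   \<open>(1/2)^a\<close>.\<close>
 define R' where "R' = 4*(R+1)"
 obtain C where C: "wsum (real R') T = ennreal C" "C >= 0" using W[rule_format, of R'] by (cases "wsum (real R') T") auto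
 have gb: "norm (gauss_seq S r a) * real R^a <= sqrt ((C+1)*V)*(1/2)^a" if S: "psd S" "wsum (real R') S <= ennreal (C+1)" for S a
 proof -
  have "ennreal (real R'^(a+a)*norm (S (a, a))) <= (\<Sum>b. ennreal (real R'^(a+b)*norm (S (a, b))))"
   by (rule ennreal_term_le_suminf[of "%b. ennreal (real R'^(a+b)*norm (S (a, b)))"])
  also have "... <= wsum (real R') S" by (rule wsum_term_le)
  also note S(2)
  finally have "real R'^(a+a)*norm (S (a, a)) <= C+1"
   by (rule ennreal_le_iff[THEN iffD1, rotated]) (use C(2) in simp)
  then have 1: "real R'^(2*a) * Re (S (a, a)) <= C+1"
   using mult_left_mono[OF complex_Re_le_cmod[of "S (a, a)"], of "real R'^(2*a)"] by (simp add: mult_2)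
  have "(norm (gauss_seq S r a) * real R'^a)\<^sup>2 = real R'^(2*a)*nsq (gauss_seq S r a)"
   unfolding power_double by (simp add: power_mult_distrib mult.commute)
  also have "... <= real R'^(2*a)*(Re (S (a, a))*(V*2^a))"
   using psd_diag[OF S(1)] V by (intro mult_left_mono order.trans[OF gauss_seq_le[OF S(1)]]) auto
  also have "... <= (C+1)*(V*2^a)"
   using mult_right_mono[OF 1, of "V*2^a"] V by (simp add: mult.assoc)
  also have "... <= (C+1)*(V*4^a)" using C V by (intro mult_left_mono power_mono) auto
  also have "... = (sqrt ((C+1)*V)*2^a)^2"
   using C V by (simp add: power_mult_distrib power_mult[symmetric] mult.commute[of a] power_mult)
  finally have "norm (gauss_seq S r a) * real R'^a <= sqrt ((C+1)*V)*2^a"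
   by (rule power2_le_imp_le) (use C V in simp)
  then have 2: "(norm (gauss_seq S r a) * real R'^a)*(1/4)^a <= (sqrt ((C+1)*V)*2^a)*(1/4)^a"
   by (rule mult_right_mono) simp
  have "real R^a <= real R'^a*(1/4)^a"
   unfolding power_mult_distrib[symmetric] by (intro power_mono) (auto simp: R'_def)
  then have "norm (gauss_seq S r a) * real R^a <= norm (gauss_seq S r a)*(real R'^a*(1/4)^a)" by (rule mult_left_mono) simp
  also have "... <= sqrt ((C+1)*V)*(2^a*(1/4)^a)" using 2 by (simp add: mult.assoc)
  also have "(2::real)^a*(1/4)^a = (1/2)^a" by (simp add: power_mult_distrib[symmetric])
  finally show ?thesis .
 qed
 define M where "M a = 2 * sqrt ((C+1)*V)*(1/2)^a" for a :: nat
 have Ms: "summable M" unfolding M_def by (intro summable_mult summable_geometric) simp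
 have gT: "norm (gauss_seq T r a) * real R^a <= sqrt ((C+1)*V)*(1/2)^a" for a
  by (rule gb[OF p(2)]) (simp add: C ennreal_leI)
 have "sqrt ((C+1)*V)*(1/2)^a <= M a" for a
  unfolding M_def using C V by (intro mult_right_mono) auto
 then have "norm (gauss_seq T r a) * real R^a <= M a" for a using gT order.trans by blast
 then have "summable (%a. norm (gauss_seq T r a) * real R^a)"
  by (intro summable_comparison_test'[OF Ms, of 0]) (simp add: abs_mult)
 then show "wseq (real R) (gauss_seq T r) < \<top>" unfolding wseq_def by (subst suminf_ennreal2) auto
 have ev: "\<forall>\<^sub>F j in sequentially. \<forall>a. norm (gauss_seq (K j) r a-gauss_seq T r a) * real R^a <= M a"
 proof -
  have "\<forall>\<^sub>F j in sequentially. wsum (real R') (%p. K j p-T p) < 1"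
   by (rule order_tendstoD(2)[OF lim]) simp
  then show ?thesis
  proof eventually_elim
   case (elim j)
   have "wsum (real R') (K j) <= wsum (real R') T+wsum (real R') (%p. K j p-T p)"
    using wsum_triangle[of "real R'" T "%p. K j p-T p"] by simp
   also have "... <= ennreal C+1" using elim by (intro add_mono) (auto simp: C)
   finally have "wsum (real R') (K j) <= ennreal (C+1)" using C by simp
   note gbj = gb[OF p(1) this]
   have "norm (gauss_seq (K j) r a) * real R^a+norm (gauss_seq T r a) * real R^a <= M a" for a
    using gT[of a] gbj[of a] unfolding M_def by linarith
   moreover have "norm (gauss_seq (K j) r a-gauss_seq T r a) * real R^a
     <= norm (gauss_seq (K j) r a) * real R^a+norm (gauss_seq T r a) * real R^a" for a
    unfolding distrib_right[symmetric] by (intro mult_right_mono norm_triangle_ineq4) simp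
   ultimately show ?case using order.trans by blast
  qed
 qed
 have "((%j. \<Sum>a. norm (gauss_seq (K j) r a-gauss_seq T r a) * real R^a) \<longlongrightarrow> (\<Sum>a::nat. 0)) sequentially"
 proof (rule tannerys_theorem[THEN conjunct2, THEN conjunct2, OF _ _ Ms])
  fix a
  have "(%j. gauss_seq (K j) r a) ----> gauss_seq T r a"
   unfolding gauss_seq_def by (intro tendsto_intros tendsto_chol Kp gs p(2))
  then have "(%j. norm (gauss_seq (K j) r a-gauss_seq T r a) * real R^a) ----> norm (gauss_seq T r a-gauss_seq T r a) * real R^a"
   by (intro tendsto_intros)
  then show "(%j. norm (gauss_seq (K j) r a-gauss_seq T r a) * real R^a) ----> 0" by simp
 next
  have "\<forall>\<^sub>F x in at_top \<times>\<^sub>F sequentially. \<forall>a. norm (gauss_seq (K (snd x)) r a-gauss_seq T r a) * real R^a <= M a"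
   by (rule eventually_compose_filterlim[OF ev filterlim_snd])
  then show "\<forall>\<^sub>F (a, j) in at_top \<times>\<^sub>F sequentially. norm (norm (gauss_seq (K j) r a-gauss_seq T r a) * real R^a) <= M a"
   by eventually_elim (auto simp: abs_mult)
 qed simp
 then have lim: "(%j. \<Sum>a. norm (gauss_seq (K j) r a-gauss_seq T r a) * real R^a) ----> 0" by simp
 have lim': "(%j. ennreal (\<Sum>a. norm (gauss_seq (K j) r a-gauss_seq T r a) * real R^a)) ----> 0"
  using tendsto_ennrealI[OF lim] unfolding ennreal_0 .
 have eq: "ennreal (\<Sum>a. norm (gauss_seq (K j) r a-gauss_seq T r a) * real R^a) = wseq (real R) (%a. gauss_seq (K j) r a-gauss_seq T r a)"
  if le: "\<forall>a. norm (gauss_seq (K j) r a-gauss_seq T r a) * real R^a <= M a" for j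
 proof -
  have "summable (%a. norm (gauss_seq (K j) r a-gauss_seq T r a) * real R^a)"
  proof (rule summable_comparison_test'[OF Ms, of 0])
   fix a
   have "0 <= norm (gauss_seq (K j) r a-gauss_seq T r a) * real R^a" by simp
   then show "norm (norm (gauss_seq (K j) r a-gauss_seq T r a) * real R^a) <= M a"
    using le[rule_format, of a] by (simp only: real_norm_def abs_of_nonneg)
  qed
  then show ?thesis unfolding wseq_def
   by (intro suminf_ennreal2[symmetric] mult_nonneg_nonneg norm_ge_zero zero_le_power of_nat_0_le_iff)
 qed
 show "(%j. wseq (real R) (%a. gauss_seq (K j) r a-gauss_seq T r a)) ----> 0"
  using lim'
 proof (rule Lim_transform_eventually)
  show "\<forall>\<^sub>F j in sequentially. ennreal (\<Sum>a. norm (gauss_seq (K j) r a-gauss_seq T r a) * real R^a) = wseq (real R) (%a. gauss_seq (K j) r a-gauss_seq T r a)"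
   using ev by (rule eventually_mono) (rule eq)
 qed
qed

lemma wseq_scale: "wseq R (%a. c*x a) = ennreal (norm c)*wseq R x"
 unfolding wseq_def by (simp add: norm_mult ennreal_mult' mult.assoc ennreal_suminf_cmult)

lemma wseq_finite_support:
 assumes "!!a. N < a ==> x a = 0" "R >= 0"
 shows "wseq R x < \<top>"
proof -
 have "wseq R x = (\<Sum>a<Suc N. ennreal (norm (x a) * R^a))"
  unfolding wseq_def by (rule suminf_finite) (use assms in auto)
 then show ?thesis by (simp add: ennreal_sum_less_top)
qed

lemma wseq_le_wnorm2:
 assumes R: "R >= 0" and x: "!!a. N < a ==> x a = 0"
 shows "wseq R x <= 2*ennreal (sqrt (wnorm2 (2 * R) N x))"
proof -
 have "wseq R x <= (\<Sum>a. ennreal ((1/2)^a)*ennreal (sqrt (wnorm2 (2 * R) N x)))"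
  unfolding wseq_def
 proof (intro suminf_le summableI)
  fix a
  have "norm (x a) * R^a <= (1/2)^a * sqrt (wnorm2 (2 * R) N x)"
  proof (cases "a <= N")
   case True
   have "(norm (x a)*(2 * R)^a)\<^sup>2 <= wnorm2 (2 * R) N x"
    using wnorm2_term_le[OF True, of "2 * R" x] unfolding power_double by (simp add: power_mult_distrib mult.commute)
   then have "norm (x a)*(2 * R)^a <= sqrt (wnorm2 (2 * R) N x)" by (rule real_le_rsqrt)
   from mult_left_mono[OF this, of "(1/2)^a"] show ?thesis
    by (simp add: power_mult_distrib power_divide)
  qed (use x wnorm2_nonneg in simp)
  then show "ennreal (norm (x a) * R^a) <= ennreal ((1/2)^a)*ennreal (sqrt (wnorm2 (2 * R) N x))"
   using wnorm2_nonneg[of "2 * R" N x] by (simp add: ennreal_mult[symmetric] ennreal_leI)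
 qed
 also have "... = 2*ennreal (sqrt (wnorm2 (2 * R) N x))" by (simp only: ennreal_suminf_multc suminf_half)
 finally show ?thesis .
qed

lemma AE_tendsto_zero:
 assumes [measurable]: "!!j. f j : borel_measurable M" and f: "!!j. (\<integral>\<^sup>+x. f j x \<partial>M) <= ennreal ((1/2)^j)"
 shows "AE x in M. (%j. f j x) ----> 0"
proof -
 have "(\<integral>\<^sup>+x. (\<Sum>j. f j x) \<partial>M) = (\<Sum>j. \<integral>\<^sup>+x. f j x \<partial>M)" by (rule nn_integral_suminf) measurable
 also have "... <= (\<Sum>j. ennreal ((1/2)^j))" by (intro suminf_le summableI f)
 finally have "(\<integral>\<^sup>+x. (\<Sum>j. f j x) \<partial>M) ~= \<infinity>" by (simp only: suminf_half infinity_ennreal_def) (auto simp: top_unique)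
 then have "AE x in M. (\<Sum>j. f j x) ~= \<infinity>" by (rule nn_integral_PInf_AE[rotated]) measurable
 then show ?thesis
 proof eventually_elim
  case (elim x)
  have le: "f j x <= (\<Sum>j. f j x)" for j by (rule ennreal_term_le_suminf)
  have fin: "f j x ~= \<top>" for j using le[of j] elim by (auto simp: top_unique)
  have e: "ennreal (enn2real (f j x)) = f j x" for j using fin by (simp add: less_top)
  have "summable (%j. enn2real (f j x))"
   using elim by (intro summable_suminf_not_top) (simp_all add: e)
  then have "(%j. ennreal (enn2real (f j x))) ----> ennreal 0" by (intro tendsto_ennrealI summable_LIMSEQ_zero)
  then show ?case by (simp add: e)
 qed
qed

text \<open>Division by the conditional standard deviation of the constant coefficient. The result
  is unchanged when \<open>q\<close> is scaled by \<open>s\<close> and \<open>T\<close> by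
  \<open>s\<^sup>2\<close>, so it can be moved between the matrices and the chain.\<close>

definition norm_value :: "(nat => complex) => (nat \<times> nat => complex) => complex => complex" where
 "norm_value q T = ent (%a. q a / of_real (sqrt (Re (T (0, 0)))))"

definition norm_kernel :: "(nat \<times> nat => complex) => nat \<times> nat => complex" where
 "norm_kernel T = (%p. of_real (1/Re (T (0, 0)))*T p)"

lemma norm_value_gauss_seq:
 assumes "Re (T (0, 0)) > 0"
 shows "norm_value (gauss_seq T r) T = ent (gauss_seq (norm_kernel T) r)"
proof -
 define s where "s = 1/sqrt (Re (T (0, 0)))"
 have s: "s > 0" "1/Re (T (0, 0)) = s\<^sup>2" using assms by (auto simp: s_def power_divide)
 have "gauss_seq (norm_kernel T) r a = gauss_seq T r a / of_real (sqrt (Re (T (0, 0))))" for a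
  unfolding norm_kernel_def s(2) gauss_seq_scale[OF s(1)] by (simp add: s_def)
 then have "gauss_seq (norm_kernel T) r = (%a. gauss_seq T r a / of_real (sqrt (Re (T (0, 0)))))" by (rule ext)
 then show ?thesis by (simp add: norm_value_def)
qed

lemma measurable_norm_value [measurable (raw)]:
 assumes "q : measurable M cgauss" "T : measurable M cgauss"
 shows "(%x. norm_value (q x) (T x)) : measurable M (ucc_borel)"
proof -
 have [measurable]: "(%x. q x a) : borel_measurable M" "(%x. T x p) : borel_measurable M" for a p
  by (rule measurable_cgauss_app, fact)+
 show ?thesis unfolding norm_value_def by (intro measurable_ent measurable_into_cgauss) measurable
qed

text \<open>With the normalising factors \<open>\<alpha> j\<close> and \<open>\<beta>\<close>, the
  difference splits into \<open>\<alpha> j\<close> times the mean plus the change of the sample, and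
  \<open>\<alpha> j-\<beta>\<close> times the limit sample.\<close>

lemma limitin_norm_value:
 assumes p: "!!j. psd (K j)" "psd T" and lim: "!!R::nat. (%j. wsum (real R) (%p. K j p-T p)) ----> 0"
  and W: "\<forall>R::nat. wsum (real R) T < \<top>" and gs: "!!k. gs_norm T k ~= 0" and T0: "Re (T (0, 0)) > 0"
  and V: "V >= 0" "!!a. (\<Sum>k\<le>a. nsq (r k)) <= V*2^a"
  and m: "!!R::nat. (%j. wseq (real R) (m j)) ----> 0"
  and fin: "!!j a. N j < a ==> m j a = 0" "!!j a. N j < a ==> gauss_seq (K j) r a = 0"
 shows "limitin ucc_topology (%j. norm_value (%a. m j a+gauss_seq (K j) r a) (K j)) (norm_value (gauss_seq T r) T) sequentially"
 unfolding norm_value_def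
proof (rule limitin_ent)
 note G = wseq_gauss_seq_limit[OF p lim W gs V]
 define \<alpha> where "\<alpha> j = 1/sqrt (Re (K j (0, 0)))" for j
 define \<beta> where "\<beta> = 1/sqrt (Re (T (0, 0)))"
 have \<alpha>: "\<alpha> ----> \<beta>"
  unfolding \<alpha>_def \<beta>_def using T0 by (intro tendsto_intros G(2)) auto
 have d: "x / of_real (sqrt (Re (K j (0, 0)))) = of_real (\<alpha> j)*x" "x / of_real (sqrt (Re (T (0, 0)))) = of_real \<beta>*x" for x :: complex and j
  by (simp_all add: \<alpha>_def \<beta>_def)
 show "\<forall>R::nat. wseq (real R) (%a. gauss_seq T r a / of_real (sqrt (Re (T (0, 0))))) < \<top>"
  unfolding d wseq_scale using G(3) by (simp add: ennreal_mult_less_top)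
 show "\<forall>R::nat. wseq (real R) (%a. (m j a+gauss_seq (K j) r a) / of_real (sqrt (Re (K j (0, 0))))) < \<top>" for j
  using fin by (auto intro!: wseq_finite_support[of "N j"])
 fix R :: nat
 let ?y = "%j a. (m j a+gauss_seq (K j) r a) / of_real (sqrt (Re (K j (0, 0))))-gauss_seq T r a / of_real (sqrt (Re (T (0, 0))))"
 obtain c where c: "wseq (real R) (gauss_seq T r) = ennreal c" "c >= 0" using G(3)[of R] by (cases "wseq (real R) (gauss_seq T r)") auto
 define U where "U j = ennreal (\<bar>\<beta>\<bar>+1)*(wseq (real R) (m j)+wseq (real R) (%a. gauss_seq (K j) r a-gauss_seq T r a))+ennreal (\<bar>\<alpha> j-\<beta>\<bar>*c)" for j
 have "(%j. U j) ----> ennreal (\<bar>\<beta>\<bar>+1)*(0+0)+ennreal (\<bar>\<beta>-\<beta>\<bar>*c)"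
  unfolding U_def by (intro tendsto_add ennreal_tendsto_cmult tendsto_ennrealI m G(1) tendsto_intros \<alpha>) simp
 then have U: "U ----> 0" by simp
 have "\<forall>\<^sub>F j in sequentially. dist (\<alpha> j) \<beta> < 1" using \<alpha> by (rule tendstoD) simp
 then have "\<forall>\<^sub>F j in sequentially. wseq (real R) (?y j) <= U j"
 proof eventually_elim
  case (elim j)
  have a: "\<bar>\<alpha> j\<bar> <= \<bar>\<beta>\<bar>+1" using elim by (simp add: dist_real_def)
  have eq: "?y j = (%a. of_real (\<alpha> j)*(m j a+(gauss_seq (K j) r a-gauss_seq T r a)) + of_real (\<alpha> j-\<beta>)*gauss_seq T r a)"
   unfolding d by (simp add: algebra_simps)
  have "wseq (real R) (?y j) <= wseq (real R) (%a. of_real (\<alpha> j)*(m j a+(gauss_seq (K j) r a-gauss_seq T r a)))+wseq (real R) (%a. of_real (\<alpha> j-\<beta>)*gauss_seq T r a)"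
   unfolding eq by (rule wseq_triangle) simp
  also have "... = ennreal \<bar>\<alpha> j\<bar>*wseq (real R) (%a. m j a+(gauss_seq (K j) r a-gauss_seq T r a))+ennreal (\<bar>\<alpha> j-\<beta>\<bar>*c)"
   unfolding wseq_scale c norm_of_real using c(2) by (simp add: ennreal_mult)
  also have "... <= U j"
   unfolding U_def using a c(2) by (intro add_mono mult_mono ennreal_leI wseq_triangle) auto
  finally show ?case .
 qed
 then show "(%j. wseq (real R) (?y j)) ----> 0"
  by (intro tendsto_sandwich[OF _ _ tendsto_const U]) auto
qed

lemma eventually_nn_integral_wsum:
 assumes "R > 0" "e > 0"
 shows "\<forall>\<^sub>F n in sequentially. (\<E> w. wsum R (%p. kern_mat n w p-kern_lim w p)) <= ennreal e"
proof -
 obtain D where D: "D >= 0" "!!n. 4 <= n ==> (\<E> w. wsum R (%p. kern_mat n w p-kern_lim w p)) <= ennreal (D/sqrt (real n))"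
  by (rule nn_integral_wsum_diff[OF assms(1)]) blast
 have "(%n. D/sqrt (real n)) ----> 0" by real_asymp
 then have "\<forall>\<^sub>F n in sequentially. D/sqrt (real n) < e" using assms(2) by (rule order_tendstoD)
 with eventually_ge_at_top[of 4] show ?thesis
  by eventually_elim (use D(2) ennreal_leI less_imp_le order.trans in \<open>meson\<close>)
qed

lemma eventually_nn_integral_mean:
 assumes "e > 0"
 shows "\<forall>\<^sub>F n in sequentially. (\<E> w. ennreal ((wnorm2 R n (mean n w))^2)) <= ennreal e"
proof -
 obtain C where C: "C >= 0" "!!n N. (\<E> w. ennreal (lyap R N (mean n w) (kern_mat n w))) <= ennreal C"
  by (rule lyap_bounded) blast
 have b: "(\<E> w. ennreal ((wnorm2 R N (mean (Suc n) w))^2)) <= ennreal (256 * R^4/(real n)^2*C)" if "n >= 3" for n N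
  by (rule nn_integral_mean_sq[OF that C(2)])
 have "(%n. 256 * R^4/(real n)^2*C) ----> 0" by real_asymp
 then have "\<forall>\<^sub>F n in sequentially. 256 * R^4/(real n)^2*C < e" using assms by (rule order_tendstoD)
 with eventually_ge_at_top[of 3] have "\<forall>\<^sub>F n in sequentially. (\<E> w. ennreal ((wnorm2 R (Suc n) (mean (Suc n) w))^2)) <= ennreal e"
  by eventually_elim (use b ennreal_leI less_imp_le order.trans in \<open>meson\<close>)
 then show ?thesis by (rule eventually_sequentially_Suc[THEN iffD1])
qed

text \<open>Only integrated bounds are available for the whole sequence, hence an argument by
  contradiction: among the times violating the limit some \<open>n j\<close> have errors at most
  \<open>(1/2)^j\<close> at growing radii, and along them kernels and means converge almost surely.
  Dominated convergence is applied over \<open>r\<close> for a fixed kernel, and then over the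
  chain.\<close>

lemma convergence_of_functionals:
 fixes \<Psi> :: "(complex => complex) => ennreal"
 assumes [measurable]: "\<Psi> : borel_measurable (ucc_borel)" and bd: "!!f. f : entire ==> \<Psi> f <= ennreal B"
  and cont: "!!X f. limitin ucc_topology X f sequentially ==> (%n. \<Psi> (X n)) ----> \<Psi> f"
 shows "(%n. \<E> u r. \<Psi> (norm_value (step_value (mean n u) (kern_mat n u) r) (kern_mat n u)))
  ----> (\<E> u r. \<Psi> (ent (gauss_seq (norm_kernel (kern_lim u)) r)))" (is "?E ----> ?L")
proof (rule ccontr)
 have nv: "norm_value q T : entire" for q T by (simp add: norm_value_def ent_entire)
 assume "\<not> ?E ----> ?L"
 then obtain S where S: "open S" "?L : S" and ns: "\<not> (\<forall>\<^sub>F n in sequentially. ?E n : S)"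
  unfolding tendsto_def by blast
 define P where "P j n \<longleftrightarrow> (\<E> u. wsum (real (Suc j)) (%p. kern_mat n u p-kern_lim u p)) <= ennreal ((1/2)^j) \<and>
   (\<E> u. ennreal ((wnorm2 (2 * real (Suc j)) n (mean n u))^2)) <= ennreal ((1/2)^j)" for j n
 have "\<exists>n. P j n \<and> ?E n \<notin> S" for j
 proof (rule ccontr)
  assume *: "\<not> (\<exists>n. P j n \<and> ?E n \<notin> S)"
  have "\<forall>\<^sub>F n in sequentially. P j n"
   unfolding P_def by (intro eventually_conj eventually_nn_integral_wsum eventually_nn_integral_mean) auto
  then have "\<forall>\<^sub>F n in sequentially. ?E n : S" by (rule eventually_mono) (use * in blast)
  then show False using ns by blast
 qed
 then have "\<forall>j. \<exists>n. P j n \<and> ?E n \<notin> S" by blast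
 from choice[OF this] obtain n where n: "!!j. P j (n j)" and n3: "!!j. ?E (n j) \<notin> S" by blast
 note n1 = n[unfolded P_def, THEN conjunct1] and n2 = n[unfolded P_def, THEN conjunct2]
 have A1: "AE u in cgauss. (%j. wsum (real (Suc j)) (%p. kern_mat (n j) u p-kern_lim u p)) ----> 0"
  by (rule AE_tendsto_zero[OF _ n1]) measurable
 have A2: "AE u in cgauss. (%j. ennreal ((wnorm2 (2 * real (Suc j)) (n j) (mean (n j) u))^2)) ----> 0"
  by (rule AE_tendsto_zero[OF _ n2]) measurable
 have inner: "AE u in cgauss. (%j. \<E> r. \<Psi> (norm_value (step_value (mean (n j) u) (kern_mat (n j) u) r) (kern_mat (n j) u)))
   ----> (\<E> r. \<Psi> (ent (gauss_seq (norm_kernel (kern_lim u)) r)))"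
  using AE_nice_kern_lim A1 A2
 proof eventually_elim
  case (elim u)
  then have T: "psd (kern_lim u)" "\<forall>R::nat. wsum (real R) (kern_lim u) < \<top>" "!!k. gs_norm (kern_lim u) k ~= 0" "Re (kern_lim u (0, 0)) > 0"
   by (auto simp: nice_def)
  have ev: "\<forall>\<^sub>F j in sequentially. R <= Suc j" for R :: nat
   by (rule eventually_sequentiallyI[of R]) simp
  have lim: "(%j. wsum (real R) (%p. kern_mat (n j) u p-kern_lim u p)) ----> 0" for R :: nat
  proof (rule tendsto_sandwich[OF _ _ tendsto_const elim(2)])
   show "\<forall>\<^sub>F j in sequentially. wsum (real R) (%p. kern_mat (n j) u p-kern_lim u p) <= wsum (real (Suc j)) (%p. kern_mat (n j) u p-kern_lim u p)"
    using ev[of R] unfolding wsum_def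
    by eventually_elim (intro suminf_le summableI ennreal_leI mult_right_mono power_mono; simp)
  qed simp
  have mlim: "(%j. wseq (real R) (mean (n j) u)) ----> 0" for R :: nat
  proof (rule tendsto_sandwich[OF _ _ tendsto_const])
   define x where "x j = wnorm2 (2 * real (Suc j)) (n j) (mean (n j) u)" for j
   have "(%j. ennreal ((x j)^2)) ----> ennreal 0" using elim(3) by (simp add: x_def)
   then have "(%j. (x j)^2) ----> 0" by (rule tendsto_ennrealD) auto
   then have "(%j. sqrt (sqrt ((x j)^2))) ----> sqrt (sqrt 0)" by (intro tendsto_real_sqrt)
   moreover have "sqrt ((x j)^2) = x j" for j using wnorm2_nonneg by (simp add: x_def)
   ultimately have "(%j. sqrt (x j)) ----> 0" by simp
   then have "(%j. 2*ennreal (sqrt (x j))) ----> 2*ennreal 0" by (intro ennreal_tendsto_cmult tendsto_ennrealI) auto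
   then show "(%j. 2*ennreal (sqrt (x j))) ----> 0" by simp
   show "\<forall>\<^sub>F j in sequentially. wseq (real R) (mean (n j) u) <= 2*ennreal (sqrt (x j))"
    using ev[of R]
   proof eventually_elim
    case (elim j)
    have "wseq (real R) (mean (n j) u) <= wseq (real (Suc j)) (mean (n j) u)" using elim by (intro wseq_mono) auto
    also have "... <= 2*ennreal (sqrt (x j))" unfolding x_def by (rule wseq_le_wnorm2) (auto simp: mean_beyond)
    finally show ?case .
   qed
  qed simp
  show ?case
  proof (rule nn_integral_dominated_convergence[where w="%_. ennreal B"])
   show "AE r in cgauss. (%j. \<Psi> (norm_value (step_value (mean (n j) u) (kern_mat (n j) u) r) (kern_mat (n j) u)))
     ----> \<Psi> (ent (gauss_seq (norm_kernel (kern_lim u)) r))"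
    using AE_noise_growth
   proof eventually_elim
    case (elim r)
    then obtain V where V: "V >= 0" "!!a. (\<Sum>k\<le>a. nsq (r k)) <= V*2^a" by blast
    show ?case
     unfolding norm_value_gauss_seq[of "kern_lim u", OF T(4), symmetric] step_value_def
     by (intro cont limitin_norm_value[OF psd_kern_mat T(1) lim T(2,3,4) V mlim, of n])
       (auto intro!: gauss_seq_vanish kern_mat_beyond mean_beyond)
   qed
  qed (auto intro!: bd nv ent_entire)
 qed
 have "(%j. ?E (n j)) ----> ?L"
 proof (rule nn_integral_dominated_convergence[where w="%_. ennreal B"])
  have le: "(\<integral>\<^sup>+r. \<Psi> (norm_value (q r) T) \<partial>(cgauss :: (nat => complex) measure)) <= ennreal B" for q T
   using nn_integral_mono[of "cgauss :: (nat => complex) measure" "%r. \<Psi> (norm_value (q r) T)" "%_. ennreal B"] bd nv by simp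
  show "AE u in cgauss. (\<E> r. \<Psi> (norm_value (step_value (mean (n j) u) (kern_mat (n j) u) r) (kern_mat (n j) u))) <= ennreal B" for j
   by (intro AE_I2 le)
  have [measurable]: "(%u. norm_kernel (kern_lim u)) : measurable cgauss cgauss"
   unfolding norm_kernel_def by (rule measurable_into_cgauss) measurable
  show "(%u. \<E> r. \<Psi> (ent (gauss_seq (norm_kernel (kern_lim u)) r))) : borel_measurable cgauss" by measurable
 qed (use inner in auto)
 then have "\<forall>\<^sub>F j in sequentially. ?E (n j) : S" using S by (rule topological_tendstoD)
 then show False using n3 by (simp add: eventually_sequentially)
qed

section \<open>Transfer to the given matrices\<close>

definition entries :: "nat => (nat \<times> nat => complex) => nat \<times> nat => complex" where
 "entries n g p = (if p : {..<n} \<times> {..<n} then g p else 0)"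

lemma ginibre_mat_entries: "ginibre_mat n (entries n g) = ginibre_mat n g"
 unfolding ginibre_mat_def by (rule eq_matI) (auto simp: entries_def)

lemma cp_coeff_entries: "cp_coeff n (entries n g) = cp_coeff n g"
 and cofactor_gram_entries: "cofactor_gram n (entries n g) = cofactor_gram n g"
 by (simp_all add: fun_eq_iff cp_coeff_def cp_poly_def cp_mat_def cofactor_gram_def row_cofactor_def ginibre_mat_entries)

text \<open>The given matrices live on arbitrary probability spaces; restriction to the block
  reduces both sides to the same finite product law. \<open>n >= 1\<close> makes the index set of
  the independent family nonempty.\<close>

lemma ginibre_entries_law:
 assumes G: "ginibre_matrix n M G" and n: "n >= 1" and [measurable]: "F : borel_measurable cgauss"
 shows "(%w. entries n (($$) (G w))) : measurable M cgauss"
  and "(\<integral>\<^sup>+w. F (entries n (($$) (G w))) \<partial>M) = (\<E> g. F (entries n g))"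
proof -
 define I where "I = {..<n} \<times> {..<n}"
 interpret prob_space M using G by (simp add: ginibre_matrix_def)
 have X: "(%(i, j) w. G w $$ (i, j)) = (%p w. G w $$ p)" by auto
 have ind: "indep_vars (%_. borel) (%p w. G w $$ p) I" using G unfolding ginibre_matrix_def X I_def by blast
 then have rv [measurable]: "(%w. G w $$ p) : borel_measurable M" if "p : I" for p using that unfolding indep_vars_def by blast
 have em: "(%w. entries n (($$) (G w)) p) : borel_measurable M" for p
  by (cases "p : I") (simp_all add: entries_def I_def[symmetric] rv)
 then show "(%w. entries n (($$) (G w))) : measurable M cgauss" by (rule measurable_into_cgauss)
 have "(0, 0) : I" using n by (simp add: I_def)
 then have ne: "I ~= {}" by blast
 have rm [measurable]: "(%h. entries n h) : measurable (Pi\<^sub>M I (%_. borel)) cgauss"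
 proof (rule measurable_into_cgauss)
  show "(%h. entries n h p) : borel_measurable (Pi\<^sub>M I (%_. borel))" for p
   by (cases "p : I") (simp_all add: entries_def I_def[symmetric])
 qed
 have res: "entries n (restrict h I) = entries n h" for h by (auto simp: entries_def I_def fun_eq_iff)
 have sets: "sets (Pi\<^sub>M I (%_. stdc)) = sets (Pi\<^sub>M I (%_. borel))" by (intro sets_PiM_cong) auto
 have d1: "distr M (Pi\<^sub>M I (%_. borel)) (%w. \<lambda>p\<in>I. G w $$ p) = Pi\<^sub>M I (%_. stdc)"
 proof -
  have "distr M (Pi\<^sub>M I (%_. borel)) (%w. \<lambda>p\<in>I. G w $$ p) = Pi\<^sub>M I (%p. distr M borel (%w. G w $$ p))"
   using indep_vars_iff_distr_eq_PiM'[OF ne, where M'="%_. borel" and X="%p w. G w $$ p"] ind rv by simp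
  also have "... = Pi\<^sub>M I (%_. stdc)"
   using G by (intro PiM_cong refl) (auto simp: ginibre_matrix_def I_def)
  finally show ?thesis .
 qed
 interpret pp: product_prob_space "%_::nat \<times> nat. stdc" UNIV ..
 have d2: "distr cgauss (Pi\<^sub>M I (%_. stdc)) (%g. restrict g I) = Pi\<^sub>M I (%_. stdc)"
  unfolding cgauss_def by (rule pp.distr_PiM_restrict_finite) (auto simp: I_def)
 have Fm: "(%h. F (entries n h)) : borel_measurable (Pi\<^sub>M I (%_. borel))" by measurable
 have "(\<integral>\<^sup>+w. F (entries n (($$) (G w))) \<partial>M) = (\<integral>\<^sup>+h. F (entries n h) \<partial>distr M (Pi\<^sub>M I (%_. borel)) (%w. \<lambda>p\<in>I. G w $$ p))"
  by (subst nn_integral_distr) (use Fm in \<open>auto intro!: measurable_restrict simp: res\<close>)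
 also have "... = (\<integral>\<^sup>+h. F (entries n h) \<partial>distr cgauss (Pi\<^sub>M I (%_. stdc)) (%g. restrict g I))"
  unfolding d1 d2 ..
 also have "... = (\<E> g. F (entries n g))"
 proof (subst nn_integral_distr)
  show "(%g. restrict g I) : measurable cgauss (Pi\<^sub>M I (%_. stdc))"
   unfolding cgauss_def by (rule measurable_restrict_subset) simp
  show "(%h. F (entries n h)) : borel_measurable (distr cgauss (Pi\<^sub>M I (%_. stdc)) (%g. restrict g I))"
   using Fm by (simp cong: measurable_cong_sets add: sets)
 qed (simp add: res)
 finally show "(\<integral>\<^sup>+w. F (entries n (($$) (G w))) \<partial>M) = (\<E> g. F (entries n g))" .
qed

lemma charpoly_fun_cp_poly:
 assumes A: "A : carrier_mat n n"
 shows "charpoly_fun n A z = poly (cp_poly n (entries n (($$) A))) z"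
proof -
 have m: "ginibre_mat n (entries n (($$) A)) = A"
  using A by (intro eq_matI) (auto simp: ginibre_mat_def entries_def)
 show ?thesis
  unfolding charpoly_fun_def cp_poly_def cp_mat_def m
 proof (rule poly_det_cong[symmetric])
  show "char_poly_matrix A : carrier_mat n n" using A by simp
  show "poly (char_poly_matrix A $$ (i, j)) z = (z \<cdot>\<^sub>m 1\<^sub>m n-A) $$ (i, j)" if "i < n" "j < n" for i j
   using that A by (auto simp: char_poly_matrix_def)
 qed (use A in auto)
qed

text \<open>The random variable \<open>A n\<close> of the theorem as a function of the matrix
  entries. The alternative 1 makes it positive everywhere, including the null set where the Gram
  entry fails to be positive.\<close>

definition normaliser :: "nat => (nat \<times> nat => complex) => real" where
 "normaliser n g = (let t = Re (cofactor_gram n g (0, 0)) in if 0 < t then sqrt t else 1)"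

lemma normaliser_pos: "0 < normaliser n g"
 by (simp add: normaliser_def Let_def)

lemma measurable_normaliser [measurable]: "normaliser n : borel_measurable cgauss"
 unfolding normaliser_def[abs_def] Let_def by measurable

lemma cp_poly_div:
 "poly (cp_poly n g) z / of_real c = ent (%a. cp_coeff n g a / of_real c) z"
proof -
 have fin: "\<forall>R::nat. wseq (real R) (%a. cp_coeff n g a / of_real c) < \<top>"
  by (auto intro!: wseq_finite_support[of "degree (cp_poly n g)"] simp: cp_coeff_def coeff_eq_0)
 have "(%a. cp_coeff n g a / of_real c*z^a) sums (\<Sum>a\<le>degree (cp_poly n g). cp_coeff n g a / of_real c*z^a)"
  by (rule sums_finite) (auto simp: cp_coeff_def coeff_eq_0)
 also have "(\<Sum>a\<le>degree (cp_poly n g). cp_coeff n g a / of_real c*z^a) = poly (cp_poly n g) z / of_real c"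
  by (simp add: poly_altdef sum_divide_distrib cp_coeff_def)
 finally show ?thesis using ent_sums[OF fin] by (rule sums_unique2)
qed

lemma kern_mat_00_pos:
 assumes "n >= 1"
 shows "AE w in cgauss. 0 < Re (kern_mat n w (0, 0))"
 using AE_pd_bound_pos
proof eventually_elim
 case (elim w)
 have "pd_bound n w*(\<Sum>a<n. nsq (unit_seq 0 a)) <= Re (sesq n (kern_mat n w) (unit_seq 0) (unit_seq 0))"
  by (rule pd_bound_lower) simp
 moreover have "nsq (unit_seq 0 0) <= (\<Sum>a<n. nsq (unit_seq 0 a))"
  using assms by (intro member_le_sum) auto
 then have "pd_bound n w*1 <= pd_bound n w*(\<Sum>a<n. nsq (unit_seq 0 a))"
  using elim by (intro mult_left_mono) (auto simp: unit_seq_def intro: less_imp_le)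
 moreover have "Re (sesq n (kern_mat n w) (unit_seq 0) (unit_seq 0)) = Re (kern_mat n w (0, 0))"
  using assms by (subst sesq_unit) auto
 ultimately show ?case using elim[rule_format, of n] by linarith
qed

lemma normalised_charpoly:
 assumes G: "ginibre_matrix n M G" and n: "n >= 1"
 defines "X \<equiv> %w z. charpoly_fun n (G w) z/complex_of_real (normaliser n (entries n (($$) (G w))))"
 shows "X : measurable M (ucc_borel)"
  and "\<Psi> : borel_measurable (ucc_borel) ==> (\<integral>\<^sup>+w. \<Psi> (X w) \<partial>M)
   = (\<E> w r. \<Psi> (norm_value (step_value (mean n w) (kern_mat n w) r) (kern_mat n w)))"
proof -
 define Y where "Y g = ent (%a. cp_coeff n g a / of_real (normaliser n g))" for g
 have Ym [measurable]: "Y : measurable cgauss (ucc_borel)"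
  unfolding Y_def[abs_def] by (intro measurable_ent measurable_into_cgauss) measurable
 have XY: "X w = Y (entries n (($$) (G w)))" if "w : space M" for w
 proof -
  have "G w : carrier_mat n n" using G that by (simp add: ginibre_matrix_def)
  then show ?thesis unfolding X_def Y_def by (intro ext) (simp only: charpoly_fun_cp_poly cp_poly_div)
 qed
 have em [measurable]: "(%w. entries n (($$) (G w))) : measurable M cgauss"
  by (rule ginibre_entries_law(1)[OF G n, of "%_. 0"]) simp
 have "(%w. Y (entries n (($$) (G w)))) : measurable M (ucc_borel)" by measurable
 then show "X : measurable M (ucc_borel)" by (subst measurable_cong[OF XY])
 assume \<Psi> [measurable]: "\<Psi> : borel_measurable (ucc_borel)"
 define F where "F q T = \<Psi> (norm_value q T)" for q T
 \<comment> \<open>The indicator of a nonpositive corner entry is scale invariant, so its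
   expectation may be computed for the chain, where \<open>pd_bound\<close> makes it vanish.\<close>
 define F0 :: "(nat => complex) => (nat \<times> nat => complex) => ennreal" where "F0 q T = (if 0 < Re (T (0, 0)) then 0 else 1)" for q T
 have Fm: "case_prod F : borel_measurable (cgauss \<Otimes>\<^sub>M cgauss)" unfolding F_def case_prod_beta by measurable
 have F0m: "case_prod F0 : borel_measurable (cgauss \<Otimes>\<^sub>M cgauss)"
 proof -
  have [measurable]: "(%x. snd x p) : borel_measurable (cgauss \<Otimes>\<^sub>M cgauss)" for p :: "nat \<times> nat"
   by (rule measurable_cgauss_app) measurable
  show ?thesis unfolding F0_def case_prod_beta by measurable
 qed
 have Fi: "scale_invariant F"
  unfolding scale_invariant_def F_def norm_value_def
 proof (intro allI impI)
  fix s :: real and q :: "nat => complex" and T :: "nat \<times> nat => complex" assume s: "s > 0"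
  have "Re (of_real (s\<^sup>2)*T (0, 0)) = s\<^sup>2 * Re (T (0, 0))" by (simp only: Re_complex_of_real Im_complex_of_real times_complex.sel mult_zero_left diff_zero)
  then have "of_real s*q a / of_real (sqrt (Re (of_real (s\<^sup>2)*T (0, 0)))) = q a / of_real (sqrt (Re (T (0, 0))))" for a
   using s by (simp only: real_sqrt_mult real_sqrt_abs of_real_mult) simp
  then show "\<Psi> (ent (%a. of_real s*q a / of_real (sqrt (Re (of_real (s\<^sup>2)*T (0, 0)))))) = \<Psi> (ent (%a. q a / of_real (sqrt (Re (T (0, 0))))))"
   by presburger
 qed
 have F0i: "scale_invariant F0"
  unfolding scale_invariant_def F0_def by (simp add: zero_less_mult_iff flip: of_real_power)
 have "(\<E> g. F0 (cp_coeff n g) (cofactor_gram n g)) = (\<E> w. F0 (value_seq n w) (kern_mat n w))"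
  by (rule ginibre_law[OF F0m F0i])
 also have "... = (\<E> (w::noise). 0)"
  by (rule nn_integral_cong_AE) (use kern_mat_00_pos[OF n] in \<open>eventually_elim, simp add: F0_def\<close>)
 finally have "(\<E> g. F0 (cp_coeff n g) (cofactor_gram n g)) = 0" by simp
 moreover have "(%g. F0 (cp_coeff n g) (cofactor_gram n g)) : borel_measurable cgauss" unfolding F0_def by measurable
 ultimately have "AE g in cgauss. F0 (cp_coeff n g) (cofactor_gram n g) = 0" by (simp add: nn_integral_0_iff_AE)
 then have pos: "AE g in cgauss. 0 < Re (cofactor_gram n g (0, 0))" by eventually_elim (simp add: F0_def split: if_splits)
 have "(\<integral>\<^sup>+w. \<Psi> (X w) \<partial>M) = (\<integral>\<^sup>+w. \<Psi> (Y (entries n (($$) (G w)))) \<partial>M)"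
  by (intro nn_integral_cong) (simp add: XY)
 also have "... = (\<E> g. \<Psi> (Y (entries n g)))"
  by (rule ginibre_entries_law(2)[OF G n, of "%g. \<Psi> (Y g)"]) measurable
 also have "... = (\<E> g. F (cp_coeff n g) (cofactor_gram n g))"
  by (rule nn_integral_cong_AE, use pos in eventually_elim)
    (simp add: Y_def F_def norm_value_def normaliser_def cp_coeff_entries cofactor_gram_entries)
 also have "... = (\<E> w. F (value_seq n w) (kern_mat n w))" by (rule ginibre_law[OF Fm Fi])
 \<comment> \<open>The row noise of time \<open>n\<close> is independent of the mean and the kernel
   at that time and is split off as the separate variable \<open>r\<close>.\<close>
 also have "... = (\<E> w. \<integral>\<^sup>+c. \<integral>\<^sup>+r. F (step_value (mean n w) (kern_mat n w) r) (kern_mat n w) \<partial>cgauss \<partial>(cgauss :: (nat => complex) measure))"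
  unfolding value_seq_def
 proof (rule nn_integral_chain_fresh[where G="%w c r. F (step_value (mean n w) (kern_mat n w) r) (kern_mat n w)"])
  show "(%(w, c, r). F (step_value (mean n w) (kern_mat n w) r) (kern_mat n w)) : borel_measurable (cgauss \<Otimes>\<^sub>M cgauss \<Otimes>\<^sub>M cgauss)"
   unfolding F_def case_prod_beta by measurable
  fix w w' :: noise and c r :: "nat => complex"
  assume "!!m x. m < n ==> w (m, x) = w' (m, x)"
  then show "F (step_value (mean n w) (kern_mat n w) r) (kern_mat n w) = F (step_value (mean n w') (kern_mat n w') r) (kern_mat n w')"
   using chain_past[of n w w'] by simp
 qed
 finally show "(\<integral>\<^sup>+w. \<Psi> (X w) \<partial>M) = (\<E> w r. \<Psi> (norm_value (step_value (mean n w) (kern_mat n w) r) (kern_mat n w)))"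
  by (simp add: F_def)
qed

section \<open>The limit law and the conditional law given the kernel\<close>

lemma limit_kernel_exists:
 "\<exists>f. f : measurable cgauss cgauss \<and> (\<forall>w. nice (f w)) \<and> (AE w in cgauss. f w = norm_kernel (kern_lim w))"
proof -
 have "AE w in cgauss. nice (norm_kernel (kern_lim w))"
  using AE_nice_kern_lim unfolding norm_kernel_def by eventually_elim (rule nice_scale, auto)
 then obtain Z where Z: "Z : null_sets cgauss" "{w. \<not> nice (norm_kernel (kern_lim w))} \<subseteq> Z"
  by (auto elim!: AE_E simp: null_sets_def)
 have "Z ~= UNIV" using Z(1) by (auto simp: null_sets_def)
 then obtain w0 where w0: "w0 \<notin> Z" by blast
 have [measurable]: "Z : sets cgauss" using Z(1) by (simp add: null_sets_def)
 \<comment> \<open>On the exceptional null set the kernel of one fixed good point is used, so that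
   \<open>nice\<close> holds everywhere and not only almost surely.\<close>
 define f where "f w = norm_kernel (kern_lim (if w : Z then w0 else w))" for w
 have "f : measurable cgauss cgauss"
 proof (rule measurable_into_cgauss)
  fix p
  have "(%w. if w : Z then norm_kernel (kern_lim w0) p else norm_kernel (kern_lim w) p) : borel_measurable cgauss"
   unfolding norm_kernel_def by measurable
  then show "(%w. f w p) : borel_measurable cgauss" by (simp add: f_def if_distrib if_distribR cong: if_cong)
 qed
 moreover have "nice (f w)" for w using Z(2) w0 by (auto simp: f_def)
 moreover have "AE w in cgauss. f w = norm_kernel (kern_lim w)"
  using AE_not_in[OF Z(1)] by eventually_elim (simp add: f_def)
 ultimately show ?thesis by blast
qed

text \<open>Adding the bound \<open>B\<close> turns a bounded real test function into a nonnegative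
  one, the form in which the laws above are expressed.\<close>

lemma (in prob_space) integral_shift_enn2real:
 fixes \<Phi> :: "'b => real"
 assumes X: "X : measurable M S" and \<Phi>: "\<Phi> : borel_measurable S" and B: "!!f. f : space S ==> \<bar>\<Phi> f\<bar> <= B"
 shows "(\<integral>x. \<Phi> (X x) \<partial>M) = enn2real (\<integral>\<^sup>+x. ennreal (\<Phi> (X x)+B) \<partial>M)-B"
proof -
 have m [measurable]: "(%x. \<Phi> (X x)) : borel_measurable M" by (rule measurable_compose[OF X \<Phi>])
 have b: "\<bar>\<Phi> (X x)\<bar> <= B" if "x : space M" for x using B measurable_space[OF X that] by blast
 have i: "integrable M (%x. \<Phi> (X x))" by (rule integrable_const_bound[of _ B]) (use b in auto)
 have "(\<integral>x. \<Phi> (X x)+B \<partial>M) = enn2real (\<integral>\<^sup>+x. ennreal (\<Phi> (X x)+B) \<partial>M)"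
  by (rule integral_eq_nn_integral) (use b abs_le_D2 in \<open>fastforce+\<close>)
 moreover have "(\<integral>x. \<Phi> (X x)+B \<partial>M) = (\<integral>x. \<Phi> (X x) \<partial>M)+B"
  using i by (simp add: prob_space)
 ultimately show ?thesis by simp
qed

theorem theorem1:
  fixes M :: "nat \<Rightarrow> 'a measure"
    and G :: "nat \<Rightarrow> 'a \<Rightarrow> complex mat"
  assumes "\<And>n. n \<ge> 1 \<Longrightarrow> ginibre_matrix n (M n) (G n)"
  shows "\<exists>(A :: nat \<Rightarrow> 'a \<Rightarrow> real)
          (N :: ((complex \<Rightarrow> complex) \<times> (complex \<Rightarrow> complex \<Rightarrow> complex)) measure) Q K.
     (\<forall>n\<ge>1. A n \<in> borel_measurable (M n) \<and> (\<forall>\<omega>\<in>space (M n). 0 < A n \<omega>)) \<and>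
     prob_space N \<and>
     converges_in_distribution ucc_topology M
       (\<lambda>n \<omega> z. charpoly_fun n (G n \<omega>) z / complex_of_real (A n \<omega>)) N Q \<and>
     random_kernel N K \<and>
     (AE \<omega> in N. hermitian_kernel (K \<omega>) \<and> positive_definite_kernel (K \<omega>) \<and>
        analytic_antianalytic_kernel (K \<omega>)) \<and>
     (\<exists>\<kappa>. conditional_law N (sigma_of_kernel N K) (borel_of ucc_topology) Q \<kappa> \<and>
        (AE \<omega> in N. complex_gaussian_field (\<kappa> \<omega>) (\<lambda>z f. f z) (K \<omega>) \<and>
           gaussian_analytic_function (\<kappa> \<omega>) (\<lambda>z f. f z) (K \<omega>)))"
proof -
 let ?S = "ucc_borel"
 obtain T where T [measurable]: "T : measurable (cgauss :: noise measure) cgauss" and nT: "!!w. nice (T w)"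
  and eT: "AE w in cgauss. T w = norm_kernel (kern_lim w)"
  using limit_kernel_exists by blast
 \<comment> \<open>The first factor carries the random kernel, the second an independent noise for
   the Gaussian sample; \<open>N\<close> will be the joint law of sample and kernel.\<close>
 define P where "P = (cgauss :: noise measure) \<Otimes>\<^sub>M (cgauss :: (nat => complex) measure)"
 interpret pp: pair_prob_space "cgauss :: noise measure" "cgauss :: (nat => complex) measure" ..
 \<comment> \<open>Curried kernels receive the \<open>\<sigma>\<close>-algebra pulled back from
   \<open>kernel_space\<close>, on a space of nice kernels only. Every point of \<open>N\<close>
   then has a nice kernel.\<close>
 define KS where "KS = vimage_algebra {kern T | T. nice T} case_prod kernel_space"
 have KS: "case_prod : measurable KS kernel_space"
  unfolding KS_def by (rule measurable_vimage_algebra1) (auto simp: space_PiM)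
 have sKS: "space KS = {kern T | T. nice T}" by (simp add: KS_def)
 have Tp [measurable]: "(%w. T w p) : borel_measurable cgauss" for p by (rule measurable_cgauss_app) fact
 have kT: "(%w. kern (T w)) : measurable cgauss KS"
  unfolding KS_def
 proof (rule measurable_vimage_algebra2)
  show "(%w. kern (T w)) : space cgauss \<rightarrow> {kern T | T. nice T}" using nT by auto
  show "(%w. case_prod (kern (T w))) : measurable cgauss kernel_space"
  proof (rule measurable_PiM_single')
   show "(%w. case_prod (kern (T w)) p) : borel_measurable cgauss" for p
    unfolding case_prod_beta kern_def bform_def sesq_def by measurable
  qed auto
 qed
 have XQ: "(%x. ent (gauss_seq (T (fst x)) (snd x))) : measurable P ?S" unfolding P_def by measurable
 have XK: "(%x. kern (T (fst x))) : measurable P KS"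
  unfolding P_def by (rule measurable_compose[OF measurable_fst kT])
 define X where "X x = (ent (gauss_seq (T (fst x)) (snd x)), kern (T (fst x)))" for x
 have X [measurable]: "X : measurable P (?S \<Otimes>\<^sub>M KS)"
  unfolding X_def[abs_def] by (rule measurable_Pair[OF XQ XK])
 define N where "N = distr P (?S \<Otimes>\<^sub>M KS) X"
 have PP: "prob_space P" unfolding P_def by unfold_locales
 interpret N: prob_space N unfolding N_def by (rule prob_space.prob_space_distr[OF PP X])
 have NQ [measurable]: "fst : measurable N ?S" unfolding N_def by simp
 have NK: "snd : measurable N KS" unfolding N_def by simp
 have spN: "\<exists>T. nice T \<and> snd x = kern T" if "x : space N" for x
  using measurable_space[OF NK that] unfolding sKS by blast
 define A where "A n w = normaliser n (entries n (($$) (G n w)))" for n w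
 have 1: "\<forall>n\<ge>1. A n : borel_measurable (M n) \<and> (\<forall>w\<in>space (M n). 0 < A n w)"
 proof (intro allI impI conjI ballI)
  fix n :: nat assume "n >= 1"
  from ginibre_entries_law(1)[OF assms[OF this] this, of "%_. 0"]
  show "A n : borel_measurable (M n)"
   unfolding A_def[abs_def] by (intro measurable_compose[OF _ measurable_normaliser]) simp
 qed (simp add: A_def normaliser_pos)
 have 2: "converges_in_distribution ucc_topology M (%n w z. charpoly_fun n (G n w) z/complex_of_real (A n w)) N fst"
  unfolding converges_in_distribution_def
 proof (intro conjI allI impI NQ)
  note np = normalised_charpoly[OF assms]
  show "\<forall>\<^sub>F n in sequentially. (%w z. charpoly_fun n (G n w) z/complex_of_real (A n w)) : measurable (M n) ?S"
   unfolding A_def by (rule eventually_sequentiallyI[of 1]) (rule np(1))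
  fix \<Phi> :: "(complex => complex) => real"
  assume \<Phi>: "continuous_map ucc_topology euclideanreal \<Phi> \<and> bounded (\<Phi> ` topspace ucc_topology)"
  then obtain B where B: "!!f. f : entire ==> \<bar>\<Phi> f\<bar> <= B"
   unfolding topspace_ucc_topology bounded_iff by auto
  have \<Phi>m [measurable]: "\<Phi> : borel_measurable ?S" using \<Phi> by (intro continuous_map_ucc_measurable) simp
  define \<Psi> where "\<Psi> f = ennreal (\<Phi> f+B)" for f
  have \<Psi>m [measurable]: "\<Psi> : borel_measurable ?S" unfolding \<Psi>_def by measurable
  define L where "L = (\<integral>\<^sup>+x. \<Psi> (fst x) \<partial>N)"
  define E where "E n = (\<E> w r. \<Psi> (norm_value (step_value (mean n w) (kern_mat n w) r) (kern_mat n w)))" for n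
  have bd: "\<Psi> f <= ennreal (2*B)" if "f : entire" for f
   unfolding \<Psi>_def using B[OF that] by (intro ennreal_leI) auto
  have "E ----> (\<E> w r. \<Psi> (ent (gauss_seq (norm_kernel (kern_lim w)) r)))"
   unfolding E_def
  proof (rule convergence_of_functionals[OF \<Psi>m bd])
   fix X f assume "limitin ucc_topology X f sequentially"
   from continuous_map_limit[OF conjunct1[OF \<Phi>] this] have "(%n. \<Phi> (X n)) ----> \<Phi> f" by (simp add: o_def)
   then show "(%n. \<Psi> (X n)) ----> \<Psi> f" unfolding \<Psi>_def by (intro tendsto_ennrealI tendsto_intros)
  qed
  also have "(\<E> w r. \<Psi> (ent (gauss_seq (norm_kernel (kern_lim w)) r))) = (\<E> w r. \<Psi> (ent (gauss_seq (T w) r)))"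
   by (rule nn_integral_cong_AE, use eT in eventually_elim) simp
  also have "... = (\<integral>\<^sup>+x. \<Psi> (ent (gauss_seq (T (fst x)) (snd x))) \<partial>P)"
   unfolding P_def by (subst cgauss.nn_integral_fst[symmetric]) auto
  also have "... = L"
   unfolding L_def N_def by (subst nn_integral_distr[OF X]) (auto simp: X_def)
  finally have EL: "E ----> L" .
  have "L <= (\<integral>\<^sup>+x. ennreal (2*B) \<partial>N)"
   unfolding L_def using measurable_space[OF NQ] by (intro nn_integral_mono bd) simp
  then have "L < \<top>" by (simp add: N.emeasure_space_1 order.strict_trans1)
  then have "E ----> ennreal (enn2real L)" using EL by (simp add: less_top)
  then have l1: "(%n. enn2real (E n)-B) ----> enn2real L-B" by (intro tendsto_intros) auto
  have l2: "enn2real L-B = (\<integral>w. \<Phi> (fst w) \<partial>N)"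
   unfolding L_def \<Psi>_def by (rule N.integral_shift_enn2real[OF NQ \<Phi>m, symmetric]) (simp add: B)
  have l3: "\<forall>\<^sub>F n in sequentially. enn2real (E n)-B = (\<integral>w. \<Phi> (%z. charpoly_fun n (G n w) z/complex_of_real (A n w)) \<partial>M n)"
  proof (rule eventually_sequentiallyI)
   fix n :: nat assume n: "1 <= n"
   interpret prob_space "M n" using assms[OF n] by (simp add: ginibre_matrix_def)
   show "enn2real (E n)-B = (\<integral>w. \<Phi> (%z. charpoly_fun n (G n w) z/complex_of_real (A n w)) \<partial>M n)"
    unfolding A_def E_def np(2)[OF n n \<Psi>m, symmetric] unfolding \<Psi>_def
    by (rule integral_shift_enn2real[OF np(1)[OF n n] \<Phi>m, symmetric]) (simp add: B)
  qed
  show "(%n. \<integral>w. \<Phi> (%z. charpoly_fun n (G n w) z/complex_of_real (A n w)) \<partial>M n) ----> (\<integral>w. \<Phi> (fst w) \<partial>N)"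
   unfolding l2[symmetric] by (rule Lim_transform_eventually[OF l1 l3])
 qed
 have NKm: "(%x. case_prod (snd x)) : measurable N kernel_space" by (rule measurable_compose[OF NK KS])
 then have 3: "random_kernel N snd" by (simp add: random_kernel_def)
 have 4: "AE x in N. hermitian_kernel (snd x) \<and> positive_definite_kernel (snd x) \<and> analytic_antianalytic_kernel (snd x)"
  using spN nice_kernel by (intro AE_I2) metis
 \<comment> \<open>The Gaussian law whose coefficients are read off from the kernel. Reading them
   off is measurable on \<open>kernel_space\<close>, so \<open>\<kappa>\<close> is measurable with
   respect to the kernel alone.\<close>
 define \<kappa> where "\<kappa> x = gauss_law (kernel_coeffs (case_prod (snd x)))" for x :: "(complex => complex) \<times> (complex => complex => complex)"
 have \<kappa>_kern: "\<kappa> (f, kern T) = gauss_law T" if "nice T" for f T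
  using that by (simp add: \<kappa>_def kernel_coeffs_kern nice_def)
 have 5: "AE x in N. complex_gaussian_field (\<kappa> x) (%z f. f z) (snd x) \<and> gaussian_analytic_function (\<kappa> x) (%z f. f z) (snd x)"
 proof (rule AE_I2)
  fix x assume "x : space N"
  then obtain S where S: "nice S" "snd x = kern S" using spN by blast
  have "\<kappa> x = gauss_law S" using \<kappa>_kern[OF S(1), of "fst x"] S(2) by (metis prod.collapse)
  then show "complex_gaussian_field (\<kappa> x) (%z f. f z) (snd x) \<and> gaussian_analytic_function (\<kappa> x) (%z f. f z) (snd x)"
   using gauss_law_field[of S] S by (simp add: nice_def)
 qed
 define F where "F = sigma_of_kernel N snd"
 have Fm: "(%x. case_prod (snd x)) : measurable F kernel_space"
  unfolding F_def sigma_of_kernel_def by (rule measurable_vimage_algebra1) (auto simp: space_PiM)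
 have sF: "sets F = {(%x. case_prod (snd x)) -` C \<inter> space N | C. C : sets kernel_space}"
  unfolding F_def sigma_of_kernel_def by (rule sets_vimage_algebra2) (auto simp: space_PiM)
 have sub: "subalgebra N F"
  unfolding subalgebra_def using measurable_sets[OF NKm] by (auto simp: sF) (auto simp: F_def sigma_of_kernel_def)
 have \<kappa>F: "\<kappa> : measurable F (prob_algebra ?S)"
  unfolding \<kappa>_def by (rule measurable_compose[OF measurable_compose[OF Fm measurable_kernel_coeffs] measurable_gauss_law])
 interpret Fs: finite_measure_subalgebra N F by unfold_locales (rule sub)
 have 6: "conditional_law N F ?S fst \<kappa>"
  unfolding conditional_law_def
 proof (intro conjI sub NQ \<kappa>F ballI)
  fix D assume D [measurable]: "D : sets ?S"
  have \<kappa>D: "(%x. measure (\<kappa> x) D) : borel_measurable F"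
   by (rule measurable_compose[OF measurable_prob_algebraD[OF \<kappa>F] measurable_measure_subprob_algebra[OF D]])
  then have \<kappa>N [measurable]: "(%x. measure (\<kappa> x) D) : borel_measurable N" by (rule measurable_from_subalg[OF sub])
  have pk: "prob_space (\<kappa> x)" for x unfolding \<kappa>_def gauss_law_def by (rule cgauss.prob_space_distr) measurable
  have i\<kappa>: "integrable N (%x. measure (\<kappa> x) D)"
   by (rule N.integrable_const_bound[of _ 1]) (use prob_space.prob_le_1[OF pk] in auto)
  have iD: "integrable N (%x. indicat_real D (fst x))"
   by (rule N.integrable_const_bound[of _ 1]) auto
  show "AE x in N. real_cond_exp N F (%x'. indicator D (fst x')) x = measure (\<kappa> x) D"
  proof (rule Fs.real_cond_exp_charact[OF _ iD i\<kappa> \<kappa>D])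
   fix H assume H: "H : sets F"
   then obtain C where C: "C : sets kernel_space" "H = (%x. case_prod (snd x)) -` C \<inter> space N" unfolding sF by blast
   have Hm [measurable]: "H : sets N" using H sub by (auto simp: subalgebra_def)
   define c where "c w = indicat_real C (case_prod (kern (T w)))" for w
   have c [measurable]: "c : borel_measurable cgauss"
    unfolding c_def by (rule measurable_compose[OF measurable_compose[OF kT KS]]) (use C in measurable)
   have XN: "X x : space N" for x
    using measurable_space[OF X, of x] by (simp add: N_def P_def space_pair_measure)
   have iH: "indicat_real H (X x) = c (fst x)" for x using XN[of x] by (simp add: C(2) c_def indicator_def X_def)
   \<comment> \<open>A set \<open>H\<close> in the \<open>\<sigma>\<close>-algebra of the kernel is
     seen only through the first factor of \<open>P\<close>, so its indicator \<open>c\<close>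
     leaves the integral over the second factor.\<close>
   have tr: "(\<integral>x\<in>H. g x \<partial>N) = (\<M> w. c w*(\<M> r. g (X (w, r))))"
    if g [measurable]: "g : borel_measurable N" and b: "!!x. \<bar>g x\<bar> <= 1" for g
   proof -
    have gX [measurable]: "(%x. g (X x)) : borel_measurable P"
     using g unfolding N_def by (intro measurable_compose[OF X]) simp
    have cP [measurable]: "(%x. c (fst x)) : borel_measurable P" unfolding P_def by measurable
    have "(\<integral>x\<in>H. g x \<partial>N) = (\<integral>x. indicat_real H (X x)*g (X x) \<partial>P)"
     unfolding set_lebesgue_integral_def N_def
     by (subst integral_distr[OF X]) (use g Hm in \<open>auto simp: N_def\<close>)
    also have "... = (\<integral>x. c (fst x)*g (X x) \<partial>P)" by (simp add: iH)
    also have "... = (\<M> w r. c w*g (X (w, r)))"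
    proof -
     have "integrable P (%x. c (fst x)*g (X x))"
     proof (rule finite_measure.integrable_const_bound[OF prob_space.finite_measure[OF PP], where B=1])
      show "(%x. c (fst x)*g (X x)) : borel_measurable P" by measurable
      have "\<bar>c (fst x)*g (X x)\<bar> <= 1" for x using b[of "X x"] by (auto simp: c_def indicator_def)
      then show "AE x in P. norm (c (fst x)*g (X x)) <= 1" by simp
     qed
     then show ?thesis using pp.integral_fst'[of "%x. c (fst x)*g (X x)"] by (simp add: P_def)
    qed
    finally show ?thesis by simp
   qed
   \<comment> \<open>For a fixed kernel the sample lies in \<open>D\<close> with probability equal
     to the \<open>\<kappa>\<close>-mass of \<open>D\<close>, since \<open>\<kappa>\<close> at
     \<open>X (w, r')\<close> is \<open>gauss_law (T w)\<close> whatever \<open>r'\<close>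
     is.\<close>
   have cond: "(\<M> r. indicat_real D (fst (X (w, r)))) = measure (\<kappa> (X (w, r'))) D" for w r'
   proof -
    have em [measurable]: "(%r. ent (gauss_seq (T w) r)) : measurable cgauss ?S" by measurable
    have "D \<subseteq> entire" using sets.sets_into_space[OF D] by simp
    then have "measure (\<kappa> (X (w, r'))) D = (\<integral>f. indicat_real D f \<partial>gauss_law (T w))"
     using D nT[of w] by (simp add: X_def \<kappa>_kern Int_absorb2)
    also have "... = (\<M> r. indicat_real D (ent (gauss_seq (T w) r)))"
     unfolding gauss_law_def by (rule integral_distr) measurable
    finally show ?thesis by (simp add: X_def)
   qed
   have "(\<integral>x\<in>H. indicat_real D (fst x) \<partial>N) = (\<M> w. c w*(\<M> r. indicat_real D (fst (X (w, r)))))"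
    by (rule tr) (auto simp: indicator_def)
   also have "... = (\<M> w. c w*(\<M> r. measure (\<kappa> (X (w, r))) D))"
   proof -
    have "(\<M> r. measure (\<kappa> (X (w, r))) D) = (\<M> r. indicat_real D (fst (X (w, r))))" for w
     unfolding cond[symmetric] by (simp add: cgauss.prob_space[unfolded space_cgauss])
    then show ?thesis by simp
   qed
   also have "... = (\<integral>x\<in>H. measure (\<kappa> x) D \<partial>N)"
    by (rule tr[symmetric]) (use \<kappa>N prob_space.prob_le_1[OF pk] in auto)
   finally show "(\<integral>x\<in>H. indicat_real D (fst x) \<partial>N) = (\<integral>x\<in>H. measure (\<kappa> x) D \<partial>N)" .
  qed
 qed
 show ?thesis
  using 1 2 3 4 5 6 N.prob_space_axioms unfolding F_def by blast
qed

end
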